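(* For a ring $R$ the following statements are equivalent: (1) For every $r\in R$, every homomorphism of $R$-modules that is seemingly divisible by $r$ is divisible by $r$. (2) Every localization of $R$ at a prime ideal is a principal ideal ring, and for every element $x\in R$ the ring $R$ can be written as a product $R_0\times R_1\times R_2$, where: $x=(0,x_1,x_2)\in R_0\times R_1\times R_2$; $x_1\in R_1$ is a non-zero divisor with discrete $V(x_1)$; and $R_2$ is a principal ideal ring. (3) Every localization of $R$ at a prime ideal is a principal ideal ring, all non-reduced points of $\mathrm{Spec}\, R$ are isolated, and whenever $\mathfrak p\in\mathrm{Spec}\, R$ is an accumulation point of a subset $S\subset \mathrm{Spec}\, R\setminus\{\mathfrak p\}$ and $\mathfrak q\subset\mathfrak p$ (with $\mathfrak q\in\mathrm{Spec}\, R$), then $\mathfrak q$ is an accumulation point of $S$ as well.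
   Context: Rings are commutative with unit. For a ring $R$, an element $r\in R$, and a homomorphism $f:M\to N$ of (arbitrary) $R$-modules, $f$ is seemingly divisible by $r$ if $f(M)\subset rN$ and $f(M[r])=0$, where $M[r]=\{m\in M: rm=0\}$; $f$ is divisible by $r$ if $f=r\cdot g$ for some $g\in\mathrm{Hom}_R(M,N)$. A principal ideal ring is a ring (possibly with zero divisors) in which all ideals are principal. $\mathrm{Spec}\, R$ carries the Zariski topology. For an element $x$ of a ring $A$, $V(x)$ denotes the closed subset of $\mathrm{Spec}\, A$ of those prime ideals containing $x$ (so $V(x_1)\subset\mathrm{Spec}\, R_1$); it is discrete if its subspace topology is discrete. The factors $R_0,R_1,R_2$ may be the zero ring. A point $\mathfrak p\in\mathrm{Spec}\, R$ is non-reduced if the local ring $R_{\mathfrak p}$ is not reduced, and isolated if $\{\mathfrak p\}$ is open in $\mathrm{Spec}\, R$. *)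

theory Defs
  imports "HOL-Algebra.Algebra" "HOL-Analysis.Abstract_Topology"
begin

text \<open>Rings are records satisfying \<open>cring\<close>, so the zero ring is included. Modules are records
  satisfying \<open>Module.module\<close>; the qualification avoids the type-class based locale of the
  same name.\<close>

section \<open>Divisibility of module homomorphisms\<close>

text \<open>Since functions are total, a homomorphism matters only through its values on the carrier;
  equality of homomorphisms below is therefore always equality on the carrier.\<close>

definition modhom ::
  "('a, 'x) ring_scheme \<Rightarrow> ('a, 'm, 'y) module_scheme \<Rightarrow> ('a, 'n, 'z) module_scheme \<Rightarrow> ('m \<Rightarrow> 'n) set"
  where "modhom R M N =
    {f \<in> carrier M \<rightarrow> carrier N.
       (\<forall>x\<in>carrier M. \<forall>y\<in>carrier M. f (x \<oplus>\<^bsub>M\<^esub> y) = f x \<oplus>\<^bsub>N\<^esub> f y) \<and>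
       (\<forall>a\<in>carrier R. \<forall>x\<in>carrier M. f (a \<odot>\<^bsub>M\<^esub> x) = a \<odot>\<^bsub>N\<^esub> f x)}"

definition seemingly_divisible ::
  "('a, 'm, 'y) module_scheme \<Rightarrow> ('a, 'n, 'z) module_scheme \<Rightarrow> ('m \<Rightarrow> 'n) \<Rightarrow> 'a \<Rightarrow> bool"
  where "seemingly_divisible M N f r \<longleftrightarrow>
    f ` carrier M \<subseteq> {r \<odot>\<^bsub>N\<^esub> n | n. n \<in> carrier N} \<and>
    f ` {m \<in> carrier M. r \<odot>\<^bsub>M\<^esub> m = \<zero>\<^bsub>M\<^esub>} \<subseteq> {\<zero>\<^bsub>N\<^esub>}"

definition divisible_hom ::
  "('a, 'x) ring_scheme \<Rightarrow> ('a, 'm, 'y) module_scheme \<Rightarrow> ('a, 'n, 'z) module_scheme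
    \<Rightarrow> ('m \<Rightarrow> 'n) \<Rightarrow> 'a \<Rightarrow> bool"
  where "divisible_hom R M N f r \<longleftrightarrow>
    (\<exists>g\<in>modhom R M N. \<forall>m\<in>carrier M. f m = r \<odot>\<^bsub>N\<^esub> g m)"

text \<open>HOL cannot quantify over types inside a formula, so the class of modules is given by
  type arguments: domains range over all modules with carrier in \<open>'m\<close>, codomains over all
  modules with carrier in \<open>'n\<close>.\<close>

definition seemingly_divisible_imp_divisible ::
  "('a, 'x) ring_scheme \<Rightarrow> 'm itself \<Rightarrow> 'n itself \<Rightarrow> bool"
  where "seemingly_divisible_imp_divisible R (_ :: 'm itself) (_ :: 'n itself) \<longleftrightarrow>
    (\<forall>r\<in>carrier R. \<forall>(M :: ('a, 'm) module) (N :: ('a, 'n) module).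
       Module.module R M \<longrightarrow> Module.module R N \<longrightarrow>
       (\<forall>f\<in>modhom R M N. seemingly_divisible M N f r \<longrightarrow> divisible_hom R M N f r))"


section \<open>Properties of rings and elements\<close>

definition principal_ideal_ring :: "('a, 'x) ring_scheme \<Rightarrow> bool"
  where "principal_ideal_ring R \<longleftrightarrow> cring R \<and> (\<forall>I. ideal I R \<longrightarrow> principalideal I R)"

text \<open>The zero element of the zero ring counts as a non-zero divisor.\<close>

definition non_zero_divisor :: "('a, 'x) ring_scheme \<Rightarrow> 'a \<Rightarrow> bool"
  where "non_zero_divisor R x \<longleftrightarrow>
    x \<in> carrier R \<and> (\<forall>y\<in>carrier R. x \<otimes>\<^bsub>R\<^esub> y = \<zero>\<^bsub>R\<^esub> \<longrightarrow> y = \<zero>\<^bsub>R\<^esub>)"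

definition reduced_ring :: "('a, 'x) ring_scheme \<Rightarrow> bool"
  where "reduced_ring R \<longleftrightarrow>
    (\<forall>x\<in>carrier R. \<forall>n::nat. x [^]\<^bsub>R\<^esub> n = \<zero>\<^bsub>R\<^esub> \<longrightarrow> x = \<zero>\<^bsub>R\<^esub>)"


section \<open>Localization at a prime ideal\<close>

text \<open>Fractions \<open>a / s\<close> with \<open>s \<notin> P\<close> are equivalence classes of pairs \<open>(a, s)\<close>; operations are
  defined on representatives, the union over all representatives being a single class.\<close>

definition loc_pairs :: "('a, 'x) ring_scheme \<Rightarrow> 'a set \<Rightarrow> ('a \<times> 'a) set"
  where "loc_pairs R P = carrier R \<times> (carrier R - P)"

definition loc_rel :: "('a, 'x) ring_scheme \<Rightarrow> 'a set \<Rightarrow> (('a \<times> 'a) \<times> ('a \<times> 'a)) set"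
  where "loc_rel R P =
    {((a, s), (b, t)). (a, s) \<in> loc_pairs R P \<and> (b, t) \<in> loc_pairs R P \<and>
       (\<exists>u\<in>carrier R - P. u \<otimes>\<^bsub>R\<^esub> (a \<otimes>\<^bsub>R\<^esub> t) = u \<otimes>\<^bsub>R\<^esub> (b \<otimes>\<^bsub>R\<^esub> s))}"

definition loc_frac :: "('a, 'x) ring_scheme \<Rightarrow> 'a set \<Rightarrow> 'a \<Rightarrow> 'a \<Rightarrow> ('a \<times> 'a) set"
  where "loc_frac R P a s = loc_rel R P `` {(a, s)}"

definition localization :: "('a, 'x) ring_scheme \<Rightarrow> 'a set \<Rightarrow> ('a \<times> 'a) set ring"
  where "localization R P =
    \<lparr> partial_object.carrier = loc_pairs R P // loc_rel R P,
      monoid.mult = (\<lambda>U V. \<Union>(a, s)\<in>U. \<Union>(b, t)\<in>V. loc_frac R P (a \<otimes>\<^bsub>R\<^esub> b) (s \<otimes>\<^bsub>R\<^esub> t)),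
      monoid.one = loc_frac R P \<one>\<^bsub>R\<^esub> \<one>\<^bsub>R\<^esub>,
      ring.zero = loc_frac R P \<zero>\<^bsub>R\<^esub> \<one>\<^bsub>R\<^esub>,
      ring.add = (\<lambda>U V. \<Union>(a, s)\<in>U. \<Union>(b, t)\<in>V.
               loc_frac R P (a \<otimes>\<^bsub>R\<^esub> t \<oplus>\<^bsub>R\<^esub> b \<otimes>\<^bsub>R\<^esub> s) (s \<otimes>\<^bsub>R\<^esub> t)) \<rparr>"


section \<open>The prime spectrum\<close>

definition Spec :: "('a, 'x) ring_scheme \<Rightarrow> 'a set set"
  where "Spec R = {P. primeideal P R}"

definition zero_locus :: "('a, 'x) ring_scheme \<Rightarrow> 'a set \<Rightarrow> 'a set set"
  where "zero_locus R A = {P \<in> Spec R. A \<subseteq> P}"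

definition zariski :: "('a, 'x) ring_scheme \<Rightarrow> 'a set topology"
  where "zariski R = topology (\<lambda>U. \<exists>A\<subseteq>carrier R. U = Spec R - zero_locus R A)"

lemma istopology_zariski:
  "istopology (\<lambda>U. \<exists>A\<subseteq>carrier R. U = Spec R - zero_locus R A)"
  unfolding istopology_def
proof (intro conjI allI impI)
  fix U V
  assume "\<exists>A\<subseteq>carrier R. U = Spec R - zero_locus R A" "\<exists>B\<subseteq>carrier R. V = Spec R - zero_locus R B"
  then obtain A B where A: "A \<subseteq> carrier R" "U = Spec R - zero_locus R A"
    and B: "B \<subseteq> carrier R" "V = Spec R - zero_locus R B"
    by auto
  define C where "C = {a \<otimes>\<^bsub>R\<^esub> b | a b. a \<in> A \<and> b \<in> B \<and> a \<otimes>\<^bsub>R\<^esub> b \<in> carrier R}"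
  have key: "C \<subseteq> P \<longleftrightarrow> A \<subseteq> P \<or> B \<subseteq> P" if P: "P \<in> Spec R" for P
  proof -
    interpret P: primeideal P R using P by (simp add: Spec_def)
    have "a \<otimes>\<^bsub>R\<^esub> b \<in> P" if "a \<in> A" "b \<in> B" "A \<subseteq> P \<or> B \<subseteq> P" for a b
      using that A B P.I_l_closed P.I_r_closed by blast
    moreover have "A \<subseteq> P \<or> B \<subseteq> P" if "C \<subseteq> P"
    proof (rule ccontr)
      assume "\<not> (A \<subseteq> P \<or> B \<subseteq> P)"
      then obtain a b where ab: "a \<in> A" "b \<in> B" "a \<notin> P" "b \<notin> P" by blast
      then have "a \<in> carrier R" "b \<in> carrier R" using A B by auto
      moreover from this have "a \<otimes>\<^bsub>R\<^esub> b \<in> P" using ab that by (auto simp: C_def)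
      ultimately show False using P.I_prime ab by blast
    qed
    ultimately show ?thesis by (auto simp: C_def)
  qed
  have "U \<inter> V = Spec R - zero_locus R C"
    using key by (auto simp: A B zero_locus_def)
  moreover have "C \<subseteq> carrier R" by (auto simp: C_def)
  ultimately show "\<exists>C\<subseteq>carrier R. U \<inter> V = Spec R - zero_locus R C"
    by blast
next
  fix \<K> assume *: "\<forall>K\<in>\<K>. \<exists>A\<subseteq>carrier R. K = Spec R - zero_locus R A"
  then obtain F where F: "\<And>K. K \<in> \<K> \<Longrightarrow> F K \<subseteq> carrier R \<and> K = Spec R - zero_locus R (F K)"
    by metis
  have "P \<in> \<Union>\<K> \<longleftrightarrow> P \<in> Spec R - zero_locus R (\<Union>K\<in>\<K>. F K)" for P
  proof -
    have "P \<in> \<Union>\<K> \<longleftrightarrow> (\<exists>K\<in>\<K>. P \<in> Spec R - zero_locus R (F K))"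
      using F by (metis UnionE UnionI)
    then show ?thesis by (auto simp: zero_locus_def)
  qed
  then have "\<Union>\<K> = Spec R - zero_locus R (\<Union>K\<in>\<K>. F K)" by (rule Set.set_eqI)
  moreover have "(\<Union>K\<in>\<K>. F K) \<subseteq> carrier R" using F by (simp add: UN_subset_iff)
  ultimately show "\<exists>A\<subseteq>carrier R. \<Union>\<K> = Spec R - zero_locus R A" by metis
qed

lemma openin_zariski:
  "openin (zariski R) U \<longleftrightarrow> (\<exists>A\<subseteq>carrier R. U = Spec R - zero_locus R A)"
  unfolding zariski_def by (simp add: istopology_zariski)

lemma topspace_zariski [simp]: "topspace (zariski R) = Spec R"
proof (rule subset_antisym)
  show "topspace (zariski R) \<subseteq> Spec R"
    using openin_topspace[of "zariski R"] unfolding openin_zariski by blast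
  have "zero_locus R (carrier R) = {}"
  proof (rule ccontr)
    assume "zero_locus R (carrier R) \<noteq> {}"
    then obtain P where P: "primeideal P R" "carrier R \<subseteq> P"
      by (auto simp: zero_locus_def Spec_def)
    interpret primeideal P R by (rule P(1))
    show False using P(2) a_subset I_notcarr by (simp add: subset_antisym)
  qed
  then have "openin (zariski R) (Spec R)" unfolding openin_zariski by blast
  then show "Spec R \<subseteq> topspace (zariski R)" by (rule openin_subset)
qed

definition discrete_subset :: "'p topology \<Rightarrow> 'p set \<Rightarrow> bool"
  where "discrete_subset T D \<longleftrightarrow> subtopology T D = discrete_topology D"

definition isolated_point :: "'p topology \<Rightarrow> 'p \<Rightarrow> bool"
  where "isolated_point T p \<longleftrightarrow> openin T {p}"

definition nonreduced_point :: "('a, 'x) ring_scheme \<Rightarrow> 'a set \<Rightarrow> bool"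
  where "nonreduced_point R P \<longleftrightarrow> P \<in> Spec R \<and> \<not> reduced_ring (localization R P)"

text \<open>Accumulation points are taken in the sense that every neighbourhood contains infinitely many
  points of the set. The spectrum is not a \<open>T\<^sub>1\<close> space, so this differs from \<open>derived_set_of\<close>,
  which only asks every neighbourhood to contain a point of the set other than the given one:
  in the spectrum of the integers, the ideal of a prime number is in the derived set of the
  singleton of the zero ideal, but the zero ideal is not.\<close>

definition accumulation_point :: "'p topology \<Rightarrow> 'p \<Rightarrow> 'p set \<Rightarrow> bool"
  where "accumulation_point T p S \<longleftrightarrow>
    p \<in> topspace T \<and> (\<forall>U. openin T U \<and> p \<in> U \<longrightarrow> infinite (U \<inter> S))"


section \<open>Product decompositions\<close>

text \<open>The factors may be taken with carriers in the same type \<open>'a\<close>: each factor of a product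
  decomposition of \<open>R\<close> is isomorphic to an ideal of \<open>R\<close> generated by an idempotent.\<close>

definition splits_at :: "('a, 'x) ring_scheme \<Rightarrow> 'a \<Rightarrow> bool"
  where "splits_at R x \<longleftrightarrow>
    (\<exists>(R0 :: 'a ring) (R1 :: 'a ring) (R2 :: 'a ring) \<phi> x1 x2.
       cring R0 \<and> cring R1 \<and> cring R2 \<and>
       \<phi> \<in> ring_iso R (RDirProd R0 (RDirProd R1 R2)) \<and>
       \<phi> x = (\<zero>\<^bsub>R0\<^esub>, x1, x2) \<and>
       non_zero_divisor R1 x1 \<and> discrete_subset (zariski R1) (zero_locus R1 {x1}) \<and>
       principal_ideal_ring R2)"

end

theory Submission
  imports Defs
begin

text \<open>(1) implies (3): a quotient of \<open>r : R / I \<rightarrow> R / (r R \<inter> I)\<close> by \<open>r\<close> yields an element \<open>h\<close> with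
  \<open>h r \<in> I\<close> and \<open>(1 - h) I \<subseteq> r R\<close>. Suitable ideals \<open>I\<close> show that the localizations are chain rings and
  that non-reduced points are isolated. A quotient of the map given by \<open>r\<close> from the module of all
  sequences \<open>v\<close> with \<open>r v\<^sub>k \<in> I\<^sub>k\<close> for almost all \<open>k\<close> to the direct sum of the \<open>R / I\<^sub>k\<close>
  excludes infinite descent, so that the localizations are principal, and gives the condition on
  accumulation points.

  (3) implies (2): \<open>Spec R\<close> is cut into the clopen set of points where \<open>x\<close> vanishes locally, the
  finitely many non-reduced points at which \<open>x\<close> lies in the prime but does not vanish
  locally, and the rest. The finiteness and the openness come from the condition on accumulation
  points, since a reduced point of this kind has a generization outside of \<open>V(x)\<close>.

  (2) implies (1): the elements \<open>c\<close> such that \<open>c f\<close> is divisible by \<open>r\<close> form an ideal, so it suffices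
  to find one outside of each prime \<open>P\<close>. If \<open>r\<close> lies in \<open>P\<close> but does not vanish there, then \<open>P\<close> is isolated
  in \<open>V(r)\<close> and \<open>R / r R\<close> has a direct factor which is a chain ring with nilpotent maximal ideal. Zorn's lemma
  extends \<open>r m \<mapsto> c f(m)\<close> along submodules that are pure modulo \<open>r M\<close>.\<close>

section \<open>Local divisibility\<close>

text \<open>Hom of arbitrary modules need not commute with localization, so divisibility of
  \<open>f\<close> cannot simply be checked over the local rings. Local statements are therefore
  kept in \<open>R\<close> by clearing denominators, and solutions are glued through ideals that lie
  in no prime. In (1) implies (3), cyclic test modules give only information at one prime or one
  annihilator. All finiteness comes from the tension between a domain containing infinite sequences
  and a codomain of finitely supported families; each application chooses ideals \<open>I k\<close>
  for which the resulting relation can be evaluated by Nakayama's lemma at a prime. A structural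
  fact serves all directions: in a localization with a uniformizer every non-maximal prime is zero.
  Hence a prime containing an element that does not vanish there is maximal in
  \<open>Spec R\<close>. In (2) implies (1), adjoining a generator to the domain of a homomorphism
  is obstructed by its multiples that already lie in the domain. Purity provides a generator for
  which all these multiples come from \<open>\<pi>^j y\<close> and \<open>r y\<close>, which lie in
  \<open>r M\<close>, where the solution is forced.\<close>

text \<open>Divisibility by \<open>a\<close> and vanishing of \<open>b\<close> in the localization at \<open>P\<close>, expressed in \<open>R\<close> itself;
  a uniformizer generates the maximal ideal of a localization in which every nonzero element is
  associated to a power of it.\<close>

definition loc_dvd :: "('a, 'x) ring_scheme \<Rightarrow> 'a set \<Rightarrow> 'a \<Rightarrow> 'a \<Rightarrow> bool"
  where "loc_dvd R P a b \<longleftrightarrow> (\<exists>s\<in>carrier R - P. \<exists>x\<in>carrier R. s \<otimes>\<^bsub>R\<^esub> b = x \<otimes>\<^bsub>R\<^esub> a)"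

definition loc_zero :: "('a, 'x) ring_scheme \<Rightarrow> 'a set \<Rightarrow> 'a \<Rightarrow> bool"
  where "loc_zero R P b \<longleftrightarrow> (\<exists>s\<in>carrier R - P. s \<otimes>\<^bsub>R\<^esub> b = \<zero>\<^bsub>R\<^esub>)"

definition uniformizer :: "('a, 'x) ring_scheme \<Rightarrow> 'a set \<Rightarrow> 'a \<Rightarrow> bool"
  where "uniformizer R P \<pi> \<longleftrightarrow> \<pi> \<in> P \<and>
    (\<forall>y\<in>carrier R. loc_zero R P y \<or>
      (\<exists>n::nat. loc_dvd R P (\<pi> [^]\<^bsub>R\<^esub> n) y \<and> loc_dvd R P y (\<pi> [^]\<^bsub>R\<^esub> n)))"

section \<open>Existence of primes and tests at all primes\<close>

lemma (in cring) idealI':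
  assumes "I \<subseteq> carrier R" "\<zero> \<in> I"
    and "\<And>a b. a \<in> I \<Longrightarrow> b \<in> I \<Longrightarrow> a \<oplus> b \<in> I"
    and "\<And>a x. a \<in> I \<Longrightarrow> x \<in> carrier R \<Longrightarrow> x \<otimes> a \<in> I"
  shows "ideal I R"
proof (rule idealI)
  show "subgroup I (add_monoid R)"
  proof (rule group.subgroupI[OF a_group])
    show "inv\<^bsub>add_monoid R\<^esub> a \<in> I" if "a \<in> I" for a
    proof -
      have "a \<in> carrier R" using that assms(1) by blast
      then have "(\<ominus> \<one>) \<otimes> a = \<ominus> a" by (simp add: l_minus)
      moreover have "(\<ominus> \<one>) \<otimes> a \<in> I" using assms(4) that by blast
      ultimately show ?thesis by (simp add: a_inv_def)
    qed
  qed (use assms in auto)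
  fix a x assume "a \<in> I" "x \<in> carrier R"
  then show "x \<otimes> a \<in> I" "a \<otimes> x \<in> I" using assms(1,4) by (auto simp: m_comm[of a x] subset_iff)
qed (rule ring_axioms)

text \<open>An ideal maximal among those containing \<open>I\<close> and disjoint from the
  multiplicative set \<open>S\<close> is prime. With \<open>S = {\<one>}\<close> this gives a prime
  above a proper ideal, with \<open>S\<close> the powers of an element the description of the
  radical.\<close>

lemma (in cring) prime_ideal_avoiding:
  assumes I: "ideal I R" and S: "S \<subseteq> carrier R" "\<one> \<in> S"
    and mult: "\<And>x y. x \<in> S \<Longrightarrow> y \<in> S \<Longrightarrow> x \<otimes> y \<in> S" and disj: "I \<inter> S = {}"
  shows "\<exists>P. primeideal P R \<and> I \<subseteq> P \<and> P \<inter> S = {}"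
proof -
  define \<A> where "\<A> = {J. ideal J R \<and> I \<subseteq> J \<and> J \<inter> S = {}}"
  have "\<exists>P\<in>\<A>. \<forall>J\<in>\<A>. P \<subseteq> J \<longrightarrow> J = P"
  proof (rule subset_Zorn_nonempty)
    show "\<A> \<noteq> {}" using I disj by (auto simp: \<A>_def)
    fix \<C> assume ne: "\<C> \<noteq> {}" and "subset.chain \<A> \<C>"
    then have sub: "\<And>J. J \<in> \<C> \<Longrightarrow> ideal J R \<and> I \<subseteq> J \<and> J \<inter> S = {}"
      and lin: "\<And>J K. J \<in> \<C> \<Longrightarrow> K \<in> \<C> \<Longrightarrow> J \<subseteq> K \<or> K \<subseteq> J"
      by (auto simp: subset_chain_def \<A>_def)
    have "ideal (\<Union>\<C>) R"
    proof (rule idealI')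
      show "\<Union>\<C> \<subseteq> carrier R" using sub ideal.Icarr by fastforce
      obtain J where "J \<in> \<C>" using ne by blast
      then show "\<zero> \<in> \<Union>\<C>" using sub additive_subgroup.zero_closed[OF ideal.axioms(1)] by blast
    next
      fix a b assume ab: "a \<in> \<Union>\<C>" "b \<in> \<Union>\<C>"
      obtain J K where "J \<in> \<C>" "a \<in> J" "K \<in> \<C>" "b \<in> K" using ab by blast
      then obtain L where L: "L \<in> \<C>" "a \<in> L" "b \<in> L" using lin by blast
      then have "ideal L R" using sub by blast
      then have "a \<oplus> b \<in> L" using L additive_subgroup.a_closed ideal.axioms(1) by metis
      then show "a \<oplus> b \<in> \<Union>\<C>" using L by auto
    next
      fix a x assume ax: "a \<in> \<Union>\<C>" "x \<in> carrier R"
      then obtain L where L: "L \<in> \<C>" "a \<in> L" by blast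
      then have "ideal L R" using sub by blast
      then have "x \<otimes> a \<in> L" using L ax ideal.I_l_closed by metis
      then show "x \<otimes> a \<in> \<Union>\<C>" using L by auto
    qed
    moreover have "I \<subseteq> \<Union>\<C>" "\<Union>\<C> \<inter> S = {}" using ne sub by blast+
    ultimately show "\<Union>\<C> \<in> \<A>" by (simp add: \<A>_def)
  qed
  then obtain P where P: "ideal P R" "I \<subseteq> P" "P \<inter> S = {}"
    and max: "\<And>J. ideal J R \<Longrightarrow> P \<subseteq> J \<Longrightarrow> J \<inter> S = {} \<Longrightarrow> J = P"
    by (auto simp: \<A>_def)
  interpret P: ideal P R by (rule P(1))
  \<comment> \<open>By maximality \<open>P + (a)\<close> meets \<open>S\<close> for each
    \<open>a\<close> outside \<open>P\<close>. If \<open>a b\<close> were in \<open>P\<close>, the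
    product of two such elements of \<open>S\<close> would be in \<open>P\<close> as well.\<close>
  have enlarge: "\<exists>p\<in>P. \<exists>x\<in>carrier R. p \<oplus> x \<otimes> a \<in> S" if a: "a \<in> carrier R" "a \<notin> P" for a
  proof -
    let ?J = "P <+>\<^bsub>R\<^esub> PIdl a"
    have "ideal ?J R" by (rule add_ideals[OF P(1) cgenideal_ideal[OF a(1)]])
    moreover have mem: "x \<in> ?J \<longleftrightarrow> (\<exists>p\<in>P. \<exists>y\<in>carrier R. x = p \<oplus> y \<otimes> a)" for x
      by (auto simp: set_add_def' cgenideal_def)
    moreover have "P \<subseteq> ?J"
    proof
      fix p assume p: "p \<in> P"
      then have "p = p \<oplus> \<zero> \<otimes> a" using a(1) P.Icarr by simp
      then show "p \<in> ?J" using p mem by blast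
    qed
    moreover have "a = \<zero> \<oplus> \<one> \<otimes> a" using a(1) by simp
    then have "a \<in> ?J" using mem P.zero_closed one_closed by blast
    ultimately have "?J \<inter> S \<noteq> {}" using max a(2) by blast
    then obtain x where "x \<in> ?J" "x \<in> S" by blast
    then show ?thesis using mem[of x] by auto
  qed
  have "primeideal P R"
  proof (rule primeidealI[OF P(1) is_cring])
    show "carrier R \<noteq> P" using P(3) S by blast
    fix a b assume ab: "a \<in> carrier R" "b \<in> carrier R" "a \<otimes> b \<in> P"
    show "a \<in> P \<or> b \<in> P"
    proof (rule ccontr)
      assume "\<not> (a \<in> P \<or> b \<in> P)"
      then obtain p q x y where pq: "p \<in> P" "q \<in> P" "x \<in> carrier R" "y \<in> carrier R"
        "p \<oplus> x \<otimes> a \<in> S" "q \<oplus> y \<otimes> b \<in> S"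
        using enlarge ab by meson
      have "(p \<oplus> x \<otimes> a) \<otimes> (q \<oplus> y \<otimes> b) =
          p \<otimes> (q \<oplus> y \<otimes> b) \<oplus> (x \<otimes> a \<otimes> q \<oplus> x \<otimes> y \<otimes> (a \<otimes> b))"
        using pq(1,2)[THEN P.Icarr] pq(3,4) ab(1,2) by algebra
      moreover have "p \<otimes> (q \<oplus> y \<otimes> b) \<in> P" "x \<otimes> a \<otimes> q \<in> P" "x \<otimes> y \<otimes> (a \<otimes> b) \<in> P"
        using pq(1,2)[THEN P.Icarr] pq ab by (auto intro: P.I_r_closed P.I_l_closed)
      then have "p \<otimes> (q \<oplus> y \<otimes> b) \<oplus> (x \<otimes> a \<otimes> q \<oplus> x \<otimes> y \<otimes> (a \<otimes> b)) \<in> P"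
        by (intro P.a_closed)
      ultimately show False using mult[OF pq(5,6)] P(3) by auto
    qed
  qed
  then show ?thesis using P by blast
qed

context cring begin

text \<open>The form in which local statements are glued: the elements of \<open>R\<close> that
  achieve some goal form an ideal, and for each prime one of them is found outside of it.\<close>

lemma ideal_eq_carrier_if_locally:
  assumes "ideal I R" and "\<And>P. primeideal P R \<Longrightarrow> \<not> I \<subseteq> P"
  shows "\<one> \<in> I"
proof (rule ccontr)
  assume "\<one> \<notin> I"
  then obtain P where "primeideal P R" "I \<subseteq> P"
    using prime_ideal_avoiding[OF assms(1), of "{\<one>}"] by auto
  then show False using assms(2) by blast
qed

text \<open>If no power of \<open>a\<close> is in \<open>I\<close>, some prime above
  \<open>I\<close> avoids all powers of \<open>a\<close>, hence \<open>a\<close> itself.\<close>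

lemma power_in_ideal:
  assumes I: "ideal I R" and a: "a \<in> carrier R" and "\<And>P. primeideal P R \<Longrightarrow> I \<subseteq> P \<Longrightarrow> a \<in> P"
  shows "\<exists>n::nat. a [^] n \<in> I"
proof (rule ccontr)
  assume *: "\<nexists>n::nat. a [^] n \<in> I"
  let ?S = "range (\<lambda>n::nat. a [^] n)"
  have "\<exists>P. primeideal P R \<and> I \<subseteq> P \<and> P \<inter> ?S = {}"
  proof (rule prime_ideal_avoiding[OF I])
    show "\<one> \<in> ?S" using nat_pow_0[of a] by (metis rangeI)
    show "x \<otimes> y \<in> ?S" if "x \<in> ?S" "y \<in> ?S" for x y
      using that nat_pow_mult[OF a] by (auto simp: image_iff)
    show "I \<inter> ?S = {}" using * by auto
  qed (use a in auto)
  then obtain P where "primeideal P R" "I \<subseteq> P" "P \<inter> ?S = {}" by blast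
  then show False using assms(3)[of P] nat_pow_eone[OF a] by (metis disjoint_iff rangeI)
qed

section \<open>Membership in primes and their complements\<close>

lemma prime_carrier: "primeideal P R \<Longrightarrow> x \<in> P \<Longrightarrow> x \<in> carrier R"
  by (meson ideal.Icarr primeideal.axioms(1))

lemma prime_one: "primeideal P R \<Longrightarrow> \<one> \<notin> P"
  by (metis ideal.one_imp_carrier primeideal.I_notcarr primeideal.axioms(1))

lemma prime_zero: "primeideal P R \<Longrightarrow> \<zero> \<in> P"
  by (meson additive_subgroup.zero_closed ideal.axioms(1) primeideal.axioms(1))

lemma prime_mult_iff:
  "primeideal P R \<Longrightarrow> x \<in> carrier R \<Longrightarrow> y \<in> carrier R \<Longrightarrow> x \<otimes> y \<in> P \<longleftrightarrow> x \<in> P \<or> y \<in> P"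
  by (meson ideal.I_l_closed ideal.I_r_closed primeideal.I_prime primeideal.axioms(1))

lemma prime_pow:
  "primeideal P R \<Longrightarrow> x \<in> carrier R \<Longrightarrow> x [^] (n::nat) \<in> P \<Longrightarrow> x \<in> P"
  by (induction n) (auto simp: prime_one prime_mult_iff)

lemma prime_add: "primeideal P R \<Longrightarrow> x \<in> P \<Longrightarrow> y \<in> P \<Longrightarrow> x \<oplus> y \<in> P"
  by (meson additive_subgroup.a_closed ideal.axioms(1) primeideal.axioms(1))

lemma prime_minus: "primeideal P R \<Longrightarrow> x \<in> P \<Longrightarrow> y \<in> P \<Longrightarrow> x \<ominus> y \<in> P"
  by (metis additive_subgroup.a_closed additive_subgroup.a_inv_closed ideal.axioms(1)
      minus_eq primeideal.axioms(1))

lemma prime_add_iff: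
  assumes "primeideal P R" "x \<in> carrier R" "y \<in> P"
  shows "x \<oplus> y \<in> P \<longleftrightarrow> x \<in> P" "x \<ominus> y \<in> P \<longleftrightarrow> x \<in> P"
proof -
  have y: "y \<in> carrier R" using assms prime_carrier by blast
  have e: "x = (x \<oplus> y) \<ominus> y" "x = (x \<ominus> y) \<oplus> y" using y assms(2) by algebra+
  show "x \<oplus> y \<in> P \<longleftrightarrow> x \<in> P"
    using e(1) prime_minus prime_add assms by metis
  show "x \<ominus> y \<in> P \<longleftrightarrow> x \<in> P"
    using e(2) prime_minus prime_add assms by metis
qed

lemma prime_compl_mult:
  "primeideal P R \<Longrightarrow> s \<in> carrier R - P \<Longrightarrow> t \<in> carrier R - P \<Longrightarrow> s \<otimes> t \<in> carrier R - P"
  by (auto simp: prime_mult_iff)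

lemma prime_one_minus:
  assumes "primeideal P R" "y \<in> P" shows "\<one> \<ominus> y \<in> carrier R - P"
  using assms prime_carrier prime_add_iff(2) prime_one by fastforce

lemma prime_compl_pow:
  "primeideal P R \<Longrightarrow> s \<in> carrier R - P \<Longrightarrow> s [^] (n::nat) \<in> carrier R - P"
  using prime_pow by auto

lemma prime_one_minus_iff:
  assumes "primeideal P R" "x \<in> carrier R" "\<one> \<ominus> x \<in> P" shows "x \<notin> P"
proof
  assume "x \<in> P"
  then have "(\<one> \<ominus> x) \<oplus> x \<in> P" using assms prime_add by blast
  moreover have "(\<one> \<ominus> x) \<oplus> x = \<one>" using assms(2) by algebra
  ultimately show False using prime_one assms by simp
qed

section \<open>Calculus of divisibility and vanishing at a prime\<close>

lemma loc_dvdI: "s \<in> carrier R \<Longrightarrow> s \<notin> P \<Longrightarrow> x \<in> carrier R \<Longrightarrow> s \<otimes> b = x \<otimes> a \<Longrightarrow> loc_dvd R P a b"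
  by (auto simp: loc_dvd_def)

lemma loc_zeroI: "s \<in> carrier R \<Longrightarrow> s \<notin> P \<Longrightarrow> s \<otimes> b = \<zero> \<Longrightarrow> loc_zero R P b"
  by (auto simp: loc_zero_def)

lemma loc_dvd_refl: "primeideal P R \<Longrightarrow> a \<in> carrier R \<Longrightarrow> loc_dvd R P a a"
  by (rule loc_dvdI[of \<one> _ \<one>]) (auto simp: prime_one)

lemma loc_dvd_trans:
  assumes P: "primeideal P R" and c: "a \<in> carrier R" "b \<in> carrier R" "c \<in> carrier R"
    and ab: "loc_dvd R P a b" and bc: "loc_dvd R P b c"
  shows "loc_dvd R P a c"
proof -
  obtain s x where s: "s \<in> carrier R - P" "x \<in> carrier R" "s \<otimes> b = x \<otimes> a"
    using ab by (auto simp: loc_dvd_def)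
  obtain t y where t: "t \<in> carrier R - P" "y \<in> carrier R" "t \<otimes> c = y \<otimes> b"
    using bc by (auto simp: loc_dvd_def)
  have "(s \<otimes> t) \<otimes> c = s \<otimes> (t \<otimes> c)" using s(1)[THEN DiffD1] s(2) t(1)[THEN DiffD1] t(2) c by algebra
  also have "\<dots> = y \<otimes> (s \<otimes> b)" unfolding t(3)
    using s(1)[THEN DiffD1] s(2) t(1)[THEN DiffD1] t(2) c by algebra
  also have "\<dots> = (y \<otimes> x) \<otimes> a" unfolding s(3)
    using s(1)[THEN DiffD1] s(2) t(1)[THEN DiffD1] t(2) c by algebra
  finally show ?thesis using prime_compl_mult[OF P s(1) t(1)] s t
    by (intro loc_dvdI[of "s \<otimes> t" _ "y \<otimes> x"]) auto
qed

lemma loc_dvd_mult: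
  assumes P: "primeideal P R" and c: "a \<in> carrier R" "b \<in> carrier R" "c \<in> carrier R" "d \<in> carrier R"
    and ab: "loc_dvd R P a b" and cd: "loc_dvd R P c d"
  shows "loc_dvd R P (a \<otimes> c) (b \<otimes> d)"
proof -
  obtain s x where s: "s \<in> carrier R - P" "x \<in> carrier R" "s \<otimes> b = x \<otimes> a"
    using ab by (auto simp: loc_dvd_def)
  obtain t y where t: "t \<in> carrier R - P" "y \<in> carrier R" "t \<otimes> d = y \<otimes> c"
    using cd by (auto simp: loc_dvd_def)
  have "(s \<otimes> t) \<otimes> (b \<otimes> d) = (s \<otimes> b) \<otimes> (t \<otimes> d)"
    using s(1)[THEN DiffD1] s(2) t(1)[THEN DiffD1] t(2) c by algebra
  also have "\<dots> = (x \<otimes> y) \<otimes> (a \<otimes> c)" unfolding t(3) s(3)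
    using s(1)[THEN DiffD1] s(2) t(1)[THEN DiffD1] t(2) c by algebra
  finally show ?thesis using prime_compl_mult[OF P s(1) t(1)] s t
    by (intro loc_dvdI[of "s \<otimes> t" _ "x \<otimes> y"]) auto
qed

lemma loc_dvd_pow:
  assumes P: "primeideal P R" and c: "a \<in> carrier R" "b \<in> carrier R" and ab: "loc_dvd R P a b"
  shows "loc_dvd R P (a [^] (n::nat)) (b [^] n)"
  using assms by (induction n) (auto intro!: loc_dvd_mult loc_dvd_refl)

lemma loc_dvd_triv:
  "primeideal P R \<Longrightarrow> a \<in> carrier R \<Longrightarrow> b \<in> carrier R \<Longrightarrow> loc_dvd R P a (b \<otimes> a)"
  "primeideal P R \<Longrightarrow> a \<in> carrier R \<Longrightarrow> b \<in> carrier R \<Longrightarrow> loc_dvd R P a (a \<otimes> b)"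
  by (rule loc_dvdI[of \<one> _ b]; simp add: prime_one m_comm)+

lemma loc_dvd_pow_le:
  assumes "primeideal P R" "a \<in> carrier R" "(m::nat) \<le> n"
  shows "loc_dvd R P (a [^] m) (a [^] n)"
  using loc_dvd_triv(2)[OF assms(1), of "a [^] m" "a [^] (n - m)"] assms by (simp add: nat_pow_mult)

lemma loc_dvd_unit:
  "a \<in> carrier R \<Longrightarrow> a \<notin> P \<Longrightarrow> b \<in> carrier R \<Longrightarrow> loc_dvd R P a b"
  by (rule loc_dvdI[of a _ b]) (auto simp: m_comm)

lemma loc_dvd_add:
  assumes P: "primeideal P R" and c: "a \<in> carrier R" "b \<in> carrier R" "d \<in> carrier R"
    and ab: "loc_dvd R P a b" and cd: "loc_dvd R P a d"
  shows "loc_dvd R P a (b \<oplus> d)"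
proof -
  obtain s x where s: "s \<in> carrier R - P" "x \<in> carrier R" "s \<otimes> b = x \<otimes> a"
    using ab by (auto simp: loc_dvd_def)
  obtain t y where t: "t \<in> carrier R - P" "y \<in> carrier R" "t \<otimes> d = y \<otimes> a"
    using cd by (auto simp: loc_dvd_def)
  have "(s \<otimes> t) \<otimes> (b \<oplus> d) = t \<otimes> (s \<otimes> b) \<oplus> s \<otimes> (t \<otimes> d)"
    using s(1)[THEN DiffD1] s(2) t(1)[THEN DiffD1] t(2) c by algebra
  also have "\<dots> = (t \<otimes> x \<oplus> s \<otimes> y) \<otimes> a" unfolding t(3) s(3)
    using s(1)[THEN DiffD1] s(2) t(1)[THEN DiffD1] t(2) c by algebra
  finally show ?thesis using prime_compl_mult[OF P s(1) t(1)] s t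
    by (intro loc_dvdI[of "s \<otimes> t" _ "t \<otimes> x \<oplus> s \<otimes> y"]) auto
qed

lemma loc_zero_iff: "a \<in> carrier R \<Longrightarrow> loc_zero R P a \<longleftrightarrow> loc_dvd R P \<zero> a"
  by (auto simp: loc_dvd_def loc_zero_def)

lemma loc_zero_dvd:
  "primeideal P R \<Longrightarrow> a \<in> carrier R \<Longrightarrow> b \<in> carrier R \<Longrightarrow> loc_zero R P b \<Longrightarrow> loc_dvd R P a b"
  by (auto simp: loc_zero_def intro: loc_dvdI[of _ _ \<zero>])

lemma loc_zero_if_dvd:
  "primeideal P R \<Longrightarrow> a \<in> carrier R \<Longrightarrow> b \<in> carrier R \<Longrightarrow> loc_zero R P a \<Longrightarrow> loc_dvd R P a b \<Longrightarrow> loc_zero R P b"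
  using loc_dvd_trans[of P \<zero> a b] by (auto simp: loc_zero_iff)

lemma loc_zero_in_prime:
  "primeideal P R \<Longrightarrow> a \<in> carrier R \<Longrightarrow> loc_zero R P a \<Longrightarrow> a \<in> P"
  using prime_mult_iff prime_zero by (fastforce simp: loc_zero_def)

text \<open>Primes below \<open>P\<close> come from primes of the localization at \<open>P\<close>,
  so they absorb local multiples: the denominator lies outside \<open>P\<close>, hence outside
  \<open>Q\<close>.\<close>

lemma loc_dvd_in_prime:
  assumes "primeideal Q R" "Q \<subseteq> P" "a \<in> Q" "b \<in> carrier R" "loc_dvd R P a b"
  shows "b \<in> Q"
proof -
  obtain s x where s: "s \<in> carrier R - P" "x \<in> carrier R" "s \<otimes> b = x \<otimes> a"
    using assms(5) by (auto simp: loc_dvd_def)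
  have "x \<otimes> a \<in> Q" using s assms(1,3) prime_mult_iff prime_carrier by metis
  then have "s \<otimes> b \<in> Q" using s(3) by simp
  then show ?thesis using s assms(1,2,4) prime_mult_iff by blast
qed

lemma loc_zero_subset: "Q \<subseteq> P \<Longrightarrow> loc_zero R P a \<Longrightarrow> loc_zero R Q a"
  by (auto simp: loc_zero_def)

lemma loc_zero_unit_mult:
  assumes "primeideal P R" "a \<in> carrier R" "u \<in> carrier R - P" "loc_zero R P (u \<otimes> a)"
  shows "loc_zero R P a"
proof -
  obtain s where s: "s \<in> carrier R - P" "s \<otimes> (u \<otimes> a) = \<zero>" using assms(4) by (auto simp: loc_zero_def)
  have "(s \<otimes> u) \<otimes> a = \<zero>" using s assms m_assoc by auto
  then show ?thesis using prime_compl_mult[OF assms(1) s(1) assms(3)] by (auto intro: loc_zeroI)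
qed

text \<open>Nakayama's lemma for a cyclic module: \<open>s a = x a c\<close> gives
  \<open>(s - x c) a = 0\<close>, and \<open>s - x c\<close> is outside \<open>P\<close> because
  \<open>c\<close> is in \<open>P\<close>.\<close>

lemma loc_nakayama:
  assumes P: "primeideal P R" and a: "a \<in> carrier R" and c: "c \<in> P" and d: "loc_dvd R P (a \<otimes> c) a"
  shows "loc_zero R P a"
proof -
  have c': "c \<in> carrier R" using P c prime_carrier by blast
  obtain s x where s: "s \<in> carrier R - P" "x \<in> carrier R" "s \<otimes> a = x \<otimes> (a \<otimes> c)"
    using d by (auto simp: loc_dvd_def)
  have "(s \<ominus> x \<otimes> c) \<otimes> a = s \<otimes> a \<ominus> x \<otimes> (a \<otimes> c)" using s(1)[THEN DiffD1] s(2) a c' by algebra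
  also have "\<dots> = \<zero>" unfolding s(3) using s(1)[THEN DiffD1] s(2) a c' by algebra
  finally have "(s \<ominus> x \<otimes> c) \<otimes> a = \<zero>" .
  moreover have "s \<ominus> x \<otimes> c \<notin> P"
    using s(1,2) c c' P prime_mult_iff[OF P s(2) c'] prime_add_iff(2)[OF P, of s "x \<otimes> c"] by blast
  moreover have "s \<ominus> x \<otimes> c \<in> carrier R" using s(1,2) c' by blast
  ultimately show ?thesis by (intro loc_zeroI)
qed

text \<open>The annihilator of \<open>b\<close> is an ideal contained in no prime.\<close>

lemma zero_if_loc_zero:
  assumes b: "b \<in> carrier R" and "\<And>P. primeideal P R \<Longrightarrow> loc_zero R P b"
  shows "b = \<zero>"
proof -
  let ?I = "{u \<in> carrier R. u \<otimes> b = \<zero>}"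
  have "ideal ?I R"
    by (rule idealI') (use b in \<open>auto simp: l_distr m_assoc\<close>)
  then have "\<one> \<in> ?I"
    by (rule ideal_eq_carrier_if_locally) (use assms(2) in \<open>auto simp: loc_zero_def\<close>)
  then show ?thesis using b by simp
qed

end

section \<open>Principal localizations\<close>

text \<open>Quantifying over ideals of \<open>R\<close> suffices, since each ideal of a localization
  is generated by the image of its contraction. The generator can be taken from \<open>I\<close>
  because denominators become units.\<close>

definition loc_principal :: "('a, 'x) ring_scheme \<Rightarrow> 'a set \<Rightarrow> bool"
  where "loc_principal R P \<longleftrightarrow> (\<forall>I. ideal I R \<longrightarrow> (\<exists>a\<in>I. \<forall>b\<in>I. loc_dvd R P a b))"

context cring begin

section \<open>The ring of fractions at a prime\<close>

context
  fixes P assumes P: "primeideal P R"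
begin

abbreviation (input) "lfrac \<equiv> loc_frac R P"
abbreviation (input) "L \<equiv> localization R P"

lemma equiv_loc_rel: "equiv (loc_pairs R P) (loc_rel R P)"
proof (rule equivI)
  show "loc_rel R P \<subseteq> loc_pairs R P \<times> loc_pairs R P" by (auto simp: loc_rel_def)
  show "refl_on (loc_pairs R P) (loc_rel R P)"
    using prime_one[OF P] by (auto simp: refl_on_def loc_rel_def loc_pairs_def intro!: bexI[of _ \<one>])
  show "sym (loc_rel R P)" by (auto simp: sym_def loc_rel_def) (metis DiffI)
  show "trans (loc_rel R P)"
  proof (rule transI)
    fix x y z assume "(x, y) \<in> loc_rel R P" "(y, z) \<in> loc_rel R P"
    moreover obtain a s b t c r where [simp]: "x = (a, s)" "y = (b, t)" "z = (c, r)"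
      by (metis prod.collapse)
    ultimately obtain u v where c: "a \<in> carrier R" "b \<in> carrier R" "c \<in> carrier R"
       "s \<in> carrier R" "t \<in> carrier R" "r \<in> carrier R" "u \<in> carrier R" "v \<in> carrier R"
      and nP: "s \<notin> P" "t \<notin> P" "r \<notin> P" "u \<notin> P" "v \<notin> P"
      and u: "u \<otimes> (a \<otimes> t) = u \<otimes> (b \<otimes> s)" and v: "v \<otimes> (b \<otimes> r) = v \<otimes> (c \<otimes> t)"
      by (auto simp: loc_rel_def loc_pairs_def)
    \<comment> \<open>In the presence of zero divisors \<open>b\<close> is eliminated with the
      multiplier \<open>u v t\<close>, which includes the middle denominator.\<close>
    have "(u \<otimes> v \<otimes> t) \<otimes> (a \<otimes> r) = v \<otimes> r \<otimes> (u \<otimes> (a \<otimes> t))" using c by algebra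
    also have "\<dots> = u \<otimes> s \<otimes> (v \<otimes> (b \<otimes> r))" unfolding u using c by algebra
    also have "\<dots> = (u \<otimes> v \<otimes> t) \<otimes> (c \<otimes> s)" unfolding v using c by algebra
    finally have "(u \<otimes> v \<otimes> t) \<otimes> (a \<otimes> r) = (u \<otimes> v \<otimes> t) \<otimes> (c \<otimes> s)" .
    moreover have "u \<otimes> v \<otimes> t \<in> carrier R - P" using c nP P by (auto simp: prime_mult_iff)
    ultimately show "(x, z) \<in> loc_rel R P" using c nP by (auto simp: loc_rel_def loc_pairs_def)
  qed
qed

lemma frac_eq_iff:
  assumes "a \<in> carrier R" "b \<in> carrier R" "s \<in> carrier R - P" "t \<in> carrier R - P"
  shows "lfrac a s = lfrac b t \<longleftrightarrow> (\<exists>u\<in>carrier R - P. u \<otimes> (a \<otimes> t) = u \<otimes> (b \<otimes> s))"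
proof -
  have "(a, s) \<in> loc_pairs R P" "(b, t) \<in> loc_pairs R P" using assms by (auto simp: loc_pairs_def)
  then have "lfrac a s = lfrac b t \<longleftrightarrow> ((a, s), (b, t)) \<in> loc_rel R P"
    unfolding loc_frac_def by (rule eq_equiv_class_iff[OF equiv_loc_rel])
  then show ?thesis using assms by (auto simp: loc_rel_def loc_pairs_def)
qed

lemma frac_eqI:
  assumes "a \<in> carrier R" "b \<in> carrier R" "s \<in> carrier R - P" "t \<in> carrier R - P" "a \<otimes> t = b \<otimes> s"
  shows "lfrac a s = lfrac b t"
  using assms frac_eq_iff[OF assms(1-4)] prime_one[OF P] by auto

lemma localization_carrier: "carrier L = {lfrac a s | a s. a \<in> carrier R \<and> s \<in> carrier R - P}"
  by (auto simp: localization_def loc_frac_def quotient_def loc_pairs_def)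

lemma frac_closed: "a \<in> carrier R \<Longrightarrow> s \<in> carrier R - P \<Longrightarrow> lfrac a s \<in> carrier L"
  by (auto simp: localization_carrier)

lemma frac_mult:
  assumes "a \<in> carrier R" "b \<in> carrier R" "s \<in> carrier R - P" "t \<in> carrier R - P"
  shows "lfrac a s \<otimes>\<^bsub>L\<^esub> lfrac b t = lfrac (a \<otimes> b) (s \<otimes> t)"
proof -
  let ?f = "\<lambda>(a, s) (b, t). lfrac (a \<otimes> b) (s \<otimes> t)"
  \<comment> \<open>Commutativity reduces independence of both representatives to independence of
    one.\<close>
  have "?f respects2 loc_rel R P"
  proof (rule congruent2_commuteI[OF equiv_loc_rel])
    show "?f y z = ?f z y" if "y \<in> loc_pairs R P" "z \<in> loc_pairs R P" for y z
      using that by (auto simp: loc_pairs_def m_comm)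
    fix y z w assume "w \<in> loc_pairs R P" "(y, z) \<in> loc_rel R P"
    moreover obtain a s b t c r where [simp]: "y = (a, s)" "z = (b, t)" "w = (c, r)"
      by (metis prod.collapse)
    ultimately obtain u where c: "a \<in> carrier R" "b \<in> carrier R" "c \<in> carrier R"
       "s \<in> carrier R" "t \<in> carrier R" "r \<in> carrier R" "u \<in> carrier R"
      and nP: "s \<notin> P" "t \<notin> P" "r \<notin> P" "u \<notin> P"
      and u: "u \<otimes> (a \<otimes> t) = u \<otimes> (b \<otimes> s)"
      by (auto simp: loc_rel_def loc_pairs_def)
    have "u \<otimes> (c \<otimes> a \<otimes> (r \<otimes> t)) = c \<otimes> r \<otimes> (u \<otimes> (a \<otimes> t))" using c by algebra
    also have "\<dots> = u \<otimes> (c \<otimes> b \<otimes> (r \<otimes> s))" unfolding u using c by algebra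
    finally have "lfrac (c \<otimes> a) (r \<otimes> s) = lfrac (c \<otimes> b) (r \<otimes> t)"
      using c nP prime_mult_iff[OF P] by (subst frac_eq_iff) auto
    then show "?f w y = ?f w z" by simp
  qed
  then have "(\<Union>x\<in>loc_rel R P `` {(a, s)}. \<Union>y\<in>loc_rel R P `` {(b, t)}. ?f x y) = ?f (a, s) (b, t)"
    by (rule UN_equiv_class2[OF equiv_loc_rel equiv_loc_rel]) (use assms in \<open>auto simp: loc_pairs_def\<close>)
  then show ?thesis
    by (simp add: localization_def loc_frac_def[of R P a s] loc_frac_def[of R P b t] case_prod_unfold)
qed

lemma frac_add:
  assumes "a \<in> carrier R" "b \<in> carrier R" "s \<in> carrier R - P" "t \<in> carrier R - P"
  shows "lfrac a s \<oplus>\<^bsub>L\<^esub> lfrac b t = lfrac (a \<otimes> t \<oplus> b \<otimes> s) (s \<otimes> t)"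
proof -
  let ?f = "\<lambda>(a, s) (b, t). lfrac (a \<otimes> t \<oplus> b \<otimes> s) (s \<otimes> t)"
  have "?f respects2 loc_rel R P"
  proof (rule congruent2_commuteI[OF equiv_loc_rel])
    show "?f y z = ?f z y" if "y \<in> loc_pairs R P" "z \<in> loc_pairs R P" for y z
      using that by (auto simp: loc_pairs_def m_comm a_comm)
    fix y z w assume "w \<in> loc_pairs R P" "(y, z) \<in> loc_rel R P"
    moreover obtain a s b t c r where [simp]: "y = (a, s)" "z = (b, t)" "w = (c, r)"
      by (metis prod.collapse)
    ultimately obtain u where c: "a \<in> carrier R" "b \<in> carrier R" "c \<in> carrier R"
       "s \<in> carrier R" "t \<in> carrier R" "r \<in> carrier R" "u \<in> carrier R"
      and nP: "s \<notin> P" "t \<notin> P" "r \<notin> P" "u \<notin> P"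
      and u: "u \<otimes> (a \<otimes> t) = u \<otimes> (b \<otimes> s)"
      by (auto simp: loc_rel_def loc_pairs_def)
    have "u \<otimes> ((c \<otimes> s \<oplus> a \<otimes> r) \<otimes> (r \<otimes> t)) = u \<otimes> c \<otimes> s \<otimes> r \<otimes> t \<oplus> r \<otimes> r \<otimes> (u \<otimes> (a \<otimes> t))"
      using c by algebra
    also have "\<dots> = u \<otimes> ((c \<otimes> t \<oplus> b \<otimes> r) \<otimes> (r \<otimes> s))" unfolding u using c by algebra
    finally have "lfrac (c \<otimes> s \<oplus> a \<otimes> r) (r \<otimes> s) = lfrac (c \<otimes> t \<oplus> b \<otimes> r) (r \<otimes> t)"
      using c nP prime_mult_iff[OF P] by (subst frac_eq_iff) auto
    then show "?f w y = ?f w z" by simp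
  qed
  then have "(\<Union>x\<in>loc_rel R P `` {(a, s)}. \<Union>y\<in>loc_rel R P `` {(b, t)}. ?f x y) = ?f (a, s) (b, t)"
    by (rule UN_equiv_class2[OF equiv_loc_rel equiv_loc_rel]) (use assms in \<open>auto simp: loc_pairs_def\<close>)
  then show ?thesis
    by (simp add: localization_def loc_frac_def[of R P a s] loc_frac_def[of R P b t] case_prod_unfold)
qed

lemma localization_zero: "\<zero>\<^bsub>L\<^esub> = lfrac \<zero> \<one>" and localization_one: "\<one>\<^bsub>L\<^esub> = lfrac \<one> \<one>"
  by (simp_all add: localization_def)

lemma one_compl: "\<one> \<in> carrier R - P"
  using prime_one[OF P] by simp

lemma localization_cring: "cring L"
proof (rule cringI)
  note [simp] = frac_mult frac_add localization_zero localization_one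
  have m: "s \<otimes> t \<in> carrier R - P" if "s \<in> carrier R - P" "t \<in> carrier R - P" for s t
    using prime_compl_mult[OF P that] .
  have E: "\<exists>a s. x = lfrac a s \<and> a \<in> carrier R \<and> s \<in> carrier R \<and> s \<notin> P" if "x \<in> carrier L" for x
    using that by (auto simp: localization_carrier)
  have i: "\<one> \<in> carrier R" "\<one> \<notin> P" using one_compl by auto
  show "abelian_group L"
  proof (rule abelian_groupI)
    show "\<zero>\<^bsub>L\<^esub> \<in> carrier L" using frac_closed one_compl by simp
    fix x assume x: "x \<in> carrier L"
    obtain a s where xa: "x = lfrac a s" "a \<in> carrier R" "s \<in> carrier R" "s \<notin> P" using E[OF x] by blast
    have "\<zero> \<otimes> s \<oplus> a \<otimes> \<one> = a" "\<one> \<otimes> s = s" using xa(2,3) by algebra+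
    then show "\<zero>\<^bsub>L\<^esub> \<oplus>\<^bsub>L\<^esub> x = x" using xa i by simp
    have "(\<ominus> a \<otimes> s \<oplus> a \<otimes> s) \<otimes> \<one> = \<zero> \<otimes> (s \<otimes> s)" using xa(2,3) by algebra
    then have "lfrac (\<ominus> a \<otimes> s \<oplus> a \<otimes> s) (s \<otimes> s) = lfrac \<zero> \<one>"
      using xa m one_compl by (intro frac_eqI) blast+
    then have "lfrac (\<ominus> a) s \<oplus>\<^bsub>L\<^esub> x = \<zero>\<^bsub>L\<^esub>"
      using xa by simp
    moreover have "lfrac (\<ominus> a) s \<in> carrier L" using xa by (intro frac_closed) auto
    ultimately show "\<exists>y\<in>carrier L. y \<oplus>\<^bsub>L\<^esub> x = \<zero>\<^bsub>L\<^esub>" by blast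
    fix y assume y: "y \<in> carrier L"
    obtain b t where yb: "y = lfrac b t" "b \<in> carrier R" "t \<in> carrier R" "t \<notin> P" using E[OF y] by blast
    show "x \<oplus>\<^bsub>L\<^esub> y \<in> carrier L" using xa yb m by (auto intro!: frac_closed)
    show "x \<oplus>\<^bsub>L\<^esub> y = y \<oplus>\<^bsub>L\<^esub> x" using xa yb by (simp add: a_comm m_comm)
    fix z assume z: "z \<in> carrier L"
    obtain c r where zc: "z = lfrac c r" "c \<in> carrier R" "r \<in> carrier R" "r \<notin> P" using E[OF z] by blast
    have "(a \<otimes> t \<oplus> b \<otimes> s) \<otimes> r \<oplus> c \<otimes> (s \<otimes> t) = a \<otimes> (t \<otimes> r) \<oplus> (b \<otimes> r \<oplus> c \<otimes> t) \<otimes> s" "s \<otimes> t \<otimes> r = s \<otimes> (t \<otimes> r)"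
      using xa(2,3) yb(2,3) zc(2,3) by algebra+
    then show "x \<oplus>\<^bsub>L\<^esub> y \<oplus>\<^bsub>L\<^esub> z = x \<oplus>\<^bsub>L\<^esub> (y \<oplus>\<^bsub>L\<^esub> z)"
      using xa yb zc prime_mult_iff[OF P] by simp
  qed
  show "comm_monoid L"
  proof (rule comm_monoidI)
    show "\<one>\<^bsub>L\<^esub> \<in> carrier L" using frac_closed one_compl by simp
    fix x assume x: "x \<in> carrier L"
    obtain a s where xa: "x = lfrac a s" "a \<in> carrier R" "s \<in> carrier R" "s \<notin> P" using E[OF x] by blast
    show "\<one>\<^bsub>L\<^esub> \<otimes>\<^bsub>L\<^esub> x = x" using xa i by simp
    fix y assume y: "y \<in> carrier L"
    obtain b t where yb: "y = lfrac b t" "b \<in> carrier R" "t \<in> carrier R" "t \<notin> P" using E[OF y] by blast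
    show "x \<otimes>\<^bsub>L\<^esub> y \<in> carrier L" using xa yb m by (auto intro!: frac_closed)
    show "x \<otimes>\<^bsub>L\<^esub> y = y \<otimes>\<^bsub>L\<^esub> x" using xa yb by (simp add: m_comm)
    fix z assume z: "z \<in> carrier L"
    obtain c r where zc: "z = lfrac c r" "c \<in> carrier R" "r \<in> carrier R" "r \<notin> P" using E[OF z] by blast
    show "x \<otimes>\<^bsub>L\<^esub> y \<otimes>\<^bsub>L\<^esub> z = x \<otimes>\<^bsub>L\<^esub> (y \<otimes>\<^bsub>L\<^esub> z)"
      using xa yb zc prime_mult_iff[OF P] by (simp add: m_assoc)
  qed
  fix x y z assume x: "x \<in> carrier L" and y: "y \<in> carrier L" and z: "z \<in> carrier L"
  obtain a s where xa: "x = lfrac a s" "a \<in> carrier R" "s \<in> carrier R" "s \<notin> P" using E[OF x] by blast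
  obtain b t where yb: "y = lfrac b t" "b \<in> carrier R" "t \<in> carrier R" "t \<notin> P" using E[OF y] by blast
  obtain c r where zc: "z = lfrac c r" "c \<in> carrier R" "r \<in> carrier R" "r \<notin> P" using E[OF z] by blast
  have "((a \<otimes> t \<oplus> b \<otimes> s) \<otimes> c) \<otimes> ((s \<otimes> r) \<otimes> (t \<otimes> r)) = (a \<otimes> c \<otimes> (t \<otimes> r) \<oplus> b \<otimes> c \<otimes> (s \<otimes> r)) \<otimes> (s \<otimes> t \<otimes> r)"
    using xa(2,3) yb(2,3) zc(2,3) by algebra
  then have "lfrac ((a \<otimes> t \<oplus> b \<otimes> s) \<otimes> c) (s \<otimes> t \<otimes> r) =
    lfrac (a \<otimes> c \<otimes> (t \<otimes> r) \<oplus> b \<otimes> c \<otimes> (s \<otimes> r)) ((s \<otimes> r) \<otimes> (t \<otimes> r))"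
    using xa yb zc prime_mult_iff[OF P] by (intro frac_eqI) auto
  then show "(x \<oplus>\<^bsub>L\<^esub> y) \<otimes>\<^bsub>L\<^esub> z = x \<otimes>\<^bsub>L\<^esub> z \<oplus>\<^bsub>L\<^esub> y \<otimes>\<^bsub>L\<^esub> z"
    using xa yb zc prime_mult_iff[OF P] by simp
qed

lemma frac_one_eq_zero_iff:
  "a \<in> carrier R \<Longrightarrow> s \<in> carrier R - P \<Longrightarrow> lfrac a s = \<zero>\<^bsub>L\<^esub> \<longleftrightarrow> loc_zero R P a"
  using one_compl by (auto simp: localization_zero frac_eq_iff loc_zero_def)

lemma frac_pow:
  assumes "a \<in> carrier R" "s \<in> carrier R - P"
  shows "lfrac a s [^]\<^bsub>L\<^esub> (n::nat) = lfrac (a [^] n) (s [^] n)"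
proof (induction n)
  interpret L: cring L by (rule localization_cring)
  { case 0 then show ?case by (simp add: localization_one) }
  case (Suc n)
  then show ?case using assms prime_compl_pow[OF P assms(2), of n] by (simp add: frac_mult)
qed

lemma reduced_localization_iff:
  "reduced_ring L \<longleftrightarrow> (\<forall>x\<in>carrier R. \<forall>n::nat. loc_zero R P (x [^] n) \<longrightarrow> loc_zero R P x)"
proof
  assume *: "reduced_ring L"
  show "\<forall>x\<in>carrier R. \<forall>n::nat. loc_zero R P (x [^] n) \<longrightarrow> loc_zero R P x"
  proof (intro ballI allI impI)
    fix x and n :: nat assume x: "x \<in> carrier R" "loc_zero R P (x [^] n)"
    then have "lfrac x \<one> [^]\<^bsub>L\<^esub> n = \<zero>\<^bsub>L\<^esub>"
      using one_compl by (simp add: frac_pow frac_one_eq_zero_iff)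
    then have "lfrac x \<one> = \<zero>\<^bsub>L\<^esub>" using * frac_closed[OF x(1) one_compl] by (auto simp: reduced_ring_def)
    then show "loc_zero R P x" using x one_compl by (simp add: frac_one_eq_zero_iff)
  qed
next
  assume *: "\<forall>x\<in>carrier R. \<forall>n::nat. loc_zero R P (x [^] n) \<longrightarrow> loc_zero R P x"
  show "reduced_ring L"
    unfolding reduced_ring_def
  proof (intro ballI allI impI)
    fix x and n :: nat assume x: "x \<in> carrier L" "x [^]\<^bsub>L\<^esub> n = \<zero>\<^bsub>L\<^esub>"
    then obtain a s where xa: "x = lfrac a s" "a \<in> carrier R" "s \<in> carrier R - P"
      by (auto simp: localization_carrier)
    then have "loc_zero R P (a [^] n)"
      using x(2) prime_compl_pow[OF P xa(3), of n] by (simp add: frac_pow frac_one_eq_zero_iff)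
    then have "loc_zero R P a" using * xa by blast
    then show "x = \<zero>\<^bsub>L\<^esub>" using xa by (simp add: frac_one_eq_zero_iff)
  qed
qed

text \<open>The image of \<open>I\<close> generates the ideal \<open>?J\<close> of fractions with
  numerator in \<open>I\<close>. A generator of \<open>?J\<close> may be replaced by its numerator,
  which lies in \<open>I\<close>.\<close>

lemma loc_principal_if_principal_ideal_ring:
  assumes "principal_ideal_ring L" shows "loc_principal R P"
  unfolding loc_principal_def
proof (intro allI impI)
  interpret L: cring L by (rule localization_cring)
  fix I assume I: "ideal I R"
  have Ic: "\<And>a. a \<in> I \<Longrightarrow> a \<in> carrier R" using ideal.Icarr[OF I] .
  let ?J = "{lfrac a s | a s. a \<in> I \<and> s \<in> carrier R - P}"
  have "ideal ?J L"
  proof (rule L.idealI')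
    show "?J \<subseteq> carrier L" using Ic frac_closed by auto
    have "\<zero> \<in> I" using I additive_subgroup.zero_closed ideal.axioms(1) by blast
    then show "\<zero>\<^bsub>L\<^esub> \<in> ?J" using one_compl by (auto simp: localization_zero)
  next
    fix x y assume "x \<in> ?J" "y \<in> ?J"
    then obtain a s b t where *: "x = lfrac a s" "y = lfrac b t" "a \<in> I" "b \<in> I" "s \<in> carrier R - P"
      "t \<in> carrier R - P"
      by blast
    moreover have "a \<otimes> t \<oplus> b \<otimes> s \<in> I"
      using * I additive_subgroup.a_closed[OF ideal.axioms(1)[OF I]] ideal.I_r_closed[OF I] by simp
    moreover have "x \<oplus>\<^bsub>L\<^esub> y = lfrac (a \<otimes> t \<oplus> b \<otimes> s) (s \<otimes> t)" using * Ic by (simp add: frac_add)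
    ultimately show "x \<oplus>\<^bsub>L\<^esub> y \<in> ?J" using prime_compl_mult[OF P] by blast
  next
    fix x y assume "x \<in> ?J" "y \<in> carrier L"
    then obtain a s b t where *: "x = lfrac a s" "y = lfrac b t" "a \<in> I" "b \<in> carrier R" "s \<in> carrier R - P"
      "t \<in> carrier R - P"
      by (auto simp: localization_carrier)
    moreover have "b \<otimes> a \<in> I" using * ideal.I_l_closed[OF I] by simp
    moreover have "y \<otimes>\<^bsub>L\<^esub> x = lfrac (b \<otimes> a) (t \<otimes> s)" using * Ic by (simp add: frac_mult)
    ultimately show "y \<otimes>\<^bsub>L\<^esub> x \<in> ?J" using prime_compl_mult[OF P] by blast
  qed
  then have "principalideal ?J L" using assms by (auto simp: principal_ideal_ring_def)
  then obtain i where i: "i \<in> carrier L" "?J = Idl\<^bsub>L\<^esub> {i}" by (auto dest!: principalideal.generate)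
  then have Ji: "?J = {x \<otimes>\<^bsub>L\<^esub> i | x. x \<in> carrier L}"
    using L.cgenideal_eq_genideal[OF i(1)] by (simp add: cgenideal_def)
  have "i \<in> ?J" using i L.genideal_self[of "{i}"] by simp
  then obtain a s where a: "i = lfrac a s" "a \<in> I" "s \<in> carrier R - P" by auto
  show "\<exists>a\<in>I. \<forall>b\<in>I. loc_dvd R P a b"
  proof (intro bexI ballI)
    fix b assume b: "b \<in> I"
    then have "lfrac b \<one> \<in> ?J" using one_compl by blast
    then obtain x t where x: "x \<in> carrier R" "t \<in> carrier R - P" "lfrac b \<one> = lfrac x t \<otimes>\<^bsub>L\<^esub> lfrac a s"
      unfolding Ji by (auto simp: localization_carrier a(1))
    then have "lfrac b \<one> = lfrac (x \<otimes> a) (t \<otimes> s)" using a Ic by (simp add: frac_mult)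
    then obtain u where u: "u \<in> carrier R - P" "u \<otimes> (b \<otimes> (t \<otimes> s)) = u \<otimes> (x \<otimes> a \<otimes> \<one>)"
      using frac_eq_iff[of b "x \<otimes> a" \<one> "t \<otimes> s"] b Ic a x prime_compl_mult[OF P x(2) a(3)] one_compl by auto
    have "(u \<otimes> (t \<otimes> s)) \<otimes> b = u \<otimes> (b \<otimes> (t \<otimes> s))"
      using u(1)[THEN DiffD1] x(2)[THEN DiffD1] a(3)[THEN DiffD1] Ic[OF b] by algebra
    also have "\<dots> = (u \<otimes> x) \<otimes> a"
      unfolding u(2) using u(1)[THEN DiffD1] x(1) Ic[OF a(2)] by algebra
    finally have "(u \<otimes> (t \<otimes> s)) \<otimes> b = (u \<otimes> x) \<otimes> a" .
    moreover have "u \<otimes> (t \<otimes> s) \<in> carrier R - P" using u x a prime_compl_mult[OF P] by metis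
    moreover have "u \<otimes> x \<in> carrier R" using u x by auto
    ultimately show "loc_dvd R P a b" using loc_dvdI by blast
  qed (rule a(2))
qed

text \<open>The contraction of \<open>J\<close> has a local generator, and its image generates
  \<open>J\<close>: a fraction in \<open>J\<close> differs from the image of its numerator by a
  unit.\<close>

lemma principal_ideal_ring_if_loc_principal:
  assumes "loc_principal R P" shows "principal_ideal_ring L"
  unfolding principal_ideal_ring_def
proof (intro conjI allI impI)
  show "cring L" by (rule localization_cring)
  interpret L: cring L by (rule localization_cring)
  fix J assume J: "ideal J L"
  interpret J: ideal J L by (rule J)
  let ?I = "{a \<in> carrier R. lfrac a \<one> \<in> J}"
  have "ideal ?I R"
  proof (rule idealI')
    show "\<zero> \<in> ?I" using J.zero_closed by (simp add: localization_zero)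
  next
    fix a b assume ab: "a \<in> ?I" "b \<in> ?I"
    then have "lfrac a \<one> \<oplus>\<^bsub>L\<^esub> lfrac b \<one> \<in> J" using J.a_closed by blast
    then show "a \<oplus> b \<in> ?I" using ab one_compl by (simp add: frac_add)
  next
    fix a x assume ab: "a \<in> ?I" "x \<in> carrier R"
    then have "lfrac x \<one> \<otimes>\<^bsub>L\<^esub> lfrac a \<one> \<in> J" using J.I_l_closed frac_closed one_compl by blast
    then show "x \<otimes> a \<in> ?I" using ab one_compl by (simp add: frac_mult)
  qed auto
  then obtain a where a: "a \<in> ?I" "\<And>b. b \<in> ?I \<Longrightarrow> loc_dvd R P a b"
    using assms unfolding loc_principal_def by blast
  have ac: "a \<in> carrier R" "lfrac a \<one> \<in> carrier L" using a(1) J.Icarr by auto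
  have "J = PIdl\<^bsub>L\<^esub> (lfrac a \<one>)"
  proof
    show "PIdl\<^bsub>L\<^esub> (lfrac a \<one>) \<subseteq> J" using L.cgenideal_minimal[OF J] a(1) by blast
    show "J \<subseteq> PIdl\<^bsub>L\<^esub> (lfrac a \<one>)"
    proof
      fix y assume y: "y \<in> J"
      then obtain b s where b: "y = lfrac b s" "b \<in> carrier R" "s \<in> carrier R - P"
        using J.Icarr unfolding localization_carrier by blast
      have "lfrac s \<one> \<otimes>\<^bsub>L\<^esub> y \<in> J" using b frac_closed one_compl J.I_l_closed[OF y] by auto
      moreover have "lfrac s \<one> \<otimes>\<^bsub>L\<^esub> y = lfrac b \<one>"
      proof -
        have "lfrac s \<one> \<otimes>\<^bsub>L\<^esub> y = lfrac (s \<otimes> b) (\<one> \<otimes> s)"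
          unfolding b(1) by (rule frac_mult) (use b one_compl in auto)
        also have "\<dots> = lfrac b \<one>" using b one_compl by (intro frac_eqI) (auto simp: m_comm)
        finally show ?thesis .
      qed
      ultimately have "loc_dvd R P a b" using a(2) b by auto
      then obtain t x where t: "t \<in> carrier R - P" "x \<in> carrier R" "t \<otimes> b = x \<otimes> a"
        by (auto simp: loc_dvd_def)
      have "b \<otimes> (t \<otimes> s \<otimes> \<one>) = s \<otimes> (t \<otimes> b)" using t(1)[THEN DiffD1] b(3)[THEN DiffD1] b(2) by algebra
      also have "\<dots> = x \<otimes> a \<otimes> s" unfolding t(3)
        using t(1)[THEN DiffD1] b(3)[THEN DiffD1] t(2) ac(1) by algebra
      finally have "lfrac b s = lfrac (x \<otimes> a) (t \<otimes> s \<otimes> \<one>)"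
        using prime_compl_mult[OF P t(1) b(3)] t ac b one_compl by (intro frac_eqI) auto
      also have "\<dots> = lfrac x (t \<otimes> s) \<otimes>\<^bsub>L\<^esub> lfrac a \<one>"
        using prime_compl_mult[OF P t(1) b(3)] t ac b one_compl by (intro frac_mult[symmetric]) auto
      finally show "y \<in> PIdl\<^bsub>L\<^esub> (lfrac a \<one>)"
        using b(1) frac_closed prime_compl_mult[OF P t(1) b(3)] t by (auto simp: cgenideal_def)
    qed
  qed
  then show "principalideal J L"
    using L.cgenideal_is_principalideal[OF ac(2)] by simp
qed

text \<open>An element of \<open>P\<close> that does not vanish locally is associated to a power of
  \<open>\<pi>\<close> with positive exponent, since exponent 0 would put \<open>\<one>\<close> into
  \<open>P\<close>.\<close>

lemma uniformizer_dvd: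
  assumes "uniformizer R P \<pi>" "a \<in> P" shows "loc_dvd R P \<pi> a"
proof -
  have a: "a \<in> carrier R" and pi: "\<pi> \<in> P" "\<pi> \<in> carrier R"
    using assms P prime_carrier by (auto simp: uniformizer_def)
  consider "loc_zero R P a" | n :: nat where "loc_dvd R P (\<pi> [^] n) a" "loc_dvd R P a (\<pi> [^] n)"
    using assms a by (auto simp: uniformizer_def)
  then show ?thesis
  proof cases
    case 1 then show ?thesis using loc_zero_dvd P pi a by blast
  next
    case 2
    then have "\<pi> [^] n \<in> P" using loc_dvd_in_prime[OF P, of P a "\<pi> [^] n"] assms(2) pi by simp
    then have "n \<noteq> 0" using prime_one[OF P] by (cases n) auto
    then have "loc_dvd R P (\<pi> [^] (1::nat)) (\<pi> [^] n)" using loc_dvd_pow_le[OF P, of \<pi> 1 n] pi by simp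
    then show ?thesis using 2 loc_dvd_trans[OF P, of \<pi> "\<pi> [^] n" a] pi a by simp
  qed
qed

text \<open>An element of \<open>I\<close> that divides the least possible power of
  \<open>\<pi>\<close> is a generator. If all of \<open>I\<close> vanishes at \<open>P\<close>,
  \<open>\<zero>\<close> is one.\<close>

lemma loc_principal_if_uniformizer:
  assumes u: "uniformizer R P \<pi>" shows "loc_principal R P"
  unfolding loc_principal_def
proof (intro allI impI)
  fix I assume I: "ideal I R"
  have Ic: "\<And>a. a \<in> I \<Longrightarrow> a \<in> carrier R" using ideal.Icarr[OF I] .
  have pi: "\<pi> \<in> carrier R" using u P prime_carrier by (auto simp: uniformizer_def)
  let ?D = "\<lambda>n::nat. \<exists>a\<in>I. loc_dvd R P a (\<pi> [^] n)"
  show "\<exists>a\<in>I. \<forall>b\<in>I. loc_dvd R P a b"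
  proof (cases "\<forall>b\<in>I. loc_zero R P b")
    case True
    have "\<zero> \<in> I" using I additive_subgroup.zero_closed ideal.axioms(1) by blast
    then show ?thesis using True Ic loc_zero_dvd P by blast
  next
    case False
    then have ex: "\<exists>n. ?D n" using u Ic unfolding uniformizer_def by blast
    define n where "n = (LEAST n. ?D n)"
    have "?D n" unfolding n_def by (rule LeastI_ex[OF ex])
    then obtain a where a: "a \<in> I" "loc_dvd R P a (\<pi> [^] n)" by blast
    have "loc_dvd R P a b" if b: "b \<in> I" for b
    proof (cases "loc_zero R P b")
      case True then show ?thesis using a b Ic loc_zero_dvd P by blast
    next
      case False
      then obtain m :: nat where m: "loc_dvd R P (\<pi> [^] m) b" "loc_dvd R P b (\<pi> [^] m)"
        using u Ic[OF b] unfolding uniformizer_def by blast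
      then have "n \<le> m" unfolding n_def using b by (intro Least_le) blast
      then have "loc_dvd R P (\<pi> [^] n) (\<pi> [^] m)" using loc_dvd_pow_le P pi by blast
      then show ?thesis using a m loc_dvd_trans[OF P] Ic b pi nat_pow_closed by meson
    qed
    then show ?thesis using a by blast
  qed
qed

text \<open>Krull's argument: if \<open>y\<close> were divisible by all powers of \<open>\<pi>\<close>, the successive quotients
  would generate an ideal which is not locally principal.\<close>

lemma uniformizer_if_loc_principal:
  assumes lp: "loc_principal R P" shows "\<exists>\<pi>. uniformizer R P \<pi>"
proof -
  have "ideal P R" using P by (rule primeideal.axioms(1))
  then obtain \<pi> where pi: "\<pi> \<in> P" "\<And>a. a \<in> P \<Longrightarrow> loc_dvd R P \<pi> a"
    using lp unfolding loc_principal_def by blast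
  have pc: "\<pi> \<in> carrier R" using pi P prime_carrier by blast
  have "loc_zero R P y"
    if y: "y \<in> carrier R" and no: "\<nexists>n::nat. loc_dvd R P (\<pi> [^] n) y \<and> loc_dvd R P y (\<pi> [^] n)" for y
  proof -
    \<comment> \<open>\<open>Q n z\<close> says that \<open>y\<close> is locally
      \<open>\<pi> [^] n\<close> times an element \<open>z\<close> still in \<open>P\<close>, so
      that another factor \<open>\<pi>\<close> can be split off.\<close>
    define Q where "Q = (\<lambda>(n::nat) z. z \<in> P \<and> (\<exists>s\<in>carrier R - P. s \<otimes> y = \<pi> [^] n \<otimes> z))"
    have step: "\<exists>w. Q (Suc n) w \<and> (\<exists>s\<in>carrier R - P. s \<otimes> z = w \<otimes> \<pi>)" if Qnz: "Q n z" for n z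
    proof -
      obtain s where z: "z \<in> P" and s: "s \<in> carrier R - P" "s \<otimes> y = \<pi> [^] n \<otimes> z"
        using Qnz unfolding Q_def by blast
      have zc: "z \<in> carrier R" using z P prime_carrier by blast
      obtain t w where t: "t \<in> carrier R - P" "w \<in> carrier R" "t \<otimes> z = w \<otimes> \<pi>"
        using pi(2)[OF z] by (auto simp: loc_dvd_def)
      have "(t \<otimes> s) \<otimes> y = t \<otimes> (s \<otimes> y)" using s t y by (simp add: m_assoc)
      also have "\<dots> = \<pi> [^] n \<otimes> (t \<otimes> z)" unfolding s(2)
        using t(1)[THEN DiffD1] zc pc nat_pow_closed[OF pc, of n] by algebra
      also have "\<dots> = \<pi> [^] Suc n \<otimes> w" unfolding t(3) nat_pow_Suc
        using t(2) pc nat_pow_closed[OF pc, of n] by algebra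
      finally have e: "(t \<otimes> s) \<otimes> y = \<pi> [^] Suc n \<otimes> w" .
      have ts: "t \<otimes> s \<in> carrier R - P" using prime_compl_mult[OF P t(1) s(1)] .
      have "w \<in> P"
      proof (rule ccontr)
        assume w: "w \<notin> P"
        have "w \<otimes> \<pi> [^] Suc n = (t \<otimes> s) \<otimes> y" using e t(2) pc m_comm[of w "\<pi> [^] Suc n"] by simp
        then have "loc_dvd R P y (\<pi> [^] Suc n)" using w t(2) ts by (intro loc_dvdI[of w _ "t \<otimes> s"]) auto
        moreover have "loc_dvd R P (\<pi> [^] Suc n) y" using e ts t(2) pc
          by (intro loc_dvdI[of "t \<otimes> s" _ w]) (auto simp: m_comm)
        ultimately show False using no by blast
      qed
      then show ?thesis using e ts t by (auto simp: Q_def)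
    qed
    have "y \<in> P"
    proof (rule ccontr)
      assume "y \<notin> P"
      then have "loc_dvd R P (\<pi> [^] (0::nat)) y \<and> loc_dvd R P y (\<pi> [^] (0::nat))"
        using y prime_one[OF P] by (auto intro!: loc_dvd_unit)
      then show False using no by blast
    qed
    then have "Q 0 y" using one_compl y unfolding Q_def by (intro conjI bexI[of _ \<one>]) auto
    then have "\<exists>f. (\<forall>n. Q n (f n)) \<and> f 0 = y \<and> (\<forall>n. \<exists>s\<in>carrier R - P. s \<otimes> f n = f (Suc n) \<otimes> \<pi>)"
      using dependent_nat_choice[of "\<lambda>n z. Q n z \<and> (n = 0 \<longrightarrow> z = y)"
          "\<lambda>n z w. \<exists>s\<in>carrier R - P. s \<otimes> z = w \<otimes> \<pi>"] step by auto
    then obtain z where z: "\<And>n. Q n (z n)" "z 0 = y" "\<And>n. \<exists>s\<in>carrier R - P. s \<otimes> z n = z (Suc n) \<otimes> \<pi>"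
      by blast
    have zc: "z n \<in> carrier R" for n using z(1)[of n] P prime_carrier by (auto simp: Q_def)
    have dS: "loc_dvd R P (z (Suc n)) (z n)" for n
      using z(3)[of n] zc pc by (auto simp: loc_dvd_def m_comm)
    have dle: "loc_dvd R P (z n) (z m)" if "m \<le> n" for m n
      using that
    proof (induction n)
      case 0 then show ?case using loc_dvd_refl[OF P] zc by simp
    next
      case (Suc n) then show ?case
        using dS[of n] loc_dvd_refl[OF P] loc_dvd_trans[OF P zc zc zc] zc by (metis le_SucE)
    qed
    \<comment> \<open>The \<open>z n\<close> generate an ascending chain of principal ideals of the
      localization, and \<open>?I\<close> is the contraction of their union. Its generator is
      already a multiple of some \<open>z n\<close>, so \<open>z n\<close> divides
      \<open>z (Suc n)\<close>, although \<open>z n\<close> is locally \<open>z (Suc n)\<close>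
      times \<open>\<pi>\<close>.\<close>
    let ?I = "{w \<in> carrier R. \<exists>n. loc_dvd R P (z n) w}"
    have "ideal ?I R"
    proof (rule idealI')
      show "\<zero> \<in> ?I" using loc_zero_dvd[OF P zc[of 0], of \<zero>] one_compl by (auto simp: loc_zero_def)
    next
      fix a b assume "a \<in> ?I" "b \<in> ?I"
      then obtain m n where ab: "a \<in> carrier R" "b \<in> carrier R" "loc_dvd R P (z m) a" "loc_dvd R P (z n) b"
        by blast
      have "loc_dvd R P (z (max m n)) a" "loc_dvd R P (z (max m n)) b"
        using ab dle[of m "max m n"] dle[of n "max m n"] loc_dvd_trans[OF P] zc
        by (metis max.cobounded1, metis max.cobounded2)
      then show "a \<oplus> b \<in> ?I" using loc_dvd_add[OF P] zc ab by blast
    next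
      fix a x assume a: "a \<in> ?I" and x: "x \<in> carrier R"
      then obtain n where "loc_dvd R P (z n) a" by blast
      then have "loc_dvd R P (z n) (x \<otimes> a)"
        using loc_dvd_trans[OF P zc[of n], of a "x \<otimes> a"] loc_dvd_triv(1)[OF P] a x by simp
      then show "x \<otimes> a \<in> ?I" using a x by blast
    qed auto
    then obtain a where a: "a \<in> ?I" "\<And>b. b \<in> ?I \<Longrightarrow> loc_dvd R P a b"
      using lp unfolding loc_principal_def by blast
    then obtain n where n: "a \<in> carrier R" "loc_dvd R P (z n) a" by blast
    have "loc_dvd R P a (z (Suc n))" using a(2) zc loc_dvd_refl[OF P] by blast
    then have "loc_dvd R P (z n) (z (Suc n))" using n loc_dvd_trans[OF P] zc by blast
    moreover obtain s where "s \<in> carrier R - P" "s \<otimes> z n = z (Suc n) \<otimes> \<pi>" using z(3) by blast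
    then have "loc_dvd R P (z (Suc n) \<otimes> \<pi>) (z n)"
      using zc pc by (intro loc_dvdI[of s _ \<one>]) auto
    ultimately have "loc_dvd R P (z (Suc n) \<otimes> \<pi>) (z (Suc n))"
      using loc_dvd_trans[OF P, of "z (Suc n) \<otimes> \<pi>" "z n" "z (Suc n)"] zc pc by simp
    then have "loc_zero R P (z (Suc n))" using loc_nakayama[OF P zc pi(1)] by blast
    then have "loc_zero R P (z 0)"
      using loc_zero_if_dvd[OF P zc zc] dle[of 0 "Suc n"] by blast
    then show ?thesis using z(2) by simp
  qed
  then show ?thesis using pi(1) unfolding uniformizer_def by blast
qed

lemma principal_localization_iff: "principal_ideal_ring L \<longleftrightarrow> (\<exists>\<pi>. uniformizer R P \<pi>)"
  using loc_principal_if_principal_ideal_ring principal_ideal_ring_if_loc_principal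
    uniformizer_if_loc_principal loc_principal_if_uniformizer by blast

end

text \<open>An element \<open>y\<close> that does not vanish at \<open>P\<close> divides a power of
  \<open>\<pi>\<close>; lying in \<open>Q\<close>, it would force \<open>\<pi>\<close> and then all
  of \<open>P\<close> into \<open>Q\<close>. So the only possible non-maximal prime of the
  localization is zero.\<close>

lemma loc_zero_if_strict_subset:
  assumes P: "primeideal P R" and Q: "primeideal Q R" "Q \<subseteq> P" "Q \<noteq> P"
    and u: "uniformizer R P \<pi>" and y: "y \<in> Q"
  shows "loc_zero R P y"
proof (rule ccontr)
  assume nz: "\<not> loc_zero R P y"
  have yc: "y \<in> carrier R" using y Q(1) prime_carrier by blast
  have pi: "\<pi> \<in> P" "\<pi> \<in> carrier R" using u P prime_carrier by (auto simp: uniformizer_def)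
  obtain n :: nat where "loc_dvd R P y (\<pi> [^] n)" using nz u yc by (auto simp: uniformizer_def)
  then have "\<pi> [^] n \<in> Q" using loc_dvd_in_prime[OF Q(1,2) y] pi by simp
  then have piQ: "\<pi> \<in> Q" using prime_pow[OF Q(1)] pi by blast
  have "P \<subseteq> Q"
  proof
    fix a assume "a \<in> P"
    then show "a \<in> Q"
      using uniformizer_dvd[OF P u] loc_dvd_in_prime[OF Q(1,2) piQ] prime_carrier[OF P] by blast
  qed
  then show False using Q by blast
qed

end

section \<open>Modules for testing divisibility\<close>

text \<open>Thins the index set for the diagonal argument. There \<open>B i\<close> bounds the
  support of the image of the \<open>i\<close>-th unit vector, so images of earlier selected vectors
  vanish at every later selected index.\<close>

lemma strict_mono_avoiding:
  fixes B :: "nat \<Rightarrow> nat"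
  shows "\<exists>\<phi> :: nat \<Rightarrow> nat. strict_mono \<phi> \<and> (\<forall>i k. i < k \<longrightarrow> B (\<phi> i) \<le> \<phi> k)"
proof -
  define \<phi> where "\<phi> = (\<lambda>n. ((\<lambda>m. Suc (m + B m)) ^^ n) 0)"
  have S: "\<phi> (Suc n) = Suc (\<phi> n + B (\<phi> n))" for n by (simp add: \<phi>_def)
  have mono: "strict_mono \<phi>" by (rule strict_mono_Suc_iff[THEN iffD2]) (simp add: S)
  have "B (\<phi> i) \<le> \<phi> k" if "i < k" for i k
  proof -
    have "B (\<phi> i) \<le> \<phi> (Suc i)" by (simp add: S)
    also have "\<dots> \<le> \<phi> k" using that strict_mono_less_eq[OF mono] by simp
    finally show ?thesis .
  qed
  then have "\<forall>i k. i < k \<longrightarrow> B (\<phi> i) \<le> \<phi> k" by blast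
  with mono show ?thesis by auto
qed

text \<open>The summand \<open>nat\<close> makes the type infinite even if \<open>'a\<close> is
  finite, so that it is equipotent to its square.\<close>

lemma card_inj_nat_times:
  "\<exists>h :: nat \<times> 'a \<Rightarrow> 'a + nat. inj h"
proof -
  have "infinite (UNIV :: ('a + nat) set)"
    by simp
  then have "|(UNIV :: ('a + nat) set) \<times> (UNIV :: ('a + nat) set)| =o |UNIV :: ('a + nat) set|"
    by (rule card_of_Times_same_infinite)
  then obtain p where p: "bij_betw p ((UNIV :: ('a + nat) set) \<times> (UNIV :: ('a + nat) set)) (UNIV :: ('a + nat) set)"
    using card_of_ordIso[THEN iffD2] by blast
  then have "inj p" by (simp add: bij_betw_def)
  then have "inj (\<lambda>(n :: nat, a :: 'a). p (Inr n, Inl a))"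
    by (auto intro!: injI dest: injD)
  then show ?thesis by (rule exI[of inj])
qed

text \<open>These are the carrier types of direct sums of quotients, of modules of sequences, and of
  single quotients. A sequence of subsets is coded by its set of pairs of index and element; the
  other two types embed into such sequences by singletons and by constant sequences.\<close>

lemma inj_into_large_universe:
  assumes "\<exists>i :: ('a + nat) set \<Rightarrow> 'u. inj i"
  shows "\<exists>j :: (nat \<Rightarrow> 'a set) \<Rightarrow> 'u. inj j" "\<exists>j :: (nat \<Rightarrow> 'a) \<Rightarrow> 'u. inj j" "\<exists>j :: 'a set \<Rightarrow> 'u. inj j"
proof -
  obtain i :: "('a + nat) set \<Rightarrow> 'u" where i: "inj i" using assms by blast
  obtain h :: "nat \<times> 'a \<Rightarrow> 'a + nat" where h: "inj h" using card_inj_nat_times by blast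
  have *: "inj (\<lambda>w :: nat \<Rightarrow> 'a set. i (h ` {(n, a). a \<in> w n}))"
  proof (rule injI)
    fix v w :: "nat \<Rightarrow> 'a set" assume "i (h ` {(n, a). a \<in> v n}) = i (h ` {(n, a). a \<in> w n})"
    then have "{(n, a). a \<in> v n} = {(n, a). a \<in> w n}"
      by (simp only: inj_eq[OF i] inj_image_eq_iff[OF h])
    then have "(n, a) \<in> {(n, a). a \<in> v n} \<longleftrightarrow> (n, a) \<in> {(n, a). a \<in> w n}" for n a by simp
    then show "v = w" by (simp add: fun_eq_iff set_eq_iff)
  qed
  then show "\<exists>j :: (nat \<Rightarrow> 'a set) \<Rightarrow> 'u. inj j" by (rule exI[of inj])
  have "inj (\<lambda>v :: nat \<Rightarrow> 'a. (\<lambda>n. {v n}))" by (rule injI) (auto simp: fun_eq_iff)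
  from inj_compose[OF * this] show "\<exists>j :: (nat \<Rightarrow> 'a) \<Rightarrow> 'u. inj j" by (rule exI[of inj])
  have "inj (\<lambda>x :: 'a set. (\<lambda>n :: nat. x))" by (rule injI) (auto simp: fun_eq_iff)
  from inj_compose[OF * this] show "\<exists>j :: 'a set \<Rightarrow> 'u. inj j" by (rule exI[of inj])
qed

text \<open>Statement (1) is available only for modules with carrier in \<open>'u\<close>, whereas
  the test modules live on types built from \<open>'a\<close>. Their structure is moved along an
  injection.\<close>

definition transport_module :: "('m \<Rightarrow> 'u) \<Rightarrow> ('a, 'm, 'y) module_scheme \<Rightarrow> ('a, 'u) module"
  where "transport_module j M =
    \<lparr> partial_object.carrier = j ` carrier M, monoid.mult = (\<lambda>x y. j (inv_into UNIV j x \<otimes>\<^bsub>M\<^esub> inv_into UNIV j y)), monoid.one = j \<one>\<^bsub>M\<^esub>,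
      ring.zero = j \<zero>\<^bsub>M\<^esub>, ring.add = (\<lambda>x y. j (inv_into UNIV j x \<oplus>\<^bsub>M\<^esub> inv_into UNIV j y)), Module.module.smult = (\<lambda>a x. j (a \<odot>\<^bsub>M\<^esub> inv_into UNIV j x)) \<rparr>"

lemma transport_module_simps:
  assumes "inj j"
  shows "carrier (transport_module j M) = j ` carrier M"
    "j x \<oplus>\<^bsub>transport_module j M\<^esub> j y = j (x \<oplus>\<^bsub>M\<^esub> y)"
    "\<zero>\<^bsub>transport_module j M\<^esub> = j \<zero>\<^bsub>M\<^esub>"
    "a \<odot>\<^bsub>transport_module j M\<^esub> j x = j (a \<odot>\<^bsub>M\<^esub> x)"
  using assms by (auto simp: transport_module_def)

lemma transport_module:
  assumes j: "inj j" and M: "Module.module R M"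
  shows "Module.module R (transport_module j M)"
proof -
  interpret M: Module.module R M by (rule M)
  note [simp] = transport_module_simps[OF j]
  show ?thesis
  proof (rule Module.moduleI)
    show "abelian_group (transport_module j M)"
    proof (rule abelian_groupI)
      fix x assume "x \<in> carrier (transport_module j M)"
      then obtain y where y: "x = j y" "y \<in> carrier M" by auto
      have "j (\<ominus>\<^bsub>M\<^esub> y) \<oplus>\<^bsub>transport_module j M\<^esub> x = \<zero>\<^bsub>transport_module j M\<^esub>"
        using y M.l_neg by simp
      then show "\<exists>y\<in>carrier (transport_module j M). y \<oplus>\<^bsub>transport_module j M\<^esub> x = \<zero>\<^bsub>transport_module j M\<^esub>"
        using y by (metis M.a_inv_closed imageI transport_module_simps(1)[OF j])
    qed (auto simp: M.M.a_ac)
  qed (auto simp: M.smult_l_distr M.smult_r_distr M.smult_assoc1 intro!: M.is_cring)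
qed

lemma modhomD:
  assumes "f \<in> modhom R M N"
  shows "\<And>x. x \<in> carrier M \<Longrightarrow> f x \<in> carrier N"
    "\<And>x y. x \<in> carrier M \<Longrightarrow> y \<in> carrier M \<Longrightarrow> f (x \<oplus>\<^bsub>M\<^esub> y) = f x \<oplus>\<^bsub>N\<^esub> f y"
    "\<And>a x. a \<in> carrier R \<Longrightarrow> x \<in> carrier M \<Longrightarrow> f (a \<odot>\<^bsub>M\<^esub> x) = a \<odot>\<^bsub>N\<^esub> f x"
  using assms by (auto simp: modhom_def)

lemma divisible_hom_if_inj:
  fixes R :: "('a, 'x) ring_scheme" and M :: "('a, 'm) module" and N :: "('a, 'n) module"
    and j1 :: "'m \<Rightarrow> 'u" and j2 :: "'n \<Rightarrow> 'u"
  assumes sd: "seemingly_divisible_imp_divisible R TYPE('u) TYPE('u)" and j: "inj j1" "inj j2"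
    and r: "r \<in> carrier R" and M: "Module.module R M" and N: "Module.module R N"
    and f: "f \<in> modhom R M N" "seemingly_divisible M N f r"
  shows "divisible_hom R M N f r"
proof -
  let ?M = "transport_module j1 M" and ?N = "transport_module j2 N"
    and ?f = "\<lambda>x. j2 (f (inv_into UNIV j1 x))"
  interpret M: Module.module R M by (rule M)
  interpret N: Module.module R N by (rule N)
  note [simp] = transport_module_simps[OF j(1)] transport_module_simps[OF j(2)] inv_f_f[OF j(1)]
    inv_f_f[OF j(2)]
  have "?f \<in> modhom R ?M ?N" using modhomD[OF f(1)] by (auto simp: modhom_def)
  moreover have "seemingly_divisible ?M ?N ?f r"
    unfolding seemingly_divisible_def
  proof (intro conjI subsetI)
    fix y assume "y \<in> ?f ` carrier ?M"
    then obtain m where m: "m \<in> carrier M" "y = j2 (f m)" by auto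
    then obtain n where "n \<in> carrier N" "f m = r \<odot>\<^bsub>N\<^esub> n" using f(2) by (auto simp: seemingly_divisible_def)
    then have "y = r \<odot>\<^bsub>?N\<^esub> j2 n" "j2 n \<in> carrier ?N" using m by auto
    then show "y \<in> {r \<odot>\<^bsub>?N\<^esub> n |n. n \<in> carrier ?N}" by blast
  next
    fix y assume "y \<in> ?f ` {m \<in> carrier ?M. r \<odot>\<^bsub>?M\<^esub> m = \<zero>\<^bsub>?M\<^esub>}"
    then obtain m where m: "m \<in> carrier M" "j1 (r \<odot>\<^bsub>M\<^esub> m) = j1 \<zero>\<^bsub>M\<^esub>" "y = j2 (f m)" by auto
    from m(1) injD[OF j(1) m(2)] have "f m = \<zero>\<^bsub>N\<^esub>" using f(2) by (auto simp: seemingly_divisible_def)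
    then show "y \<in> {\<zero>\<^bsub>?N\<^esub>}" using m by simp
  qed
  ultimately have "divisible_hom R ?M ?N ?f r"
    using sd[unfolded seemingly_divisible_imp_divisible_def, rule_format, OF r
        transport_module[OF j(1) M] transport_module[OF j(2) N]] by simp
  then obtain g where g: "g \<in> modhom R ?M ?N" "\<forall>m\<in>carrier ?M. ?f m = r \<odot>\<^bsub>?N\<^esub> g m"
    by (auto simp: divisible_hom_def)
  \<comment> \<open>The quotient can be conjugated back because its values on the transported
    carrier lie in the range of \<open>j2\<close>.\<close>
  let ?g = "\<lambda>x. inv_into UNIV j2 (g (j1 x))"
  have gj: "g (j1 x) = j2 (?g x) \<and> ?g x \<in> carrier N" if "x \<in> carrier M" for x
    using modhomD(1)[OF g(1), of "j1 x"] that by auto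
  have "?g \<in> modhom R M N"
    unfolding modhom_def
  proof (intro CollectI conjI ballI funcsetI)
    fix x assume x: "x \<in> carrier M"
    then show "?g x \<in> carrier N" using gj by blast
    fix y assume y: "y \<in> carrier M"
    have "g (j1 (x \<oplus>\<^bsub>M\<^esub> y)) = j2 (?g x) \<oplus>\<^bsub>?N\<^esub> j2 (?g y)"
      using modhomD(2)[OF g(1), of "j1 x" "j1 y"] x y gj by simp
    then show "?g (x \<oplus>\<^bsub>M\<^esub> y) = ?g x \<oplus>\<^bsub>N\<^esub> ?g y" by simp
  next
    fix a x assume a: "a \<in> carrier R" and x: "x \<in> carrier M"
    have "g (j1 (a \<odot>\<^bsub>M\<^esub> x)) = a \<odot>\<^bsub>?N\<^esub> j2 (?g x)"
      using modhomD(3)[OF g(1), of a "j1 x"] x a gj by simp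
    then show "?g (a \<odot>\<^bsub>M\<^esub> x) = a \<odot>\<^bsub>N\<^esub> ?g x" by simp
  qed
  moreover have "f m = r \<odot>\<^bsub>N\<^esub> ?g m" if m: "m \<in> carrier M" for m
  proof -
    have "j2 (f m) = r \<odot>\<^bsub>?N\<^esub> j2 (?g m)" using g(2) m gj[OF m] by auto
    then show ?thesis by (simp add: inj_eq[OF j(2)])
  qed
  ultimately show ?thesis by (auto simp: divisible_hom_def)
qed

text \<open>The entries \<open>mult\<close> and \<open>one\<close> of a module record are irrelevant.\<close>

definition quotient_module :: "('a, 'x) ring_scheme \<Rightarrow> 'a set \<Rightarrow> ('a, 'a set) module"
  where "quotient_module R I =
    \<lparr> partial_object.carrier = carrier (R Quot I), monoid.mult = monoid.mult (R Quot I), monoid.one = monoid.one (R Quot I),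
      ring.zero = I, ring.add = ring.add (R Quot I), Module.module.smult = (\<lambda>a x. (I +>\<^bsub>R\<^esub> a) \<otimes>\<^bsub>R Quot I\<^esub> x) \<rparr>"

definition quotient_sum :: "('a, 'x) ring_scheme \<Rightarrow> (nat \<Rightarrow> 'a set) \<Rightarrow> ('a, nat \<Rightarrow> 'a set) module"
  where "quotient_sum R I =
    \<lparr> partial_object.carrier = {w. (\<forall>k. w k \<in> carrier (R Quot (I k))) \<and> finite {k. w k \<noteq> I k}},
      monoid.mult = (\<lambda>v w k. v k \<otimes>\<^bsub>R Quot I k\<^esub> w k), monoid.one = (\<lambda>k. monoid.one (R Quot I k)),
      ring.zero = I, ring.add = (\<lambda>v w k. v k \<oplus>\<^bsub>quotient_module R (I k)\<^esub> w k),
      Module.module.smult = (\<lambda>a w k. a \<odot>\<^bsub>quotient_module R (I k)\<^esub> w k) \<rparr>"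

text \<open>Multiplication by \<open>r\<close> maps this module into the direct sum of the \<open>R / I\<^sub>k\<close>, and is seemingly
  divisible by \<open>r\<close>.\<close>

definition almost_multiples :: "('a, 'x) ring_scheme \<Rightarrow> 'a \<Rightarrow> (nat \<Rightarrow> 'a set) \<Rightarrow> ('a, nat \<Rightarrow> 'a) module"
  where "almost_multiples R r I =
    \<lparr> partial_object.carrier = {v. (\<forall>k. v k \<in> carrier R) \<and> finite {k. r \<otimes>\<^bsub>R\<^esub> v k \<notin> I k}},
      monoid.mult = (\<lambda>v w k. v k \<otimes>\<^bsub>R\<^esub> w k), monoid.one = (\<lambda>k. \<one>\<^bsub>R\<^esub>),
      ring.zero = (\<lambda>k. \<zero>\<^bsub>R\<^esub>), ring.add = (\<lambda>v w k. v k \<oplus>\<^bsub>R\<^esub> w k), Module.module.smult = (\<lambda>a w k. a \<otimes>\<^bsub>R\<^esub> w k) \<rparr>"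

context cring begin

section \<open>Quotient modules, their direct sums, and modules of sequences\<close>

lemma quotient_carrier: "carrier (R Quot I) = {I +> a | a. a \<in> carrier R}"
  by (auto simp: FactRing_def A_RCOSETS_def')

lemma coset_eq_iff: "ideal I R \<Longrightarrow> a \<in> carrier R \<Longrightarrow> b \<in> carrier R \<Longrightarrow> I +> a = I +> b \<longleftrightarrow> a \<ominus> b \<in> I"
  using quotient_eq_iff_same_a_r_cos[of I a b] by simp

lemma coset_zero: "ideal I R \<Longrightarrow> I +> \<zero> = I"
  by (meson additive_subgroup.a_subset a_coset_add_zero ideal.axioms(1))

lemma coset_eq_self_iff: "ideal I R \<Longrightarrow> a \<in> carrier R \<Longrightarrow> I +> a = I \<longleftrightarrow> a \<in> I"
  using coset_eq_iff[of I a \<zero>] coset_zero[of I] by (simp add: minus_eq)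

lemma quotient_module_simps:
  assumes "ideal I R"
  shows "carrier (quotient_module R I) = {I +> a | a. a \<in> carrier R}"
    "\<zero>\<^bsub>quotient_module R I\<^esub> = I"
    "a \<in> carrier R \<Longrightarrow> b \<in> carrier R \<Longrightarrow> (I +> a) \<oplus>\<^bsub>quotient_module R I\<^esub> (I +> b) = I +> (a \<oplus> b)"
    "a \<in> carrier R \<Longrightarrow> b \<in> carrier R \<Longrightarrow> a \<odot>\<^bsub>quotient_module R I\<^esub> (I +> b) = I +> (a \<otimes> b)"
proof -
  interpret I: ideal I R by (rule assms)
  interpret I: abelian_subgroup I R
    by (rule abelian_subgroupI3[OF I.additive_subgroup_axioms abelian_group_axioms])
  show "a \<in> carrier R \<Longrightarrow> b \<in> carrier R \<Longrightarrow> (I +> a) \<oplus>\<^bsub>quotient_module R I\<^esub> (I +> b) = I +> (a \<oplus> b)"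
    using I.a_rcos_sum by (simp add: quotient_module_def FactRing_def)
  show "a \<in> carrier R \<Longrightarrow> b \<in> carrier R \<Longrightarrow> a \<odot>\<^bsub>quotient_module R I\<^esub> (I +> b) = I +> (a \<otimes> b)"
    using I.rcoset_mult_add by (simp add: quotient_module_def FactRing_def)
qed (auto simp: quotient_module_def quotient_carrier)

lemma quotient_module:
  assumes I: "ideal I R"
  shows "Module.module R (quotient_module R I)"
proof -
  let ?Q = "quotient_module R I"
  note Q = quotient_module_simps(2-4)[OF I]
  have cl: "I +> a \<in> carrier ?Q" if "a \<in> carrier R" for a
    unfolding quotient_module_simps(1)[OF I] using that by blast
  have E: "\<exists>a\<in>carrier R. x = I +> a" if "x \<in> carrier ?Q" for x
    using that unfolding quotient_module_simps(1)[OF I] by blast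
  show ?thesis
  proof (rule Module.moduleI)
    show "abelian_group ?Q"
    proof (rule abelian_groupI)
      show "\<zero>\<^bsub>?Q\<^esub> \<in> carrier ?Q" using coset_zero[OF I] cl[OF zero_closed] by (simp add: Q)
      fix x assume "x \<in> carrier ?Q"
      then obtain a where a: "x = I +> a" "a \<in> carrier R" using E by blast
      show "\<zero>\<^bsub>?Q\<^esub> \<oplus>\<^bsub>?Q\<^esub> x = x"
        using a Q(2)[of \<zero> a] coset_zero[OF I] by (simp add: Q(1))
      have "(I +> (\<ominus> a)) \<oplus>\<^bsub>?Q\<^esub> x = \<zero>\<^bsub>?Q\<^esub>"
        using a coset_zero[OF I] by (simp add: l_neg Q)
      then show "\<exists>y\<in>carrier ?Q. y \<oplus>\<^bsub>?Q\<^esub> x = \<zero>\<^bsub>?Q\<^esub>"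
        using cl[of "\<ominus> a"] a(2) by blast
      fix y assume "y \<in> carrier ?Q"
      then obtain b where b: "y = I +> b" "b \<in> carrier R" using E by blast
      show "x \<oplus>\<^bsub>?Q\<^esub> y \<in> carrier ?Q" using a b cl by (simp add: Q)
      show "x \<oplus>\<^bsub>?Q\<^esub> y = y \<oplus>\<^bsub>?Q\<^esub> x" using a b by (simp add: Q a_comm)
      fix z assume "z \<in> carrier ?Q"
      then obtain c where c: "z = I +> c" "c \<in> carrier R" using E by blast
      show "x \<oplus>\<^bsub>?Q\<^esub> y \<oplus>\<^bsub>?Q\<^esub> z = x \<oplus>\<^bsub>?Q\<^esub> (y \<oplus>\<^bsub>?Q\<^esub> z)" using a b c by (simp add: Q a_assoc)
    qed
  next
    fix x assume "x \<in> carrier ?Q"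
    then obtain a where a: "x = I +> a" "a \<in> carrier R" using E by blast
    show "\<one> \<odot>\<^bsub>?Q\<^esub> x = x" using a by (simp add: Q)
    fix u assume u: "u \<in> carrier R"
    show "u \<odot>\<^bsub>?Q\<^esub> x \<in> carrier ?Q" using a u cl by (simp add: Q)
    {
      fix v assume v: "v \<in> carrier R"
      show "(u \<oplus> v) \<odot>\<^bsub>?Q\<^esub> x = u \<odot>\<^bsub>?Q\<^esub> x \<oplus>\<^bsub>?Q\<^esub> v \<odot>\<^bsub>?Q\<^esub> x" using a u v by (simp add: Q l_distr)
      show "(u \<otimes> v) \<odot>\<^bsub>?Q\<^esub> x = u \<odot>\<^bsub>?Q\<^esub> (v \<odot>\<^bsub>?Q\<^esub> x)" using a u v by (simp add: Q m_assoc)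
    next
      fix y assume "y \<in> carrier ?Q"
      then obtain b where b: "y = I +> b" "b \<in> carrier R" using E by blast
      show "u \<odot>\<^bsub>?Q\<^esub> (x \<oplus>\<^bsub>?Q\<^esub> y) = u \<odot>\<^bsub>?Q\<^esub> x \<oplus>\<^bsub>?Q\<^esub> u \<odot>\<^bsub>?Q\<^esub> y"
        using a b u by (simp add: Q r_distr)
    }
  qed (rule is_cring)
qed

lemma quotient_sum:
  assumes I: "\<And>k. ideal (I k) R"
  shows "Module.module R (quotient_sum R I)"
proof -
  interpret Q: Module.module R "quotient_module R (I k)" for k by (rule quotient_module[OF I])
  have c: "carrier (quotient_sum R I) = {w. (\<forall>k. w k \<in> carrier (quotient_module R (I k))) \<and>
    finite {k. w k \<noteq> I k}}"
    by (simp add: quotient_sum_def quotient_module_def)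
  have z: "\<zero>\<^bsub>quotient_module R (I k)\<^esub> = I k" for k by (simp add: quotient_module_def)
  have ops: "\<zero>\<^bsub>quotient_sum R I\<^esub> = I"
    "v \<oplus>\<^bsub>quotient_sum R I\<^esub> w = (\<lambda>k. v k \<oplus>\<^bsub>quotient_module R (I k)\<^esub> w k)"
    "a \<odot>\<^bsub>quotient_sum R I\<^esub> w = (\<lambda>k. a \<odot>\<^bsub>quotient_module R (I k)\<^esub> w k)" for v w a
    by (simp_all add: quotient_sum_def)
  have Ic: "I k \<in> carrier (quotient_module R (I k))" for k using Q.zero_closed[of k] z by simp
  have zz: "I k \<oplus>\<^bsub>quotient_module R (I k)\<^esub> I k = I k" for k using Q.l_zero[of "I k" k] Ic z by simp
  have az: "a \<odot>\<^bsub>quotient_module R (I k)\<^esub> I k = I k" if "a \<in> carrier R" for a k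
    using Q.smult_r_null[OF that, of k] z by simp
  have addc: "v \<oplus>\<^bsub>quotient_sum R I\<^esub> w \<in> carrier (quotient_sum R I)"
    if "v \<in> carrier (quotient_sum R I)" "w \<in> carrier (quotient_sum R I)" for v w
  proof -
    have "finite ({k. v k \<noteq> I k} \<union> {k. w k \<noteq> I k})" using that by (simp add: c)
    then have "finite {k. v k \<oplus>\<^bsub>quotient_module R (I k)\<^esub> w k \<noteq> I k}"
      by (rule rev_finite_subset) (use zz in auto)
    then show ?thesis using that by (simp add: c ops)
  qed
  have smc: "a \<odot>\<^bsub>quotient_sum R I\<^esub> w \<in> carrier (quotient_sum R I)"
    if "a \<in> carrier R" "w \<in> carrier (quotient_sum R I)" for a w
  proof -
    have "finite {k. w k \<noteq> I k}" using that by (simp add: c)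
    then have "finite {k. a \<odot>\<^bsub>quotient_module R (I k)\<^esub> w k \<noteq> I k}"
      by (rule rev_finite_subset) (use az that in auto)
    then show ?thesis using that by (simp add: c ops)
  qed
  show ?thesis
  proof (rule Module.moduleI)
    show "abelian_group (quotient_sum R I)"
    proof (rule abelian_groupI)
      show "\<zero>\<^bsub>quotient_sum R I\<^esub> \<in> carrier (quotient_sum R I)" using Ic by (simp add: c ops)
      fix x assume x: "x \<in> carrier (quotient_sum R I)"
      show "\<zero>\<^bsub>quotient_sum R I\<^esub> \<oplus>\<^bsub>quotient_sum R I\<^esub> x = x"
        using x Q.l_zero z by (auto simp: c ops)
      have "((\<ominus> \<one>) \<odot>\<^bsub>quotient_sum R I\<^esub> x) \<oplus>\<^bsub>quotient_sum R I\<^esub> x = \<zero>\<^bsub>quotient_sum R I\<^esub>"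
        using x Q.l_neg z Q.smult_l_minus[of \<one>] by (auto simp: c ops)
      then show "\<exists>y\<in>carrier (quotient_sum R I). y \<oplus>\<^bsub>quotient_sum R I\<^esub> x = \<zero>\<^bsub>quotient_sum R I\<^esub>"
        using smc[of "\<ominus> \<one>" x] x by blast
      fix y assume y: "y \<in> carrier (quotient_sum R I)"
      show "x \<oplus>\<^bsub>quotient_sum R I\<^esub> y = y \<oplus>\<^bsub>quotient_sum R I\<^esub> x"
        using x y Q.a_comm by (auto simp: c ops)
      fix w assume w: "w \<in> carrier (quotient_sum R I)"
      show "x \<oplus>\<^bsub>quotient_sum R I\<^esub> y \<oplus>\<^bsub>quotient_sum R I\<^esub> w = x \<oplus>\<^bsub>quotient_sum R I\<^esub> (y \<oplus>\<^bsub>quotient_sum R I\<^esub> w)"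
        using x y w Q.a_assoc by (auto simp: c ops)
    qed (rule addc)
  qed (use smc in \<open>auto simp: is_cring c ops Q.smult_l_distr Q.smult_r_distr Q.smult_assoc1\<close>)
qed

lemma almost_multiples:
  assumes I: "\<And>k. ideal (I k) R" and r: "r \<in> carrier R"
  shows "Module.module R (almost_multiples R r I)"
proof -
  let ?M = "almost_multiples R r I"
  have c: "carrier ?M = {v. (\<forall>k. v k \<in> carrier R) \<and> finite {k. r \<otimes> v k \<notin> I k}}"
    by (simp add: almost_multiples_def)
  have ops: "\<zero>\<^bsub>?M\<^esub> = (\<lambda>k. \<zero>)" "v \<oplus>\<^bsub>?M\<^esub> w = (\<lambda>k. v k \<oplus> w k)" "a \<odot>\<^bsub>?M\<^esub> w = (\<lambda>k. a \<otimes> w k)" for v w a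
    by (simp_all add: almost_multiples_def)
  have addc: "v \<oplus>\<^bsub>?M\<^esub> w \<in> carrier ?M" if "v \<in> carrier ?M" "w \<in> carrier ?M" for v w
  proof -
    have "finite ({k. r \<otimes> v k \<notin> I k} \<union> {k. r \<otimes> w k \<notin> I k})" using that by (simp add: c)
    then have "finite {k. r \<otimes> (v k \<oplus> w k) \<notin> I k}"
      by (rule rev_finite_subset)
        (use that r in \<open>auto simp: c r_distr intro: additive_subgroup.a_closed[OF ideal.axioms(1)[OF I]]\<close>)
    then show ?thesis using that by (simp add: c ops)
  qed
  have smc: "a \<odot>\<^bsub>?M\<^esub> w \<in> carrier ?M" if "a \<in> carrier R" "w \<in> carrier ?M" for a w
  proof -
    have "finite {k. r \<otimes> w k \<notin> I k}" using that by (simp add: c)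
    then have "finite {k. r \<otimes> (a \<otimes> w k) \<notin> I k}"
      by (rule rev_finite_subset)
        (use that r in \<open>auto simp: c m_lcomm[of r a] intro: ideal.I_l_closed[OF I]\<close>)
    then show ?thesis using that by (simp add: c ops)
  qed
  have z: "\<zero> \<in> I k" for k using additive_subgroup.zero_closed[OF ideal.axioms(1)[OF I]] .
  show ?thesis
  proof (rule Module.moduleI)
    show "abelian_group ?M"
    proof (rule abelian_groupI)
      show "\<zero>\<^bsub>?M\<^esub> \<in> carrier ?M" using z r by (simp add: c ops)
      fix x assume x: "x \<in> carrier ?M"
      have "((\<ominus> \<one>) \<odot>\<^bsub>?M\<^esub> x) \<oplus>\<^bsub>?M\<^esub> x = \<zero>\<^bsub>?M\<^esub>"
        using x by (auto simp: c ops l_minus l_neg)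
      then show "\<exists>y\<in>carrier ?M. y \<oplus>\<^bsub>?M\<^esub> x = \<zero>\<^bsub>?M\<^esub>" using smc[of "\<ominus> \<one>" x] x by blast
    qed (use addc in \<open>auto simp: c ops a_ac\<close>)
  qed (use smc in \<open>auto simp: is_cring c ops l_distr r_distr m_assoc\<close>)
qed

end

locale seemingly_divisible_ring = cring R for R :: "('a, 'x) ring_scheme" (structure) +
  fixes universe :: "'u itself"
  assumes sd: "seemingly_divisible_imp_divisible R TYPE('u) TYPE('u)"
    and large: "\<exists>i :: ('a + nat) set \<Rightarrow> 'u. inj i"
begin

text \<open>Multiplication by \<open>r\<close> is a seemingly divisible homomorphism from \<open>R / I\<close> to \<open>R / (r R \<inter> I)\<close>;
  \<open>1 - h\<close> represents the image of \<open>1\<close> under a quotient of it by \<open>r\<close>.\<close>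

lemma ideal_splitting:
  assumes I: "ideal I R" and r: "r \<in> carrier R"
  shows "\<exists>h\<in>carrier R. h \<otimes> r \<in> I \<and> (\<forall>b\<in>I. \<exists>z\<in>carrier R. r \<otimes> z \<in> I \<and> (\<one> \<ominus> h) \<otimes> b = r \<otimes> z)"
proof -
  interpret I: ideal I R by (rule I)
  \<comment> \<open>The intersection of \<open>r R\<close> with \<open>I\<close>, written with the
    cofactor \<open>z\<close> at hand. It is the least ideal such that multiplication by
    \<open>r\<close> from \<open>R / I\<close> to \<open>R / J\<close> kills all
    \<open>r\<close>-torsion.\<close>
  define J where "J = {r \<otimes> z | z. z \<in> carrier R \<and> r \<otimes> z \<in> I}"
  have JI: "x \<in> J \<longleftrightarrow> (\<exists>z\<in>carrier R. x = r \<otimes> z \<and> r \<otimes> z \<in> I)" for x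
    unfolding J_def by auto
  have J: "ideal J R"
  proof (rule idealI')
    show "J \<subseteq> carrier R" using r by (auto simp: J_def)
    show "\<zero> \<in> J" using r I.zero_closed unfolding JI by (intro bexI[of _ \<zero>]) auto
    fix x assume "x \<in> J"
    then obtain a where a: "a \<in> carrier R" "x = r \<otimes> a" "r \<otimes> a \<in> I" using JI by blast
    { fix y assume "y \<in> J"
      then obtain b where b: "b \<in> carrier R" "y = r \<otimes> b" "r \<otimes> b \<in> I" using JI by blast
      have "x \<oplus> y = r \<otimes> (a \<oplus> b)" using a b r by (simp add: r_distr)
      moreover have "x \<oplus> y \<in> I" using I.a_closed a b by simp
      ultimately show "x \<oplus> y \<in> J" using a b unfolding JI by (intro bexI[of _ "a \<oplus> b"]) auto }
    fix c assume c: "c \<in> carrier R"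
    have "c \<otimes> x = r \<otimes> (c \<otimes> a)" using a c r by (simp add: m_lcomm)
    moreover have "c \<otimes> x \<in> I" using I.I_l_closed a c by simp
    ultimately show "c \<otimes> x \<in> J" using a c unfolding JI by (intro bexI[of _ "c \<otimes> a"]) auto
  qed
  interpret J: ideal J R by (rule J)
  let ?M = "quotient_module R I" and ?N = "quotient_module R J"
  define f where "f = (\<lambda>x. \<Union>a\<in>x. J +> (r \<otimes> a))"
  have f: "f (I +> a) = J +> (r \<otimes> a)" if a: "a \<in> carrier R" for a
  proof -
    have "J +> (r \<otimes> c) = J +> (r \<otimes> a)" if cI: "c \<in> I +> a" for c
    proof -
      obtain i where i: "i \<in> I" "c = i \<oplus> a" using cI by (auto simp: a_r_coset_def')
      have ic: "i \<in> carrier R" using I.Icarr i by simp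
      have "r \<otimes> c \<ominus> r \<otimes> a = r \<otimes> i" unfolding i(2) using ic a r by algebra
      moreover have "r \<otimes> i \<in> J" using I.I_l_closed[OF i(1) r] ic unfolding JI by blast
      ultimately show ?thesis using coset_eq_iff[OF J, of "r \<otimes> c" "r \<otimes> a"] i ic a r by simp
    qed
    moreover have "\<zero> \<oplus> a \<in> I +> a" using I.zero_closed unfolding a_r_coset_def' by blast
    ultimately show ?thesis unfolding f_def by blast
  qed
  note QI = quotient_module_simps[OF I] and QJ = quotient_module_simps[OF J]
  have "f \<in> modhom R ?M ?N"
    unfolding modhom_def
  proof (intro CollectI conjI ballI funcsetI)
    fix x assume "x \<in> carrier ?M"
    then obtain a where a: "x = I +> a" "a \<in> carrier R" unfolding QI by blast
    show "f x \<in> carrier ?N" unfolding QJ using a f r m_closed by blast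
    { fix y assume "y \<in> carrier ?M"
      then obtain b where b: "y = I +> b" "b \<in> carrier R" unfolding QI by blast
      show "f (x \<oplus>\<^bsub>?M\<^esub> y) = f x \<oplus>\<^bsub>?N\<^esub> f y"
        using a b r by (simp add: QI(3) QJ(3) f r_distr) }
    fix c assume "c \<in> carrier R"
    then show "f (c \<odot>\<^bsub>?M\<^esub> x) = c \<odot>\<^bsub>?N\<^esub> f x"
      using a r by (simp add: QI(4) QJ(4) f m_lcomm)
  qed
  moreover have "seemingly_divisible ?M ?N f r"
    unfolding seemingly_divisible_def
  proof (intro conjI subsetI)
    fix y assume "y \<in> f ` carrier ?M"
    then obtain a where a: "y = f (I +> a)" "a \<in> carrier R" unfolding QI by blast
    then have "y = r \<odot>\<^bsub>?N\<^esub> (J +> a)" using r by (simp add: f QJ(4))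
    moreover have "J +> a \<in> carrier ?N" unfolding QJ using a by blast
    ultimately show "y \<in> {r \<odot>\<^bsub>?N\<^esub> n |n. n \<in> carrier ?N}" by blast
  next
    fix y assume "y \<in> f ` {m \<in> carrier ?M. r \<odot>\<^bsub>?M\<^esub> m = \<zero>\<^bsub>?M\<^esub>}"
    then obtain a where a: "y = f (I +> a)" "a \<in> carrier R" "r \<odot>\<^bsub>?M\<^esub> (I +> a) = \<zero>\<^bsub>?M\<^esub>"
      unfolding QI(1) by blast
    then have "I +> (r \<otimes> a) = I" using r by (simp add: QI(2,4))
    then have "r \<otimes> a \<in> I" using coset_eq_self_iff[OF I] a r by simp
    then have "r \<otimes> a \<in> J" using a unfolding JI by blast
    then show "y \<in> {\<zero>\<^bsub>?N\<^esub>}" using coset_eq_self_iff[OF J] a r by (simp add: QJ(2) f)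
  qed
  moreover obtain j :: "'a set \<Rightarrow> 'u" where j: "inj j"
    using inj_into_large_universe(3)[OF large] by (rule exE)
  ultimately have "divisible_hom R ?M ?N f r"
    by (intro divisible_hom_if_inj[OF sd j j r quotient_module[OF I] quotient_module[OF J]])
  then obtain g where g: "g \<in> modhom R ?M ?N" "\<And>m. m \<in> carrier ?M \<Longrightarrow> f m = r \<odot>\<^bsub>?N\<^esub> g m"
    unfolding divisible_hom_def by blast
  have one: "I +> \<one> \<in> carrier ?M" unfolding QI(1) by blast
  then obtain y where y: "y \<in> carrier R" "g (I +> \<one>) = J +> y"
    using modhomD(1)[OF g(1) one] unfolding QJ(1) by blast
  have gb: "g (I +> b) = J +> (b \<otimes> y)" if b: "b \<in> carrier R" for b
    using modhomD(3)[OF g(1) b one] b y by (simp add: QI(4) QJ(4))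
  have "J +> r = J +> (r \<otimes> y)" using g(2)[OF one] r y by (simp add: f QJ(4))
  then have "r \<ominus> r \<otimes> y \<in> J" using coset_eq_iff[OF J] r y by simp
  moreover have "r \<ominus> r \<otimes> y = (\<one> \<ominus> y) \<otimes> r" using r y(1) by algebra
  ultimately have 1: "(\<one> \<ominus> y) \<otimes> r \<in> I" unfolding JI by auto
  have 2: "\<exists>z\<in>carrier R. r \<otimes> z \<in> I \<and> (\<one> \<ominus> (\<one> \<ominus> y)) \<otimes> b = r \<otimes> z" if b: "b \<in> I" for b
  proof -
    have bc: "b \<in> carrier R" using b I.Icarr by simp
    \<comment> \<open>\<open>b\<close> is zero in the domain of \<open>g\<close>, so its image, the
      coset of \<open>b y\<close>, is zero modulo \<open>J\<close>; this makes \<open>b y\<close> a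
      multiple of \<open>r\<close>.\<close>
    have "I +> b = I +> \<zero>" using coset_eq_self_iff[OF I bc] b coset_zero[OF I] by simp
    then have "J +> (b \<otimes> y) = J +> (\<zero> \<otimes> y)" using gb[OF bc] gb[OF zero_closed] by simp
    then have "b \<otimes> y \<in> J" using coset_eq_self_iff[OF J] coset_zero[OF J] bc y by simp
    then obtain z where "z \<in> carrier R" "b \<otimes> y = r \<otimes> z" "r \<otimes> z \<in> I" using JI by blast
    moreover have "(\<one> \<ominus> (\<one> \<ominus> y)) \<otimes> b = b \<otimes> y" using bc y(1) by algebra
    ultimately show ?thesis by auto
  qed
  show ?thesis using 1 2 y(1) by (intro bexI[of _ "\<one> \<ominus> y"]) auto
qed

text \<open>The quotient of the homomorphism on \<^const>\<open>almost_multiples\<close> maps to finitely supported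
  families, so after thinning the index set the image of the \<open>i\<close>-th unit vector vanishes in all
  components \<open>k > i\<close>; for large \<open>k\<close> the \<open>k\<close>-th component of the image of \<open>v\<close> vanishes, too. Here
  \<open>y\<close> is the \<open>k\<close>-th component of the image of the \<open>k\<close>-th unit vector.\<close>

lemma diagonal_splitting:
  fixes I :: "nat \<Rightarrow> 'a set"
  assumes I: "\<And>k. ideal (I k) R" and r: "r \<in> carrier R"
    and vc: "\<And>k. v k \<in> carrier R" and bc: "\<And>k. b k \<in> carrier R"
    and w: "\<And>k l. k < l \<Longrightarrow> w k l \<in> carrier R \<and> v l = b k \<otimes> w k l \<and> r \<otimes> w k l \<in> I l"
  shows "\<exists>k. \<exists>y\<in>carrier R. \<exists>z\<in>carrier R. r \<otimes> (\<one> \<ominus> y) \<in> I k \<and> v k \<otimes> y \<oplus> b k \<otimes> z \<in> I k"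
proof -
  interpret I: ideal "I k" R for k by (rule I)
  let ?M = "almost_multiples R r I" and ?N = "quotient_sum R I" and ?Q = "\<lambda>k. quotient_module R (I k)"
  note Q = quotient_module_simps[OF I]
  have cM: "x \<in> carrier ?M \<longleftrightarrow> (\<forall>k. x k \<in> carrier R) \<and> finite {k. r \<otimes> x k \<notin> I k}" for x
    by (simp add: almost_multiples_def)
  have cN: "x \<in> carrier ?N \<longleftrightarrow> (\<forall>k. \<exists>a\<in>carrier R. x k = I k +> a) \<and> finite {k. x k \<noteq> I k}" for x
    unfolding quotient_sum_def by (auto simp: quotient_carrier)
  have opsM: "\<zero>\<^bsub>?M\<^esub> = (\<lambda>k. \<zero>)" "x \<oplus>\<^bsub>?M\<^esub> y = (\<lambda>k. x k \<oplus> y k)" "a \<odot>\<^bsub>?M\<^esub> y = (\<lambda>k. a \<otimes> y k)" for x y a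
    by (simp_all add: almost_multiples_def)
  have opsN: "\<zero>\<^bsub>?N\<^esub> = I" "x \<oplus>\<^bsub>?N\<^esub> y = (\<lambda>k. x k \<oplus>\<^bsub>?Q k\<^esub> y k)" "a \<odot>\<^bsub>?N\<^esub> y = (\<lambda>k. a \<odot>\<^bsub>?Q k\<^esub> y k)" for x y a
    by (simp_all add: quotient_sum_def)
  define f where "f = (\<lambda>x k. I k +> (r \<otimes> x k))"
  have f0: "I k +> (r \<otimes> a) = I k \<longleftrightarrow> r \<otimes> a \<in> I k" if "a \<in> carrier R" for k a
    using coset_eq_self_iff[OF I] r that by simp
  have "f \<in> modhom R ?M ?N"
    unfolding modhom_def
  proof (intro CollectI conjI ballI funcsetI)
    fix x assume x: "x \<in> carrier ?M"
    have "{k. f x k \<noteq> I k} \<subseteq> {k. r \<otimes> x k \<notin> I k}" using x f0 by (auto simp: cM f_def)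
    then have "finite {k. f x k \<noteq> I k}" using x finite_subset unfolding cM by blast
    then show "f x \<in> carrier ?N" using x r unfolding cN f_def cM by blast
    { fix y assume y: "y \<in> carrier ?M"
      show "f (x \<oplus>\<^bsub>?M\<^esub> y) = f x \<oplus>\<^bsub>?N\<^esub> f y"
        using x y r by (simp add: opsM opsN cM f_def Q(3) r_distr) }
    fix c assume "c \<in> carrier R"
    then show "f (c \<odot>\<^bsub>?M\<^esub> x) = c \<odot>\<^bsub>?N\<^esub> f x"
      using x r by (simp add: opsM opsN cM f_def Q(4) m_lcomm)
  qed
  moreover have "seemingly_divisible ?M ?N f r"
    unfolding seemingly_divisible_def
  proof (intro conjI subsetI)
    fix y assume "y \<in> f ` carrier ?M"
    then obtain x where x: "x \<in> carrier ?M" "y = f x" by blast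
    \<comment> \<open>A family with \<open>r n = f x\<close>. The coset of \<open>x k\<close> is
      replaced by zero wherever \<open>f x\<close> vanishes anyway, which keeps the support
      finite.\<close>
    define n where "n = (\<lambda>k. if r \<otimes> x k \<in> I k then I k else I k +> x k)"
    have "\<exists>a\<in>carrier R. n k = I k +> a" for k
      using x(1) coset_zero[OF I] unfolding cM
      by (intro bexI[of _ "if r \<otimes> x k \<in> I k then \<zero> else x k"]) (simp_all add: n_def)
    then have "\<forall>k. \<exists>a\<in>carrier R. n k = I k +> a" ..
    moreover have "finite {k. n k \<noteq> I k}"
      using x(1) unfolding cM by (auto simp: n_def elim!: rev_finite_subset)
    ultimately have "n \<in> carrier ?N" using cN by blast
    moreover have "y = r \<odot>\<^bsub>?N\<^esub> n"
    proof
      fix k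
      have c: "x k \<in> carrier R" using x(1) cM by blast
      show "y k = (r \<odot>\<^bsub>?N\<^esub> n) k"
      proof (cases "r \<otimes> x k \<in> I k")
        case True
        have "r \<odot>\<^bsub>?Q k\<^esub> (I k +> \<zero>) = I k" using r Q(4)[of r \<zero> k] coset_zero[OF I] by simp
        then show ?thesis using True x(2) f0[OF c] coset_zero[OF I] by (simp add: opsN n_def f_def)
      next
        case False
        then show ?thesis using x(2) r c by (simp add: opsN n_def f_def Q(4))
      qed
    qed
    ultimately show "y \<in> {r \<odot>\<^bsub>?N\<^esub> n |n. n \<in> carrier ?N}" by blast
  next
    fix y assume "y \<in> f ` {m \<in> carrier ?M. r \<odot>\<^bsub>?M\<^esub> m = \<zero>\<^bsub>?M\<^esub>}"
    then obtain x where x: "y = f x" "(\<lambda>k. r \<otimes> x k) = (\<lambda>k. \<zero>)" unfolding opsM by blast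
    have "r \<otimes> x k = \<zero>" for k using fun_cong[OF x(2)] by simp
    then show "y \<in> {\<zero>\<^bsub>?N\<^esub>}" using x(1) coset_zero[OF I] by (auto simp: opsN f_def)
  qed
  moreover obtain j1 :: "(nat \<Rightarrow> 'a) \<Rightarrow> 'u" where j1: "inj j1"
    using inj_into_large_universe(2)[OF large] by (rule exE)
  moreover obtain j2 :: "(nat \<Rightarrow> 'a set) \<Rightarrow> 'u" where j2: "inj j2"
    using inj_into_large_universe(1)[OF large] by (rule exE)
  ultimately have "divisible_hom R ?M ?N f r"
    by (intro divisible_hom_if_inj[OF sd j1 j2 r almost_multiples[OF I r] quotient_sum[OF I]])
  then obtain g where g: "g \<in> modhom R ?M ?N" "\<And>m. m \<in> carrier ?M \<Longrightarrow> f m = r \<odot>\<^bsub>?N\<^esub> g m"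
    unfolding divisible_hom_def by blast
  have grep: "\<exists>a\<in>carrier R. g x k = I k +> a" and gfin: "finite {k. g x k \<noteq> I k}"
    if "x \<in> carrier ?M" for x k
    using modhomD(1)[OF g(1) that] unfolding cN by blast+
  have gadd: "g (\<lambda>k. x k \<oplus> y k) k = g x k \<oplus>\<^bsub>?Q k\<^esub> g y k" if "x \<in> carrier ?M" "y \<in> carrier ?M" for x y k
    using modhomD(2)[OF g(1) that] by (simp add: opsM opsN)
  have gsm: "g (\<lambda>k. a \<otimes> x k) k = a \<odot>\<^bsub>?Q k\<^esub> g x k" if "a \<in> carrier R" "x \<in> carrier ?M" for x a k
    using modhomD(3)[OF g(1) that] by (simp add: opsM opsN)
  interpret M: Module.module R ?M by (rule almost_multiples[OF I r])
  have Madd: "(\<lambda>k. x k \<oplus> y k) \<in> carrier ?M" if "x \<in> carrier ?M" "y \<in> carrier ?M" for x y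
    using M.add.m_closed[OF that] by (simp add: opsM)
  have Msm: "(\<lambda>k. a \<otimes> x k) \<in> carrier ?M" if "a \<in> carrier R" "x \<in> carrier ?M" for x a
    using M.smult_closed[OF that] by (simp add: opsM)
  define e where "e = (\<lambda>i k :: nat. if k = i then \<one> else \<zero>)"
  have eM: "e i \<in> carrier ?M" for i
  proof -
    have "{k. r \<otimes> e i k \<notin> I k} \<subseteq> {i}" using r I.zero_closed by (auto simp: e_def)
    then have "finite {k. r \<otimes> e i k \<notin> I k}" by (rule finite_subset) simp
    then show ?thesis by (simp add: cM e_def)
  qed
  have "\<exists>B. \<forall>k\<ge>B. g (e i) k = I k" for i
  proof -
    obtain B where "\<forall>k\<in>{k. g (e i) k \<noteq> I k}. k < B"
      using gfin[OF eM] finite_nat_set_iff_bounded by blast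
    then show ?thesis by (intro exI[of _ B]) (auto simp: not_less[symmetric])
  qed
  then obtain B where B: "\<And>i k. B i \<le> k \<Longrightarrow> g (e i) k = I k" by metis
  obtain \<phi> :: "nat \<Rightarrow> nat" where mono: "strict_mono \<phi>" and \<phi>: "\<And>i k. i < k \<Longrightarrow> B (\<phi> i) \<le> \<phi> k"
    using strict_mono_avoiding[of B] by auto
  have inj\<phi>: "inj \<phi>" using mono by (rule strict_mono_imp_inj_on)
  \<comment> \<open>\<open>v\<close> restricted to the selected indices. Beyond the first of them,
    \<open>v l\<close> is a multiple of some \<open>w k l\<close>, so \<open>r v l\<close> is in
    \<open>I l\<close> and \<open>V\<close> belongs to the domain.\<close>
  define V where "V = (\<lambda>l. if l \<in> range \<phi> then v l else \<zero>)"
  have VM: "V \<in> carrier ?M"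
  proof -
    have *: "r \<otimes> v (\<phi> i) \<in> I (\<phi> i)" if "i \<noteq> 0" for i
    proof -
      have "\<phi> 0 < \<phi> i" using that strict_mono_less[OF mono] by simp
      then have *: "w (\<phi> 0) (\<phi> i) \<in> carrier R" "v (\<phi> i) = b (\<phi> 0) \<otimes> w (\<phi> 0) (\<phi> i)"
        "r \<otimes> w (\<phi> 0) (\<phi> i) \<in> I (\<phi> i)"
        using w by blast+
      have "r \<otimes> v (\<phi> i) = b (\<phi> 0) \<otimes> (r \<otimes> w (\<phi> 0) (\<phi> i))"
        unfolding *(2) using r bc *(1) by (simp add: m_lcomm)
      then show ?thesis using I.I_l_closed[OF *(3) bc] by simp
    qed
    have "{k. r \<otimes> V k \<notin> I k} \<subseteq> {\<phi> 0}"
    proof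
      fix l assume "l \<in> {k. r \<otimes> V k \<notin> I k}"
      then have l: "r \<otimes> V l \<notin> I l" by simp
      have "l \<in> range \<phi>"
      proof (rule ccontr)
        assume "l \<notin> range \<phi>"
        then show False using l r I.zero_closed by (simp add: V_def)
      qed
      then obtain i where i: "l = \<phi> i" by blast
      have "i = 0" using l *[of i] by (cases "i = 0") (auto simp: V_def i)
      then show "l \<in> {\<phi> 0}" using i by simp
    qed
    then have "finite {k. r \<otimes> V k \<notin> I k}" by (rule finite_subset) simp
    then show ?thesis using vc by (simp add: cM V_def)
  qed
  \<comment> \<open>The image of \<open>V\<close> has finite support, while infinitely many indices
    are selected.\<close>
  have "\<exists>m. g V (\<phi> m) = I (\<phi> m)"
  proof (rule ccontr)
    assume "\<nexists>m. g V (\<phi> m) = I (\<phi> m)"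
    then have "range \<phi> \<subseteq> {k. g V k \<noteq> I k}" by auto
    then have "finite (range \<phi>)" using gfin[OF VM] finite_subset by blast
    then show False using inj\<phi> finite_imageD by blast
  qed
  then obtain m where m: "g V (\<phi> m) = I (\<phi> m)" by blast
  define k where "k = \<phi> m"
  \<comment> \<open>For \<open>j = m\<close> this is the part of \<open>V\<close> before
    \<open>k\<close>: a combination of unit vectors whose images vanish at \<open>k\<close> by the
    choice of \<open>\<phi>\<close>.\<close>
  define hd where "hd = (\<lambda>j l. if l \<in> \<phi> ` {..<j} then v l else \<zero>)"
  have hdM: "hd j \<in> carrier ?M" for j
  proof -
    have "{l. r \<otimes> hd j l \<notin> I l} \<subseteq> \<phi> ` {..<j}" using r I.zero_closed by (auto simp: hd_def)
    then have "finite {l. r \<otimes> hd j l \<notin> I l}" by (rule finite_subset) simp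
    then show ?thesis using vc by (simp add: cM hd_def)
  qed
  have hdS: "hd (Suc j) = (\<lambda>l. hd j l \<oplus> v (\<phi> j) \<otimes> e (\<phi> j) l)" for j
  proof
    fix l
    have "l \<in> \<phi> ` {..<Suc j} \<longleftrightarrow> l \<in> \<phi> ` {..<j} \<or> l = \<phi> j" by (auto simp: lessThan_Suc)
    moreover have "\<phi> j \<notin> \<phi> ` {..<j}" using inj\<phi> by (auto dest: injD)
    ultimately show "hd (Suc j) l = hd j l \<oplus> v (\<phi> j) \<otimes> e (\<phi> j) l"
      using vc by (auto simp: hd_def e_def)
  qed
  have ghd: "g (hd j) k = I k" if "j \<le> m" for j
    using that
  proof (induction j)
    case 0
    obtain a where a: "a \<in> carrier R" "g (hd 0) k = I k +> a" using grep[OF hdM] by blast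
    \<comment> \<open>\<open>hd 0\<close> is zero, written as a multiple of itself so that linearity
      of \<open>g\<close> applies.\<close>
    have "hd 0 = (\<lambda>l. \<zero> \<otimes> hd 0 l)" using vc by (simp add: hd_def)
    then have "g (hd 0) k = g (\<lambda>l. \<zero> \<otimes> hd 0 l) k" by simp
    also have "\<dots> = \<zero> \<odot>\<^bsub>?Q k\<^esub> g (hd 0) k" by (rule gsm[OF zero_closed hdM])
    also have "\<dots> = I k" using a Q(4)[of \<zero> a k] coset_zero[OF I] by simp
    finally show ?case .
  next
    case (Suc j)
    have 1: "g (e (\<phi> j)) k = I k +> \<zero>" using B \<phi>[of j m] Suc.prems coset_zero[OF I] by (simp add: k_def)
    have 2: "g (hd j) k = I k +> \<zero>" using Suc coset_zero[OF I] by simp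
    have "g (hd (Suc j)) k = g (hd j) k \<oplus>\<^bsub>?Q k\<^esub> v (\<phi> j) \<odot>\<^bsub>?Q k\<^esub> g (e (\<phi> j)) k"
      unfolding hdS using gadd[OF hdM Msm[OF vc eM]] gsm[OF vc eM] by simp
    also have "\<dots> = I k +> \<zero>" unfolding 1 2 using vc by (simp add: Q(3,4))
    finally show ?case using coset_zero[OF I] by simp
  qed
  \<comment> \<open>The part of \<open>V\<close> after \<open>k\<close>, divided by
    \<open>b k\<close>. The assumption that \<open>r w k l\<close> is in \<open>I l\<close> puts
    this possibly infinite sequence into the domain, so that \<open>g\<close> has a value on
    it.\<close>
  define tl where "tl = (\<lambda>l. if l \<in> range \<phi> \<and> k < l then w k l else \<zero>)"
  have tlM: "tl \<in> carrier ?M"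
  proof -
    have "{l. r \<otimes> tl l \<notin> I l} = {}" using r I.zero_closed w by (auto simp: tl_def)
    then show ?thesis using w by (simp add: cM tl_def)
  qed
  have V: "V = (\<lambda>l. (hd m l \<oplus> v k \<otimes> e k l) \<oplus> b k \<otimes> tl l)"
  proof
    fix l
    have kn: "k \<notin> \<phi> ` {..<m}" using inj\<phi> by (auto simp: k_def dest: injD)
    have lt: "l \<in> \<phi> ` {..<m} \<longleftrightarrow> l \<in> range \<phi> \<and> l < k"
      using strict_mono_less[OF mono] by (auto simp: k_def)
    consider "l \<notin> range \<phi>" | "l \<in> range \<phi>" "l < k" | "l = k" | "l \<in> range \<phi>" "k < l" by force
    then show "V l = (hd m l \<oplus> v k \<otimes> e k l) \<oplus> b k \<otimes> tl l"
    proof cases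
      case 1
      then have "l \<noteq> k" by (auto simp: k_def)
      then show ?thesis using 1 lt vc bc by (simp add: V_def hd_def e_def tl_def)
    next
      case 2 then show ?thesis using lt vc bc by (simp add: V_def hd_def e_def tl_def)
    next
      case 3
      then have "l \<in> range \<phi>" by (simp add: k_def)
      then show ?thesis using 3 lt vc bc by (simp add: V_def hd_def e_def tl_def)
    next
      case 4
      then have "v l = b k \<otimes> w k l" "w k l \<in> carrier R" using w by blast+
      then show ?thesis using 4 lt vc bc by (simp add: V_def hd_def e_def tl_def)
    qed
  qed
  obtain y where y: "y \<in> carrier R" "g (e k) k = I k +> y" using grep[OF eM] by blast
  obtain z where z: "z \<in> carrier R" "g tl k = I k +> z" using grep[OF tlM] by blast
  have "I k +> (r \<otimes> \<one>) = I k +> (r \<otimes> y)"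
  proof -
    have "f (e k) k = r \<odot>\<^bsub>?Q k\<^esub> g (e k) k" using g(2)[OF eM] by (simp add: opsN)
    then show ?thesis using y r by (simp add: f_def e_def Q(4))
  qed
  then have "r \<otimes> \<one> \<ominus> r \<otimes> y \<in> I k" using coset_eq_iff[OF I] r y by simp
  moreover have "r \<otimes> \<one> \<ominus> r \<otimes> y = r \<otimes> (\<one> \<ominus> y)" using r y(1) by algebra
  ultimately have 1: "r \<otimes> (\<one> \<ominus> y) \<in> I k" by simp
  have hv: "(\<lambda>l. hd m l \<oplus> v k \<otimes> e k l) \<in> carrier ?M" by (rule Madd[OF hdM Msm[OF vc eM]])
  \<comment> \<open>At the coordinate \<open>k\<close> both \<open>V\<close> and its head have image
    zero; what remains is \<open>v k y + b k z\<close>.\<close>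
  have "I k = g V k" using m by (simp add: k_def)
  also have "\<dots> = (g (hd m) k \<oplus>\<^bsub>?Q k\<^esub> v k \<odot>\<^bsub>?Q k\<^esub> g (e k) k) \<oplus>\<^bsub>?Q k\<^esub> b k \<odot>\<^bsub>?Q k\<^esub> g tl k"
    unfolding V
      using gadd[OF hv Msm[OF bc tlM]] gadd[OF hdM Msm[OF vc eM]] gsm[OF vc eM] gsm[OF bc tlM] by simp
  also have "g (hd m) k = I k +> \<zero>" using ghd[of m] coset_zero[OF I] by simp
  finally have "I k = I k +> (v k \<otimes> y \<oplus> b k \<otimes> z)"
    using y z vc bc by (simp add: Q(3,4))
  moreover have "v k \<otimes> y \<oplus> b k \<otimes> z \<in> carrier R" using y z vc bc by simp
  ultimately have "v k \<otimes> y \<oplus> b k \<otimes> z \<in> I k" by (subst coset_eq_self_iff[OF I, symmetric]) simp_all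
  then show ?thesis using 1 y z by blast
qed

end

section \<open>Spectra of rings with divisible homomorphisms\<close>

text \<open>The contraction to \<open>R\<close> of the ideal generated by \<open>a\<close> in the
  localization; for \<open>a = \<zero>\<close> it is the kernel of the localization map. Splitting
  such ideals yields statements at a single prime.\<close>

lemma (in cring) ideal_loc_multiples:
  assumes P: "primeideal P R" and a: "a \<in> carrier R"
  shows "ideal {x \<in> carrier R. loc_dvd R P a x} R"
proof (rule idealI')
  show "\<zero> \<in> {x \<in> carrier R. loc_dvd R P a x}"
    using a prime_one[OF P] by (auto intro!: loc_dvdI[of \<one> P \<zero>])
next
  fix x y assume "x \<in> {x \<in> carrier R. loc_dvd R P a x}" "y \<in> {x \<in> carrier R. loc_dvd R P a x}"
  then show "x \<oplus> y \<in> {x \<in> carrier R. loc_dvd R P a x}"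
    using loc_dvd_add[OF P a, of x y] by simp
next
  fix x c assume x: "x \<in> {x \<in> carrier R. loc_dvd R P a x}" and c: "c \<in> carrier R"
  then show "c \<otimes> x \<in> {x \<in> carrier R. loc_dvd R P a x}"
    using loc_dvd_trans[OF P a, of x "c \<otimes> x"] loc_dvd_triv(1)[OF P, of x c] by simp
qed auto

lemma (in cring) loc_dvd_unit_mult:
  assumes P: "primeideal P R" and c: "a \<in> carrier R" "x \<in> carrier R" "u \<in> carrier R" "u \<notin> P"
    and d: "loc_dvd R P a (u \<otimes> x)"
  shows "loc_dvd R P a x"
proof -
  have "loc_dvd R P (u \<otimes> x) x" using c by (intro loc_dvdI[of u P \<one>]) auto
  then show ?thesis by (rule loc_dvd_trans[OF P c(1) m_closed[OF c(3,2)] c(2) d])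
qed

section \<open>Chain property and absence of infinite descent\<close>

context seemingly_divisible_ring
begin

text \<open>The splitting for the contraction \<open>?I\<close> of the ideal of \<open>b\<close> has
  two outcomes. If \<open>h\<close> is in \<open>P\<close>, then \<open>1 - h\<close> is a unit at
  \<open>P\<close> and \<open>a\<close> divides \<open>b\<close>; otherwise \<open>h\<close> is a
  unit and \<open>h a\<close> in \<open>?I\<close> means that \<open>b\<close> divides
  \<open>a\<close>.\<close>

lemma loc_dvd_linear:
  assumes P: "primeideal P R" and c: "a \<in> carrier R" "b \<in> carrier R"
  shows "loc_dvd R P a b \<or> loc_dvd R P b a"
proof -
  let ?I = "{x \<in> carrier R. loc_dvd R P b x}"
  obtain h where h: "h \<in> carrier R" "h \<otimes> a \<in> ?I"
    and z: "\<And>x. x \<in> ?I \<Longrightarrow> \<exists>z\<in>carrier R. a \<otimes> z \<in> ?I \<and> (\<one> \<ominus> h) \<otimes> x = a \<otimes> z"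
    using ideal_splitting[OF ideal_loc_multiples[OF P c(2)] c(1)] by blast
  show ?thesis
  proof (cases "h \<in> P")
    case True
    have "b \<in> ?I" using loc_dvd_refl[OF P] c by simp
    then obtain z where "z \<in> carrier R" "(\<one> \<ominus> h) \<otimes> b = a \<otimes> z" using z by blast
    then have "loc_dvd R P a b" using prime_one_minus[OF P True] c
      by (intro loc_dvdI[of "\<one> \<ominus> h" _ z]) (auto simp: m_comm)
    then show ?thesis ..
  next
    case False
    then have "loc_dvd R P b a" using h by (intro loc_dvd_unit_mult[OF P c(2,1) h(1)]) auto
    then show ?thesis ..
  qed
qed

text \<open>Serves as a chain condition: long products of elements of \<open>P\<close> become
  divisible by any \<open>r\<close> that is nonzero at \<open>P\<close>. Each step adjoins two
  factors: \<open>c k\<close> separates \<open>v k\<close> from \<open>b k = v k c k\<close> by a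
  non-unit, and the \<open>d k\<close> do the same for \<open>r\<close> and the generators of the
  ideals \<open>I l\<close>.\<close>

lemma loc_dvd_product:
  fixes c d v :: "nat \<Rightarrow> 'a"
  assumes P: "primeideal P R" and r: "r \<in> carrier R" "\<not> loc_zero R P r"
    and c: "\<And>k. c k \<in> P" and d: "\<And>k. d k \<in> P"
    and v0: "v 0 = \<one>" and vS: "\<And>k. v (Suc k) = v k \<otimes> (c k \<otimes> d k)"
  shows "\<exists>k. loc_dvd R P r (v k)"
proof -
  have cc: "c k \<in> carrier R" and dc: "d k \<in> carrier R" for k using c d prime_carrier[OF P] by auto
  have vc: "v k \<in> carrier R" for k by (induction k) (auto simp: v0 vS cc dc)
  \<comment> \<open>\<open>u\<close> is the quotient of \<open>v l\<close> by
    \<open>v k c k\<close>; it retains the last factor \<open>d (l - 1)\<close> of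
    \<open>v l\<close>.\<close>
  have "\<exists>u. k < l \<longrightarrow> u \<in> carrier R \<and> v l = (v k \<otimes> c k) \<otimes> u \<and> (\<exists>x\<in>carrier R. u = x \<otimes> d (l - 1))" for k l
  proof (induction l)
    case (Suc l)
    show ?case
    proof (cases "k = l")
      case True
      then show ?thesis
        using cc dc vc by (intro exI[of _ "d k"]) (auto simp: vS m_assoc intro!: bexI[of _ \<one>])
    next
      case False
      show ?thesis
      proof (cases "k < l")
        case True
        then obtain u where u: "u \<in> carrier R" "v l = (v k \<otimes> c k) \<otimes> u" using Suc by blast
        have "v (Suc l) = (v k \<otimes> c k) \<otimes> (u \<otimes> c l \<otimes> d l)"
          unfolding vS u(2) using u(1) cc dc vc by (simp add: m_assoc)
        then show ?thesis using u cc dc by (intro exI[of _ "u \<otimes> c l \<otimes> d l"]) auto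
      qed (use False in auto)
    qed
  qed simp
  then obtain w where w: "\<And>k l. k < l \<Longrightarrow> w k l \<in> carrier R \<and> v l = (v k \<otimes> c k) \<otimes> w k l \<and>
    (\<exists>x\<in>carrier R. w k l = x \<otimes> d (l - 1))"
    by metis
  \<comment> \<open>The index is shifted because \<open>v l\<close> ends with
    \<open>d (l - 1)\<close>. At \<open>l = 0\<close> truncated subtraction gives
    \<open>d 0\<close>, which also lies in \<open>P\<close>, as the use of Nakayama's lemma
    requires.\<close>
  define I where "I = (\<lambda>l. {x \<in> carrier R. loc_dvd R P (r \<otimes> d (l - 1)) x})"
  have I: "ideal (I k) R" for k unfolding I_def using r(1) dc by (intro ideal_loc_multiples[OF P]) auto
  have "w k l \<in> carrier R \<and> v l = (v k \<otimes> c k) \<otimes> w k l \<and> r \<otimes> w k l \<in> I l" if kl: "k < l" for k l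
  proof -
    obtain x where x: "x \<in> carrier R" "w k l = x \<otimes> d (l - 1)" using w[OF kl] by blast
    have "r \<otimes> w k l = x \<otimes> (r \<otimes> d (l - 1))" unfolding x(2) using x(1) r(1) dc by (simp add: m_lcomm)
    then have "r \<otimes> w k l \<in> I l"
      using loc_dvd_triv(1)[OF P, of "r \<otimes> d (l - 1)" x] x(1) r(1) dc by (simp add: I_def)
    then show ?thesis using w[OF kl] by simp
  qed
  then have "\<exists>k. \<exists>y\<in>carrier R. \<exists>z\<in>carrier R. r \<otimes> (\<one> \<ominus> y) \<in> I k \<and> v k \<otimes> y \<oplus> v k \<otimes> c k \<otimes> z \<in> I k"
    by (rule diagonal_splitting[where I = I and w = w, OF I r(1) vc m_closed[OF vc cc]])
  then obtain k y z where yz: "y \<in> carrier R" "z \<in> carrier R" "r \<otimes> (\<one> \<ominus> y) \<in> I k"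
    "v k \<otimes> y \<oplus> v k \<otimes> c k \<otimes> z \<in> I k"
    by blast
  \<comment> \<open>Otherwise \<open>r\<close> would be a local multiple of
    \<open>r d (k - 1)\<close>, hence zero at \<open>P\<close>. So \<open>y\<close> and then
    \<open>y + c k z\<close> are units, and \<open>v k\<close> itself is a local multiple of
    \<open>r d (k - 1)\<close>.\<close>
  have "\<one> \<ominus> y \<in> P"
  proof (rule ccontr)
    assume *: "\<one> \<ominus> y \<notin> P"
    have "loc_dvd R P (r \<otimes> d (k - 1)) ((\<one> \<ominus> y) \<otimes> r)"
      using yz(3) r(1) yz(1) by (simp add: I_def m_comm)
    then have "loc_dvd R P (r \<otimes> d (k - 1)) r"
      using loc_dvd_unit_mult[OF P _ r(1), of "r \<otimes> d (k - 1)" "\<one> \<ominus> y"] * r(1) yz(1) dc by simp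
    then show False using loc_nakayama[OF P r(1) d] r(2) by blast
  qed
  then have "y \<notin> P" using prime_one_minus_iff[OF P yz(1)] by blast
  moreover have "c k \<otimes> z \<in> P" using c prime_mult_iff[OF P cc yz(2)] by blast
  ultimately have *: "y \<oplus> c k \<otimes> z \<notin> P" using prime_add_iff(1)[OF P yz(1)] by blast
  have "v k \<otimes> y \<oplus> v k \<otimes> c k \<otimes> z = (y \<oplus> c k \<otimes> z) \<otimes> v k"
    using yz(1,2) cc[of k] vc[of k] by algebra
  then have "loc_dvd R P (r \<otimes> d (k - 1)) ((y \<oplus> c k \<otimes> z) \<otimes> v k)" using yz(4) by (simp add: I_def)
  then have "loc_dvd R P (r \<otimes> d (k - 1)) (v k)"
    using loc_dvd_unit_mult[OF P _ vc, of "r \<otimes> d (k - 1)" "y \<oplus> c k \<otimes> z"] * r(1) yz(1,2) dc cc by simp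
  then have "loc_dvd R P r (v k)"
    using loc_dvd_trans[OF P r(1) _ vc] loc_dvd_triv(2)[OF P r(1) dc] r(1) dc by blast
  then show ?thesis ..
qed

text \<open>If \<open>P\<close> had no local generator, every \<open>a\<close> in \<open>P\<close>
  would factor inside \<open>P\<close>: some \<open>c\<close> in \<open>P\<close> is not a multiple
  of \<open>a\<close>, so by the chain property it divides \<open>a\<close>, with a cofactor in
  \<open>P\<close>. Iterating on one factor gives an infinite descent, which
  \<open>loc_dvd_product\<close> excludes.\<close>

lemma loc_principal_prime:
  assumes P: "primeideal P R"
  shows "\<exists>\<pi>\<in>P. \<forall>a\<in>P. loc_dvd R P \<pi> a"
proof (rule ccontr)
  assume neg: "\<not> (\<exists>\<pi>\<in>P. \<forall>a\<in>P. loc_dvd R P \<pi> a)"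
  have Pc: "a \<in> carrier R" if "a \<in> P" for a using prime_carrier[OF P that] .
  have factor: "\<exists>s\<in>carrier R - P. \<exists>x\<in>P. \<exists>c\<in>P. s \<otimes> a = x \<otimes> c" if a: "a \<in> P" for a
  proof -
    obtain c where c: "c \<in> P" "\<not> loc_dvd R P a c" using neg a by blast
    then have "loc_dvd R P c a" using loc_dvd_linear[OF P Pc[OF a] Pc[OF c(1)]] by blast
    then obtain s x where s: "s \<in> carrier R - P" "x \<in> carrier R" "s \<otimes> a = x \<otimes> c" by (auto simp: loc_dvd_def)
    have "x \<in> P"
    proof (rule ccontr)
      assume "x \<notin> P"
      then have "loc_dvd R P a c" using s by (intro loc_dvdI[of x _ s]) auto
      then show False using c(2) by blast
    qed
    then show ?thesis using s c(1) by blast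
  qed
  \<comment> \<open>Of the three factors, two enter the product \<open>v\<close> and the third is
    factored further.\<close>
  have factor2: "\<exists>c d w. a \<in> P \<longrightarrow> c \<in> P \<and> d \<in> P \<and> w \<in> P \<and> (\<exists>s\<in>carrier R - P. s \<otimes> a = c \<otimes> d \<otimes> w)" for a
  proof (cases "a \<in> P")
    case True
    obtain s x c where s: "s \<in> carrier R - P" "x \<in> P" "c \<in> P" "s \<otimes> a = x \<otimes> c" using factor[OF True] by blast
    obtain t y w where t: "t \<in> carrier R - P" "y \<in> P" "w \<in> P" "t \<otimes> c = y \<otimes> w" using factor[OF s(3)] by blast
    have "(t \<otimes> s) \<otimes> a = t \<otimes> (s \<otimes> a)" using s(1) t(1) Pc[OF True] by (simp add: m_assoc)
    also have "\<dots> = x \<otimes> (t \<otimes> c)" unfolding s(4) using t(1) s(2,3) Pc by (simp add: m_lcomm)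
    also have "\<dots> = x \<otimes> y \<otimes> w" unfolding t(4) using s(2) t(2,3) Pc by (simp add: m_assoc)
    finally show ?thesis using prime_compl_mult[OF P t(1) s(1)] s(2) t(2,3) by blast
  qed auto
  obtain fc fd fw where F: "\<And>a. a \<in> P \<Longrightarrow> fc a \<in> P \<and> fd a \<in> P \<and> fw a \<in> P \<and> (\<exists>s\<in>carrier R - P. s \<otimes> a =
    fc a \<otimes> fd a \<otimes> fw a)"
    using factor2 by metis
  obtain r where r: "r \<in> P" "\<not> loc_zero R P r"
  proof -
    obtain r where "r \<in> P" "\<not> loc_dvd R P \<zero> r" using neg prime_zero[OF P] by blast
    then have "\<not> loc_zero R P r" using loc_zero_iff Pc by simp
    then show thesis using \<open>r \<in> P\<close> that by blast
  qed
  define w where "w = (\<lambda>n. (fw ^^ n) r)"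
  have w: "w n \<in> P" for n by (induction n) (use r F in \<open>auto simp: w_def\<close>)
  define v where "v = rec_nat \<one> (\<lambda>n u. u \<otimes> (fc (w n) \<otimes> fd (w n)))"
  have v0: "v 0 = \<one>" and vS: "v (Suc n) = v n \<otimes> (fc (w n) \<otimes> fd (w n))" for n by (simp_all add: v_def)
  have cd: "fc (w n) \<in> P" "fd (w n) \<in> P" for n using F[OF w] by auto
  have vc: "v n \<in> carrier R" for n by (induction n) (use cd[THEN Pc] in \<open>auto simp: v0 vS\<close>)
  have rv: "loc_dvd R P (v n \<otimes> w n) r" for n
  proof (induction n)
    case 0 show ?case using loc_dvd_refl[OF P] Pc[OF r(1)] by (simp add: v0 w_def)
  next
    case (Suc n)
    obtain s where s: "s \<in> carrier R - P" "s \<otimes> w n = fc (w n) \<otimes> fd (w n) \<otimes> w (Suc n)"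
      using F[OF w, of n] by (auto simp: w_def)
    have "s \<otimes> (v n \<otimes> w n) = v n \<otimes> (s \<otimes> w n)" using s(1) vc Pc[OF w] by (simp add: m_lcomm)
    also have "\<dots> = \<one> \<otimes> (v (Suc n) \<otimes> w (Suc n))" unfolding s(2) vS using vc Pc w cd by (simp add: m_assoc)
    finally have "loc_dvd R P (v (Suc n) \<otimes> w (Suc n)) (v n \<otimes> w n)"
      using s(1) by (intro loc_dvdI[of s _ \<one>]) auto
    then show ?case using loc_dvd_trans[OF P _ _ _ _ Suc] vc Pc[OF w] Pc[OF r(1)] by simp
  qed
  \<comment> \<open>Since \<open>v n w n\<close> divides \<open>r\<close>, divisibility of
    \<open>v n\<close> by \<open>r\<close> makes \<open>r w n\<close> divide
    \<open>r\<close>.\<close>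
  obtain n where "loc_dvd R P r (v n)"
    using loc_dvd_product[OF P Pc[OF r(1)] r(2) cd v0 vS] by blast
  then have "loc_dvd R P (r \<otimes> w n) (v n \<otimes> w n)"
    using loc_dvd_mult[OF P _ _ _ _ _ loc_dvd_refl[OF P]] Pc[OF r(1)] Pc[OF w] vc by blast
  then have "loc_dvd R P (r \<otimes> w n) r"
    using loc_dvd_trans[OF P _ _ _ _ rv] Pc[OF r(1)] Pc[OF w] vc by blast
  then show False using loc_nakayama[OF P Pc[OF r(1)] w] r(2) by blast
qed

text \<open>With all factors equal to \<open>\<pi>\<close>, \<open>loc_dvd_product\<close> shows
  that \<open>y\<close> divides a power of \<open>\<pi>\<close>. This bounds the powers of
  \<open>\<pi>\<close> dividing \<open>y\<close>, and at the last exponent the cofactor is a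
  unit.\<close>

lemma uniformizer_exists:
  assumes P: "primeideal P R"
  shows "\<exists>\<pi>. uniformizer R P \<pi>"
proof -
  obtain \<pi> where pi: "\<pi> \<in> P" "\<And>a. a \<in> P \<Longrightarrow> loc_dvd R P \<pi> a" using loc_principal_prime[OF P] by blast
  have pc: "\<pi> \<in> carrier R" using pi P prime_carrier by blast
  have "\<exists>n::nat. loc_dvd R P (\<pi> [^] n) y \<and> loc_dvd R P y (\<pi> [^] n)"
    if y: "y \<in> carrier R" and nz: "\<not> loc_zero R P y" for y
  proof -
    \<comment> \<open>The exponent is \<open>2 * k\<close> because each step of the product adjoins
      two factors.\<close>
    have "\<exists>k. loc_dvd R P y (\<pi> [^] (2 * k :: nat))"
      by (rule loc_dvd_product[OF P y nz pi(1) pi(1)]) (use pc in \<open>auto simp: m_assoc\<close>)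
    then obtain m :: nat where m: "loc_dvd R P y (\<pi> [^] m)" by blast
    have nm: "\<not> loc_dvd R P (\<pi> [^] Suc m) y"
    proof
      assume *: "loc_dvd R P (\<pi> [^] Suc m) y"
      have "loc_dvd R P (\<pi> [^] m \<otimes> \<pi>) (\<pi> [^] m)"
        using loc_dvd_trans[OF P _ y _ * m] pc by simp
      then have "loc_zero R P (\<pi> [^] m)" using loc_nakayama[OF P _ pi(1)] pc by simp
      then have "loc_zero R P (\<pi> [^] Suc m)"
        using loc_zero_if_dvd[OF P _ _ _ loc_dvd_pow_le[OF P pc, of m "Suc m"]] pc
          by (simp del: nat_pow_Suc)
      then show False using loc_zero_if_dvd[OF P _ y _ *] nz pc by simp
    qed
    define n where "n = (LEAST j. \<not> loc_dvd R P (\<pi> [^] Suc j) y)"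
    have n: "\<not> loc_dvd R P (\<pi> [^] Suc n) y" unfolding n_def using nm by (rule LeastI)
    have n': "loc_dvd R P (\<pi> [^] n) y"
    proof (cases n)
      case 0
      then show ?thesis using loc_dvd_unit[of \<one> P y] prime_one[OF P] y by simp
    next
      case (Suc j)
      then have "j < (LEAST j. \<not> loc_dvd R P (\<pi> [^] Suc j) y)" by (simp add: n_def)
      then show ?thesis using not_less_Least Suc by blast
    qed
    then obtain s x where s: "s \<in> carrier R - P" "x \<in> carrier R" "s \<otimes> y = x \<otimes> \<pi> [^] n"
      by (auto simp: loc_dvd_def)
    have "x \<notin> P"
    proof
      assume "x \<in> P"
      then have "loc_dvd R P (\<pi> \<otimes> \<pi> [^] n) (x \<otimes> \<pi> [^] n)"
        using loc_dvd_mult[OF P _ _ _ _ pi(2) loc_dvd_refl[OF P]] pc s(2) by simp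
      then have "loc_dvd R P (\<pi> [^] Suc n) (s \<otimes> y)" using s(3) pc by (simp add: m_comm)
      then have "loc_dvd R P (\<pi> [^] Suc n) y"
        using loc_dvd_unit_mult[OF P _ y, of "\<pi> [^] Suc n" s] s(1) pc by simp
      then show False using n by blast
    qed
    then have "loc_dvd R P y (\<pi> [^] n)" using s by (intro loc_dvdI[of x _ s]) auto
    then show ?thesis using n' by blast
  qed
  then show ?thesis using pi(1) unfolding uniformizer_def by blast
qed

lemma principal_localization: "P \<in> Spec R \<Longrightarrow> principal_ideal_ring (localization R P)"
  using principal_localization_iff[of P] uniformizer_exists[of P] by (simp add: Spec_def)

text \<open>At a non-reduced point \<open>\<pi>\<close> is nilpotent but nonzero, so its last
  nonzero power has square zero. Splitting the kernel of the localization map with a representative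
  \<open>r\<close> of this power gives \<open>1 - h\<close> outside \<open>P\<close>, and
  \<open>P\<close> is the only prime that avoids it.\<close>

lemma isolated_if_nonreduced:
  assumes nr: "nonreduced_point R P"
  shows "isolated_point (zariski R) P"
proof -
  have P: "primeideal P R" using nr by (simp add: nonreduced_point_def Spec_def)
  obtain x n where x: "x \<in> carrier R" "loc_zero R P (x [^] (n::nat))" "\<not> loc_zero R P x"
    using nr unfolding nonreduced_point_def reduced_localization_iff[OF P] by blast
  obtain \<pi> where u: "uniformizer R P \<pi>" using uniformizer_exists[OF P] by blast
  have pi: "\<pi> \<in> P" "\<pi> \<in> carrier R" using u P prime_carrier by (auto simp: uniformizer_def)
  obtain j :: nat where j: "loc_dvd R P (\<pi> [^] j) x" "loc_dvd R P x (\<pi> [^] j)"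
    using u x unfolding uniformizer_def by blast
  have "loc_dvd R P (x [^] n) ((\<pi> [^] j) [^] n)" using loc_dvd_pow[OF P x(1) _ j(2)] pi by simp
  then have ex: "loc_zero R P (\<pi> [^] (j * n))"
    using loc_zero_if_dvd[OF P _ _ x(2)] x(1) pi by (simp add: nat_pow_pow)
  define N where "N = (LEAST N. loc_zero R P (\<pi> [^] (N::nat)))"
  have N: "loc_zero R P (\<pi> [^] N)" unfolding N_def using ex by (rule LeastI)
  have npi: "\<not> loc_zero R P \<pi>"
  proof
    assume z: "loc_zero R P \<pi>"
    have "j \<noteq> 0"
    proof
      assume "j = 0"
      then have "\<one> \<in> P" using loc_zero_in_prime[OF P _ ex] by simp
      then show False using prime_one[OF P] by blast
    qed
    then have "loc_dvd R P \<pi> (\<pi> [^] j)" using loc_dvd_pow_le[OF P pi(2), of 1 j] pi by simp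
    then have "loc_zero R P (\<pi> [^] j)" using loc_zero_if_dvd[OF P _ _ z] pi by simp
    then show False using loc_zero_if_dvd[OF P _ _ _ j(1)] x pi by simp
  qed
  have "N \<noteq> 0" using N prime_one[OF P] loc_zero_in_prime[OF P _ N] pi by (cases N) auto
  \<comment> \<open>\<open>M\<close> is positive because \<open>\<pi>\<close> does not vanish, so
    \<open>M + M\<close> is at least \<open>N\<close> and \<open>\<pi> [^] M\<close> has square zero
    locally.\<close>
  then obtain M where M: "N = Suc M" by (cases N) auto
  have "M \<noteq> 0" using N npi pi by (cases M) (auto simp: M)
  let ?p = "\<pi> [^] M"
  have "\<not> loc_zero R P ?p"
    using not_less_Least[of M "\<lambda>N. loc_zero R P (\<pi> [^] N)"] M unfolding N_def by simp
  have "loc_dvd R P (\<pi> [^] N) (\<pi> [^] (M + M))"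
    using loc_dvd_pow_le[OF P pi(2), of N "M + M"] M \<open>M \<noteq> 0\<close> by (simp del: nat_pow_Suc)
  then have "loc_zero R P (?p \<otimes> ?p)" using loc_zero_if_dvd[OF P _ _ N] pi by (simp add: nat_pow_mult)
  then obtain s where s: "s \<in> carrier R - P" "s \<otimes> (?p \<otimes> ?p) = \<zero>" by (auto simp: loc_zero_def)
  \<comment> \<open>The factor \<open>s\<close> makes the square zero in \<open>R\<close> and not
    only at \<open>P\<close>, so \<open>r\<close> lies in every prime.\<close>
  define r where "r = s \<otimes> ?p"
  have rc: "r \<in> carrier R" using s pi by (simp add: r_def)
  have "r \<otimes> r = s \<otimes> (s \<otimes> (?p \<otimes> ?p))"
    unfolding r_def using s(1)[THEN DiffD1] nat_pow_closed[OF pi(2), of M] by algebra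
  then have rr: "r \<otimes> r = \<zero>" using s by simp
  have rnz: "\<not> loc_zero R P r"
    using loc_zero_unit_mult[OF P _ s(1)] pi \<open>\<not> loc_zero R P ?p\<close> unfolding r_def by auto
  let ?I = "{x \<in> carrier R. loc_dvd R P \<zero> x}"
  obtain h where h: "h \<in> carrier R" "h \<otimes> r \<in> ?I"
    and hI: "\<And>b. b \<in> ?I \<Longrightarrow> \<exists>z\<in>carrier R. r \<otimes> z \<in> ?I \<and> (\<one> \<ominus> h) \<otimes> b = r \<otimes> z"
    using ideal_splitting[OF ideal_loc_multiples[OF P zero_closed] rc] by blast
  have hP: "h \<in> P"
  proof (rule ccontr)
    assume "h \<notin> P"
    moreover have "loc_zero R P (h \<otimes> r)" using h rc loc_zero_iff by simp
    ultimately show False using loc_zero_unit_mult[OF P rc, of h] h rnz by blast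
  qed
  have h1: "\<one> \<ominus> h \<in> carrier R" "\<one> \<ominus> h \<notin> P" using prime_one_minus[OF P hP] by auto
  \<comment> \<open>The kernel multiplied by \<open>1 - h\<close> consists of multiples of the
    nilpotent \<open>r\<close>. A prime avoiding \<open>1 - h\<close> therefore contains the kernel,
    hence a power of each element of \<open>P\<close>, hence \<open>P\<close>. If it were strictly
    larger, \<open>\<pi>\<close> would vanish there and also at \<open>P\<close>.\<close>
  have uniq: "P' = P" if P': "primeideal P' R" and hP': "\<one> \<ominus> h \<notin> P'" for P'
  proof -
    have IP': "b \<in> P'" if b: "b \<in> ?I" for b
    proof -
      obtain z where z: "z \<in> carrier R" "(\<one> \<ominus> h) \<otimes> b = r \<otimes> z" using hI[OF b] by blast
      have bc: "b \<in> carrier R" using b by simp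
      have "((\<one> \<ominus> h) \<otimes> b) \<otimes> ((\<one> \<ominus> h) \<otimes> b) = (r \<otimes> r) \<otimes> (z \<otimes> z)"
        unfolding z(2) using rc z(1) by algebra
      then have "((\<one> \<ominus> h) \<otimes> b) \<otimes> ((\<one> \<ominus> h) \<otimes> b) \<in> P'" using rr z(1) prime_zero[OF P'] by simp
      then show ?thesis using prime_mult_iff[OF P'] h1(1) bc hP' by simp
    qed
    have sub: "P \<subseteq> P'"
    proof
      fix a assume a: "a \<in> P"
      have ac: "a \<in> carrier R" using prime_carrier[OF P a] .
      have "loc_dvd R P (\<pi> [^] N) (a [^] N)"
        using loc_dvd_pow[OF P pi(2) ac uniformizer_dvd[OF P u a]] .
      then have "loc_zero R P (a [^] N)" using loc_zero_if_dvd[OF P _ _ N] pi ac by simp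
      then have "a [^] N \<in> P'" using IP' ac loc_zero_iff by simp
      then show "a \<in> P'" using prime_pow[OF P' ac] by blast
    qed
    show ?thesis
    proof (rule ccontr)
      assume "P' \<noteq> P"
      obtain \<pi>' where "uniformizer R P' \<pi>'" using uniformizer_exists[OF P'] by blast
      then have "loc_zero R P' \<pi>" using loc_zero_if_strict_subset[OF P' P sub] \<open>P' \<noteq> P\<close> pi(1) by blast
      then show False using loc_zero_subset[OF sub] npi by blast
    qed
  qed
  have "Q \<in> Spec R - zero_locus R {\<one> \<ominus> h} \<longleftrightarrow> Q = P" for Q
    using P h1 uniq[of Q] by (auto simp: Spec_def zero_locus_def)
  then have "{P} = Spec R - zero_locus R {\<one> \<ominus> h}" by blast
  moreover have "{\<one> \<ominus> h} \<subseteq> carrier R" using h1 by simp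
  ultimately have "\<exists>A\<subseteq>carrier R. {P} = Spec R - zero_locus R A" by blast
  then show ?thesis unfolding isolated_point_def openin_zariski .
qed

text \<open>Otherwise some \<open>r\<close> outside \<open>q\<close> lies in all but finitely many
  points of \<open>S\<close>, while each neighbourhood of \<open>p\<close> contains infinitely many
  of them. A sequence of these points gives ideals for \<open>diagonal_splitting\<close> none of
  which contains \<open>r\<close>, whereas the conclusion puts \<open>r\<close> into one of
  them.\<close>

lemma accumulation_point_generization:
  assumes p: "p \<in> Spec R" and q: "q \<in> Spec R" "q \<subseteq> p" and S: "S \<subseteq> Spec R - {p}"
    and acc: "accumulation_point (zariski R) p S"
  shows "accumulation_point (zariski R) q S"
proof (rule ccontr)
  assume "\<not> accumulation_point (zariski R) q S"
  then obtain U where U: "openin (zariski R) U" "q \<in> U" "finite (U \<inter> S)"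
    using q by (auto simp: accumulation_point_def)
  have pp: "primeideal p R" and qq: "primeideal q R" using p q by (auto simp: Spec_def)
  have Sp: "primeideal s R" "s \<noteq> p" if "s \<in> S" for s using that S by (auto simp: Spec_def)
  obtain A where A: "A \<subseteq> carrier R" "U = Spec R - zero_locus R A"
    using U(1)[unfolded openin_zariski] by blast
  then obtain r where r: "r \<in> A" "r \<notin> q" using U(2) q by (auto simp: zero_locus_def)
  have rc: "r \<in> carrier R" using r A by blast
  have "{s \<in> S. r \<notin> s} \<subseteq> U \<inter> S" using r A S by (auto simp: zero_locus_def)
  then have fin: "finite {s \<in> S. r \<notin> s}" using U(3) finite_subset by blast
  have inf: "infinite {s \<in> S. c \<notin> s}" if c: "c \<in> carrier R - p" for c
  proof -
    have "\<exists>A\<subseteq>carrier R. Spec R - zero_locus R {c} = Spec R - zero_locus R A"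
      using c by (intro exI[of _ "{c}"]) simp
    then have "openin (zariski R) (Spec R - zero_locus R {c})" unfolding openin_zariski .
    moreover have "p \<in> Spec R - zero_locus R {c}" using p c by (simp add: zero_locus_def)
    ultimately have "infinite ((Spec R - zero_locus R {c}) \<inter> S)"
      using acc unfolding accumulation_point_def by blast
    moreover have "(Spec R - zero_locus R {c}) \<inter> S = {s \<in> S. c \<notin> s}" using S by (auto simp: zero_locus_def)
    ultimately show ?thesis by simp
  qed
  have rp: "r \<in> p" using inf[of r] fin rc by blast
  then have "q \<noteq> p" using r by blast
  obtain \<rho> where "uniformizer R p \<rho>" using uniformizer_exists[OF pp] by blast
  note max = loc_zero_if_strict_subset[OF pp _ _ _ this]
  have nz: "\<not> loc_zero R p y" if "y \<in> carrier R" "y \<notin> q" for y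
    using that loc_zero_subset[OF q(2)] loc_zero_in_prime[OF qq] by blast
  have rr: "\<not> loc_zero R p (r \<otimes> r)" using nz[of "r \<otimes> r"] prime_mult_iff[OF qq rc rc] r rc by simp
  \<comment> \<open>The splitting of the annihilator of \<open>r\<close> gives \<open>h\<close> with
    \<open>h r r = 0\<close>. Since \<open>r r\<close> does not vanish at \<open>p\<close>,
    \<open>h\<close> is in \<open>p\<close>; hence in a neighbourhood of \<open>p\<close>
    annihilators of \<open>r\<close> are locally multiples of \<open>r\<close>.\<close>
  let ?ann = "{x \<in> carrier R. x \<otimes> r = \<zero>}"
  have ann: "ideal ?ann R"
    by (rule idealI') (use rc in \<open>auto simp: l_distr m_assoc\<close>)
  obtain h where h: "h \<in> carrier R" "h \<otimes> r \<in> ?ann"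
    and hann: "\<And>b. b \<in> ?ann \<Longrightarrow> \<exists>z\<in>carrier R. r \<otimes> z \<in> ?ann \<and> (\<one> \<ominus> h) \<otimes> b = r \<otimes> z"
    using ideal_splitting[OF ann rc] by blast
  have hp: "h \<in> p"
  proof (rule ccontr)
    assume "h \<notin> p"
    moreover have "h \<otimes> (r \<otimes> r) = \<zero>" using h rc by (simp add: m_assoc)
    ultimately show False using rr h(1) loc_zeroI by blast
  qed
  have h1: "\<one> \<ominus> h \<in> carrier R" "\<one> \<ominus> h \<notin> p" using prime_one_minus[OF pp hp] by auto
  \<comment> \<open>At these points \<open>r\<close> lies in the prime but does not vanish: an
    annihilator of \<open>r\<close> outside \<open>s\<close> becomes a multiple of \<open>r\<close>,
    hence an element of \<open>s\<close>, after multiplication by \<open>1 - h\<close>.\<close>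
  define T where "T = {s \<in> S. r \<in> s \<and> \<one> \<ominus> h \<notin> s}"
  have Tp: "primeideal s R" "s \<noteq> p" "r \<in> s" "\<one> \<ominus> h \<notin> s" if "s \<in> T" for s using that Sp by (auto simp: T_def)
  have Tnz: "\<not> loc_zero R s r" if s: "s \<in> T" for s
  proof
    assume "loc_zero R s r"
    then obtain t where t: "t \<in> carrier R - s" "t \<otimes> r = \<zero>" by (auto simp: loc_zero_def)
    then obtain z where z: "z \<in> carrier R" "(\<one> \<ominus> h) \<otimes> t = r \<otimes> z" using hann[of t] by auto
    have "r \<otimes> z \<in> s" using Tp[OF s] prime_mult_iff[OF Tp(1)[OF s] rc z(1)] by simp
    then have "(\<one> \<ominus> h) \<otimes> t \<in> s" using z(2) by simp
    then show False using prime_mult_iff[OF Tp(1)[OF s] h1(1), of t] t Tp(4)[OF s] by blast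
  qed
  have hit: "\<exists>s\<in>T. c \<notin> s" if c: "c \<in> carrier R - p" for c
  proof -
    have ch: "c \<otimes> (\<one> \<ominus> h) \<in> carrier R - p" using prime_compl_mult[OF pp c] h1 by blast
    have "\<not> {s \<in> S. c \<otimes> (\<one> \<ominus> h) \<notin> s} \<subseteq> {s \<in> S. r \<notin> s}"
      using inf[OF ch] fin finite_subset by blast
    then obtain s where s: "s \<in> S" "c \<otimes> (\<one> \<ominus> h) \<notin> s" "r \<in> s" by blast
    then have "c \<notin> s" "\<one> \<ominus> h \<notin> s" using prime_mult_iff[OF Sp(1), of s c "\<one> \<ominus> h"] c h1 by blast+
    then show ?thesis using s by (auto simp: T_def)
  qed
  \<comment> \<open>The contraction of \<open>r\<close> times the maximal ideal of the localization
    at \<open>s\<close>; Nakayama's lemma keeps \<open>r\<close> itself out.\<close>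
  define J where "J = (\<lambda>s. {x \<in> carrier R. \<exists>t\<in>carrier R - s. \<exists>z\<in>s. t \<otimes> x = r \<otimes> z})"
  have Jmem: "x \<in> J s \<longleftrightarrow> x \<in> carrier R \<and> (\<exists>t\<in>carrier R - s. \<exists>z\<in>s. t \<otimes> x = r \<otimes> z)" for x s
    by (simp add: J_def)
  have J: "ideal (J s) R" if s: "primeideal s R" for s
  proof (rule idealI')
    show "J s \<subseteq> carrier R" by (auto simp: J_def)
    show "\<zero> \<in> J s" unfolding Jmem
      using prime_zero[OF s] prime_one[OF s] rc
      by (intro conjI bexI[of _ \<one>] bexI[of _ \<zero>]) auto
  next
    fix a b assume "a \<in> J s" "b \<in> J s"
    then obtain t z u y where *: "a \<in> carrier R" "b \<in> carrier R" "t \<in> carrier R - s" "u \<in> carrier R - s"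
      "z \<in> s" "y \<in> s" "t \<otimes> a = r \<otimes> z" "u \<otimes> b = r \<otimes> y" unfolding Jmem by blast
    have zy: "z \<in> carrier R" "y \<in> carrier R" using * prime_carrier[OF s] by auto
    have "(t \<otimes> u) \<otimes> (a \<oplus> b) = u \<otimes> (t \<otimes> a) \<oplus> t \<otimes> (u \<otimes> b)"
      using *(1,2) *(3,4)[THEN DiffD1] by algebra
    also have "\<dots> = r \<otimes> (u \<otimes> z \<oplus> t \<otimes> y)"
      unfolding *(7,8) using *(3,4)[THEN DiffD1] zy rc by algebra
    finally have "(t \<otimes> u) \<otimes> (a \<oplus> b) = r \<otimes> (u \<otimes> z \<oplus> t \<otimes> y)" .
    moreover have "u \<otimes> z \<oplus> t \<otimes> y \<in> s" using * zy prime_mult_iff[OF s] by (intro prime_add[OF s]) auto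
    ultimately show "a \<oplus> b \<in> J s" using prime_compl_mult[OF s *(3,4)] *(1,2) unfolding Jmem by blast
  next
    fix a c assume "a \<in> J s" and c: "c \<in> carrier R"
    then obtain t z where *: "a \<in> carrier R" "t \<in> carrier R - s" "z \<in> s" "t \<otimes> a = r \<otimes> z" unfolding Jmem
      by blast
    have zc: "z \<in> carrier R" using * prime_carrier[OF s] by auto
    have "t \<otimes> (c \<otimes> a) = c \<otimes> (t \<otimes> a)" using *(1,2) c by (simp add: m_lcomm)
    also have "\<dots> = r \<otimes> (c \<otimes> z)" unfolding *(4) using rc c zc by (simp add: m_lcomm)
    finally have "t \<otimes> (c \<otimes> a) = r \<otimes> (c \<otimes> z)" .
    moreover have "c \<otimes> z \<in> s" using *(3) c zc prime_mult_iff[OF s] by simp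
    ultimately show "c \<otimes> a \<in> J s" using *(1,2) c unfolding Jmem by blast
  qed
  have Jsat: "x \<in> J s"
    if s: "primeideal s R" and ux: "u \<in> carrier R" "u \<notin> s" "x \<in> carrier R" "u \<otimes> x \<in> J s" for s u x
  proof -
    obtain t z where *: "t \<in> carrier R - s" "z \<in> s" "t \<otimes> (u \<otimes> x) = r \<otimes> z"
      using ux(4) unfolding Jmem by blast
    have "(t \<otimes> u) \<otimes> x = r \<otimes> z" using * ux by (simp add: m_assoc)
    moreover have "t \<otimes> u \<in> carrier R - s" using prime_compl_mult[OF s *(1)] ux by blast
    ultimately show ?thesis using *(2) ux(3) unfolding Jmem by blast
  qed
  have Jr: "r \<notin> J s" if s: "s \<in> T" for s
  proof
    assume "r \<in> J s"
    then obtain t z where *: "t \<in> carrier R - s" "z \<in> s" "t \<otimes> r = r \<otimes> z" unfolding Jmem by blast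
    then have "loc_dvd R s (r \<otimes> z) r"
      using prime_carrier[OF Tp(1)[OF s] *(2)] rc by (intro loc_dvdI[of t _ \<one>]) auto
    then show False using loc_nakayama[OF Tp(1)[OF s] rc *(2)] Tnz[OF s] by blast
  qed
  \<comment> \<open>\<open>s\<close> is not below \<open>p\<close>, since \<open>r\<close> would
    then vanish at \<open>p\<close>. For \<open>c\<close> in \<open>s\<close> outside
    \<open>p\<close>, a power of \<open>c\<close> is a multiple of \<open>r\<close> at
    \<open>s\<close>, and one more factor \<open>c\<close> leads into \<open>J s\<close>.\<close>
  have Jp: "\<exists>c\<in>J s. c \<notin> p" if s: "s \<in> T" for s
  proof -
    note sp = Tp(1)[OF s]
    have "\<not> s \<subseteq> p" using max[OF sp _ Tp(2)[OF s] Tp(3)[OF s]] nz[OF rc r(2)] by blast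
    then obtain c where c: "c \<in> s" "c \<notin> p" by blast
    have cc: "c \<in> carrier R" using prime_carrier[OF sp c(1)] .
    obtain \<pi> where u: "uniformizer R s \<pi>" using uniformizer_exists[OF sp] by blast
    then have pi: "\<pi> \<in> s" "\<pi> \<in> carrier R" using prime_carrier[OF sp] by (auto simp: uniformizer_def)
    obtain n :: nat where n: "loc_dvd R s r (\<pi> [^] n)"
      using u rc Tnz[OF s] unfolding uniformizer_def by blast
    have "loc_dvd R s (\<pi> [^] n) (c [^] n)"
      by (rule loc_dvd_pow[OF sp pi(2) cc uniformizer_dvd[OF sp u c(1)]])
    then have "loc_dvd R s r (c [^] n)" using loc_dvd_trans[OF sp rc _ _ n] pi cc by simp
    then obtain t x where t: "t \<in> carrier R - s" "x \<in> carrier R" "t \<otimes> c [^] n = x \<otimes> r"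
      by (auto simp: loc_dvd_def)
    have "t \<otimes> c [^] Suc n = (t \<otimes> c [^] n) \<otimes> c" using t(1) cc by (simp add: m_assoc)
    also have "\<dots> = r \<otimes> (x \<otimes> c)" unfolding t(3) using t(2) rc cc by (simp add: m_comm m_lcomm m_assoc)
    finally have "t \<otimes> c [^] Suc n = r \<otimes> (x \<otimes> c)" .
    moreover have "x \<otimes> c \<in> s" using c(1) t(2) cc prime_mult_iff[OF sp] by simp
    moreover have "c [^] Suc n \<in> carrier R" using cc by simp
    ultimately have "c [^] Suc n \<in> J s" using t(1) unfolding Jmem by blast
    moreover have "c [^] Suc n \<notin> p" using prime_pow[OF pp cc] c(2) by blast
    ultimately show ?thesis by blast
  qed
  have "\<exists>s c. C \<in> carrier R - p \<longrightarrow> s \<in> T \<and> C \<notin> s \<and> c \<in> J s \<and> c \<notin> p" for C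
    using hit[of C] Jp by blast
  then obtain fs fc where F: "\<And>C. C \<in> carrier R - p \<Longrightarrow> fs C \<in> T \<and> C \<notin> fs C \<and> fc C \<in> J (fs C) \<and> fc C \<notin> p"
    by metis
  have fcc: "fc C \<in> carrier R - p" if "C \<in> carrier R - p" for C using F[OF that] by (simp add: Jmem)
  \<comment> \<open>The product of all elements chosen before step \<open>n\<close>. It stays
    outside \<open>p\<close>, which guarantees a prime in \<open>T\<close> avoiding it.\<close>
  define Cs where "Cs = (\<lambda>n. ((\<lambda>C. C \<otimes> fc C) ^^ n) \<one>)"
  have Cs0: "Cs 0 = \<one>" and CsS: "Cs (Suc n) = Cs n \<otimes> fc (Cs n)" for n by (simp_all add: Cs_def)
  have Csp: "Cs n \<in> carrier R - p" for n
  proof (induction n)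
    case 0 show ?case using prime_one[OF pp] by (simp add: Cs0)
  next
    case (Suc n) show ?case unfolding CsS by (rule prime_compl_mult[OF pp Suc fcc[OF Suc]])
  qed
  let ?c = "\<lambda>n. fc (Cs n)" and ?s = "\<lambda>n. fs (Cs n)"
  have cc: "?c n \<in> carrier R" and Csc: "Cs n \<in> carrier R" for n using fcc[OF Csp] Csp by blast+
  have sT: "?s n \<in> T" and Cns: "Cs n \<notin> ?s n" and cJ: "?c n \<in> J (?s n)" for n using F[OF Csp] by blast+
  have "\<exists>D. k < l \<longrightarrow> D \<in> carrier R \<and> Cs l = ?c k \<otimes> D" for k l
  proof (induction l)
    case (Suc l)
    show ?case
    proof (cases "k = l")
      case True
      then show ?thesis using cc Csc by (intro exI[of _ "Cs k"]) (simp add: CsS m_comm)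
    next
      case False
      show ?thesis
      proof (cases "k < l")
        case True
        then obtain D where D: "D \<in> carrier R" "Cs l = ?c k \<otimes> D" using Suc by blast
        have "Cs (Suc l) = ?c k \<otimes> D \<otimes> ?c l" unfolding CsS by (subst (1) D(2)) (rule refl)
        then have "Cs (Suc l) = ?c k \<otimes> (D \<otimes> ?c l)" using D(1) cc m_assoc by simp
        then show ?thesis using D(1) cc m_closed by blast
      qed (use False in auto)
    qed
  qed simp
  then obtain D where D: "\<And>k l. k < l \<Longrightarrow> D k l \<in> carrier R \<and> Cs l = ?c k \<otimes> D k l" by metis
  \<comment> \<open>The cofactor \<open>r D k l\<close> of \<open>r Cs l\<close> keeps the factor
    \<open>r\<close>, which lies in the prime \<open>?s l\<close>; a further factor \<open>r\<close>
    puts it into \<open>J (?s l)\<close>.\<close>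
  have W: "r \<otimes> D k l \<in> carrier R \<and> r \<otimes> Cs l = ?c k \<otimes> (r \<otimes> D k l) \<and> r \<otimes> (r \<otimes> D k l) \<in> J (?s l)"
    if kl: "k < l" for k l
  proof (intro conjI)
    note d = D[OF kl, THEN conjunct1] D[OF kl, THEN conjunct2]
    show "r \<otimes> D k l \<in> carrier R" using d rc by simp
    show "r \<otimes> Cs l = ?c k \<otimes> (r \<otimes> D k l)" unfolding d(2) using d(1) rc cc by (simp add: m_lcomm)
    have "r \<otimes> D k l \<in> ?s l" using Tp(3)[OF sT] prime_mult_iff[OF Tp(1)[OF sT] rc d(1)] by simp
    then show "r \<otimes> (r \<otimes> D k l) \<in> J (?s l)"
      using d(1) rc prime_one[OF Tp(1)[OF sT]] unfolding Jmem
      by (intro conjI bexI[of _ \<one>] bexI[of _ "r \<otimes> D k l"]) auto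
  qed
  have "\<exists>k. \<exists>y\<in>carrier R. \<exists>z\<in>carrier R. r \<otimes> (\<one> \<ominus> y) \<in> J (?s k) \<and> r \<otimes> Cs k \<otimes> y \<oplus> ?c k \<otimes> z \<in> J (?s k)"
    by (rule diagonal_splitting[where I = "\<lambda>k. J (?s k)" and w = "\<lambda>k l. r \<otimes> D k l",
          OF J[OF Tp(1)[OF sT]] rc m_closed[OF rc Csc] cc W])
  then obtain k y z where yz: "y \<in> carrier R" "z \<in> carrier R" "r \<otimes> (\<one> \<ominus> y) \<in> J (?s k)"
    "r \<otimes> Cs k \<otimes> y \<oplus> ?c k \<otimes> z \<in> J (?s k)" by blast
  note sk = Tp(1)[OF sT[of k]]
  interpret Jk: ideal "J (?s k)" R by (rule J[OF sk])
  have "y \<notin> ?s k"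
  proof (rule prime_one_minus_iff[OF sk yz(1)], rule ccontr)
    assume "\<one> \<ominus> y \<notin> ?s k"
    moreover have "(\<one> \<ominus> y) \<otimes> r \<in> J (?s k)" using yz(1,3) rc by (simp add: m_comm)
    ultimately have "r \<in> J (?s k)" using Jsat[OF sk, of "\<one> \<ominus> y" r] yz(1) rc by simp
    then show False using Jr[OF sT] by blast
  qed
  then have Cy: "Cs k \<otimes> y \<in> carrier R - ?s k" using prime_compl_mult[OF sk] Cns Csc yz(1) by blast
  \<comment> \<open>The term with \<open>z\<close> drops out because \<open>?c k\<close> was chosen
    in \<open>J (?s k)\<close>. What is left is \<open>r\<close> times an element outside the
    prime.\<close>
  have "?c k \<otimes> z \<in> J (?s k)" by (rule Jk.I_r_closed[OF cJ yz(2)])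
  then have "(r \<otimes> Cs k \<otimes> y \<oplus> ?c k \<otimes> z) \<ominus> ?c k \<otimes> z \<in> J (?s k)"
    using yz(4) by (simp add: a_minus_def)
  moreover have "(r \<otimes> Cs k \<otimes> y \<oplus> ?c k \<otimes> z) \<ominus> ?c k \<otimes> z = (Cs k \<otimes> y) \<otimes> r"
    using yz(1,2) rc cc[of k] Csc[of k] by algebra
  ultimately have "r \<in> J (?s k)" using Jsat[OF sk, of "Cs k \<otimes> y" r] Cy rc by simp
  then show False using Jr[OF sT] by blast
qed

end

section \<open>Idempotents and clopen subsets of the spectrum\<close>

text \<open>For idempotent \<open>e\<close> this is \<open>e R\<close>, a factor of \<open>R\<close>
  whose carrier stays inside \<open>'a\<close> as \<open>splits_at\<close> demands.\<close>

definition corner_ring :: "('a, 'x) ring_scheme \<Rightarrow> 'a \<Rightarrow> 'a ring"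
  where "corner_ring R e =
    \<lparr> partial_object.carrier = {a \<in> carrier R. e \<otimes>\<^bsub>R\<^esub> a = a}, monoid.mult = (\<otimes>\<^bsub>R\<^esub>), monoid.one = e,
      ring.zero = \<zero>\<^bsub>R\<^esub>, ring.add = (\<oplus>\<^bsub>R\<^esub>) \<rparr>"

lemma corner_ring_simps [simp]:
  "carrier (corner_ring R e) = {a \<in> carrier R. e \<otimes>\<^bsub>R\<^esub> a = a}"
  "a \<otimes>\<^bsub>corner_ring R e\<^esub> b = a \<otimes>\<^bsub>R\<^esub> b" "\<one>\<^bsub>corner_ring R e\<^esub> = e"
  "\<zero>\<^bsub>corner_ring R e\<^esub> = \<zero>\<^bsub>R\<^esub>" "a \<oplus>\<^bsub>corner_ring R e\<^esub> b = a \<oplus>\<^bsub>R\<^esub> b"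
  by (simp_all add: corner_ring_def)

context cring
begin

lemma corner_ring_cring:
  assumes e: "e \<in> carrier R" "e \<otimes> e = e"
  shows "cring (corner_ring R e)"
proof (rule cringI)
  show "abelian_group (corner_ring R e)"
  proof (rule abelian_groupI)
    fix x assume "x \<in> carrier (corner_ring R e)"
    then show "\<exists>y\<in>carrier (corner_ring R e). y \<oplus>\<^bsub>corner_ring R e\<^esub> x = \<zero>\<^bsub>corner_ring R e\<^esub>"
      using e by (intro bexI[of _ "\<ominus> x"]) (auto simp: l_neg r_minus)
  qed (use e in \<open>auto simp: r_distr a_ac\<close>)
  show "comm_monoid (corner_ring R e)"
  proof (rule comm_monoidI)
    fix x y assume "x \<in> carrier (corner_ring R e)" "y \<in> carrier (corner_ring R e)"
    then show "x \<otimes>\<^bsub>corner_ring R e\<^esub> y \<in> carrier (corner_ring R e)"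
      using e m_assoc[of e x y] by auto
  qed (use e in \<open>auto simp: m_ac\<close>)
qed (auto simp: l_distr)

lemma corner_closed: "e \<in> carrier R \<Longrightarrow> e \<otimes> e = e \<Longrightarrow> a \<in> carrier R \<Longrightarrow> e \<otimes> a \<in> carrier (corner_ring R e)"
  by (simp add: m_assoc[symmetric])

text \<open>For \<open>a\<close> in \<open>J\<close> the products \<open>c a\<close> and
  \<open>(e c) a\<close> agree, so stability under \<open>e R\<close> is stability under
  \<open>R\<close>.\<close>

lemma ideal_of_corner_ideal:
  assumes e: "e \<in> carrier R" "e \<otimes> e = e" and J: "ideal J (corner_ring R e)"
  shows "ideal J R"
proof -
  interpret J: ideal J "corner_ring R e" by (rule J)
  show ?thesis
  proof (rule idealI')
    show "J \<subseteq> carrier R" using J.Icarr by auto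
    show "\<zero> \<in> J"
      using additive_subgroup.zero_closed[OF ideal.axioms(1)[OF J]] by (simp only: corner_ring_simps)
    show "a \<oplus> b \<in> J" if "a \<in> J" "b \<in> J" for a b
      using additive_subgroup.a_closed[OF ideal.axioms(1)[OF J] that] by (simp only: corner_ring_simps)
    fix a c assume a: "a \<in> J" and c: "c \<in> carrier R"
    have ac: "a \<in> carrier R" "e \<otimes> a = a" using J.Icarr[OF a] by auto
    have "(e \<otimes> c) \<otimes> a \<in> J" using J.I_l_closed[OF a corner_closed[OF e c]] by (simp only: corner_ring_simps)
    moreover have "(e \<otimes> c) \<otimes> a = c \<otimes> (e \<otimes> a)" using e(1) c ac(1) by algebra
    ultimately show "c \<otimes> a \<in> J" by (simp add: ac(2))
  qed
qed

text \<open>The preimage under the projection from \<open>R\<close> to \<open>e R\<close>. It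
  identifies the spectrum of \<open>e R\<close> with a set of primes of \<open>R\<close> avoiding
  \<open>e\<close>.\<close>

lemma prime_of_corner_prime:
  assumes e: "e \<in> carrier R" "e \<otimes> e = e" and Q: "primeideal Q (corner_ring R e)"
  shows "primeideal {a \<in> carrier R. e \<otimes> a \<in> Q} R" "e \<notin> {a \<in> carrier R. e \<otimes> a \<in> Q}"
    "Q = {a \<in> carrier R. e \<otimes> a \<in> Q} \<inter> carrier (corner_ring R e)"
proof -
  interpret C: cring "corner_ring R e" by (rule corner_ring_cring[OF e])
  have id: "ideal Q R" using ideal_of_corner_ideal[OF e] primeideal.axioms(1)[OF Q] by blast
  interpret QR: ideal Q R by (rule id)
  have eQ: "e \<notin> Q" using C.prime_one[OF Q] by simp
  then show "e \<notin> {a \<in> carrier R. e \<otimes> a \<in> Q}" using e by simp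
  show "primeideal {a \<in> carrier R. e \<otimes> a \<in> Q} R"
  proof (rule primeidealI[OF _ is_cring])
    show "ideal {a \<in> carrier R. e \<otimes> a \<in> Q} R"
    proof (rule idealI')
      show "\<zero> \<in> {a \<in> carrier R. e \<otimes> a \<in> Q}" using e QR.zero_closed by simp
      show "a \<oplus> b \<in> {a \<in> carrier R. e \<otimes> a \<in> Q}"
        if "a \<in> {a \<in> carrier R. e \<otimes> a \<in> Q}" "b \<in> {a \<in> carrier R. e \<otimes> a \<in> Q}" for a b
        using that e QR.a_closed by (simp add: r_distr)
      show "x \<otimes> a \<in> {a \<in> carrier R. e \<otimes> a \<in> Q}"
        if "a \<in> {a \<in> carrier R. e \<otimes> a \<in> Q}" "x \<in> carrier R" for a x
        using that e QR.I_l_closed[of "e \<otimes> a" x] by (simp add: m_lcomm)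
    qed auto
    have "\<one> \<notin> {a \<in> carrier R. e \<otimes> a \<in> Q}" using e eQ by simp
    then show "carrier R \<noteq> {a \<in> carrier R. e \<otimes> a \<in> Q}" using one_closed by metis
    fix a b assume ab: "a \<in> carrier R" "b \<in> carrier R" "a \<otimes> b \<in> {a \<in> carrier R. e \<otimes> a \<in> Q}"
    have "(e \<otimes> a) \<otimes> (e \<otimes> b) = (e \<otimes> e) \<otimes> (a \<otimes> b)" using e(1) ab(1,2) by algebra
    then have "(e \<otimes> a) \<otimes> (e \<otimes> b) \<in> Q" using ab(3) e(2) by simp
    then show "a \<in> {a \<in> carrier R. e \<otimes> a \<in> Q} \<or> b \<in> {a \<in> carrier R. e \<otimes> a \<in> Q}"
      using C.prime_mult_iff[OF Q corner_closed[OF e ab(1)] corner_closed[OF e ab(2)]] ab by simp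
  qed
  show "Q = {a \<in> carrier R. e \<otimes> a \<in> Q} \<inter> carrier (corner_ring R e)"
  proof
    show "Q \<subseteq> {a \<in> carrier R. e \<otimes> a \<in> Q} \<inter> carrier (corner_ring R e)"
      using C.prime_carrier[OF Q] by auto
    show "{a \<in> carrier R. e \<otimes> a \<in> Q} \<inter> carrier (corner_ring R e) \<subseteq> Q" by auto
  qed
qed

lemma RDirProd_ops:
  "(a, b) \<otimes>\<^bsub>RDirProd A B\<^esub> (c, d) = (a \<otimes>\<^bsub>A\<^esub> c, b \<otimes>\<^bsub>B\<^esub> d)"
  "(a, b) \<oplus>\<^bsub>RDirProd A B\<^esub> (c, d) = (a \<oplus>\<^bsub>A\<^esub> c, b \<oplus>\<^bsub>B\<^esub> d)"
  "\<one>\<^bsub>RDirProd A B\<^esub> = (\<one>\<^bsub>A\<^esub>, \<one>\<^bsub>B\<^esub>)" "\<zero>\<^bsub>RDirProd A B\<^esub> = (\<zero>\<^bsub>A\<^esub>, \<zero>\<^bsub>B\<^esub>)"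
  by (simp_all add: RDirProd_def DirProd_def monoid.defs)

text \<open>The inverse adds the three components; orthogonality separates them again.\<close>

lemma product_iso_corner_rings:
  assumes e: "e0 \<in> carrier R" "e1 \<in> carrier R" "e2 \<in> carrier R"
    and idem: "e0 \<otimes> e0 = e0" "e1 \<otimes> e1 = e1" "e2 \<otimes> e2 = e2"
    and orth: "e0 \<otimes> e1 = \<zero>" "e0 \<otimes> e2 = \<zero>" "e1 \<otimes> e2 = \<zero>"
    and sum: "e0 \<oplus> (e1 \<oplus> e2) = \<one>"
  shows "(\<lambda>x. (e0 \<otimes> x, e1 \<otimes> x, e2 \<otimes> x)) \<in>
    ring_iso R (RDirProd (corner_ring R e0) (RDirProd (corner_ring R e1) (corner_ring R e2)))"
    (is "?\<phi> \<in> ring_iso R ?D")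
proof -
  have cD: "carrier ?D = carrier (corner_ring R e0) \<times> (carrier (corner_ring R e1) \<times> carrier (corner_ring R e2))"
    by (simp only: RDirProd_carrier)
  have mm: "(e \<otimes> x) \<otimes> (e \<otimes> y) = e \<otimes> (x \<otimes> y)"
    if "e \<in> carrier R" "e \<otimes> e = e" "x \<in> carrier R" "y \<in> carrier R" for e x y
  proof -
    have "(e \<otimes> x) \<otimes> (e \<otimes> y) = (e \<otimes> e) \<otimes> (x \<otimes> y)" using that(1,3,4) by algebra
    then show ?thesis using that(2) by simp
  qed
  have closed: "?\<phi> x \<in> carrier ?D" if "x \<in> carrier R" for x
    unfolding cD mem_Sigma_iff using corner_closed e idem that by blast
  have "?\<phi> \<in> ring_hom R ?D"
    by (rule ring_hom_memI) (use closed e idem mm in \<open>simp_all add: RDirProd_ops r_distr\<close>)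
  moreover have "bij_betw ?\<phi> (carrier R) (carrier ?D)"
  proof (rule bij_betwI[where g = "\<lambda>(a, b, c). a \<oplus> (b \<oplus> c)"])
    show "?\<phi> \<in> carrier R \<rightarrow> carrier ?D" using closed by blast
    show "(\<lambda>(a, b, c). a \<oplus> (b \<oplus> c)) \<in> carrier ?D \<rightarrow> carrier R"
      unfolding cD by auto
    fix x assume x: "x \<in> carrier R"
    have "e0 \<otimes> x \<oplus> (e1 \<otimes> x \<oplus> e2 \<otimes> x) = (e0 \<oplus> (e1 \<oplus> e2)) \<otimes> x" using e x by algebra
    then show "(case ?\<phi> x of (a, b, c) \<Rightarrow> a \<oplus> (b \<oplus> c)) = x" using sum x by simp
  next
    fix y assume "y \<in> carrier ?D"
    then obtain a b c where y: "y = (a, b, c)" and c: "a \<in> carrier R" "b \<in> carrier R" "c \<in> carrier R"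
      and abc: "e0 \<otimes> a = a" "e1 \<otimes> b = b" "e2 \<otimes> c = c" unfolding cD by auto
    have z: "f \<otimes> a = \<zero>" if "g \<otimes> a = a" "f \<otimes> g = \<zero>" "f \<in> carrier R" "g \<in> carrier R" "a \<in> carrier R" for f g a
      using that m_assoc[of f g a] by simp
    have o: "e1 \<otimes> e0 = \<zero>" "e2 \<otimes> e0 = \<zero>" "e2 \<otimes> e1 = \<zero>" using orth e by (simp_all add: m_comm)
    have "e0 \<otimes> b = \<zero>" "e0 \<otimes> c = \<zero>" "e1 \<otimes> a = \<zero>" "e1 \<otimes> c = \<zero>" "e2 \<otimes> a = \<zero>" "e2 \<otimes> b = \<zero>"
      using z abc orth o e c by blast+
    then show "?\<phi> (case y of (a, b, c) \<Rightarrow> a \<oplus> (b \<oplus> c)) = y"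
      using y c e abc by (simp add: r_distr)
  qed
  ultimately show ?thesis by (simp add: ring_iso_def)
qed

text \<open>A prime containing both powers would contain \<open>a\<close> and \<open>b\<close>,
  hence \<open>\<one>\<close>.\<close>

lemma comaximal_powers:
  assumes ab: "a \<in> carrier R" "b \<in> carrier R" "a \<oplus> b = \<one>"
  shows "\<exists>u\<in>carrier R. \<exists>v\<in>carrier R. u \<otimes> a [^] (m::nat) \<oplus> v \<otimes> b [^] (n::nat) = \<one>"
proof -
  let ?I = "{u \<otimes> a [^] m \<oplus> v \<otimes> b [^] n | u v. u \<in> carrier R \<and> v \<in> carrier R}"
  have mem: "x \<in> ?I \<longleftrightarrow> (\<exists>u\<in>carrier R. \<exists>v\<in>carrier R. x = u \<otimes> a [^] m \<oplus> v \<otimes> b [^] n)" for x by blast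
  have pc: "a [^] m \<in> carrier R" "b [^] n \<in> carrier R" using ab by simp_all
  have id: "ideal ?I R"
  proof (rule idealI')
    show "?I \<subseteq> carrier R" using pc by auto
    show "\<zero> \<in> ?I" unfolding mem using pc by (intro bexI[of _ \<zero>]) simp_all
  next
    fix x y assume "x \<in> ?I" "y \<in> ?I"
    then obtain u v u' v' where *: "u \<in> carrier R" "v \<in> carrier R" "u' \<in> carrier R" "v' \<in> carrier R"
      "x = u \<otimes> a [^] m \<oplus> v \<otimes> b [^] n" "y = u' \<otimes> a [^] m \<oplus> v' \<otimes> b [^] n" unfolding mem by blast
    have "x \<oplus> y = (u \<oplus> u') \<otimes> a [^] m \<oplus> (v \<oplus> v') \<otimes> b [^] n" unfolding *(5,6) using *(1-4) pc by algebra
    then show "x \<oplus> y \<in> ?I" unfolding mem using *(1-4) by blast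
  next
    fix x c assume "x \<in> ?I" and c: "c \<in> carrier R"
    then obtain u v where *: "u \<in> carrier R" "v \<in> carrier R" "x = u \<otimes> a [^] m \<oplus> v \<otimes> b [^] n" unfolding mem
      by blast
    have "c \<otimes> x = (c \<otimes> u) \<otimes> a [^] m \<oplus> (c \<otimes> v) \<otimes> b [^] n" unfolding *(3) using *(1,2) c pc by algebra
    then show "c \<otimes> x \<in> ?I" unfolding mem using *(1,2) c by blast
  qed
  have "\<one> \<in> ?I"
  proof (rule ideal_eq_carrier_if_locally[OF id], rule notI)
    fix P assume P: "primeideal P R" "?I \<subseteq> P"
    have "a [^] m = \<one> \<otimes> a [^] m \<oplus> \<zero> \<otimes> b [^] n" "b [^] n = \<zero> \<otimes> a [^] m \<oplus> \<one> \<otimes> b [^] n"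
      using pc by simp_all
    then have "a [^] m \<in> ?I" "b [^] n \<in> ?I" unfolding mem by blast+
    then have "a \<in> P" "b \<in> P" using P prime_pow[OF P(1)] ab by blast+
    then have "\<one> \<in> P" using prime_add[OF P(1)] ab(3) by metis
    then show False using prime_one[OF P(1)] by blast
  qed
  then show ?thesis unfolding mem by metis
qed

section \<open>Basic open sets, accumulation points and clopen sets\<close>

lemma openin_zariski_if_locally:
  assumes U: "U \<subseteq> Spec R"
    and sep: "\<And>P. P \<in> U \<Longrightarrow> \<exists>c\<in>carrier R. c \<notin> P \<and> (\<forall>Q\<in>Spec R - U. c \<in> Q)"
  shows "openin (zariski R) U"
proof -
  let ?A = "{c \<in> carrier R. \<forall>Q\<in>Spec R - U. c \<in> Q}"
  have "P \<in> U \<longleftrightarrow> P \<in> Spec R - zero_locus R ?A" for P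
    using U sep[of P] unfolding zero_locus_def by blast
  then have "U = Spec R - zero_locus R ?A" by blast
  moreover have "?A \<subseteq> carrier R" by blast
  ultimately show ?thesis unfolding openin_zariski by blast
qed

lemma openin_zariski_basic:
  assumes "openin (zariski R) U" "P \<in> U"
  shows "\<exists>c\<in>carrier R. c \<notin> P \<and> (\<forall>Q\<in>Spec R. c \<notin> Q \<longrightarrow> Q \<in> U)"
proof -
  obtain A where A: "A \<subseteq> carrier R" "U = Spec R - zero_locus R A"
    using assms(1)[unfolded openin_zariski] by blast
  obtain c where c: "c \<in> A" "c \<notin> P" using A(2) assms(2) by (auto simp: zero_locus_def)
  have "Q \<in> U" if "Q \<in> Spec R" "c \<notin> Q" for Q using A(2) c(1) that by (auto simp: zero_locus_def)
  then show ?thesis using c A(1) by blast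
qed

lemma accumulation_point_zariskiI:
  assumes P: "P \<in> Spec R" and S: "S \<subseteq> Spec R"
    and "\<And>c. c \<in> carrier R - P \<Longrightarrow> infinite {s \<in> S. c \<notin> s}"
  shows "accumulation_point (zariski R) P S"
  unfolding accumulation_point_def
proof (intro conjI allI impI)
  fix U assume "openin (zariski R) U \<and> P \<in> U"
  then obtain c where c: "c \<in> carrier R" "c \<notin> P" "\<forall>Q\<in>Spec R. c \<notin> Q \<longrightarrow> Q \<in> U"
    using openin_zariski_basic[of U P] by blast
  have "{s \<in> S. c \<notin> s} \<subseteq> U \<inter> S" using c(3) S by blast
  moreover have "infinite {s \<in> S. c \<notin> s}" using assms(3) c(1,2) by blast
  ultimately show "infinite (U \<inter> S)" using finite_subset by blast
qed (use P in simp)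

text \<open>There are \<open>a\<close> vanishing off \<open>U\<close> and \<open>b\<close> vanishing
  on \<open>U\<close> with \<open>a + b = 1\<close>, and their product is nilpotent. Passing to
  comaximal powers with product zero turns this partition of unity into an idempotent.\<close>

lemma idempotent_of_clopen:
  assumes U: "openin (zariski R) U" and V: "openin (zariski R) (Spec R - U)"
  shows "\<exists>e\<in>carrier R. e \<otimes> e = e \<and> (\<forall>P\<in>Spec R. e \<notin> P \<longleftrightarrow> P \<in> U)"
proof -
  define I where "I = (\<lambda>W. {x \<in> carrier R. \<forall>P\<in>W. x \<in> P})"
  have I: "ideal (I W) R" if W: "W \<subseteq> Spec R" for W
  proof (rule idealI')
    have Wp: "primeideal P R" if "P \<in> W" for P using W that by (auto simp: Spec_def)
    show "\<zero> \<in> I W" using prime_zero[OF Wp] by (simp add: I_def)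
    show "a \<oplus> b \<in> I W" if "a \<in> I W" "b \<in> I W" for a b
      using that prime_add[OF Wp] by (simp add: I_def)
    show "x \<otimes> a \<in> I W" if "a \<in> I W" "x \<in> carrier R" for a x
      using that prime_mult_iff[OF Wp] by (simp add: I_def)
  qed (auto simp: I_def)
  have US: "U \<subseteq> Spec R" using openin_subset[OF U] by simp
  let ?K = "I (Spec R - U) <+>\<^bsub>R\<^esub> I U"
  have mem: "x \<in> ?K \<longleftrightarrow> (\<exists>a\<in>I (Spec R - U). \<exists>b\<in>I U. x = a \<oplus> b)" for x
    by (auto simp: set_add_def')
  have id: "ideal ?K R" by (rule add_ideals[OF I I]) (use US in auto)
  have "\<one> \<in> ?K"
  proof (rule ideal_eq_carrier_if_locally[OF id], rule notI)
    fix P assume P: "primeideal P R" "?K \<subseteq> P"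
    have PS: "P \<in> Spec R" using P by (simp add: Spec_def)
    have z: "\<zero> \<in> I W" if "W \<subseteq> Spec R" for W
      using additive_subgroup.zero_closed[OF ideal.axioms(1)[OF I[OF that]]] .
    show False
    proof (cases "P \<in> U")
      case True
      then obtain c where c: "c \<in> carrier R" "c \<notin> P" "\<forall>Q\<in>Spec R. c \<notin> Q \<longrightarrow> Q \<in> U"
        using openin_zariski_basic[OF U] by blast
      then have "c \<in> I (Spec R - U)" by (auto simp: I_def)
      moreover have "c = c \<oplus> \<zero>" using c(1) by simp
      ultimately have "c \<in> ?K" unfolding mem using z[OF US] by blast
      then show False using P(2) c(2) by blast
    next
      case False
      then obtain c where c: "c \<in> carrier R" "c \<notin> P" "\<forall>Q\<in>Spec R. c \<notin> Q \<longrightarrow> Q \<in> Spec R - U"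
        using openin_zariski_basic[OF V, of P] PS by blast
      then have "c \<in> I U" using US by (auto simp: I_def)
      moreover have "c = \<zero> \<oplus> c" using c(1) by simp
      ultimately have "c \<in> ?K" unfolding mem using z[of "Spec R - U"] by blast
      then show False using P(2) c(2) by blast
    qed
  qed
  then obtain a b where ab: "a \<in> I (Spec R - U)" "b \<in> I U" "a \<oplus> b = \<one>" unfolding mem by metis
  have c: "a \<in> carrier R" "b \<in> carrier R" using ab by (auto simp: I_def)
  have ab0: "a \<otimes> b \<in> P" if P: "primeideal P R" for P
    using ab(1,2) prime_mult_iff[OF P c] P by (auto simp: I_def Spec_def)
  have "\<exists>n::nat. (a \<otimes> b) [^] n \<in> {\<zero>}"
    by (rule power_in_ideal[OF zeroideal m_closed[OF c]]) (rule ab0)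
  then obtain n :: nat where "(a \<otimes> b) [^] n = \<zero>" by blast
  \<comment> \<open>With a positive exponent the powers still lie in every prime that contains
    \<open>a\<close> or \<open>b\<close>, respectively.\<close>
  then have "(a \<otimes> b) [^] Suc n = \<zero>" using c by simp
  then have n: "a [^] Suc n \<otimes> b [^] Suc n = \<zero>" unfolding nat_pow_distrib[OF c] .
  obtain u v where uv: "u \<in> carrier R" "v \<in> carrier R" "u \<otimes> a [^] Suc n \<oplus> v \<otimes> b [^] Suc n = \<one>"
    using comaximal_powers[OF c ab(3)] by blast
  let ?p = "a [^] Suc n" and ?q = "b [^] Suc n"
  have pq: "?p \<in> carrier R" "?q \<in> carrier R" using nat_pow_closed c by blast+
  define e where "e = u \<otimes> ?p"
  have ec: "e \<in> carrier R" using uv pq by (simp add: e_def del: nat_pow_Suc)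
  have "e \<otimes> e = e \<otimes> (u \<otimes> ?p \<oplus> v \<otimes> ?q) \<ominus> u \<otimes> v \<otimes> (?p \<otimes> ?q)"
    unfolding e_def using uv(1,2) pq by algebra
  also have "\<dots> = e" unfolding uv(3) n using ec uv(1,2) by (simp add: minus_eq)
  finally have ee: "e \<otimes> e = e" .
  have "e \<notin> P \<longleftrightarrow> P \<in> U" if PS: "P \<in> Spec R" for P
  proof
    have P: "primeideal P R" using PS by (simp add: Spec_def)
    show "P \<in> U" if "e \<notin> P"
    proof (rule ccontr)
      assume "P \<notin> U"
      then have "a \<in> P" using ab(1) PS by (simp add: I_def)
      then have "?p \<in> P" using prime_mult_iff[OF P, of "a [^] n" a] c by simp
      then have "e \<in> P" using prime_mult_iff[OF P uv(1) pq(1)] by (simp only: e_def simp_thms)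
      then show False using that by blast
    qed
    show "e \<notin> P" if "P \<in> U"
    proof
      assume e: "e \<in> P"
      have "b \<in> P" using ab(2) that by (simp add: I_def)
      then have "?q \<in> P" using prime_mult_iff[OF P, of "b [^] n" b] c by simp
      then have "v \<otimes> ?q \<in> P" using prime_mult_iff[OF P uv(2) pq(2)] by blast
      then have "e \<oplus> v \<otimes> ?q \<in> P" by (rule prime_add[OF P e])
      moreover have "e \<oplus> v \<otimes> ?q = \<one>" using uv(3) by (simp only: e_def)
      ultimately have "\<one> \<in> P" by metis
      then show False using prime_one[OF P] by blast
    qed
  qed
  then show ?thesis using ec ee by blast
qed

text \<open>A product of elements chosen from the members of \<open>F\<close>, each outside
  \<open>P\<close>.\<close>

lemma separating_element:
  assumes F: "finite F" and P: "primeideal P R"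
    and "\<And>Q. Q \<in> F \<Longrightarrow> primeideal Q R \<and> \<not> Q \<subseteq> P"
  shows "\<exists>d\<in>carrier R - P. \<forall>Q\<in>F. d \<in> Q"
  using F assms(3)
proof (induction F rule: finite_induct)
  case empty
  show ?case using prime_one[OF P] by auto
next
  case (insert Q F)
  then obtain d where d: "d \<in> carrier R - P" "\<forall>Q\<in>F. d \<in> Q" by blast
  have Q: "primeideal Q R" "\<not> Q \<subseteq> P" using insert.prems by blast+
  then obtain c where c: "c \<in> Q" "c \<notin> P" by blast
  have cc: "c \<in> carrier R" using prime_carrier[OF Q(1) c(1)] .
  have "c \<otimes> d \<in> Q'" if "Q' \<in> insert Q F" for Q'
    using that d c cc prime_mult_iff[of Q' c d] insert.prems by auto
  moreover have "c \<otimes> d \<in> carrier R - P" using prime_compl_mult[OF P _ d(1)] c cc by blast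
  ultimately show ?case by blast
qed

text \<open>A reduced localization with a uniformizer is a domain. Nonzero \<open>y\<close> and
  \<open>z\<close> are associated to powers of \<open>\<pi>\<close>; if their product vanishes, then
  \<open>\<pi>\<close> vanishes by reducedness, both exponents are 0, and \<open>\<one>\<close>
  would vanish.\<close>

lemma loc_zero_mult_reduced:
  assumes P: "primeideal P R" and u: "uniformizer R P \<pi>" and red: "\<not> nonreduced_point R P"
    and yz: "y \<in> carrier R" "z \<in> carrier R" "loc_zero R P (y \<otimes> z)"
  shows "loc_zero R P y \<or> loc_zero R P z"
proof (rule ccontr)
  assume "\<not> (loc_zero R P y \<or> loc_zero R P z)"
  then have nz: "\<not> loc_zero R P y" "\<not> loc_zero R P z" by blast+
  have pi: "\<pi> \<in> P" "\<pi> \<in> carrier R" using u P prime_carrier by (auto simp: uniformizer_def)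
  obtain i :: nat where i: "loc_dvd R P (\<pi> [^] i) y" "loc_dvd R P y (\<pi> [^] i)"
    using u yz(1) nz unfolding uniformizer_def by blast
  obtain j :: nat where j: "loc_dvd R P (\<pi> [^] j) z" "loc_dvd R P z (\<pi> [^] j)"
    using u yz(2) nz unfolding uniformizer_def by blast
  have "loc_dvd R P (y \<otimes> z) (\<pi> [^] i \<otimes> \<pi> [^] j)" by (rule loc_dvd_mult[OF P]) (use yz pi i j in auto)
  then have ij: "loc_zero R P (\<pi> [^] (i + j))"
    using loc_zero_if_dvd[OF P _ _ yz(3)] yz pi by (simp add: nat_pow_mult)
  then have p0: "loc_zero R P \<pi>"
    using red P pi(2) by (auto simp: nonreduced_point_def Spec_def reduced_localization_iff[OF P])
  have z: "loc_zero R P (\<pi> [^] k)" if "k \<noteq> 0" for k :: nat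
    using loc_zero_if_dvd[OF P _ _ p0] loc_dvd_pow_le[OF P pi(2), of 1 k] pi that by simp
  have "i = 0" using loc_zero_if_dvd[OF P _ yz(1) _ i(1)] z[of i] nz(1) pi by auto
  moreover have "j = 0" using loc_zero_if_dvd[OF P _ yz(2) _ j(1)] z[of j] nz(2) pi by auto
  ultimately have "loc_zero R P \<one>" using ij by simp
  then show False using loc_zero_in_prime[OF P] prime_one[OF P] by blast
qed

end

context cring
begin

text \<open>The primes avoiding \<open>e\<close> are finitely many, and each is cut out by an
  idempotent. Local generators at these points can therefore be glued.\<close>

lemma corner_ring_principal:
  assumes e: "e \<in> carrier R" "e \<otimes> e = e"
    and F: "finite F" "\<And>P. P \<in> Spec R \<Longrightarrow> e \<notin> P \<longleftrightarrow> P \<in> F" "F \<subseteq> Spec R"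
    and lp: "\<And>P. P \<in> F \<Longrightarrow> loc_principal R P"
    and isol: "\<And>P. P \<in> F \<Longrightarrow> \<exists>\<epsilon>\<in>carrier R. \<epsilon> \<otimes> \<epsilon> = \<epsilon> \<and> (\<forall>Q\<in>Spec R. \<epsilon> \<notin> Q \<longleftrightarrow> Q = P)"
  shows "principal_ideal_ring (corner_ring R e)"
  unfolding principal_ideal_ring_def
proof (intro conjI allI impI)
  show "cring (corner_ring R e)" by (rule corner_ring_cring[OF e])
  interpret C: cring "corner_ring R e" by (rule corner_ring_cring[OF e])
  fix J assume J: "ideal J (corner_ring R e)"
  have JR: "ideal J R" by (rule ideal_of_corner_ideal[OF e J])
  interpret JR: ideal J R by (rule JR)
  have JC: "b \<in> carrier R \<and> e \<otimes> b = b" if "b \<in> J" for b using ideal.Icarr[OF J that] by simp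
  have ex: "\<exists>a\<in>J. \<forall>P\<in>G. \<forall>b\<in>J. loc_dvd R P a b" if "finite G" "G \<subseteq> F" for G
    using that
  proof (induction G rule: finite_induct)
    case empty
    show ?case using JR.zero_closed by blast
  next
    case (insert P G)
    then obtain a where a: "a \<in> J" "\<And>Q b. Q \<in> G \<Longrightarrow> b \<in> J \<Longrightarrow> loc_dvd R Q a b" by blast
    have PF: "P \<in> F" using insert.prems by blast
    then have P: "primeideal P R" using F(3) by (auto simp: Spec_def)
    obtain c where c: "c \<in> J" "\<And>b. b \<in> J \<Longrightarrow> loc_dvd R P c b"
      using lp[OF PF] JR unfolding loc_principal_def by blast
    obtain \<epsilon> where eps: "\<epsilon> \<in> carrier R" "\<epsilon> \<otimes> \<epsilon> = \<epsilon>" "\<forall>Q\<in>Spec R. \<epsilon> \<notin> Q \<longleftrightarrow> Q = P"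
      using isol[OF PF] by blast
    have ac: "a \<in> carrier R" "c \<in> carrier R" using a c JC by blast+
    \<comment> \<open>Locally \<open>\<epsilon>\<close> is one at \<open>P\<close> and zero
      elsewhere, so \<open>a'\<close> is the new generator \<open>c\<close> at \<open>P\<close> and
      the old one \<open>a\<close> at the other points.\<close>
    define a' where "a' = \<epsilon> \<otimes> c \<oplus> (\<one> \<ominus> \<epsilon>) \<otimes> a"
    have a'J: "a' \<in> J" unfolding a'_def
      using JR.I_l_closed[OF c(1) eps(1)] JR.I_l_closed[OF a(1), of "\<one> \<ominus> \<epsilon>"] eps(1) JR.a_closed by simp
    have a'c: "a' \<in> carrier R" using a'J JC by blast
    have "loc_dvd R Q a' b" if Q: "Q \<in> insert P G" and b: "b \<in> J" for Q b
    proof (cases "Q = P")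
      case True
      have "\<epsilon> \<otimes> a' = \<epsilon> \<otimes> c \<oplus> (\<epsilon> \<otimes> \<epsilon> \<ominus> \<epsilon>) \<otimes> c \<oplus> (\<epsilon> \<ominus> \<epsilon> \<otimes> \<epsilon>) \<otimes> a"
        unfolding a'_def using eps(1) ac by algebra
      also have "\<dots> = \<epsilon> \<otimes> c" unfolding eps(2) using eps(1) ac by algebra
      finally have "\<epsilon> \<otimes> c = \<epsilon> \<otimes> a'" by simp
      moreover have "\<epsilon> \<notin> P" using eps(3) PF F(3) by blast
      ultimately have "loc_dvd R P a' c" using eps(1) by (intro loc_dvdI[of \<epsilon> _ \<epsilon>])
      then have "loc_dvd R P a' b" using loc_dvd_trans[OF P a'c ac(2) _ _ c(2)[OF b]] JC[OF b] by blast
      then show ?thesis using True by simp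
    next
      case False
      then have QG: "Q \<in> G" using Q by blast
      then have QS: "Q \<in> Spec R" using insert.prems F(3) by blast
      then have Qp: "primeideal Q R" by (simp add: Spec_def)
      have "(\<one> \<ominus> \<epsilon>) \<otimes> a' = (\<one> \<ominus> \<epsilon>) \<otimes> a \<oplus> (\<epsilon> \<ominus> \<epsilon> \<otimes> \<epsilon>) \<otimes> c \<oplus> (\<epsilon> \<otimes> \<epsilon> \<ominus> \<epsilon>) \<otimes> a"
        unfolding a'_def using eps(1) ac by algebra
      also have "\<dots> = (\<one> \<ominus> \<epsilon>) \<otimes> a" unfolding eps(2) using eps(1) ac by algebra
      finally have "(\<one> \<ominus> \<epsilon>) \<otimes> a = (\<one> \<ominus> \<epsilon>) \<otimes> a'" by simp
      moreover have "\<one> \<ominus> \<epsilon> \<in> carrier R - Q" using prime_one_minus[OF Qp] eps(3) QS False by blast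
      ultimately have "loc_dvd R Q a' a" by (intro loc_dvdI[of "\<one> \<ominus> \<epsilon>" _ "\<one> \<ominus> \<epsilon>"]) auto
      then show ?thesis using loc_dvd_trans[OF Qp a'c ac(1) _ _ a(2)[OF QG b]] JC[OF b] by blast
    qed
    then show ?case using a'J by blast
  qed
  obtain a where a: "a \<in> J" "\<And>P b. P \<in> F \<Longrightarrow> b \<in> J \<Longrightarrow> loc_dvd R P a b" using ex[OF F(1)] by blast
  have ac: "a \<in> carrier R" "e \<otimes> a = a" using JC[OF a(1)] by blast+
  have "J = PIdl\<^bsub>corner_ring R e\<^esub> a"
  proof
    show "PIdl\<^bsub>corner_ring R e\<^esub> a \<subseteq> J" by (rule C.cgenideal_minimal[OF J a(1)])
    show "J \<subseteq> PIdl\<^bsub>corner_ring R e\<^esub> a"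
    proof
      fix b assume b: "b \<in> J"
      have bc: "b \<in> carrier R" "e \<otimes> b = b" using JC[OF b] by blast+
      \<comment> \<open>Divisibility of \<open>b\<close> by \<open>a\<close> is tested at all
        primes. Outside of \<open>F\<close> the element \<open>1 - e\<close> avoids the prime and
        annihilates \<open>b\<close>.\<close>
      let ?K = "{u \<in> carrier R. \<exists>z\<in>carrier R. u \<otimes> b = z \<otimes> a}"
      have K: "ideal ?K R"
      proof (rule idealI')
        show "\<zero> \<in> ?K" using bc ac by (auto intro!: bexI[of _ \<zero>])
      next
        fix u v assume "u \<in> ?K" "v \<in> ?K"
        then obtain y z where "u \<in> carrier R" "v \<in> carrier R" "y \<in> carrier R" "z \<in> carrier R"
          "u \<otimes> b = y \<otimes> a" "v \<otimes> b = z \<otimes> a" by blast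
        then have "(u \<oplus> v) \<otimes> b = (y \<oplus> z) \<otimes> a" "u \<oplus> v \<in> carrier R" "y \<oplus> z \<in> carrier R"
          using bc(1) ac(1) by (simp_all add: l_distr)
        then show "u \<oplus> v \<in> ?K" by blast
      next
        fix u c assume "u \<in> ?K" and c: "c \<in> carrier R"
        then obtain y where "u \<in> carrier R" "y \<in> carrier R" "u \<otimes> b = y \<otimes> a" by blast
        then have "(c \<otimes> u) \<otimes> b = (c \<otimes> y) \<otimes> a" "c \<otimes> u \<in> carrier R" "c \<otimes> y \<in> carrier R"
          using bc(1) ac(1) c by (simp_all add: m_assoc)
        then show "c \<otimes> u \<in> ?K" by blast
      qed auto
      have "\<one> \<in> ?K"
      proof (rule ideal_eq_carrier_if_locally[OF K])
        fix P assume P: "primeideal P R"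
        have PS: "P \<in> Spec R" using P by (simp add: Spec_def)
        show "\<not> ?K \<subseteq> P"
        proof (cases "P \<in> F")
          case True
          then show ?thesis using a(2)[OF True b] unfolding loc_dvd_def by blast
        next
          case False
          then have "e \<in> P" using F(2)[OF PS] by blast
          then have "\<one> \<ominus> e \<in> carrier R - P" by (rule prime_one_minus[OF P])
          moreover have "(\<one> \<ominus> e) \<otimes> b = b \<ominus> e \<otimes> b" using e(1) bc(1) by algebra
          then have "(\<one> \<ominus> e) \<otimes> b = \<zero> \<otimes> a" unfolding bc(2) using bc(1) ac(1) by (simp add: minus_eq r_neg)
          ultimately show ?thesis by blast
        qed
      qed
      then obtain z where z: "z \<in> carrier R" "b = z \<otimes> a" using bc by auto
      have "(e \<otimes> z) \<otimes> a = z \<otimes> (e \<otimes> a)" using e(1) z(1) ac(1) by algebra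
      then have "b = (e \<otimes> z) \<otimes> a" using z(2) ac(2) by simp
      then show "b \<in> PIdl\<^bsub>corner_ring R e\<^esub> a"
        using corner_closed[OF e z(1)] unfolding cgenideal_def corner_ring_simps(2) by blast
    qed
  qed
  then show "principalideal J (corner_ring R e)"
    using C.cgenideal_is_principalideal[of a] ac by simp
qed

text \<open>At a strictly larger \<open>Q\<close> the element \<open>x\<close> lies in the smaller
  prime \<open>P\<close>, so it vanishes at \<open>Q\<close>, hence at \<open>P\<close>.\<close>

lemma maximal_at_nonzero:
  assumes unif: "\<forall>P. primeideal P R \<longrightarrow> (\<exists>\<pi>. uniformizer R P \<pi>)"
    and P: "primeideal P R" and x: "x \<in> P" "\<not> loc_zero R P x" and Q: "primeideal Q R" "P \<subseteq> Q"
  shows "Q = P"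
proof (rule ccontr)
  assume "Q \<noteq> P"
  obtain \<pi> where "uniformizer R Q \<pi>" using unif[rule_format, OF Q(1)] by blast
  then have "loc_zero R Q x"
    using loc_zero_if_strict_subset[OF Q(1) P Q(2)] \<open>Q \<noteq> P\<close> x(1) by blast
  then show False using loc_zero_subset[OF Q(2)] x(2) by blast
qed

text \<open>The condition on accumulation points enters only through \<open>key\<close>: a reduced
  point of \<open>T\<close> is not an accumulation point of other points of \<open>V(x)\<close>,
  because it has a generization in the open set where \<open>x\<close> is nonzero.\<close>

lemma splits_at_if_accumulation:
  assumes unif: "\<And>P. primeideal P R \<Longrightarrow> \<exists>\<pi>. uniformizer R P \<pi>"
    and iso: "\<And>P. P \<in> Spec R \<Longrightarrow> nonreduced_point R P \<Longrightarrow> isolated_point (zariski R) P"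
    and acc: "\<And>P Q S. P \<in> Spec R \<Longrightarrow> Q \<in> Spec R \<Longrightarrow> S \<subseteq> Spec R - {P} \<Longrightarrow>
        accumulation_point (zariski R) P S \<Longrightarrow> Q \<subseteq> P \<Longrightarrow> accumulation_point (zariski R) Q S"
    and x: "x \<in> carrier R"
  shows "splits_at R x"
proof -
  define U where "U = {P \<in> Spec R. loc_zero R P x}"
  define T where "T = {P \<in> Spec R. x \<in> P \<and> \<not> loc_zero R P x}"
  have SP: "primeideal P R" if "P \<in> Spec R" for P using that by (simp add: Spec_def)
  have TD: "P \<in> Spec R" "primeideal P R" "x \<in> P" "\<not> loc_zero R P x" if "P \<in> T" for P
    using that SP by (auto simp: T_def)
  have UD: "P \<in> Spec R" "primeideal P R" "x \<in> P" "loc_zero R P x" if "P \<in> U" for P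
    using that SP loc_zero_in_prime[OF SP x] by (auto simp: U_def)
  have maxT: "P' = P" if P: "P \<in> T" and P': "primeideal P' R" "P \<subseteq> P'" for P P'
    by (rule maximal_at_nonzero[OF _ TD(2-4)[OF P] P']) (simp add: unif)
  \<comment> \<open>The localization is a domain here, so the kernel of the localization map is a
    prime below \<open>P\<close>. It avoids \<open>x\<close> because \<open>x\<close> does not
    vanish at \<open>P\<close>.\<close>
  have generic: "\<exists>Q\<in>Spec R. Q \<subseteq> P \<and> x \<notin> Q" if P: "P \<in> T" and red: "\<not> nonreduced_point R P" for P
  proof -
    note Pp = TD(2)[OF P]
    obtain \<pi> where u: "uniformizer R P \<pi>" using unif[OF Pp] by blast
    let ?Q = "{y \<in> carrier R. loc_dvd R P \<zero> y}"
    have Qmem: "y \<in> ?Q \<longleftrightarrow> y \<in> carrier R \<and> loc_zero R P y" for y using loc_zero_iff[of y P] by auto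
    have "primeideal ?Q R"
    proof (rule primeidealI[OF ideal_loc_multiples[OF Pp zero_closed] is_cring])
      have "\<one> \<notin> ?Q" unfolding Qmem using loc_zero_in_prime[OF Pp one_closed] prime_one[OF Pp] by blast
      then show "carrier R \<noteq> ?Q" using one_closed by metis
      show "a \<in> ?Q \<or> b \<in> ?Q" if "a \<in> carrier R" "b \<in> carrier R" "a \<otimes> b \<in> ?Q" for a b
        using loc_zero_mult_reduced[OF Pp u red that(1,2)] that unfolding Qmem by blast
    qed
    moreover have "?Q \<subseteq> P" using loc_zero_in_prime[OF Pp] Qmem by blast
    moreover have "x \<notin> ?Q" using TD(4)[OF P] Qmem by blast
    ultimately show ?thesis unfolding Spec_def by blast
  qed
  have openD: "openin (zariski R) {P \<in> Spec R. x \<notin> P}"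
    by (rule openin_zariski_if_locally) (use x in auto)
  have key: "\<exists>s\<in>S. x \<notin> s"
    if P: "P \<in> T" and red: "\<not> nonreduced_point R P" and S: "S \<subseteq> Spec R - {P}"
      and a: "accumulation_point (zariski R) P S" for P S
  proof -
    obtain Q where Q: "Q \<in> Spec R" "Q \<subseteq> P" "x \<notin> Q" using generic[OF P red] by blast
    have "accumulation_point (zariski R) Q S" by (rule acc[OF TD(1)[OF P] Q(1) S a Q(2)])
    then have "infinite ({P \<in> Spec R. x \<notin> P} \<inter> S)"
      using openD Q unfolding accumulation_point_def by blast
    then have "{P \<in> Spec R. x \<notin> P} \<inter> S \<noteq> {}" by (metis finite.emptyI)
    then show ?thesis by blast
  qed
  have isoD: "\<exists>c\<in>carrier R. c \<notin> P \<and> (\<forall>Q\<in>Spec R. c \<notin> Q \<longrightarrow> Q = P)" if "P \<in> Spec R" "nonreduced_point R P" for P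
    using openin_zariski_basic[OF iso[OF that, unfolded isolated_point_def], of P] by simp
  have finT: "finite T"
  proof (rule ccontr)
    assume inf: "infinite T"
    \<comment> \<open>A compactness argument: elements whose basic open set contains only finitely
      many points of \<open>T\<close> form an ideal. It is proper if \<open>T\<close> is infinite,
      and every neighbourhood of a prime \<open>P\<close> above it contains infinitely many points
      of \<open>T\<close>.\<close>
    let ?I = "{c \<in> carrier R. finite {t \<in> T. c \<notin> t}}"
    have I: "ideal ?I R"
    proof (rule idealI')
      have "{t \<in> T. \<zero> \<notin> t} = {}" using prime_zero[OF TD(2)] by blast
      then have "finite {t \<in> T. \<zero> \<notin> t}" by (metis finite.emptyI)
      then show "\<zero> \<in> ?I" by simp
    next
      fix a b assume ab: "a \<in> ?I" "b \<in> ?I"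
      have "{t \<in> T. a \<oplus> b \<notin> t} \<subseteq> {t \<in> T. a \<notin> t} \<union> {t \<in> T. b \<notin> t}"
        using prime_add[OF TD(2)] by blast
      moreover have "finite ({t \<in> T. a \<notin> t} \<union> {t \<in> T. b \<notin> t})" using ab by simp
      ultimately have "finite {t \<in> T. a \<oplus> b \<notin> t}" using finite_subset by blast
      then show "a \<oplus> b \<in> ?I" using ab by simp
    next
      fix a c assume ac: "a \<in> ?I" "c \<in> carrier R"
      have "{t \<in> T. c \<otimes> a \<notin> t} \<subseteq> {t \<in> T. a \<notin> t}"
        using prime_mult_iff[OF TD(2) ac(2)] ac(1) by blast
      moreover have "finite {t \<in> T. a \<notin> t}" using ac by simp
      ultimately have "finite {t \<in> T. c \<otimes> a \<notin> t}" using finite_subset by blast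
      then show "c \<otimes> a \<in> ?I" using ac by simp
    qed auto
    have "{t \<in> T. \<one> \<notin> t} = T" using prime_one[OF TD(2)] by blast
    then have "\<one> \<notin> ?I" using inf by simp
    then obtain P where P: "primeideal P R" "?I \<subseteq> P"
      using ideal_eq_carrier_if_locally[OF I] by blast
    have infP: "infinite {t \<in> T. c \<notin> t}" if "c \<in> carrier R - P" for c using that P(2) by blast
    have PS: "P \<in> Spec R" using P by (simp add: Spec_def)
    \<comment> \<open>\<open>x\<close> lies in every member of \<open>T\<close>, and so does every
      annihilator of \<open>x\<close>. Since each basic neighbourhood of \<open>P\<close> meets
      \<open>T\<close>, neither \<open>x\<close> nor an annihilator of \<open>x\<close> can be
      outside \<open>P\<close>.\<close>
    have PT: "P \<in> T"
    proof -
      have "{t \<in> T. x \<notin> t} = {}" using TD(3) by blast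
      then have "x \<in> P" using infP[of x] x by (metis Diff_iff finite.emptyI)
      moreover have "\<not> loc_zero R P x"
      proof
        assume "loc_zero R P x"
        then obtain s where s: "s \<in> carrier R - P" "s \<otimes> x = \<zero>" by (auto simp: loc_zero_def)
        have "{t \<in> T. s \<notin> t} = {}" using s TD(4) by (auto simp: loc_zero_def)
        then show False using infP[OF s(1)] by (metis finite.emptyI)
      qed
      ultimately show ?thesis using PS by (simp add: T_def)
    qed
    have infP': "infinite {t \<in> T - {P}. c \<notin> t}" if "c \<in> carrier R - P" for c
    proof
      assume "finite {t \<in> T - {P}. c \<notin> t}"
      moreover have "{t \<in> T. c \<notin> t} \<subseteq> insert P {t \<in> T - {P}. c \<notin> t}" by blast
      ultimately show False using infP[OF that] finite_subset by blast
    qed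
    have red: "\<not> nonreduced_point R P"
    proof
      assume "nonreduced_point R P"
      then obtain c where c: "c \<in> carrier R" "c \<notin> P" "\<forall>Q\<in>Spec R. c \<notin> Q \<longrightarrow> Q = P" using isoD[OF PS] by blast
      have "{t \<in> T - {P}. c \<notin> t} = {}" using c(3) TD(1) by blast
      then show False using infP'[of c] c by (metis Diff_iff finite.emptyI)
    qed
    have "accumulation_point (zariski R) P (T - {P})"
      by (rule accumulation_point_zariskiI[OF PS _ infP']) (use TD(1) in blast)
    then have "\<exists>s\<in>T - {P}. x \<notin> s" by (intro key[OF PT red]) (use TD(1) in blast)
    then show False using TD(3) by blast
  qed
  have openU: "openin (zariski R) U"
  proof (rule openin_zariski_if_locally)
    fix P assume P: "P \<in> U"
    then obtain s where s: "s \<in> carrier R - P" "s \<otimes> x = \<zero>" using UD(4) by (auto simp: loc_zero_def)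
    have "s \<in> Q" if "Q \<in> Spec R - U" for Q
      using that s by (auto simp: U_def loc_zero_def)
    then show "\<exists>c\<in>carrier R. c \<notin> P \<and> (\<forall>Q\<in>Spec R - U. c \<in> Q)" using s(1) by blast
  qed (auto simp: U_def)
  have openU': "openin (zariski R) (Spec R - U)"
  proof (rule openin_zariski_if_locally, rule Diff_subset, rule ccontr)
    fix P assume P: "P \<in> Spec R - U" and "\<not> (\<exists>c\<in>carrier R. c \<notin> P \<and> (\<forall>Q\<in>Spec R - (Spec R - U). c \<in> Q))"
    then have hit: "\<exists>s\<in>U. c \<notin> s" if "c \<in> carrier R" "c \<notin> P" for c using that by blast
    have PS: "P \<in> Spec R" and Pp: "primeideal P R" using P SP by auto
    have "x \<in> P" using hit[OF x] UD(3) by blast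
    then have PT: "P \<in> T" using P by (auto simp: T_def U_def)
    have red: "\<not> nonreduced_point R P"
    proof
      assume "nonreduced_point R P"
      then obtain c where c: "c \<in> carrier R" "c \<notin> P" "\<forall>Q\<in>Spec R. c \<notin> Q \<longrightarrow> Q = P" using isoD[OF PS] by blast
      then have "P \<in> U" using hit[OF c(1,2)] UD(1) by blast
      then show False using P by blast
    qed
    \<comment> \<open>This allows any finite set of points of \<open>U\<close> to be separated from
      \<open>P\<close>, so a point all of whose neighbourhoods meet \<open>U\<close> has infinitely
      many points of \<open>U\<close> in each.\<close>
    have nsub: "\<not> s \<subseteq> P" if s: "s \<in> U" for s
    proof
      assume sub: "s \<subseteq> P"
      have "s \<noteq> P" using s P by blast
      obtain \<pi> where "uniformizer R P \<pi>" using unif[OF Pp] by blast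
      then have "loc_zero R P x"
        using loc_zero_if_strict_subset[OF Pp UD(2)[OF s] sub \<open>s \<noteq> P\<close>] UD(3)[OF s] by blast
      then show False using TD(4)[OF PT] by blast
    qed
    have "infinite {s \<in> U. c \<notin> s}" if c: "c \<in> carrier R - P" for c
    proof
      assume "finite {s \<in> U. c \<notin> s}"
      moreover have "primeideal Q R \<and> \<not> Q \<subseteq> P" if "Q \<in> {s \<in> U. c \<notin> s}" for Q
        using that UD(2) nsub by blast
      ultimately obtain d where d: "d \<in> carrier R - P" "\<forall>Q\<in>{s \<in> U. c \<notin> s}. d \<in> Q"
        using separating_element[OF _ Pp, of "{s \<in> U. c \<notin> s}"] by blast
      have cd: "c \<otimes> d \<in> carrier R - P" by (rule prime_compl_mult[OF Pp c d(1)])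
      then obtain s where s: "s \<in> U" "c \<otimes> d \<notin> s" using hit[of "c \<otimes> d"] by blast
      then show False using prime_mult_iff[OF UD(2)[OF s(1)], of c d] c d by blast
    qed
    then have "accumulation_point (zariski R) P U"
      by (intro accumulation_point_zariskiI[OF PS]) (use UD(1) in blast)+
    then have "\<exists>s\<in>U. x \<notin> s" by (intro key[OF PT red]) (use UD(1) P in blast)
    then show False using UD(3) by blast
  qed

  \<comment> \<open>The idempotents of the three factors\<close>
  define N where "N = {P \<in> T. nonreduced_point R P}"
  have NT: "P \<in> T" if "P \<in> N" for P using that by (simp add: N_def)
  have finN: "finite N" using finT by (simp add: N_def)
  \<comment> \<open>Points of \<open>N\<close> are isolated, and they are closed because they are
    maximal. Arbitrary subsets are treated since \<open>corner_ring_principal\<close> also needs an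
    idempotent for each single point.\<close>
  have clopen: "\<exists>\<epsilon>\<in>carrier R. \<epsilon> \<otimes> \<epsilon> = \<epsilon> \<and> (\<forall>Q\<in>Spec R. \<epsilon> \<notin> Q \<longleftrightarrow> Q \<in> M)" if M: "M \<subseteq> N" for M
  proof (rule idempotent_of_clopen)
    show "openin (zariski R) M"
    proof (rule openin_zariski_if_locally)
      show "M \<subseteq> Spec R" using M NT TD(1) by blast
      fix P assume P: "P \<in> M"
      then have PN: "P \<in> N" using M by blast
      have "P \<in> Spec R" by (rule TD(1)[OF NT[OF PN]])
      moreover have "nonreduced_point R P" using PN by (simp add: N_def)
      ultimately obtain c where "c \<in> carrier R" "c \<notin> P" "\<forall>Q\<in>Spec R. c \<notin> Q \<longrightarrow> Q = P" using isoD by blast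
      then show "\<exists>c\<in>carrier R. c \<notin> P \<and> (\<forall>Q\<in>Spec R - M. c \<in> Q)" using P by blast
    qed
    show "openin (zariski R) (Spec R - M)"
    proof (rule openin_zariski_if_locally)
      fix P assume P: "P \<in> Spec R - M"
      then have Pp: "primeideal P R" using SP by blast
      have "primeideal Q R \<and> \<not> Q \<subseteq> P" if Q: "Q \<in> M" for Q
      proof -
        have QT: "Q \<in> T" using Q M NT by blast
        have "Q \<noteq> P" using Q P by blast
        then show ?thesis using maxT[OF QT Pp] TD(2)[OF QT] by blast
      qed
      then obtain d where "d \<in> carrier R - P" "\<forall>Q\<in>M. d \<in> Q"
        using separating_element[OF finite_subset[OF M finN] Pp] by blast
      then show "\<exists>c\<in>carrier R. c \<notin> P \<and> (\<forall>Q\<in>Spec R - (Spec R - M). c \<in> Q)" by blast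
    qed blast
  qed
  obtain e0 where e0: "e0 \<in> carrier R" "e0 \<otimes> e0 = e0" "\<And>Q. Q \<in> Spec R \<Longrightarrow> e0 \<notin> Q \<longleftrightarrow> Q \<in> U"
    using idempotent_of_clopen[OF openU openU'] by blast
  obtain f where f: "f \<in> carrier R" "f \<otimes> f = f" "\<And>Q. Q \<in> Spec R \<Longrightarrow> f \<notin> Q \<longleftrightarrow> Q \<in> N"
    using clopen[of N] by blast
  define e1 where "e1 = (\<one> \<ominus> e0) \<otimes> (\<one> \<ominus> f)"
  define e2 where "e2 = (\<one> \<ominus> e0) \<otimes> f"
  have ec: "e1 \<in> carrier R" "e2 \<in> carrier R" using e0 f by (simp_all add: e1_def e2_def)
  have i0: "(\<one> \<ominus> e0) \<otimes> (\<one> \<ominus> e0) = \<one> \<ominus> e0" "e0 \<otimes> (\<one> \<ominus> e0) = \<zero>"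
  proof -
    have "(\<one> \<ominus> e0) \<otimes> (\<one> \<ominus> e0) = \<one> \<ominus> e0 \<ominus> e0 \<oplus> e0 \<otimes> e0" "e0 \<otimes> (\<one> \<ominus> e0) = e0 \<ominus> e0 \<otimes> e0"
      using e0(1) by algebra+
    moreover have "\<one> \<ominus> e0 \<ominus> e0 \<oplus> e0 = \<one> \<ominus> e0" "e0 \<ominus> e0 = \<zero>" using e0(1) by algebra+
    ultimately show "(\<one> \<ominus> e0) \<otimes> (\<one> \<ominus> e0) = \<one> \<ominus> e0" "e0 \<otimes> (\<one> \<ominus> e0) = \<zero>" by (simp_all only: e0(2))
  qed
  have i1: "(\<one> \<ominus> f) \<otimes> (\<one> \<ominus> f) = \<one> \<ominus> f" "(\<one> \<ominus> f) \<otimes> f = \<zero>"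
  proof -
    have "(\<one> \<ominus> f) \<otimes> (\<one> \<ominus> f) = \<one> \<ominus> f \<ominus> f \<oplus> f \<otimes> f" "(\<one> \<ominus> f) \<otimes> f = f \<ominus> f \<otimes> f" using f(1) by algebra+
    moreover have "\<one> \<ominus> f \<ominus> f \<oplus> f = \<one> \<ominus> f" "f \<ominus> f = \<zero>" using f(1) by algebra+
    ultimately show "(\<one> \<ominus> f) \<otimes> (\<one> \<ominus> f) = \<one> \<ominus> f" "(\<one> \<ominus> f) \<otimes> f = \<zero>" by (simp_all only: f(2))
  qed
  have c1: "\<one> \<ominus> e0 \<in> carrier R" "\<one> \<ominus> f \<in> carrier R" using e0 f by simp_all
  have sq: "(a \<otimes> b) \<otimes> (a \<otimes> b) = (a \<otimes> a) \<otimes> (b \<otimes> b)" if "a \<in> carrier R" "b \<in> carrier R" for a b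
    using that by algebra
  have ii: "e1 \<otimes> e1 = e1" "e2 \<otimes> e2 = e2"
    unfolding e1_def e2_def sq[OF c1] sq[OF c1(1) f(1)] i0(1) i1(1) f(2) by (rule refl)+
  have orth: "e0 \<otimes> e1 = \<zero>" "e0 \<otimes> e2 = \<zero>" "e1 \<otimes> e2 = \<zero>"
  proof -
    have "e0 \<otimes> e1 = (e0 \<otimes> (\<one> \<ominus> e0)) \<otimes> (\<one> \<ominus> f)" "e0 \<otimes> e2 = (e0 \<otimes> (\<one> \<ominus> e0)) \<otimes> f"
      "e1 \<otimes> e2 = ((\<one> \<ominus> e0) \<otimes> (\<one> \<ominus> e0)) \<otimes> ((\<one> \<ominus> f) \<otimes> f)"
      unfolding e1_def e2_def using e0(1) f(1) by algebra+
    then show "e0 \<otimes> e1 = \<zero>" "e0 \<otimes> e2 = \<zero>" "e1 \<otimes> e2 = \<zero>" unfolding i0(2) i1(2) using c1 f(1) by simp_all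
  qed
  have sum: "e0 \<oplus> (e1 \<oplus> e2) = \<one>" unfolding e1_def e2_def using e0(1) f(1) by algebra
  have mem: "(e1 \<notin> Q \<longleftrightarrow> Q \<notin> U \<and> Q \<notin> N) \<and> (e2 \<notin> Q \<longleftrightarrow> Q \<in> N)" if Q: "Q \<in> Spec R" for Q
  proof -
    note Qp = SP[OF Q]
    have 1: "\<one> \<ominus> g \<notin> Q \<longleftrightarrow> g \<in> Q" if g: "g \<in> carrier R" "(\<one> \<ominus> g) \<otimes> g = \<zero>" for g
      using prime_one_minus[OF Qp, of g] prime_mult_iff[OF Qp, of "\<one> \<ominus> g" g] g prime_zero[OF Qp] by auto
    have "(\<one> \<ominus> e0) \<otimes> e0 = \<zero>" using i0(2) m_comm[OF e0(1) c1(1)] by simp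
    note 2 = 1[OF e0(1) this] 1[OF f(1) i1(2)]
    have "N \<inter> U = {}" using NT TD(4) UD(4) by blast
    then show ?thesis
      using 2 e0(3)[OF Q] f(3)[OF Q] prime_mult_iff[OF Qp c1] prime_mult_iff[OF Qp c1(1) f(1)]
      unfolding e1_def e2_def by blast
  qed
  \<comment> \<open>Elements of \<open>g R\<close> vanish at primes containing \<open>g\<close>,
    because \<open>1 - g\<close> avoids such a prime and annihilates them.\<close>
  have locz: "loc_zero R P y"
    if P: "primeideal P R" and y: "y \<in> carrier R" "g \<otimes> y = y" and g: "g \<in> P" for P g y
  proof -
    have gc: "g \<in> carrier R" by (rule prime_carrier[OF P g])
    have "(\<one> \<ominus> g) \<otimes> y = y \<ominus> g \<otimes> y" using gc y(1) by algebra
    then have "(\<one> \<ominus> g) \<otimes> y = \<zero>" unfolding y(2) using y(1) by (simp add: minus_eq r_neg)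
    then show ?thesis using prime_one_minus[OF P g] by (intro loc_zeroI) auto
  qed
  have e0x: "e0 \<otimes> x = \<zero>"
  proof (rule zero_if_loc_zero)
    fix P assume P: "primeideal P R"
    have PS: "P \<in> Spec R" using P by (simp add: Spec_def)
    show "loc_zero R P (e0 \<otimes> x)"
    proof (cases "P \<in> U")
      case True
      then show ?thesis
        using loc_zero_if_dvd[OF P x _ UD(4)[OF True] loc_dvd_triv(1)[OF P x e0(1)]] e0 x by simp
    next
      case False
      then have "e0 \<in> P" using e0(3)[OF PS] by blast
      moreover have "e0 \<otimes> (e0 \<otimes> x) = e0 \<otimes> x" using e0 x m_assoc[of e0 e0 x] by simp
      ultimately show ?thesis using locz[OF P] e0 x by simp
    qed
  qed (use e0 x in simp)
  \<comment> \<open>At a prime avoiding \<open>e1\<close>, either \<open>x\<close> is a unit, or the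
    prime is a reduced point of \<open>T\<close>, where the localization is a domain and
    \<open>x\<close> is nonzero.\<close>
  have nzd: "non_zero_divisor (corner_ring R e1) (e1 \<otimes> x)"
    unfolding non_zero_divisor_def
  proof (intro conjI ballI impI)
    show "e1 \<otimes> x \<in> carrier (corner_ring R e1)" by (rule corner_closed[OF ec(1) ii(1) x])
    fix y assume "y \<in> carrier (corner_ring R e1)"
      and xy: "e1 \<otimes> x \<otimes>\<^bsub>corner_ring R e1\<^esub> y = \<zero>\<^bsub>corner_ring R e1\<^esub>"
    then have y: "y \<in> carrier R" "e1 \<otimes> y = y" by auto
    have "e1 \<otimes> x \<otimes> y = x \<otimes> (e1 \<otimes> y)" using ec(1) x y(1) by algebra
    then have xy0: "x \<otimes> y = \<zero>" using xy y(2) by simp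
    have "y = \<zero>"
    proof (rule zero_if_loc_zero[OF y(1)])
      fix P assume P: "primeideal P R"
      have PS: "P \<in> Spec R" using P by (simp add: Spec_def)
      show "loc_zero R P y"
      proof (cases "e1 \<in> P")
        case True then show ?thesis using locz[OF P y] by blast
      next
        case False
        then have PN: "P \<notin> U" "P \<notin> N" using mem[OF PS] by blast+
        show ?thesis
        proof (cases "x \<in> P")
          case True
          then have PT: "P \<in> T" using PN PS by (auto simp: T_def U_def)
          then have red: "\<not> nonreduced_point R P" using PN by (auto simp: N_def)
          obtain \<pi> where u: "uniformizer R P \<pi>" using unif[OF P] by blast
          have "loc_zero R P (x \<otimes> y)" unfolding xy0 using prime_one[OF P] by (intro loc_zeroI[of \<one>]) auto
          then show ?thesis using loc_zero_mult_reduced[OF P u red x y(1)] TD(4)[OF PT] by blast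
        next
          case False
          then show ?thesis using x xy0 by (intro loc_zeroI)
        qed
      qed
    qed
    then show "y = \<zero>\<^bsub>corner_ring R e1\<^esub>" by simp
  qed
  \<comment> \<open>The zero locus embeds into the finite set \<open>T\<close> of maximal ideals,
    whose points can be separated by elements of \<open>R\<close>.\<close>
  have discr: "discrete_subset (zariski (corner_ring R e1)) (zero_locus (corner_ring R e1) {e1 \<otimes> x})"
    (is "discrete_subset (zariski ?C) ?V")
  proof -
    have VS: "?V \<subseteq> Spec ?C" by (auto simp: zero_locus_def)
    have top: "topspace (subtopology (zariski ?C) ?V) = ?V" using VS by auto
    let ?P = "\<lambda>Q. {a \<in> carrier R. e1 \<otimes> a \<in> Q}"
    have V: "?P Q \<in> T \<and> Q = ?P Q \<inter> carrier ?C" if Q: "Q \<in> ?V" for Q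
    proof -
      have Qp: "primeideal Q ?C" and xQ: "e1 \<otimes> x \<in> Q" using Q by (auto simp: zero_locus_def Spec_def)
      note * = prime_of_corner_prime[OF ec(1) ii(1) Qp]
      have PS: "?P Q \<in> Spec R" using *(1) by (simp add: Spec_def)
      have "x \<in> ?P Q" using xQ x by simp
      moreover have "?P Q \<notin> U" using mem[OF PS] *(2) by blast
      ultimately show ?thesis using PS *(3) by (auto simp: T_def U_def)
    qed
    have "openin (subtopology (zariski ?C) ?V) {Q}" if Q: "Q \<in> ?V" for Q
    proof -
      let ?F = "T - {?P Q}"
      have PT: "?P Q \<in> T" using V[OF Q] by blast
      have "primeideal s R \<and> \<not> s \<subseteq> ?P Q" if "s \<in> ?F" for s
        using that TD(2) maxT[of s "?P Q"] PT by blast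
      then obtain d where d: "d \<in> carrier R - ?P Q" "\<forall>s\<in>?F. d \<in> s"
        using separating_element[of ?F "?P Q"] finT TD(2)[OF PT] by blast
      let ?W = "Spec ?C - zero_locus ?C {e1 \<otimes> d}"
      have "\<exists>A\<subseteq>carrier ?C. ?W = Spec ?C - zero_locus ?C A"
        using corner_closed[OF ec(1) ii(1), of d] d(1) by (intro exI[of _ "{e1 \<otimes> d}"]) simp
      then have "openin (zariski ?C) ?W" unfolding openin_zariski .
      moreover have "Q' \<in> ?W \<inter> ?V \<longleftrightarrow> Q' = Q" for Q'
      proof
        assume "Q' = Q"
        then show "Q' \<in> ?W \<inter> ?V" using Q VS d(1) by (auto simp: zero_locus_def)
      next
        assume Q': "Q' \<in> ?W \<inter> ?V"
        then have "e1 \<otimes> d \<notin> Q'" by (auto simp: zero_locus_def)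
        then have dQ': "d \<notin> ?P Q'" by simp
        note v = V[OF Q'[THEN IntD2]]
        have eq: "?P Q' = ?P Q"
        proof (rule ccontr)
          assume "?P Q' \<noteq> ?P Q"
          then have "?P Q' \<in> ?F" using v[THEN conjunct1] by simp
          then have "d \<in> ?P Q'" by (rule bspec[OF d(2)])
          then show False using dQ' by contradiction
        qed
        have "Q' = ?P Q' \<inter> carrier ?C" by (rule v[THEN conjunct2])
        also have "\<dots> = ?P Q \<inter> carrier ?C" by (simp only: eq)
        also have "\<dots> = Q" by (rule V[OF Q, THEN conjunct2, symmetric])
        finally show "Q' = Q" .
      qed
      then have "{Q} = ?W \<inter> ?V" by blast
      ultimately show ?thesis unfolding openin_subtopology by blast
    qed
    then have "discrete_topology ?V = subtopology (zariski ?C) ?V"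
      using top by (subst discrete_topology_unique) blast
    then show ?thesis unfolding discrete_subset_def by simp
  qed
  have pir: "principal_ideal_ring (corner_ring R e2)"
  proof (rule corner_ring_principal[OF ec(2) ii(2) finN])
    show "e2 \<notin> P \<longleftrightarrow> P \<in> N" if "P \<in> Spec R" for P using mem[OF that] by blast
    show "N \<subseteq> Spec R" using NT TD(1) by blast
    show "loc_principal R P" if "P \<in> N" for P
      using unif[OF TD(2)[OF NT[OF that]]] loc_principal_if_uniformizer[OF TD(2)[OF NT[OF that]]] by blast
    show "\<exists>\<epsilon>\<in>carrier R. \<epsilon> \<otimes> \<epsilon> = \<epsilon> \<and> (\<forall>Q\<in>Spec R. \<epsilon> \<notin> Q \<longleftrightarrow> Q = P)" if "P \<in> N" for P
      using clopen[of "{P}"] that by simp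
  qed
  show ?thesis
    unfolding splits_at_def
  proof (intro exI conjI)
    show "cring (corner_ring R e0)" "cring (corner_ring R e1)" "cring (corner_ring R e2)"
      using corner_ring_cring e0 ec ii by blast+
    show "(\<lambda>x. (e0 \<otimes> x, e1 \<otimes> x,
      e2 \<otimes> x)) \<in> ring_iso R (RDirProd (corner_ring R e0) (RDirProd (corner_ring R e1) (corner_ring R e2)))"
      by (rule product_iso_corner_rings) (fact e0(1) ec e0(2) ii orth sum)+
    show "(e0 \<otimes> x, e1 \<otimes> x, e2 \<otimes> x) = (\<zero>\<^bsub>corner_ring R e0\<^esub>, e1 \<otimes> x, e2 \<otimes> x)" by (simp add: e0x)
  qed (fact nzd discr pir)+
qed

end

section \<open>Isolated points of closed subsets\<close>

context cring
begin

lemma PIdl_iff: "a \<in> PIdl r \<longleftrightarrow> (\<exists>z\<in>carrier R. a = z \<otimes> r)"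
  by (auto simp: cgenideal_def)

text \<open>Abstracts the projection to a factor, with \<open>E\<close> a lift of its unit. Since
  \<open>E\<close> annihilates the kernel, a prime avoiding \<open>E\<close> contains the kernel and
  corresponds to a prime of \<open>S\<close>.\<close>

lemma prime_image_factor:
  assumes h: "h \<in> ring_hom R S" "h ` carrier R = carrier S" and S: "cring S"
    and E: "E \<in> carrier R" "\<forall>a\<in>carrier R. h a = \<zero>\<^bsub>S\<^esub> \<longrightarrow> E \<otimes> a = \<zero>"
    and Q: "primeideal Q R" "E \<notin> Q"
  shows "primeideal (h ` Q) S" "\<And>a. a \<in> carrier R \<Longrightarrow> h a \<in> h ` Q \<longleftrightarrow> a \<in> Q"
proof -
  interpret S: cring S by (rule S)
  interpret h: ring_hom_cring R S h
    by (rule ring_hom_cring.intro[OF is_cring S ring_hom_cring_axioms.intro[OF h(1)]])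
  have iff: "h a \<in> h ` Q \<longleftrightarrow> a \<in> Q" if a: "a \<in> carrier R" for a
  proof
    assume "h a \<in> h ` Q"
    then obtain q where q: "q \<in> Q" "h a = h q" by blast
    have qc: "q \<in> carrier R" by (rule prime_carrier[OF Q(1) q(1)])
    have "h (a \<ominus> q) = \<zero>\<^bsub>S\<^esub>" using a qc q(2) by (simp add: minus_eq S.r_neg)
    then have "E \<otimes> (a \<ominus> q) \<in> Q" using E(2)[rule_format, of "a \<ominus> q"] a qc prime_zero[OF Q(1)] by simp
    then have "a \<ominus> q \<in> Q" using prime_mult_iff[OF Q(1) E(1)] Q(2) a qc by simp
    then show "a \<in> Q" using prime_add_iff(2)[OF Q(1) a q(1)] by blast
  qed blast
  show "h a \<in> h ` Q \<longleftrightarrow> a \<in> Q" if "a \<in> carrier R" for a by (rule iff[OF that])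
  have rep: "\<exists>a\<in>carrier R. s = h a" if "s \<in> carrier S" for s using that h(2) by blast
  show "primeideal (h ` Q) S"
  proof (rule primeidealI[OF _ S])
    show "ideal (h ` Q) S"
    proof (rule S.idealI')
      show "h ` Q \<subseteq> carrier S" using prime_carrier[OF Q(1)] h(2) by blast
      show "\<zero>\<^bsub>S\<^esub> \<in> h ` Q" using prime_zero[OF Q(1)] h.hom_zero by (metis imageI)
    next
      fix s t assume "s \<in> h ` Q" "t \<in> h ` Q"
      then obtain a b where ab: "a \<in> Q" "b \<in> Q" "s = h a" "t = h b" by blast
      then have "s \<oplus>\<^bsub>S\<^esub> t = h (a \<oplus> b)" using prime_carrier[OF Q(1)] by simp
      then show "s \<oplus>\<^bsub>S\<^esub> t \<in> h ` Q" using prime_add[OF Q(1) ab(1,2)] by blast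
    next
      fix s t assume "s \<in> h ` Q" "t \<in> carrier S"
      then obtain a where a: "a \<in> Q" "s = h a" by blast
      obtain b where b: "b \<in> carrier R" "t = h b" using rep[OF \<open>t \<in> carrier S\<close>] by (rule bexE)
      note ab = a(1) b(1) a(2) b(2)
      then have "t \<otimes>\<^bsub>S\<^esub> s = h (b \<otimes> a)" using prime_carrier[OF Q(1)] by simp
      moreover have "b \<otimes> a \<in> Q" using prime_mult_iff[OF Q(1) ab(2)] ab(1) prime_carrier[OF Q(1)] by blast
      ultimately show "t \<otimes>\<^bsub>S\<^esub> s \<in> h ` Q" by blast
    qed
    have "h \<one> \<notin> h ` Q" using iff[OF one_closed] prime_one[OF Q(1)] by blast
    then show "carrier S \<noteq> h ` Q" using h.hom_closed[OF one_closed] by metis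
    fix s t assume st: "s \<in> carrier S" "t \<in> carrier S" "s \<otimes>\<^bsub>S\<^esub> t \<in> h ` Q"
    obtain a where a: "a \<in> carrier R" "s = h a" using rep[OF st(1)] by (rule bexE)
    obtain b where b: "b \<in> carrier R" "t = h b" using rep[OF st(2)] by (rule bexE)
    note ab = a(1) b(1) a(2) b(2)
    then have "h (a \<otimes> b) \<in> h ` Q" using st(3) by simp
    then have "a \<otimes> b \<in> Q" using iff[of "a \<otimes> b"] ab(1,2) by simp
    then show "s \<in> h ` Q \<or> t \<in> h ` Q" using prime_mult_iff[OF Q(1) ab(1,2)] ab(3,4) by blast
  qed
qed

text \<open>A neighbourhood isolating the image of \<open>P\<close> is pulled back along
  \<open>h\<close>; the factor \<open>E\<close> restricts attention to primes that come from
  \<open>S\<close>.\<close>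

lemma isolated_if_factor_discrete:
  assumes h: "h \<in> ring_hom R S" "h ` carrier R = carrier S" and S: "cring S"
    and E: "E \<in> carrier R" "\<forall>a\<in>carrier R. h a = \<zero>\<^bsub>S\<^esub> \<longrightarrow> E \<otimes> a = \<zero>"
    and disc: "discrete_subset (zariski S) (zero_locus S {h x})"
    and P: "primeideal P R" "E \<notin> P" "x \<in> P"
  shows "\<exists>c\<in>carrier R - P. \<forall>Q. primeideal Q R \<longrightarrow> x \<in> Q \<longrightarrow> c \<notin> Q \<longrightarrow> Q = P"
proof -
  interpret S: cring S by (rule S)
  note fac = prime_image_factor[OF h S E]
  let ?V = "zero_locus S {h x}"
  have V: "h ` Q \<in> ?V" if "primeideal Q R" "E \<notin> Q" "x \<in> Q" for Q
    using fac(1)[OF that(1,2)] that(3) by (simp add: zero_locus_def Spec_def)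
  have "openin (subtopology (zariski S) ?V) {h ` P}"
    using disc V[OF P] unfolding discrete_subset_def by simp
  then obtain W where W: "openin (zariski S) W" "{h ` P} = W \<inter> ?V" unfolding openin_subtopology by blast
  then have "h ` P \<in> W" by blast
  then obtain c' where c': "c' \<in> carrier S" "c' \<notin> h ` P" "\<forall>Q\<in>Spec S. c' \<notin> Q \<longrightarrow> Q \<in> W"
    using S.openin_zariski_basic[OF W(1)] by blast
  then obtain c where c: "c \<in> carrier R" "c' = h c" using h(2) by blast
  have "c \<notin> P" using c'(2) c fac(2)[OF P(1,2)] by blast
  then have cE: "c \<otimes> E \<in> carrier R - P" using prime_compl_mult[OF P(1), of c E] c(1) E(1) P(2) by blast
  have "Q = P" if Q: "primeideal Q R" "x \<in> Q" "c \<otimes> E \<notin> Q" for Q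
  proof -
    have nQ: "c \<notin> Q" "E \<notin> Q" using Q(3) prime_mult_iff[OF Q(1) c(1) E(1)] by blast+
    have "h c \<notin> h ` Q" using fac(2)[OF Q(1) nQ(2) c(1)] nQ(1) by blast
    moreover have "h ` Q \<in> Spec S" using fac(1)[OF Q(1) nQ(2)] by (simp add: Spec_def)
    ultimately have "h ` Q \<in> W" using c'(3) c(2) by blast
    then have "h ` Q \<in> W \<inter> ?V" using V[OF Q(1) nQ(2) Q(2)] by (rule IntI)
    then have "h ` Q \<in> {h ` P}" by (simp only: W(2))
    then have eq: "h ` Q = h ` P" by (rule singletonD)
    have "a \<in> Q \<longleftrightarrow> a \<in> P" if "a \<in> carrier R" for a
      using fac(2)[OF Q(1) nQ(2) that] fac(2)[OF P(1,2) that] by (simp only: eq)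
    then show ?thesis using prime_carrier[OF Q(1)] prime_carrier[OF P(1)] by blast
  qed
  then show ?thesis using cE by blast
qed

text \<open>A generator of the image of \<open>P\<close> lifts to \<open>c\<close> in
  \<open>P\<close> with \<open>E P\<close> inside \<open>c R\<close>. As \<open>x\<close> divides a
  power of \<open>c\<close> at \<open>P\<close>, in a neighbourhood of \<open>P\<close> every prime
  containing \<open>x\<close> contains \<open>c\<close>, hence contains \<open>P\<close>, and equals
  it by maximality.\<close>

lemma isolated_if_factor_principal:
  assumes unif: "\<forall>P. primeideal P R \<longrightarrow> (\<exists>\<pi>. uniformizer R P \<pi>)"
    and h: "h \<in> ring_hom R S" "h ` carrier R = carrier S" and S: "principal_ideal_ring S"
    and E: "E \<in> carrier R" "\<forall>a\<in>carrier R. h a = \<zero>\<^bsub>S\<^esub> \<longrightarrow> E \<otimes> a = \<zero>"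
    and P: "primeideal P R" "E \<notin> P" "x \<in> P" "\<not> loc_zero R P x"
  shows "\<exists>c\<in>carrier R - P. \<forall>Q. primeideal Q R \<longrightarrow> x \<in> Q \<longrightarrow> c \<notin> Q \<longrightarrow> Q = P"
proof -
  have Sc: "cring S" using S by (simp add: principal_ideal_ring_def)
  interpret S: cring S by (rule Sc)
  interpret h: ring_hom_cring R S h
    by (rule ring_hom_cring.intro[OF is_cring Sc ring_hom_cring_axioms.intro[OF h(1)]])
  note fac = prime_image_factor[OF h Sc E P(1,2)]
  have xc: "x \<in> carrier R" by (rule prime_carrier[OF P(1,3)])
  have "principalideal (h ` P) S"
    using S primeideal.axioms(1)[OF fac(1)] by (simp add: principal_ideal_ring_def)
  then obtain i where i: "i \<in> carrier S" "h ` P = Idl\<^bsub>S\<^esub> {i}" by (auto dest!: principalideal.generate)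
  then have Pi: "h ` P = PIdl\<^bsub>S\<^esub> i" using S.cgenideal_eq_genideal by simp
  have "i \<in> h ` P" using i S.genideal_self[of "{i}"] by simp
  then obtain c where c: "c \<in> P" "i = h c" by blast
  have cc: "c \<in> carrier R" by (rule prime_carrier[OF P(1) c(1)])
  have gen: "\<exists>b\<in>carrier R. E \<otimes> a = b \<otimes> c" if a: "a \<in> P" for a
  proof -
    have ac: "a \<in> carrier R" by (rule prime_carrier[OF P(1) a])
    have "h a \<in> PIdl\<^bsub>S\<^esub> i" using a Pi by blast
    then obtain s where s: "s \<in> carrier S" "h a = s \<otimes>\<^bsub>S\<^esub> i" by (auto simp: cgenideal_def)
    have "s \<in> h ` carrier R" using s(1) by (simp only: h(2))
    then obtain b where b: "s = h b" "b \<in> carrier R" by (rule imageE)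
    have b: "b \<in> carrier R" "h a = h b \<otimes>\<^bsub>S\<^esub> h c" using b s(2) c(2) by simp_all
    have "h (a \<ominus> b \<otimes> c) = \<zero>\<^bsub>S\<^esub>" using ac b cc by (simp add: minus_eq S.r_neg)
    then have z: "E \<otimes> (a \<ominus> b \<otimes> c) = \<zero>" using E(2)[rule_format, of "a \<ominus> b \<otimes> c"] ac b(1) cc by simp
    have "E \<otimes> a = E \<otimes> (a \<ominus> b \<otimes> c) \<oplus> (E \<otimes> b) \<otimes> c" using E(1) ac b(1) cc by algebra
    then have "E \<otimes> a = (E \<otimes> b) \<otimes> c" using z E(1) b(1) cc by simp
    then show ?thesis using E(1) b(1) by blast
  qed
  obtain \<pi> where u: "uniformizer R P \<pi>" using unif[rule_format, OF P(1)] by blast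
  have pi: "\<pi> \<in> P" "\<pi> \<in> carrier R" using u P(1) prime_carrier by (auto simp: uniformizer_def)
  obtain k :: nat where k: "loc_dvd R P x (\<pi> [^] k)" using u xc P(4) unfolding uniformizer_def by blast
  have "loc_dvd R P (\<pi> [^] k) (c [^] k)"
    by (rule loc_dvd_pow[OF P(1) pi(2) cc uniformizer_dvd[OF P(1) u c(1)]])
  then have "loc_dvd R P x (c [^] k)" using loc_dvd_trans[OF P(1) xc _ _ k] pi cc by simp
  then obtain s z where s: "s \<in> carrier R - P" "z \<in> carrier R" "s \<otimes> c [^] k = z \<otimes> x"
    by (auto simp: loc_dvd_def)
  have sE: "s \<otimes> E \<in> carrier R - P" using prime_compl_mult[OF P(1) s(1)] E(1) P(2) by blast
  have "Q = P" if Q: "primeideal Q R" "x \<in> Q" "s \<otimes> E \<notin> Q" for Q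
  proof (rule maximal_at_nonzero[OF unif P(1,3,4) Q(1)])
    have nQ: "s \<notin> Q" "E \<notin> Q" using Q(3) prime_mult_iff[OF Q(1), of s E] s(1) E(1) by blast+
    have "z \<otimes> x \<in> Q" using prime_mult_iff[OF Q(1) s(2) xc] Q(2) by blast
    then have "s \<otimes> c [^] k \<in> Q" using s(3) by simp
    then have "c [^] k \<in> Q" using prime_mult_iff[OF Q(1), of s "c [^] k"] s(1) nQ(1) cc by simp
    then have cQ: "c \<in> Q" by (rule prime_pow[OF Q(1) cc])
    show "P \<subseteq> Q"
    proof
      fix a assume a: "a \<in> P"
      then obtain b where b: "b \<in> carrier R" "E \<otimes> a = b \<otimes> c" using gen by blast
      have "E \<otimes> a \<in> Q" unfolding b(2) using prime_mult_iff[OF Q(1) b(1) cc] cQ by blast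
      then show "a \<in> Q" using prime_mult_iff[OF Q(1) E(1) prime_carrier[OF P(1) a]] nQ(2) by blast
    qed
  qed
  then show ?thesis using sE by blast
qed

text \<open>The lift \<open>E0\<close> of the unit of the first factor kills \<open>x\<close>, so it
  lies in \<open>P\<close>. One of the other two lifts then avoids \<open>P\<close> and decides
  which factor applies.\<close>

lemma isolated_if_splits_at:
  assumes unif: "\<forall>P. primeideal P R \<longrightarrow> (\<exists>\<pi>. uniformizer R P \<pi>)" and x: "x \<in> carrier R"
    and split: "splits_at R x"
    and P: "primeideal P R" "x \<in> P" "\<not> loc_zero R P x"
  shows "\<exists>c\<in>carrier R - P. \<forall>Q. primeideal Q R \<longrightarrow> x \<in> Q \<longrightarrow> c \<notin> Q \<longrightarrow> Q = P"
proof -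
  obtain R0 R1 R2 :: "'a ring" and \<phi> x1 x2 where S: "cring R0" "cring R1" "cring R2"
    and iso: "\<phi> \<in> ring_iso R (RDirProd R0 (RDirProd R1 R2))" and \<phi>x: "\<phi> x = (\<zero>\<^bsub>R0\<^esub>, x1, x2)"
    and disc: "discrete_subset (zariski R1) (zero_locus R1 {x1})" and pir: "principal_ideal_ring R2"
    using split unfolding splits_at_def by blast
  interpret R0: cring R0 by (rule S(1))
  interpret R1: cring R1 by (rule S(2))
  interpret R2: cring R2 by (rule S(3))
  let ?D = "RDirProd R0 (RDirProd R1 R2)"
  have cD: "carrier ?D = carrier R0 \<times> (carrier R1 \<times> carrier R2)" by (simp only: RDirProd_carrier)
  have hom: "\<phi> \<in> ring_hom R ?D" and bij: "bij_betw \<phi> (carrier R) (carrier ?D)"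
    using iso by (auto simp: ring_iso_def)
  have inj: "a = b" if "a \<in> carrier R" "b \<in> carrier R" "\<phi> a = \<phi> b" for a b
    by (rule inj_onD[OF bij_betw_imp_inj_on[OF bij] that(3,1,2)])
  have surj: "\<exists>a\<in>carrier R. \<phi> a = (a0, a1, a2)"
    if "a0 \<in> carrier R0" "a1 \<in> carrier R1" "a2 \<in> carrier R2" for a0 a1 a2
  proof -
    have "(a0, a1, a2) \<in> \<phi> ` carrier R" using bij_betw_imp_surj_on[OF bij] that unfolding cD by simp
    then show ?thesis by auto
  qed
  define p0 where "p0 = (\<lambda>a. fst (\<phi> a))"
  define p1 where "p1 = (\<lambda>a. fst (snd (\<phi> a)))"
  define p2 where "p2 = (\<lambda>a. snd (snd (\<phi> a)))"
  have \<phi>: "\<phi> a = (p0 a, p1 a, p2 a)" for a by (simp add: p0_def p1_def p2_def)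
  have pc: "p0 a \<in> carrier R0 \<and> p1 a \<in> carrier R1 \<and> p2 a \<in> carrier R2" if "a \<in> carrier R" for a
    using ring_hom_closed[OF hom that] unfolding cD \<phi> by simp
  have pm: "p0 (a \<otimes> b) = p0 a \<otimes>\<^bsub>R0\<^esub> p0 b \<and> p1 (a \<otimes> b) = p1 a \<otimes>\<^bsub>R1\<^esub> p1 b \<and> p2 (a \<otimes> b) = p2 a \<otimes>\<^bsub>R2\<^esub> p2 b"
    if "a \<in> carrier R" "b \<in> carrier R" for a b
    using ring_hom_mult[OF hom that] unfolding \<phi> RDirProd_ops by simp
  have pa: "p0 (a \<oplus> b) = p0 a \<oplus>\<^bsub>R0\<^esub> p0 b \<and> p1 (a \<oplus> b) = p1 a \<oplus>\<^bsub>R1\<^esub> p1 b \<and> p2 (a \<oplus> b) = p2 a \<oplus>\<^bsub>R2\<^esub> p2 b"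
    if "a \<in> carrier R" "b \<in> carrier R" for a b
    using ring_hom_add[OF hom that] unfolding \<phi> RDirProd_ops by simp
  have p1: "p0 \<one> = \<one>\<^bsub>R0\<^esub> \<and> p1 \<one> = \<one>\<^bsub>R1\<^esub> \<and> p2 \<one> = \<one>\<^bsub>R2\<^esub>"
    using ring_hom_one[OF hom] unfolding \<phi> RDirProd_ops by simp
  have eq0: "a = \<zero>" if a: "a \<in> carrier R" and z: "p0 a = \<zero>\<^bsub>R0\<^esub>" "p1 a = \<zero>\<^bsub>R1\<^esub>" "p2 a = \<zero>\<^bsub>R2\<^esub>" for a
  proof (rule inj[OF a zero_closed])
    have "p0 \<zero> \<oplus>\<^bsub>R0\<^esub> p0 \<zero> = p0 \<zero>" "p1 \<zero> \<oplus>\<^bsub>R1\<^esub> p1 \<zero> = p1 \<zero>" "p2 \<zero> \<oplus>\<^bsub>R2\<^esub> p2 \<zero> = p2 \<zero>"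
      using pa[OF zero_closed zero_closed] by simp_all
    then have "p0 \<zero> = \<zero>\<^bsub>R0\<^esub>" "p1 \<zero> = \<zero>\<^bsub>R1\<^esub>" "p2 \<zero> = \<zero>\<^bsub>R2\<^esub>"
      using pc[OF zero_closed] R0.add.l_cancel_one R1.add.l_cancel_one R2.add.l_cancel_one by simp_all
    then show "\<phi> a = \<phi> \<zero>" unfolding \<phi> using z by simp
  qed
  obtain E0 where E0: "E0 \<in> carrier R" "\<phi> E0 = (\<one>\<^bsub>R0\<^esub>, \<zero>\<^bsub>R1\<^esub>, \<zero>\<^bsub>R2\<^esub>)" using surj by blast
  obtain E1 where E1: "E1 \<in> carrier R" "\<phi> E1 = (\<zero>\<^bsub>R0\<^esub>, \<one>\<^bsub>R1\<^esub>, \<zero>\<^bsub>R2\<^esub>)" using surj by blast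
  obtain E2 where E2: "E2 \<in> carrier R" "\<phi> E2 = (\<zero>\<^bsub>R0\<^esub>, \<zero>\<^bsub>R1\<^esub>, \<one>\<^bsub>R2\<^esub>)" using surj by blast
  have pE: "p0 E0 = \<one>\<^bsub>R0\<^esub>" "p1 E0 = \<zero>\<^bsub>R1\<^esub>" "p2 E0 = \<zero>\<^bsub>R2\<^esub>"
    "p0 E1 = \<zero>\<^bsub>R0\<^esub>" "p1 E1 = \<one>\<^bsub>R1\<^esub>" "p2 E1 = \<zero>\<^bsub>R2\<^esub>"
    "p0 E2 = \<zero>\<^bsub>R0\<^esub>" "p1 E2 = \<zero>\<^bsub>R1\<^esub>" "p2 E2 = \<one>\<^bsub>R2\<^esub>"
    using E0 E1 E2 unfolding \<phi> by auto
  have "\<phi> (E0 \<oplus> (E1 \<oplus> E2)) = \<phi> \<one>"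
    unfolding \<phi> using pa[OF E0(1) a_closed[OF E1(1) E2(1)]] pa[OF E1(1) E2(1)] pE p1 by simp
  then have sum: "E0 \<oplus> (E1 \<oplus> E2) = \<one>" using inj E0 E1 E2 by simp
  have px: "p0 x = \<zero>\<^bsub>R0\<^esub>" "p1 x = x1" "p2 x = x2" using \<phi>x unfolding \<phi> by auto
  have "E0 \<otimes> x = \<zero>"
    by (rule eq0) (use pm[OF E0(1) x] pE px pc[OF x] E0(1) x in simp_all)
  then have "E0 \<in> P" using P(3) E0(1) loc_zeroI by blast
  then have "E1 \<notin> P \<or> E2 \<notin> P"
    using prime_add[OF P(1)] sum prime_one[OF P(1)] by metis
  then show ?thesis
  proof
    assume E1P: "E1 \<notin> P"
    have "p1 \<in> ring_hom R R1" by (rule ring_hom_memI) (use pc pm pa p1 in auto)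
    moreover have "p1 ` carrier R = carrier R1"
    proof
      show "p1 ` carrier R \<subseteq> carrier R1" using pc by blast
      show "carrier R1 \<subseteq> p1 ` carrier R"
      proof
        fix b assume "b \<in> carrier R1"
        then obtain a where "a \<in> carrier R" "\<phi> a = (\<zero>\<^bsub>R0\<^esub>, b, \<zero>\<^bsub>R2\<^esub>)" using surj[of _ b] by blast
        then show "b \<in> p1 ` carrier R" unfolding p1_def by (intro image_eqI[of _ _ a]) simp_all
      qed
    qed
    moreover have "E1 \<otimes> a = \<zero>" if "a \<in> carrier R" "p1 a = \<zero>\<^bsub>R1\<^esub>" for a
      by (rule eq0) (use pm[OF E1(1) that(1)] pE that pc[OF that(1)] E1(1) in simp_all)
    then have "\<forall>a\<in>carrier R. p1 a = \<zero>\<^bsub>R1\<^esub> \<longrightarrow> E1 \<otimes> a = \<zero>" by blast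
    moreover have "discrete_subset (zariski R1) (zero_locus R1 {p1 x})" using disc px(2) by simp
    ultimately show ?thesis
      using isolated_if_factor_discrete[OF _ _ S(2) E1(1) _ _ P(1) E1P P(2), of p1] by blast
  next
    assume E2P: "E2 \<notin> P"
    have "p2 \<in> ring_hom R R2" by (rule ring_hom_memI) (use pc pm pa p1 in auto)
    moreover have "p2 ` carrier R = carrier R2"
    proof
      show "p2 ` carrier R \<subseteq> carrier R2" using pc by blast
      show "carrier R2 \<subseteq> p2 ` carrier R"
      proof
        fix b assume "b \<in> carrier R2"
        then obtain a where "a \<in> carrier R" "\<phi> a = (\<zero>\<^bsub>R0\<^esub>, \<zero>\<^bsub>R1\<^esub>, b)" using surj[of _ _ b] by blast
        then show "b \<in> p2 ` carrier R" unfolding p2_def by (intro image_eqI[of _ _ a]) simp_all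
      qed
    qed
    moreover have "E2 \<otimes> a = \<zero>" if "a \<in> carrier R" "p2 a = \<zero>\<^bsub>R2\<^esub>" for a
      by (rule eq0) (use pm[OF E2(1) that(1)] pE that pc[OF that(1)] E2(1) in simp_all)
    then have "\<forall>a\<in>carrier R. p2 a = \<zero>\<^bsub>R2\<^esub> \<longrightarrow> E2 \<otimes> a = \<zero>" by blast
    ultimately show ?thesis
      using isolated_if_factor_principal[OF unif _ _ pir E2(1) _ P(1) E2P P(2,3), of p2] by blast
  qed
qed

text \<open>The direct factor of \<open>R / r R\<close> at \<open>P\<close>, expressed in
  \<open>R\<close>: \<open>\<epsilon>\<close> represents its unit, and \<open>\<pi>\<close> is
  nilpotent in it with \<open>k\<close>-th power zero. The last clause is the chain property,
  comparing \<open>b\<close> with \<open>\<pi> [^] i\<close>; \<open>u\<close> and \<open>t\<close>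
  record that \<open>r\<close> is locally a multiple of \<open>\<pi> [^] k\<close>.\<close>

lemma local_data:
  assumes unif: "\<forall>P. primeideal P R \<longrightarrow> (\<exists>\<pi>. uniformizer R P \<pi>)" and r: "r \<in> carrier R"
    and P: "primeideal P R" "r \<in> P" "\<not> loc_zero R P r"
    and isol: "\<exists>c\<in>carrier R - P. \<forall>Q. primeideal Q R \<longrightarrow> r \<in> Q \<longrightarrow> c \<notin> Q \<longrightarrow> Q = P"
  shows "\<exists>\<epsilon>\<in>carrier R - P. \<exists>\<pi>\<in>carrier R. \<exists>k::nat. \<exists>u\<in>carrier R - P. \<exists>t\<in>carrier R.
    \<epsilon> \<otimes> \<epsilon> \<ominus> \<epsilon> \<in> PIdl r \<and> \<epsilon> \<otimes> \<pi> [^] k \<in> PIdl r \<and> u \<otimes> r = t \<otimes> \<pi> [^] k \<and>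
    (\<forall>b\<in>carrier R. \<forall>i::nat. (\<exists>b'\<in>carrier R. \<epsilon> \<otimes> b \<ominus> \<epsilon> \<otimes> \<pi> [^] i \<otimes> b' \<in> PIdl r) \<or>
      (\<exists>l<i. \<exists>w\<in>carrier R. \<epsilon> \<otimes> w \<otimes> b \<ominus> \<epsilon> \<otimes> \<pi> [^] l \<in> PIdl r))"
proof -
  interpret I: ideal "PIdl r" R by (rule cgenideal_ideal[OF r])
  obtain c where c0: "c \<in> carrier R - P" "\<forall>Q. primeideal Q R \<longrightarrow> r \<in> Q \<longrightarrow> c \<notin> Q \<longrightarrow> Q = P"
    by (rule bexE[OF isol])
  note c = c0(1)[THEN DiffD1] c0(1)[THEN DiffD2] c0(2)[rule_format]
  \<comment> \<open>The ideal \<open>c R + P\<close>; it contains \<open>\<one>\<close> because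
    \<open>P\<close> is maximal and does not contain \<open>c\<close>.\<close>
  let ?K = "{x \<in> carrier R. \<exists>b\<in>carrier R. \<exists>a\<in>P. x = c \<otimes> b \<oplus> a}"
  note Pc = prime_carrier[OF P(1)]
  have K: "ideal ?K R"
  proof (rule idealI')
    show "\<zero> \<in> ?K" using c(1) prime_zero[OF P(1)] by (auto intro!: bexI[of _ \<zero>])
  next
    fix x y assume "x \<in> ?K" "y \<in> ?K"
    then obtain b a b' a' where *: "b \<in> carrier R" "b' \<in> carrier R" "a \<in> P" "a' \<in> P" "x = c \<otimes> b \<oplus> a"
      "y = c \<otimes> b' \<oplus> a'" by blast
    have "x \<oplus> y = c \<otimes> (b \<oplus> b') \<oplus> (a \<oplus> a')" unfolding *(5,6) using c(1) *(1,2) *(3,4)[THEN Pc] by algebra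
    moreover have "x \<oplus> y \<in> carrier R" unfolding *(5,6) using c(1) *(1,2) *(3,4)[THEN Pc] by simp
    ultimately show "x \<oplus> y \<in> ?K" using prime_add[OF P(1) *(3,4)] *(1,2) by blast
  next
    fix x y assume "x \<in> ?K" and y: "y \<in> carrier R"
    then obtain b a where *: "b \<in> carrier R" "a \<in> P" "x = c \<otimes> b \<oplus> a" by blast
    have "y \<otimes> x = c \<otimes> (y \<otimes> b) \<oplus> (y \<otimes> a)" unfolding *(3) using c(1) y *(1) *(2)[THEN Pc] by algebra
    moreover have "y \<otimes> x \<in> carrier R" unfolding *(3) using c(1) y *(1) *(2)[THEN Pc] by simp
    moreover have "y \<otimes> a \<in> P" using prime_mult_iff[OF P(1) y Pc] *(2) by blast
    ultimately show "y \<otimes> x \<in> ?K" using *(1) y by blast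
  qed auto
  have "\<one> \<in> ?K"
  proof (rule ideal_eq_carrier_if_locally[OF K], rule notI)
    fix Q assume Q: "primeideal Q R" "?K \<subseteq> Q"
    have "a \<in> ?K" if "a \<in> P" for a
    proof -
      have "a = c \<otimes> \<zero> \<oplus> a" using c(1) Pc[OF that] by simp
      then show ?thesis using Pc[OF that] that by blast
    qed
    then have "P \<subseteq> Q" using Q(2) by blast
    then have "Q = P" by (rule maximal_at_nonzero[OF unif P Q(1)])
    moreover have "c = c \<otimes> \<one> \<oplus> \<zero>" using c(1) by simp
    then have "c \<in> ?K" using c(1) prime_zero[OF P(1)] by blast
    ultimately show False using Q(2) c(2) by blast
  qed
  then obtain b a where ba: "b \<in> carrier R" "a \<in> P" "\<one> = c \<otimes> b \<oplus> a" by blast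
  define d where "d = c \<otimes> b"
  have da: "d \<in> carrier R" "a \<in> carrier R" "d \<oplus> a = \<one>" using ba c(1) Pc by (auto simp: d_def)
  \<comment> \<open>On \<open>V(r)\<close> the element \<open>c\<close>, and so \<open>d\<close>,
    vanishes away from \<open>P\<close>, and \<open>a\<close> vanishes at \<open>P\<close>. The
    idempotent is then produced as for clopen sets, now modulo \<open>r\<close>.\<close>
  have "\<exists>n::nat. (d \<otimes> a) [^] n \<in> PIdl r"
  proof (rule power_in_ideal[OF cgenideal_ideal[OF r]])
    fix Q assume Q: "primeideal Q R" "PIdl r \<subseteq> Q"
    have "r \<in> Q" using Q(2) cgenideal_self[OF r] by blast
    then have "c \<in> Q \<or> a \<in> Q" using c(3)[OF Q(1)] ba(2) by blast
    then show "d \<otimes> a \<in> Q" using prime_mult_iff[OF Q(1)] da(1,2) ba(1) c(1) unfolding d_def by blast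
  qed (use da in simp)
  then obtain n :: nat where n0: "(d \<otimes> a) [^] n \<in> PIdl r" by blast
  have "(d \<otimes> a) [^] Suc n \<in> PIdl r"
    unfolding nat_pow_Suc by (rule I.I_r_closed[OF n0]) (use da in simp)
  then have n: "d [^] Suc n \<otimes> a [^] Suc n \<in> PIdl r" unfolding nat_pow_distrib[OF da(1,2)] .
  obtain p q where pq: "p \<in> carrier R" "q \<in> carrier R" "p \<otimes> d [^] Suc n \<oplus> q \<otimes> a [^] Suc n = \<one>"
    using comaximal_powers[OF da] by blast
  let ?x = "d [^] Suc n" and ?y = "a [^] Suc n"
  have xy: "?x \<in> carrier R" "?y \<in> carrier R" using nat_pow_closed da(1,2) by blast+
  define \<epsilon> where "\<epsilon> = p \<otimes> ?x"
  have ec: "\<epsilon> \<in> carrier R" unfolding \<epsilon>_def using pq(1) xy(1) by (rule m_closed)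
  have "\<epsilon> \<otimes> \<epsilon> \<ominus> \<epsilon> = \<epsilon> \<otimes> (p \<otimes> ?x \<oplus> q \<otimes> ?y) \<ominus> \<epsilon> \<ominus> p \<otimes> q \<otimes> (?x \<otimes> ?y)"
    unfolding \<epsilon>_def using pq(1,2) xy by algebra
  also have "\<dots> = \<ominus> (p \<otimes> q) \<otimes> (?x \<otimes> ?y)" unfolding pq(3) using ec pq(1,2) xy by algebra
  finally have idem: "\<epsilon> \<otimes> \<epsilon> \<ominus> \<epsilon> \<in> PIdl r"
    using I.I_l_closed[OF n, of "\<ominus> (p \<otimes> q)"] pq(1,2) by simp
  have eP: "\<epsilon> \<notin> P"
  proof
    assume e: "\<epsilon> \<in> P"
    have "?y \<in> P" unfolding nat_pow_Suc using prime_mult_iff[OF P(1), of "a [^] n" a] da(2) ba(2) by simp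
    then have "q \<otimes> ?y \<in> P" using prime_mult_iff[OF P(1) pq(2) xy(2)] by blast
    then have "\<epsilon> \<oplus> q \<otimes> ?y \<in> P" by (rule prime_add[OF P(1) e])
    moreover have "\<epsilon> \<oplus> q \<otimes> ?y = \<one>" unfolding \<epsilon>_def by (rule pq(3))
    ultimately have "\<one> \<in> P" by metis
    then show False using prime_one[OF P(1)] by blast
  qed
  have only: "Q = P" if Q: "primeideal Q R" "r \<in> Q" "\<epsilon> \<notin> Q" for Q
  proof (rule c(3)[OF Q(1,2)], rule notI)
    assume "c \<in> Q"
    then have "d \<in> Q" unfolding d_def using prime_mult_iff[OF Q(1) c(1) ba(1)] by blast
    then have "?x \<in> Q" unfolding nat_pow_Suc using prime_mult_iff[OF Q(1), of "d [^] n" d] da(1) by simp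
    then have "\<epsilon> \<in> Q" unfolding \<epsilon>_def using prime_mult_iff[OF Q(1) pq(1) xy(1)] by blast
    then show False using Q(3) by blast
  qed
  \<comment> \<open>A prime containing \<open>?L\<close> would contain \<open>r\<close> and
    \<open>1 - \<epsilon>\<close>, hence be \<open>P\<close>, but it would also contain
    \<open>s\<close>. So elements outside \<open>P\<close> are invertible in the factor.\<close>
  have unit: "\<exists>v\<in>carrier R. \<epsilon> \<ominus> s \<otimes> v \<otimes> \<epsilon> \<in> PIdl r" if s: "s \<in> carrier R - P" for s
  proof -
    have sc: "s \<in> carrier R" using s by blast
    let ?L = "{x \<in> carrier R. \<exists>v\<in>carrier R. x \<otimes> \<epsilon> \<ominus> s \<otimes> v \<otimes> \<epsilon> \<in> PIdl r}"
    have Lmem: "x \<in> ?L" if "x \<in> carrier R" "v \<in> carrier R" "x \<otimes> \<epsilon> \<ominus> s \<otimes> v \<otimes> \<epsilon> = w" "w \<in> PIdl r" for x v w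
      using that by blast
    have L: "ideal ?L R"
    proof (rule idealI')
      show "\<zero> \<in> ?L" by (rule Lmem[of \<zero> \<zero> \<zero>]) (use sc ec I.zero_closed in \<open>simp_all add: minus_eq\<close>)
    next
      fix x y assume "x \<in> ?L" "y \<in> ?L"
      then obtain v w where *: "x \<in> carrier R" "y \<in> carrier R" "v \<in> carrier R" "w \<in> carrier R"
        "x \<otimes> \<epsilon> \<ominus> s \<otimes> v \<otimes> \<epsilon> \<in> PIdl r" "y \<otimes> \<epsilon> \<ominus> s \<otimes> w \<otimes> \<epsilon> \<in> PIdl r" by blast
      show "x \<oplus> y \<in> ?L"
      proof (rule Lmem[of _ "v \<oplus> w"])
        show "(x \<oplus> y) \<otimes> \<epsilon> \<ominus> s \<otimes> (v \<oplus> w) \<otimes> \<epsilon> = (x \<otimes> \<epsilon> \<ominus> s \<otimes> v \<otimes> \<epsilon>) \<oplus> (y \<otimes> \<epsilon> \<ominus> s \<otimes> w \<otimes> \<epsilon>)"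
          using *(1-4) sc ec by algebra
        show "(x \<otimes> \<epsilon> \<ominus> s \<otimes> v \<otimes> \<epsilon>) \<oplus> (y \<otimes> \<epsilon> \<ominus> s \<otimes> w \<otimes> \<epsilon>) \<in> PIdl r" by (rule I.a_closed[OF *(5,6)])
      qed (use * in simp_all)
    next
      fix x y assume "x \<in> ?L" and y: "y \<in> carrier R"
      then obtain v where *: "x \<in> carrier R" "v \<in> carrier R" "x \<otimes> \<epsilon> \<ominus> s \<otimes> v \<otimes> \<epsilon> \<in> PIdl r" by blast
      show "y \<otimes> x \<in> ?L"
      proof (rule Lmem[of _ "y \<otimes> v"])
        show "(y \<otimes> x) \<otimes> \<epsilon> \<ominus> s \<otimes> (y \<otimes> v) \<otimes> \<epsilon> = y \<otimes> (x \<otimes> \<epsilon> \<ominus> s \<otimes> v \<otimes> \<epsilon>)"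
          using *(1,2) y sc ec by algebra
        show "y \<otimes> (x \<otimes> \<epsilon> \<ominus> s \<otimes> v \<otimes> \<epsilon>) \<in> PIdl r" by (rule I.I_l_closed[OF *(3) y])
      qed (use * y in simp_all)
    qed auto
    have "\<one> \<in> ?L"
    proof (rule ideal_eq_carrier_if_locally[OF L], rule notI)
      fix Q assume Q: "primeideal Q R" "?L \<subseteq> Q"
      have "r \<in> ?L"
      proof (rule Lmem[of _ \<zero>])
        show "r \<otimes> \<epsilon> \<ominus> s \<otimes> \<zero> \<otimes> \<epsilon> = \<epsilon> \<otimes> r" using r sc ec by algebra
        show "\<epsilon> \<otimes> r \<in> PIdl r" using ec unfolding PIdl_iff by blast
      qed (use r in simp_all)
      moreover have "s \<in> ?L"
      proof (rule Lmem[of _ \<one>])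
        show "s \<otimes> \<epsilon> \<ominus> s \<otimes> \<one> \<otimes> \<epsilon> = \<zero>" using sc ec by algebra
      qed (use sc I.zero_closed in simp_all)
      moreover have "\<one> \<ominus> \<epsilon> \<in> ?L"
      proof (rule Lmem[of _ \<zero>])
        show "(\<one> \<ominus> \<epsilon>) \<otimes> \<epsilon> \<ominus> s \<otimes> \<zero> \<otimes> \<epsilon> = \<ominus> \<one> \<otimes> (\<epsilon> \<otimes> \<epsilon> \<ominus> \<epsilon>)" using sc ec by algebra
        show "\<ominus> \<one> \<otimes> (\<epsilon> \<otimes> \<epsilon> \<ominus> \<epsilon>) \<in> PIdl r" by (rule I.I_l_closed[OF idem]) simp
      qed (use ec in simp_all)
      ultimately have "r \<in> Q" "s \<in> Q" "\<one> \<ominus> \<epsilon> \<in> Q" using Q(2) by blast+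
      then have "Q = P" using only[OF Q(1)] prime_one_minus_iff[OF Q(1) ec] by blast
      then show False using \<open>s \<in> Q\<close> s by blast
    qed
    then show ?thesis using ec by auto
  qed
  obtain \<pi> where uf: "uniformizer R P \<pi>" using unif[rule_format, OF P(1)] by blast
  have pi: "\<pi> \<in> carrier R" using uf P(1) prime_carrier by (auto simp: uniformizer_def)
  obtain k :: nat where k: "loc_dvd R P (\<pi> [^] k) r" "loc_dvd R P r (\<pi> [^] k)"
    using uf r P(3) unfolding uniformizer_def by blast
  \<comment> \<open>Local divisibility at \<open>P\<close> becomes divisibility in the factor,
    because the denominator is invertible there.\<close>
  have loc: "\<exists>z\<in>carrier R. \<epsilon> \<otimes> y \<ominus> \<epsilon> \<otimes> z \<otimes> x \<in> PIdl r"
    if d: "loc_dvd R P x y" and x: "x \<in> carrier R" and y: "y \<in> carrier R" for x y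
  proof -
    obtain s z where s: "s \<in> carrier R - P" "z \<in> carrier R" "s \<otimes> y = z \<otimes> x"
      using d by (auto simp: loc_dvd_def)
    have sc: "s \<in> carrier R" using s by blast
    obtain v where v: "v \<in> carrier R" "\<epsilon> \<ominus> s \<otimes> v \<otimes> \<epsilon> \<in> PIdl r" using unit[OF s(1)] by blast
    have "\<epsilon> \<otimes> y \<ominus> \<epsilon> \<otimes> (v \<otimes> z) \<otimes> x = \<epsilon> \<otimes> y \<ominus> \<epsilon> \<otimes> v \<otimes> (z \<otimes> x)" using ec y v(1) s(2) x by algebra
    also have "\<dots> = y \<otimes> (\<epsilon> \<ominus> s \<otimes> v \<otimes> \<epsilon>)" unfolding s(3)[symmetric] using ec y v(1) sc by algebra
    finally have "\<epsilon> \<otimes> y \<ominus> \<epsilon> \<otimes> (v \<otimes> z) \<otimes> x \<in> PIdl r" using I.I_l_closed[OF v(2) y] by simp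
    then show ?thesis using v(1) s(2) by blast
  qed
  have 2: "\<epsilon> \<otimes> \<pi> [^] k \<in> PIdl r"
  proof -
    have pk: "\<pi> [^] k \<in> carrier R" using pi by simp
    obtain z where z: "z \<in> carrier R" "\<epsilon> \<otimes> \<pi> [^] k \<ominus> \<epsilon> \<otimes> z \<otimes> r \<in> PIdl r" using loc[OF k(2) r pk] by blast
    have "\<epsilon> \<otimes> z \<otimes> r \<in> PIdl r" unfolding PIdl_iff using ec z(1) by blast
    then have "(\<epsilon> \<otimes> \<pi> [^] k \<ominus> \<epsilon> \<otimes> z \<otimes> r) \<oplus> \<epsilon> \<otimes> z \<otimes> r \<in> PIdl r" by (rule I.a_closed[OF z(2)])
    moreover have "(\<epsilon> \<otimes> \<pi> [^] k \<ominus> \<epsilon> \<otimes> z \<otimes> r) \<oplus> \<epsilon> \<otimes> z \<otimes> r = \<epsilon> \<otimes> \<pi> [^] k"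
      using ec pk z(1) r by algebra
    ultimately show ?thesis by simp
  qed
  obtain u t where u: "u \<in> carrier R - P" "t \<in> carrier R" "u \<otimes> r = t \<otimes> \<pi> [^] k"
    using k(1) by (auto simp: loc_dvd_def)
  have 4: "(\<exists>b'\<in>carrier R. \<epsilon> \<otimes> b \<ominus> \<epsilon> \<otimes> \<pi> [^] i \<otimes> b' \<in> PIdl r) \<or>
      (\<exists>l<i. \<exists>w\<in>carrier R. \<epsilon> \<otimes> w \<otimes> b \<ominus> \<epsilon> \<otimes> \<pi> [^] l \<in> PIdl r)" if b: "b \<in> carrier R" for b and i :: nat
  proof -
    have pk: "\<pi> [^] l \<in> carrier R" for l :: nat using pi by simp
    have A: ?thesis if d: "loc_dvd R P (\<pi> [^] i) b"
    proof -
      obtain z where z: "z \<in> carrier R" "\<epsilon> \<otimes> b \<ominus> \<epsilon> \<otimes> z \<otimes> \<pi> [^] i \<in> PIdl r" using loc[OF d pk b] by blast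
      moreover have "\<epsilon> \<otimes> z \<otimes> \<pi> [^] i = \<epsilon> \<otimes> \<pi> [^] i \<otimes> z" using ec pk[of i] z(1) by algebra
      ultimately show ?thesis by auto
    qed
    consider "loc_zero R P b" | l :: nat where "loc_dvd R P (\<pi> [^] l) b" "loc_dvd R P b (\<pi> [^] l)"
      using uf b unfolding uniformizer_def by blast
    then show ?thesis
    proof cases
      case 1 then show ?thesis using A loc_zero_dvd[OF P(1) pk b] by blast
    next
      case 2
      show ?thesis
      proof (cases "i \<le> l")
        case True
        then show ?thesis
          using A loc_dvd_trans[OF P(1) pk pk b loc_dvd_pow_le[OF P(1) pi True] 2(1)] by blast
      next
        case False
        obtain z where z: "z \<in> carrier R" "\<epsilon> \<otimes> \<pi> [^] l \<ominus> \<epsilon> \<otimes> z \<otimes> b \<in> PIdl r"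
          using loc[OF 2(2) b pk] by blast
        have "\<epsilon> \<otimes> z \<otimes> b \<ominus> \<epsilon> \<otimes> \<pi> [^] l = \<ominus> \<one> \<otimes> (\<epsilon> \<otimes> \<pi> [^] l \<ominus> \<epsilon> \<otimes> z \<otimes> b)"
          using ec pk[of l] z(1) b by algebra
        then have "\<epsilon> \<otimes> z \<otimes> b \<ominus> \<epsilon> \<otimes> \<pi> [^] l \<in> PIdl r" using I.I_l_closed[OF z(2), of "\<ominus> \<one>"] by simp
        then show ?thesis using z(1) False by (metis not_le)
      qed
    qed
  qed
  show ?thesis using ec eP pi u idem 2 4
    by (intro bexI[of _ \<epsilon>] bexI[of _ \<pi>] exI[of _ k] bexI[of _ u] bexI[of _ t]) simp_all
qed

end

section \<open>Extension of partial solutions\<close>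

lemma modhom_zero:
  assumes f: "f \<in> modhom R M N" and M: "Module.module R M" and N: "Module.module R N"
  shows "f \<zero>\<^bsub>M\<^esub> = \<zero>\<^bsub>N\<^esub>"
proof -
  interpret M: Module.module R M by (rule M)
  interpret N: Module.module R N by (rule N)
  have "f (\<zero>\<^bsub>R\<^esub> \<odot>\<^bsub>M\<^esub> \<zero>\<^bsub>M\<^esub>) = \<zero>\<^bsub>R\<^esub> \<odot>\<^bsub>N\<^esub> f \<zero>\<^bsub>M\<^esub>"
    by (rule modhomD(3)[OF f]) simp_all
  then show ?thesis using modhomD(1)[OF f M.M.zero_closed] by simp
qed

locale divisibility_problem =
  R: cring R + M: Module.module R M + N: Module.module R N
  for R :: "('a, 'x) ring_scheme" (structure) and M :: "('a, 'm) module" and N :: "('a, 'n) module" +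
  fixes r :: 'a and f :: "'m \<Rightarrow> 'n"
  assumes r: "r \<in> carrier R" and f: "f \<in> modhom R M N" and sd: "seemingly_divisible M N f r"
begin

lemma f_closed: "m \<in> carrier M \<Longrightarrow> f m \<in> carrier N"
  and f_add: "m \<in> carrier M \<Longrightarrow> m' \<in> carrier M \<Longrightarrow> f (m \<oplus>\<^bsub>M\<^esub> m') = f m \<oplus>\<^bsub>N\<^esub> f m'"
  and f_smult: "a \<in> carrier R \<Longrightarrow> m \<in> carrier M \<Longrightarrow> f (a \<odot>\<^bsub>M\<^esub> m) = a \<odot>\<^bsub>N\<^esub> f m"
  by (rule modhomD[OF f]; assumption)+

lemma f_multiple: "m \<in> carrier M \<Longrightarrow> \<exists>n\<in>carrier N. f m = r \<odot>\<^bsub>N\<^esub> n"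
  using sd[unfolded seemingly_divisible_def, THEN conjunct1, THEN subsetD, OF imageI, of m] by auto

lemma f_torsion: "m \<in> carrier M \<Longrightarrow> r \<odot>\<^bsub>M\<^esub> m = \<zero>\<^bsub>M\<^esub> \<Longrightarrow> f m = \<zero>\<^bsub>N\<^esub>"
  using sd[unfolded seemingly_divisible_def, THEN conjunct2, THEN subsetD, OF imageI, of m] by simp

section \<open>The ideal of multipliers\<close>

definition multiplier :: "'a \<Rightarrow> bool"
  where "multiplier c \<longleftrightarrow> c \<in> carrier R \<and> (\<exists>g\<in>modhom R M N. \<forall>m\<in>carrier M. c \<odot>\<^bsub>N\<^esub> f m = r \<odot>\<^bsub>N\<^esub> g m)"

lemma multiplierI:
  "c \<in> carrier R \<Longrightarrow> g \<in> modhom R M N \<Longrightarrow> (\<And>m. m \<in> carrier M \<Longrightarrow> c \<odot>\<^bsub>N\<^esub> f m = r \<odot>\<^bsub>N\<^esub> g m) \<Longrightarrow> multiplier c"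
  by (auto simp: multiplier_def)

lemma multiplier_add:
  assumes "multiplier c" "multiplier d" shows "multiplier (c \<oplus> d)"
proof -
  obtain g where g: "g \<in> modhom R M N" "\<forall>m\<in>carrier M. c \<odot>\<^bsub>N\<^esub> f m = r \<odot>\<^bsub>N\<^esub> g m" and c: "c \<in> carrier R"
    using assms(1) unfolding multiplier_def by blast
  obtain h where h: "h \<in> modhom R M N" "\<forall>m\<in>carrier M. d \<odot>\<^bsub>N\<^esub> f m = r \<odot>\<^bsub>N\<^esub> h m" and d: "d \<in> carrier R"
    using assms(2) unfolding multiplier_def by blast
  note G = modhomD[OF g(1)] and H = modhomD[OF h(1)]
  let ?k = "\<lambda>m. g m \<oplus>\<^bsub>N\<^esub> h m"
  have k: "?k \<in> modhom R M N"
    unfolding modhom_def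
    by (intro CollectI conjI ballI funcsetI) (use G H in \<open>simp_all add: N.M.a_ac N.smult_r_distr\<close>)
  have e: "\<forall>m\<in>carrier M. (c \<oplus> d) \<odot>\<^bsub>N\<^esub> f m = r \<odot>\<^bsub>N\<^esub> ?k m"
    using g(2) h(2) c d r f_closed G(1) H(1) by (simp add: N.smult_l_distr N.smult_r_distr)
  show ?thesis by (rule multiplierI[OF R.a_closed[OF c d] k e[rule_format]])
qed

lemma multiplier_mult:
  assumes "multiplier c" and d: "d \<in> carrier R" shows "multiplier (d \<otimes> c)"
proof -
  obtain g where g: "g \<in> modhom R M N" "\<forall>m\<in>carrier M. c \<odot>\<^bsub>N\<^esub> f m = r \<odot>\<^bsub>N\<^esub> g m" and c: "c \<in> carrier R"
    using assms(1) unfolding multiplier_def by blast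
  note G = modhomD[OF g(1)]
  have comm: "a \<odot>\<^bsub>N\<^esub> (b \<odot>\<^bsub>N\<^esub> n) = b \<odot>\<^bsub>N\<^esub> (a \<odot>\<^bsub>N\<^esub> n)"
    if "a \<in> carrier R" "b \<in> carrier R" "n \<in> carrier N" for a b n
    using that N.smult_assoc1[of a b n] N.smult_assoc1[of b a n] R.m_comm[of a b] by simp
  let ?k = "\<lambda>m. d \<odot>\<^bsub>N\<^esub> g m"
  have k: "?k \<in> modhom R M N"
    unfolding modhom_def
  proof (intro CollectI conjI ballI funcsetI)
    fix x assume x: "x \<in> carrier M"
    show "?k x \<in> carrier N" using G(1)[OF x] d by simp
    show "?k (x \<oplus>\<^bsub>M\<^esub> y) = ?k x \<oplus>\<^bsub>N\<^esub> ?k y" if "y \<in> carrier M" for y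
      using G x that d by (simp add: N.smult_r_distr)
    show "?k (a \<odot>\<^bsub>M\<^esub> x) = a \<odot>\<^bsub>N\<^esub> ?k x" if "a \<in> carrier R" for a
      using G(3)[OF that x] comm[OF d that G(1)[OF x]] by simp
  qed
  have e: "\<forall>m\<in>carrier M. (d \<otimes> c) \<odot>\<^bsub>N\<^esub> f m = r \<odot>\<^bsub>N\<^esub> ?k m"
  proof
    fix m assume m: "m \<in> carrier M"
    show "(d \<otimes> c) \<odot>\<^bsub>N\<^esub> f m = r \<odot>\<^bsub>N\<^esub> ?k m"
      using g(2) m N.smult_assoc1[OF d c f_closed[OF m]] comm[OF d r G(1)[OF m]] by simp
  qed
  show ?thesis by (rule multiplierI[OF R.m_closed[OF d c] k e[rule_format]])
qed

lemma multiplier_zero: "multiplier \<zero>"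
proof -
  have "(\<lambda>m. \<zero>\<^bsub>N\<^esub>) \<in> modhom R M N" by (auto simp: modhom_def)
  then show ?thesis unfolding multiplier_def using f_closed r
    by (intro conjI bexI[of _ "\<lambda>m. \<zero>\<^bsub>N\<^esub>"]) auto
qed

text \<open>Every \<open>f m\<close> is a multiple of \<open>r\<close>, so \<open>u f\<close> is
  zero.\<close>

lemma multiplier_if_annihilates:
  assumes u: "u \<in> carrier R" "u \<otimes> r = \<zero>" shows "multiplier u"
proof -
  have k: "(\<lambda>m. \<zero>\<^bsub>N\<^esub>) \<in> modhom R M N" by (auto simp: modhom_def)
  have e: "u \<odot>\<^bsub>N\<^esub> f m = r \<odot>\<^bsub>N\<^esub> \<zero>\<^bsub>N\<^esub>" if m: "m \<in> carrier M" for m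
  proof -
    obtain n where n: "n \<in> carrier N" "f m = r \<odot>\<^bsub>N\<^esub> n" using f_multiple[OF m] by blast
    have "u \<odot>\<^bsub>N\<^esub> f m = (u \<otimes> r) \<odot>\<^bsub>N\<^esub> n" unfolding n(2) using N.smult_assoc1[OF u(1) r n(1)] by simp
    then show ?thesis unfolding u(2) using n(1) r by simp
  qed
  show ?thesis by (rule multiplierI[OF u(1) k e])
qed

lemma multiplier_self: "multiplier r"
  unfolding multiplier_def by (intro conjI r bexI[OF _ f]) simp

text \<open>A partial solution is the graph of a homomorphism \<open>g\<close> with \<open>r g = p f\<close> defined on a
  submodule of \<open>M\<close> which contains \<open>r M\<close> and is pure modulo \<open>r M\<close>, as far as the first \<open>k\<close> powers
  of \<open>\<pi>\<close> are concerned.\<close>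

definition partial_solution :: "'a \<Rightarrow> 'a \<Rightarrow> nat \<Rightarrow> ('m \<times> 'n) set \<Rightarrow> bool"
  where "partial_solution p \<pi> k G \<longleftrightarrow>
    (\<forall>m n. (m, n) \<in> G \<longrightarrow> m \<in> carrier M \<and> n \<in> carrier N \<and> r \<odot>\<^bsub>N\<^esub> n = p \<odot>\<^bsub>N\<^esub> f m) \<and>
    (\<forall>m n m' n'. (m, n) \<in> G \<longrightarrow> (m', n') \<in> G \<longrightarrow> (m \<oplus>\<^bsub>M\<^esub> m', n \<oplus>\<^bsub>N\<^esub> n') \<in> G) \<and>
    (\<forall>a\<in>carrier R. \<forall>m n. (m, n) \<in> G \<longrightarrow> (a \<odot>\<^bsub>M\<^esub> m, a \<odot>\<^bsub>N\<^esub> n) \<in> G) \<and>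
    (\<forall>m\<in>carrier M. (r \<odot>\<^bsub>M\<^esub> m, p \<odot>\<^bsub>N\<^esub> f m) \<in> G) \<and>
    (\<forall>n. (\<zero>\<^bsub>M\<^esub>, n) \<in> G \<longrightarrow> n = \<zero>\<^bsub>N\<^esub>) \<and>
    (\<forall>j\<le>k. \<forall>m\<in>carrier M. \<forall>n. (\<pi> [^] j \<odot>\<^bsub>M\<^esub> m, n) \<in> G \<longrightarrow>
      (\<exists>d n'. (d, n') \<in> G \<and> (\<exists>m'\<in>carrier M. \<pi> [^] j \<odot>\<^bsub>M\<^esub> m = \<pi> [^] j \<odot>\<^bsub>M\<^esub> d \<oplus>\<^bsub>M\<^esub> r \<odot>\<^bsub>M\<^esub> m')))"

lemma partial_solutionD:
  assumes "partial_solution p \<pi> k G"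
  shows "\<And>m n. (m, n) \<in> G \<Longrightarrow> m \<in> carrier M" "\<And>m n. (m, n) \<in> G \<Longrightarrow> n \<in> carrier N"
    "\<And>m n. (m, n) \<in> G \<Longrightarrow> r \<odot>\<^bsub>N\<^esub> n = p \<odot>\<^bsub>N\<^esub> f m"
    "\<And>m n m' n'. (m, n) \<in> G \<Longrightarrow> (m', n') \<in> G \<Longrightarrow> (m \<oplus>\<^bsub>M\<^esub> m', n \<oplus>\<^bsub>N\<^esub> n') \<in> G"
    "\<And>a m n. a \<in> carrier R \<Longrightarrow> (m, n) \<in> G \<Longrightarrow> (a \<odot>\<^bsub>M\<^esub> m, a \<odot>\<^bsub>N\<^esub> n) \<in> G"
    "\<And>m. m \<in> carrier M \<Longrightarrow> (r \<odot>\<^bsub>M\<^esub> m, p \<odot>\<^bsub>N\<^esub> f m) \<in> G"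
    "\<And>n. (\<zero>\<^bsub>M\<^esub>, n) \<in> G \<Longrightarrow> n = \<zero>\<^bsub>N\<^esub>"
    "\<And>j m n. j \<le> k \<Longrightarrow> m \<in> carrier M \<Longrightarrow> (\<pi> [^] j \<odot>\<^bsub>M\<^esub> m, n) \<in> G \<Longrightarrow>
      \<exists>d n'. (d, n') \<in> G \<and> (\<exists>m'\<in>carrier M. \<pi> [^] j \<odot>\<^bsub>M\<^esub> m = \<pi> [^] j \<odot>\<^bsub>M\<^esub> d \<oplus>\<^bsub>M\<^esub> r \<odot>\<^bsub>M\<^esub> m')"
proof -
  note s = assms[unfolded partial_solution_def]
  show "\<And>m n. (m, n) \<in> G \<Longrightarrow> m \<in> carrier M" "\<And>m n. (m, n) \<in> G \<Longrightarrow> n \<in> carrier N"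
    "\<And>m n. (m, n) \<in> G \<Longrightarrow> r \<odot>\<^bsub>N\<^esub> n = p \<odot>\<^bsub>N\<^esub> f m"
    using s[THEN conjunct1] by simp_all
  note s = s[THEN conjunct2]
  show "\<And>m n m' n'. (m, n) \<in> G \<Longrightarrow> (m', n') \<in> G \<Longrightarrow> (m \<oplus>\<^bsub>M\<^esub> m', n \<oplus>\<^bsub>N\<^esub> n') \<in> G"
    using s[THEN conjunct1] by simp
  note s = s[THEN conjunct2]
  show "\<And>a m n. a \<in> carrier R \<Longrightarrow> (m, n) \<in> G \<Longrightarrow> (a \<odot>\<^bsub>M\<^esub> m, a \<odot>\<^bsub>N\<^esub> n) \<in> G"
    using s[THEN conjunct1] by simp
  note s = s[THEN conjunct2]
  show "\<And>m. m \<in> carrier M \<Longrightarrow> (r \<odot>\<^bsub>M\<^esub> m, p \<odot>\<^bsub>N\<^esub> f m) \<in> G" using s[THEN conjunct1] by simp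
  note s = s[THEN conjunct2]
  show "\<And>n. (\<zero>\<^bsub>M\<^esub>, n) \<in> G \<Longrightarrow> n = \<zero>\<^bsub>N\<^esub>" using s[THEN conjunct1] by simp
  note s = s[THEN conjunct2]
  show "\<And>j m n. j \<le> k \<Longrightarrow> m \<in> carrier M \<Longrightarrow> (\<pi> [^] j \<odot>\<^bsub>M\<^esub> m, n) \<in> G \<Longrightarrow>
      \<exists>d n'. (d, n') \<in> G \<and> (\<exists>m'\<in>carrier M. \<pi> [^] j \<odot>\<^bsub>M\<^esub> m = \<pi> [^] j \<odot>\<^bsub>M\<^esub> d \<oplus>\<^bsub>M\<^esub> r \<odot>\<^bsub>M\<^esub> m')"
    by (rule s[rule_format])
qed

text \<open>On \<open>r M\<close> the solution is forced. It is well defined by the torsion half of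
  seeming divisibility, and purity holds with \<open>d\<close> zero because the whole domain is
  \<open>r M\<close>.\<close>

lemma partial_solution_base:
  assumes p: "p \<in> carrier R" and pi: "\<pi> \<in> carrier R"
  shows "partial_solution p \<pi> k {(r \<odot>\<^bsub>M\<^esub> m, p \<odot>\<^bsub>N\<^esub> f m) | m. m \<in> carrier M}" (is
    "partial_solution p \<pi> k ?G")
proof -
  have comm: "a \<odot>\<^bsub>M\<^esub> (b \<odot>\<^bsub>M\<^esub> n) = b \<odot>\<^bsub>M\<^esub> (a \<odot>\<^bsub>M\<^esub> n)"
    if "a \<in> carrier R" "b \<in> carrier R" "n \<in> carrier M" for a b n
    using that M.smult_assoc1[of a b n] M.smult_assoc1[of b a n] R.m_comm[of a b] by simp
  have commN: "a \<odot>\<^bsub>N\<^esub> (b \<odot>\<^bsub>N\<^esub> n) = b \<odot>\<^bsub>N\<^esub> (a \<odot>\<^bsub>N\<^esub> n)"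
    if "a \<in> carrier R" "b \<in> carrier R" "n \<in> carrier N" for a b n
    using that N.smult_assoc1[of a b n] N.smult_assoc1[of b a n] R.m_comm[of a b] by simp
  have mem: "(m, n) \<in> ?G \<longleftrightarrow> (\<exists>x\<in>carrier M. m = r \<odot>\<^bsub>M\<^esub> x \<and> n = p \<odot>\<^bsub>N\<^esub> f x)" for m n by auto
  have z: "(\<zero>\<^bsub>M\<^esub>, \<zero>\<^bsub>N\<^esub>) \<in> ?G"
    unfolding mem
      using r p modhom_zero[OF f M.module_axioms N.module_axioms] by (intro bexI[of _ "\<zero>\<^bsub>M\<^esub>"]) simp_all
  show ?thesis
    unfolding partial_solution_def
  proof (intro conjI allI ballI impI)
    fix m n assume "(m, n) \<in> ?G"
    then obtain x where x: "x \<in> carrier M" "m = r \<odot>\<^bsub>M\<^esub> x" "n = p \<odot>\<^bsub>N\<^esub> f x" using mem by blast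
    show "m \<in> carrier M" "n \<in> carrier N" using x r p f_closed by simp_all
    show "r \<odot>\<^bsub>N\<^esub> n = p \<odot>\<^bsub>N\<^esub> f m"
      using x r p f_closed f_smult commN by simp
    { fix m' n' assume "(m', n') \<in> ?G"
      then obtain y where y: "y \<in> carrier M" "m' = r \<odot>\<^bsub>M\<^esub> y" "n' = p \<odot>\<^bsub>N\<^esub> f y" using mem by blast
      show "(m \<oplus>\<^bsub>M\<^esub> m', n \<oplus>\<^bsub>N\<^esub> n') \<in> ?G"
        unfolding mem using x y r p f_closed f_add
        by (intro bexI[of _ "x \<oplus>\<^bsub>M\<^esub> y"]) (simp_all add: M.smult_r_distr N.smult_r_distr) }
    fix a assume a: "a \<in> carrier R"
    show "(a \<odot>\<^bsub>M\<^esub> m, a \<odot>\<^bsub>N\<^esub> n) \<in> ?G"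
      unfolding mem using x r p a f_closed f_smult comm[OF a r x(1)] commN[OF a p f_closed[OF x(1)]]
      by (intro bexI[of _ "a \<odot>\<^bsub>M\<^esub> x"]) simp_all
  next
    show "(r \<odot>\<^bsub>M\<^esub> m, p \<odot>\<^bsub>N\<^esub> f m) \<in> ?G" if "m \<in> carrier M" for m using that by blast
  next
    fix n assume "(\<zero>\<^bsub>M\<^esub>, n) \<in> ?G"
    then obtain x where x: "x \<in> carrier M" "\<zero>\<^bsub>M\<^esub> = r \<odot>\<^bsub>M\<^esub> x" "n = p \<odot>\<^bsub>N\<^esub> f x" using mem by blast
    then show "n = \<zero>\<^bsub>N\<^esub>" using f_torsion[OF x(1)] p by simp
  next
    fix j m n assume m: "m \<in> carrier M" and "(\<pi> [^] (j::nat) \<odot>\<^bsub>M\<^esub> m, n) \<in> ?G"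
    then obtain x where x: "x \<in> carrier M" "\<pi> [^] j \<odot>\<^bsub>M\<^esub> m = r \<odot>\<^bsub>M\<^esub> x" using mem by blast
    then have "\<pi> [^] j \<odot>\<^bsub>M\<^esub> m = \<pi> [^] j \<odot>\<^bsub>M\<^esub> \<zero>\<^bsub>M\<^esub> \<oplus>\<^bsub>M\<^esub> r \<odot>\<^bsub>M\<^esub> x" using r pi by simp
    then show "\<exists>d n'. (d, n') \<in> ?G \<and> (\<exists>m'\<in>carrier M. \<pi> [^] j \<odot>\<^bsub>M\<^esub> m = \<pi> [^] j \<odot>\<^bsub>M\<^esub> d \<oplus>\<^bsub>M\<^esub> r \<odot>\<^bsub>M\<^esub> m')"
      using z x(1) by blast
  qed
qed

text \<open>Each condition involves at most two given pairs, which lie in one member of the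
  chain.\<close>

lemma partial_solution_Union:
  assumes ne: "\<C> \<noteq> {}" and ps: "\<And>G. G \<in> \<C> \<Longrightarrow> partial_solution p \<pi> k G"
    and lin: "\<And>G H. G \<in> \<C> \<Longrightarrow> H \<in> \<C> \<Longrightarrow> G \<subseteq> H \<or> H \<subseteq> G"
  shows "partial_solution p \<pi> k (\<Union>\<C>)"
  unfolding partial_solution_def
proof (intro conjI allI ballI impI)
  fix m n assume "(m, n) \<in> \<Union>\<C>"
  then obtain G where G: "G \<in> \<C>" "(m, n) \<in> G" by blast
  note D = partial_solutionD[OF ps[OF G(1)]]
  show "m \<in> carrier M" by (rule D(1)[OF G(2)])
  show "n \<in> carrier N" by (rule D(2)[OF G(2)])
  show "r \<odot>\<^bsub>N\<^esub> n = p \<odot>\<^bsub>N\<^esub> f m" by (rule D(3)[OF G(2)])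
  show "(a \<odot>\<^bsub>M\<^esub> m, a \<odot>\<^bsub>N\<^esub> n) \<in> \<Union>\<C>" if "a \<in> carrier R" for a
    using D(5)[OF that G(2)] G(1) by (rule UnionI[rotated])
  fix m' n' assume "(m', n') \<in> \<Union>\<C>"
  then obtain H where H: "H \<in> \<C>" "(m', n') \<in> H" by blast
  obtain K where K: "K \<in> \<C>" "(m, n) \<in> K" "(m', n') \<in> K" using lin[OF G(1) H(1)] G H by blast
  show "(m \<oplus>\<^bsub>M\<^esub> m', n \<oplus>\<^bsub>N\<^esub> n') \<in> \<Union>\<C>"
    using K(1) partial_solutionD(4)[OF ps[OF K(1)] K(2,3)] by (rule UnionI)
next
  fix m assume m: "m \<in> carrier M"
  obtain G where G: "G \<in> \<C>" using ne by blast
  show "(r \<odot>\<^bsub>M\<^esub> m, p \<odot>\<^bsub>N\<^esub> f m) \<in> \<Union>\<C>" using G partial_solutionD(6)[OF ps[OF G] m] by (rule UnionI)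
next
  fix n assume "(\<zero>\<^bsub>M\<^esub>, n) \<in> \<Union>\<C>"
  then obtain G where G: "G \<in> \<C>" "(\<zero>\<^bsub>M\<^esub>, n) \<in> G" by blast
  show "n = \<zero>\<^bsub>N\<^esub>" by (rule partial_solutionD(7)[OF ps[OF G(1)] G(2)])
next
  fix j m n assume j: "j \<le> k" and m: "m \<in> carrier M" and "(\<pi> [^] j \<odot>\<^bsub>M\<^esub> m, n) \<in> \<Union>\<C>"
  then obtain G where G: "G \<in> \<C>" "(\<pi> [^] j \<odot>\<^bsub>M\<^esub> m, n) \<in> G" by blast
  show "\<exists>d n'. (d, n') \<in> \<Union>\<C> \<and> (\<exists>m'\<in>carrier M. \<pi> [^] j \<odot>\<^bsub>M\<^esub> m = \<pi> [^] j \<odot>\<^bsub>M\<^esub> d \<oplus>\<^bsub>M\<^esub> r \<odot>\<^bsub>M\<^esub> m')"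
    using partial_solutionD(8)[OF ps[OF G(1)] j m G(2)] G(1) by blast
qed

end

context divisibility_problem
begin

text \<open>Multiples of \<open>\<epsilon> y\<close> are adjoined to the domain \<open>D\<close>,
  where \<open>y\<close> is chosen such that \<open>\<pi> [^] j y\<close> lies in \<open>r M\<close>
  while \<open>\<pi> [^] l \<epsilon> y\<close> is outside \<open>D\<close> for all
  \<open>l < j\<close>. In the chain ring cut out by \<open>\<epsilon>\<close> this determines the
  multiples of \<open>\<epsilon> y\<close> in \<open>D\<close>, so the value \<open>n\<close> at
  \<open>y\<close> only has to be compatible with the forced values on \<open>r M\<close>.\<close>

lemma partial_solution_extend:
  assumes c: "\<epsilon> \<in> carrier R" "\<pi> \<in> carrier R" "u \<in> carrier R" "t \<in> carrier R"
    and idem: "\<epsilon> \<otimes> \<epsilon> \<ominus> \<epsilon> \<in> PIdl r" and epk: "\<epsilon> \<otimes> \<pi> [^] (k::nat) \<in> PIdl r" and ut: "u \<otimes> r = t \<otimes> \<pi> [^] k"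
    and tri: "\<And>b i. b \<in> carrier R \<Longrightarrow> (\<exists>b'\<in>carrier R. \<epsilon> \<otimes> b \<ominus> \<epsilon> \<otimes> \<pi> [^] i \<otimes> b' \<in> PIdl r) \<or>
      (\<exists>l<i. \<exists>w\<in>carrier R. \<epsilon> \<otimes> w \<otimes> b \<ominus> \<epsilon> \<otimes> \<pi> [^] (l::nat) \<in> PIdl r)"
    and G: "partial_solution (u \<otimes> u) \<pi> k G" and m0: "m0 \<in> carrier M" "\<nexists>n. (\<epsilon> \<odot>\<^bsub>M\<^esub> m0, n) \<in> G"
  shows "\<exists>G'. partial_solution (u \<otimes> u) \<pi> k G' \<and> G \<subset> G'"
proof -
  interpret I: ideal "PIdl r" R by (rule R.cgenideal_ideal[OF r])
  note G = partial_solutionD[OF G]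
  have pk: "\<pi> [^] i \<in> carrier R" for i :: nat using c(2) by simp
  note sm = M.smult_assoc1[symmetric]
  note smN = N.smult_assoc1[symmetric]
  have canc: "(a \<oplus>\<^bsub>M\<^esub> b) \<oplus>\<^bsub>M\<^esub> \<ominus>\<^bsub>M\<^esub> a = b" "\<ominus>\<^bsub>M\<^esub> a \<oplus>\<^bsub>M\<^esub> (a \<oplus>\<^bsub>M\<^esub> b) = b"
    if "a \<in> carrier M" "b \<in> carrier M" for a b
  proof -
    show "(a \<oplus>\<^bsub>M\<^esub> b) \<oplus>\<^bsub>M\<^esub> \<ominus>\<^bsub>M\<^esub> a = b"
      using that by (simp add: M.M.a_comm[of a b] M.M.a_assoc M.M.r_neg)
    show "\<ominus>\<^bsub>M\<^esub> a \<oplus>\<^bsub>M\<^esub> (a \<oplus>\<^bsub>M\<^esub> b) = b"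
      using that by (simp add: M.M.a_assoc[symmetric] M.M.l_neg)
  qed
  have canc3: "(a \<oplus>\<^bsub>M\<^esub> (b \<oplus>\<^bsub>M\<^esub> e)) \<oplus>\<^bsub>M\<^esub> \<ominus>\<^bsub>M\<^esub> b = a \<oplus>\<^bsub>M\<^esub> e"
    if "a \<in> carrier M" "b \<in> carrier M" "e \<in> carrier M" for a b e
  proof -
    have "a \<oplus>\<^bsub>M\<^esub> (b \<oplus>\<^bsub>M\<^esub> e) = b \<oplus>\<^bsub>M\<^esub> (a \<oplus>\<^bsub>M\<^esub> e)" using that by (rule M.M.a_lcomm)
    then show ?thesis using canc(1)[of b "a \<oplus>\<^bsub>M\<^esub> e"] that by simp
  qed
  define D where "D = (\<lambda>m. \<exists>n. (m, n) \<in> G)"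
  have DI: "D m" if "(m, n) \<in> G" for m n using that unfolding D_def by blast
  have Dc: "m \<in> carrier M" if "D m" for m using that G(1) unfolding D_def by blast
  have Dadd: "D (m \<oplus>\<^bsub>M\<^esub> m')" if "D m" "D m'" for m m' using that G(4) unfolding D_def by blast
  have Dsm: "D (a \<odot>\<^bsub>M\<^esub> m)" if "a \<in> carrier R" "D m" for a m using that G(5) unfolding D_def by blast
  have DrM: "D (r \<odot>\<^bsub>M\<^esub> m)" if "m \<in> carrier M" for m using G(6)[OF that] DI by blast
  have Dmul: "D ((b \<otimes> a) \<odot>\<^bsub>M\<^esub> m)"
    if "D (a \<odot>\<^bsub>M\<^esub> m)" "a \<in> carrier R" "b \<in> carrier R" "m \<in> carrier M" for a b m
    using Dsm[OF that(3,1)] that by (simp add: sm)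
  have Dsub: "D b" if "D (a \<oplus>\<^bsub>M\<^esub> b)" "D a" "b \<in> carrier M" for a b
  proof -
    have "(a \<oplus>\<^bsub>M\<^esub> b) \<oplus>\<^bsub>M\<^esub> (\<ominus> \<one>) \<odot>\<^bsub>M\<^esub> a = (a \<oplus>\<^bsub>M\<^esub> b) \<oplus>\<^bsub>M\<^esub> \<ominus>\<^bsub>M\<^esub> a"
      using Dc[OF that(2)] M.smult_l_minus[of \<one> a] by simp
    also have "\<dots> = b" by (rule canc(1)[OF Dc[OF that(2)] that(3)])
    finally show ?thesis using Dadd[OF that(1) Dsm[OF _ that(2), of "\<ominus> \<one>"]] by simp
  qed
  have pid: "\<exists>z\<in>carrier R. a = b \<oplus> z \<otimes> r" if ab: "a \<ominus> b \<in> PIdl r" "a \<in> carrier R" "b \<in> carrier R" for a b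
  proof -
    obtain z where z: "z \<in> carrier R" "a \<ominus> b = z \<otimes> r" using ab(1)[unfolded R.PIdl_iff] by (rule bexE)
    have "a = b \<oplus> (a \<ominus> b)" using ab(2,3) by algebra
    then show ?thesis using z by auto
  qed
  have Dz: "D ((z \<otimes> r) \<odot>\<^bsub>M\<^esub> m)" if "z \<in> carrier R" "m \<in> carrier M" for z m
    using Dsm[OF that(1) DrM[OF that(2)]] that r by (simp add: sm)
  have Dcong: "D (b \<odot>\<^bsub>M\<^esub> m)"
    if ab: "a \<ominus> b \<in> PIdl r" "a \<in> carrier R" "b \<in> carrier R" "m \<in> carrier M" "D (a \<odot>\<^bsub>M\<^esub> m)" for a b m
  proof -
    obtain z where z: "z \<in> carrier R" "a = b \<oplus> z \<otimes> r" using pid[OF ab(1-3)] by (rule bexE)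
    have "a \<odot>\<^bsub>M\<^esub> m = (z \<otimes> r) \<odot>\<^bsub>M\<^esub> m \<oplus>\<^bsub>M\<^esub> b \<odot>\<^bsub>M\<^esub> m"
      unfolding z(2) using z(1) ab(3,4) r by (simp add: M.smult_l_distr M.M.a_comm)
    then show ?thesis using Dsub[of "(z \<otimes> r) \<odot>\<^bsub>M\<^esub> m" "b \<odot>\<^bsub>M\<^esub> m"] ab(3-5) Dz[OF z(1) ab(4)] by simp
  qed
  have idemI: "a \<otimes> (\<epsilon> \<otimes> \<epsilon> \<ominus> \<epsilon>) \<in> PIdl r" if "a \<in> carrier R" for a by (rule I.I_l_closed[OF idem that])
  have "D ((\<pi> [^] k \<otimes> \<epsilon>) \<odot>\<^bsub>M\<^esub> m)" if m: "m \<in> carrier M" for m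
  proof -
    obtain z where z: "z \<in> carrier R" "\<epsilon> \<otimes> \<pi> [^] k = z \<otimes> r" using epk[unfolded R.PIdl_iff] by (rule bexE)
    have "\<pi> [^] k \<otimes> \<epsilon> = z \<otimes> r" using z(2) R.m_comm[OF c(1) pk] by simp
    then show ?thesis using Dz[OF z(1) m] by simp
  qed
  then have ex: "\<forall>m\<in>carrier M. D ((\<pi> [^] k \<otimes> \<epsilon>) \<odot>\<^bsub>M\<^esub> m)" by blast
  let ?Q = "\<lambda>j::nat. \<forall>m\<in>carrier M. D ((\<pi> [^] j \<otimes> \<epsilon>) \<odot>\<^bsub>M\<^esub> m)"
  \<comment> \<open>The least exponent with \<open>\<pi> [^] j \<epsilon> M\<close> inside
    \<open>D\<close>. Choosing a new element of this maximal order makes the enlarged domain pure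
    again.\<close>
  define j where "j = (LEAST j. ?Q j)"
  have jall: "D ((\<pi> [^] j \<otimes> \<epsilon>) \<odot>\<^bsub>M\<^esub> m)" if "m \<in> carrier M" for m
    using LeastI[of ?Q k, OF ex] that unfolding j_def by blast
  have jk: "j \<le> k" unfolding j_def by (rule Least_le[of ?Q, OF ex])
  have "j \<noteq> 0"
  proof
    assume "j = 0"
    then have "D (\<epsilon> \<odot>\<^bsub>M\<^esub> m0)" using jall[OF m0(1)] c(1) by simp
    then show False using m0(2) unfolding D_def by blast
  qed
  then obtain i where ji: "j = Suc i" by (cases j) auto
  have "\<not> ?Q i" using not_less_Least[of i ?Q] ji unfolding j_def by simp
  then obtain m1 where m1: "m1 \<in> carrier M" "\<not> D ((\<pi> [^] i \<otimes> \<epsilon>) \<odot>\<^bsub>M\<^esub> m1)" by blast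
  have em: "\<epsilon> \<odot>\<^bsub>M\<^esub> m1 \<in> carrier M" using c(1) m1(1) by simp
  have "D (\<pi> [^] j \<odot>\<^bsub>M\<^esub> (\<epsilon> \<odot>\<^bsub>M\<^esub> m1))" using jall[OF m1(1)] c(1) pk m1(1) by (simp add: sm)
  then obtain n1 where "(\<pi> [^] j \<odot>\<^bsub>M\<^esub> (\<epsilon> \<odot>\<^bsub>M\<^esub> m1), n1) \<in> G" unfolding D_def by blast
  \<comment> \<open>Purity of \<open>G\<close>: subtracting \<open>d\<close> from
    \<open>\<epsilon> m1\<close> moves its multiple by \<open>\<pi> [^] j\<close> from
    \<open>D\<close> into \<open>r M\<close>.\<close>
  then obtain d nd x where d: "(d, nd) \<in> G" and x: "x \<in> carrier M"
    and dx: "\<pi> [^] j \<odot>\<^bsub>M\<^esub> (\<epsilon> \<odot>\<^bsub>M\<^esub> m1) = \<pi> [^] j \<odot>\<^bsub>M\<^esub> d \<oplus>\<^bsub>M\<^esub> r \<odot>\<^bsub>M\<^esub> x"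
    using G(8)[OF jk em] by blast
  have dc: "d \<in> carrier M" by (rule G(1)[OF d])
  define y where "y = (\<ominus> \<one>) \<odot>\<^bsub>M\<^esub> d \<oplus>\<^bsub>M\<^esub> \<epsilon> \<odot>\<^bsub>M\<^esub> m1"
  have y: "y \<in> carrier M" using dc em by (simp add: y_def)
  have ay: "a \<odot>\<^bsub>M\<^esub> y = (\<ominus> a) \<odot>\<^bsub>M\<^esub> d \<oplus>\<^bsub>M\<^esub> a \<odot>\<^bsub>M\<^esub> (\<epsilon> \<odot>\<^bsub>M\<^esub> m1)" if a: "a \<in> carrier R" for a
  proof -
    have "a \<otimes> (\<ominus> \<one>) = \<ominus> a" using a by (simp add: R.r_minus)
    then show ?thesis unfolding y_def using a dc em by (simp add: M.smult_r_distr sm)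
  qed
  have pjy: "\<pi> [^] j \<odot>\<^bsub>M\<^esub> y = r \<odot>\<^bsub>M\<^esub> x"
    unfolding ay[OF pk] dx
      using canc(2)[of "\<pi> [^] j \<odot>\<^bsub>M\<^esub> d" "r \<odot>\<^bsub>M\<^esub> x"] pk dc x r by (simp add: M.smult_l_minus)
  have ny: "\<not> D ((\<pi> [^] i \<otimes> \<epsilon>) \<odot>\<^bsub>M\<^esub> y)"
  proof
    let ?a = "\<pi> [^] i \<otimes> \<epsilon>"
    have ac: "?a \<in> carrier R" using pk c(1) by simp
    assume "D (?a \<odot>\<^bsub>M\<^esub> y)"
    then have "D ((\<ominus> ?a) \<odot>\<^bsub>M\<^esub> d \<oplus>\<^bsub>M\<^esub> ?a \<odot>\<^bsub>M\<^esub> (\<epsilon> \<odot>\<^bsub>M\<^esub> m1))" unfolding ay[OF ac] .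
    then have "D (?a \<odot>\<^bsub>M\<^esub> (\<epsilon> \<odot>\<^bsub>M\<^esub> m1))" using Dsub Dsm[OF _ DI[OF d], of "\<ominus> ?a"] ac em by simp
    then have "D ((?a \<otimes> \<epsilon>) \<odot>\<^bsub>M\<^esub> m1)" using ac c(1) m1(1) by (simp add: sm)
    moreover have "?a \<otimes> \<epsilon> \<ominus> ?a = \<pi> [^] i \<otimes> (\<epsilon> \<otimes> \<epsilon> \<ominus> \<epsilon>)" using pk[of i] c(1) by algebra
    then have "?a \<otimes> \<epsilon> \<ominus> ?a \<in> PIdl r" using idemI[OF pk] by simp
    ultimately have "D (?a \<odot>\<^bsub>M\<^esub> m1)" using Dcong[of "?a \<otimes> \<epsilon>" ?a m1] ac c(1) m1(1) by simp
    then show False using m1(2) by blast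
  qed
  \<comment> \<open>Together with \<open>pjy\<close>, this says that \<open>\<epsilon> y\<close> has
    order exactly \<open>j\<close> modulo \<open>D\<close>.\<close>
  have nil: False if l: "l \<le> i" and Dl: "D ((\<pi> [^] l \<otimes> \<epsilon>) \<odot>\<^bsub>M\<^esub> y)" for l
  proof -
    have "D ((\<pi> [^] (i - l) \<otimes> (\<pi> [^] l \<otimes> \<epsilon>)) \<odot>\<^bsub>M\<^esub> y)" using Dmul[OF Dl _ pk y] pk c(1) by simp
    moreover have "\<pi> [^] (i - l) \<otimes> (\<pi> [^] l \<otimes> \<epsilon>) = \<pi> [^] i \<otimes> \<epsilon>"
      using l c(1,2) pk R.m_assoc[of "\<pi> [^] (i - l)" "\<pi> [^] l" \<epsilon>, symmetric] by (simp add: R.nat_pow_mult)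
    ultimately show False using ny by simp
  qed
  obtain n' where n': "n' \<in> carrier N" "f x = r \<odot>\<^bsub>N\<^esub> n'" using f_multiple[OF x] by blast
  \<comment> \<open>\<open>q\<close> stands for \<open>u r / \<pi> [^] j\<close>; it exists because
    \<open>j\<close> is at most \<open>k\<close> and \<open>u r = t \<pi> [^] k\<close>.\<close>
  define q where "q = t \<otimes> \<pi> [^] (k - j)"
  have qc: "q \<in> carrier R" using c(4) pk by (simp add: q_def)
  have uq: "u \<otimes> r = q \<otimes> \<pi> [^] j"
    unfolding ut q_def using R.m_assoc[OF c(4) pk pk] jk c(2) by (simp add: R.nat_pow_mult)
  \<comment> \<open>As \<open>\<pi> [^] j y = r x\<close> and \<open>f x = r n'\<close>, a value at
    \<open>y\<close> for \<open>u f\<close> would be \<open>q n'\<close>; the other \<open>u\<close>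
    matches the factor \<open>u \<otimes> u\<close> of the partial solution.\<close>
  define n where "n = (u \<otimes> q) \<odot>\<^bsub>N\<^esub> n'"
  have n: "n \<in> carrier N" using c(3) qc n'(1) by (simp add: n_def)
  have E1: "\<pi> [^] j \<odot>\<^bsub>N\<^esub> n = (u \<otimes> u) \<odot>\<^bsub>N\<^esub> f x"
  proof -
    have "\<pi> [^] j \<otimes> (u \<otimes> q) = u \<otimes> (q \<otimes> \<pi> [^] j)" using pk[of j] c(3) qc by algebra
    also have "\<dots> = (u \<otimes> u) \<otimes> r" unfolding uq[symmetric] using c(3) r by algebra
    finally have "\<pi> [^] j \<otimes> (u \<otimes> q) = (u \<otimes> u) \<otimes> r" .
    then show ?thesis unfolding n_def n'(2) using pk c(3) qc n'(1) r smN by simp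
  qed
  \<comment> \<open>The element \<open>w = u u y - u q x\<close> is killed by \<open>r\<close>, so
    \<open>f w\<close> is zero by the torsion condition; this relates \<open>f y\<close> to
    \<open>f x\<close>.\<close>
  have E2: "r \<odot>\<^bsub>N\<^esub> n = (u \<otimes> u) \<odot>\<^bsub>N\<^esub> f y"
  proof -
    have uc: "u \<otimes> q \<in> carrier R" "u \<otimes> u \<in> carrier R" using c(3) qc by simp_all
    define w where "w = (u \<otimes> u) \<odot>\<^bsub>M\<^esub> y \<oplus>\<^bsub>M\<^esub> (\<ominus> (u \<otimes> q)) \<odot>\<^bsub>M\<^esub> x"
    have w: "w \<in> carrier M" using uc x y by (simp add: w_def)
    have "r \<otimes> (u \<otimes> u) = u \<otimes> (u \<otimes> r)" using c(3) r by algebra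
    also have "\<dots> = (u \<otimes> q) \<otimes> \<pi> [^] j" unfolding uq using c(3) qc pk[of j] by algebra
    finally have 1: "(r \<otimes> (u \<otimes> u)) \<odot>\<^bsub>M\<^esub> y = (u \<otimes> q) \<odot>\<^bsub>M\<^esub> (r \<odot>\<^bsub>M\<^esub> x)"
      using M.smult_assoc1[OF uc(1) pk y, of j] pjy by simp
    have 2: "r \<otimes> (\<ominus> (u \<otimes> q)) = \<ominus> ((u \<otimes> q) \<otimes> r)" using r c(3) qc by algebra
    have "r \<odot>\<^bsub>M\<^esub> w = (r \<otimes> (u \<otimes> u)) \<odot>\<^bsub>M\<^esub> y \<oplus>\<^bsub>M\<^esub> (r \<otimes> (\<ominus> (u \<otimes> q))) \<odot>\<^bsub>M\<^esub> x"
      unfolding w_def using r uc x y by (simp add: M.smult_r_distr sm del: R.r_minus R.l_minus)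
    also have "\<dots> = \<zero>\<^bsub>M\<^esub>"
      unfolding 1 2 using r uc x y by (simp add: M.smult_l_minus sm M.M.r_neg)
    finally have "f w = \<zero>\<^bsub>N\<^esub>" by (rule f_torsion[OF w])
    then have "(u \<otimes> u) \<odot>\<^bsub>N\<^esub> f y \<oplus>\<^bsub>N\<^esub> (\<ominus> (u \<otimes> q)) \<odot>\<^bsub>N\<^esub> f x = \<zero>\<^bsub>N\<^esub>"
      unfolding w_def using uc x y by (simp add: f_add f_smult)
    then have "(u \<otimes> u) \<odot>\<^bsub>N\<^esub> f y \<oplus>\<^bsub>N\<^esub> \<ominus>\<^bsub>N\<^esub> ((u \<otimes> q) \<odot>\<^bsub>N\<^esub> f x) = \<zero>\<^bsub>N\<^esub>"
      using uc f_closed[OF x] by (simp add: N.smult_l_minus)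
    then have "(u \<otimes> u) \<odot>\<^bsub>N\<^esub> f y = (u \<otimes> q) \<odot>\<^bsub>N\<^esub> f x"
      using uc f_closed[OF x] f_closed[OF y]
        N.M.minus_equality[of "(u \<otimes> u) \<odot>\<^bsub>N\<^esub> f y" "\<ominus>\<^bsub>N\<^esub> ((u \<otimes> q) \<odot>\<^bsub>N\<^esub> f x)"] by simp
    also have "\<dots> = ((u \<otimes> q) \<otimes> r) \<odot>\<^bsub>N\<^esub> n'" unfolding n'(2) using uc r n'(1) by (simp add: smN)
    also have "(u \<otimes> q) \<otimes> r = r \<otimes> (u \<otimes> q)" using uc(1) r by (rule R.m_comm)
    also have "(r \<otimes> (u \<otimes> q)) \<odot>\<^bsub>N\<^esub> n' = r \<odot>\<^bsub>N\<^esub> n" unfolding n_def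
      using uc(1) r n'(1) by (simp add: N.smult_assoc1)
    finally show ?thesis by simp
  qed
  have Gr: "((a \<otimes> r) \<odot>\<^bsub>M\<^esub> y, (a \<otimes> r) \<odot>\<^bsub>N\<^esub> n) \<in> G" if a: "a \<in> carrier R" for a
  proof -
    have "(r \<odot>\<^bsub>M\<^esub> y, r \<odot>\<^bsub>N\<^esub> n) \<in> G" unfolding E2 by (rule G(6)[OF y])
    from G(5)[OF a this] show ?thesis using a r y n by (simp add: sm smN)
  qed
  have Gj: "((a \<otimes> \<pi> [^] j) \<odot>\<^bsub>M\<^esub> y, (a \<otimes> \<pi> [^] j) \<odot>\<^bsub>N\<^esub> n) \<in> G" if a: "a \<in> carrier R" for a
  proof -
    have "(\<pi> [^] j \<odot>\<^bsub>M\<^esub> y, \<pi> [^] j \<odot>\<^bsub>N\<^esub> n) \<in> G" unfolding E1 pjy by (rule G(6)[OF x])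
    from G(5)[OF a this] show ?thesis using a pk y n by (simp add: sm smN)
  qed
  \<comment> \<open>A multiple of \<open>\<epsilon> y\<close> in \<open>D\<close> already carries
    the intended value. Its coefficient is a multiple of \<open>\<pi> [^] j\<close> modulo
    \<open>r\<close>, where \<open>Gj\<close> and \<open>Gr\<close> apply; otherwise it would divide
    a lower power of \<open>\<pi>\<close> in the factor, contrary to \<open>nil\<close>.\<close>
  have K: "((b \<otimes> \<epsilon>) \<odot>\<^bsub>M\<^esub> y, (b \<otimes> \<epsilon>) \<odot>\<^bsub>N\<^esub> n) \<in> G" if b: "b \<in> carrier R" and Db: "D ((b \<otimes> \<epsilon>) \<odot>\<^bsub>M\<^esub> y)" for b
    using tri[OF b, of j]
  proof
    assume "\<exists>b'\<in>carrier R. \<epsilon> \<otimes> b \<ominus> \<epsilon> \<otimes> \<pi> [^] j \<otimes> b' \<in> PIdl r"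
    then obtain b' where b': "b' \<in> carrier R" "\<epsilon> \<otimes> b \<ominus> \<epsilon> \<otimes> \<pi> [^] j \<otimes> b' \<in> PIdl r" by blast
    then obtain z where z: "z \<in> carrier R" "\<epsilon> \<otimes> b = \<epsilon> \<otimes> \<pi> [^] j \<otimes> b' \<oplus> z \<otimes> r"
      using pid[OF b'(2)] c(1) b pk by auto
    have "b \<otimes> \<epsilon> = \<epsilon> \<otimes> b" by (rule R.m_comm[OF b c(1)])
    also have "\<dots> = (\<epsilon> \<otimes> b') \<otimes> \<pi> [^] j \<oplus> z \<otimes> r" unfolding z(2) using c(1) b'(1) pk[of j] z(1) r by algebra
    finally have e: "b \<otimes> \<epsilon> = (\<epsilon> \<otimes> b') \<otimes> \<pi> [^] j \<oplus> z \<otimes> r" .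
    have "\<epsilon> \<otimes> b' \<in> carrier R" using c(1) b'(1) by simp
    from G(4)[OF Gj[OF this] Gr[OF z(1)]] show ?thesis
      unfolding e using c(1) b'(1) pk z(1) r y n by (simp add: M.smult_l_distr N.smult_l_distr)
  next
    assume "\<exists>l<j. \<exists>w\<in>carrier R. \<epsilon> \<otimes> w \<otimes> b \<ominus> \<epsilon> \<otimes> \<pi> [^] l \<in> PIdl r"
    then obtain l w where l: "l < j" "w \<in> carrier R" "\<epsilon> \<otimes> w \<otimes> b \<ominus> \<epsilon> \<otimes> \<pi> [^] l \<in> PIdl r" by blast
    have "D ((w \<otimes> (b \<otimes> \<epsilon>)) \<odot>\<^bsub>M\<^esub> y)" using Dmul[OF Db _ l(2) y] b c(1) by simp
    moreover have "w \<otimes> (b \<otimes> \<epsilon>) = \<epsilon> \<otimes> w \<otimes> b" using l(2) b c(1) by algebra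
    ultimately have "D ((\<epsilon> \<otimes> \<pi> [^] l) \<odot>\<^bsub>M\<^esub> y)" using Dcong[OF l(3) _ _ y] l(2) b c(1) pk by simp
    then have "D ((\<pi> [^] l \<otimes> \<epsilon>) \<odot>\<^bsub>M\<^esub> y)" using R.m_comm[OF c(1) pk] by simp
    then show ?thesis using nil[of l] l(1) ji by simp
  qed
  define G' where "G' = {(m \<oplus>\<^bsub>M\<^esub> (b \<otimes> \<epsilon>) \<odot>\<^bsub>M\<^esub> y, n0 \<oplus>\<^bsub>N\<^esub> (b \<otimes> \<epsilon>) \<odot>\<^bsub>N\<^esub> n) | m n0 b. (m, n0) \<in> G \<and>
    b \<in> carrier R}"
  have G'I: "(m \<oplus>\<^bsub>M\<^esub> (b \<otimes> \<epsilon>) \<odot>\<^bsub>M\<^esub> y, n0 \<oplus>\<^bsub>N\<^esub> (b \<otimes> \<epsilon>) \<odot>\<^bsub>N\<^esub> n) \<in> G'"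
    if "(m, n0) \<in> G" "b \<in> carrier R" for m n0 b
    using that unfolding G'_def by blast
  have G'E: "\<exists>m0 n0 b. (m0, n0) \<in> G \<and> b \<in> carrier R \<and> m = m0 \<oplus>\<^bsub>M\<^esub> (b \<otimes> \<epsilon>) \<odot>\<^bsub>M\<^esub> y \<and> nn =
    n0 \<oplus>\<^bsub>N\<^esub> (b \<otimes> \<epsilon>) \<odot>\<^bsub>N\<^esub> n"
    if "(m, nn) \<in> G'" for m nn using that unfolding G'_def by blast
  have bc: "b \<otimes> \<epsilon> \<in> carrier R \<and> (b \<otimes> \<epsilon>) \<odot>\<^bsub>M\<^esub> y \<in> carrier M \<and> (b \<otimes> \<epsilon>) \<odot>\<^bsub>N\<^esub> n \<in> carrier N"
    if "b \<in> carrier R" for b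
    using that c(1) y n by simp
  have sub: "(m, n0) \<in> G'" if g: "(m, n0) \<in> G" for m n0
  proof -
    have "m \<oplus>\<^bsub>M\<^esub> (\<zero> \<otimes> \<epsilon>) \<odot>\<^bsub>M\<^esub> y = m" "n0 \<oplus>\<^bsub>N\<^esub> (\<zero> \<otimes> \<epsilon>) \<odot>\<^bsub>N\<^esub> n = n0"
      using G(1,2)[OF g] c(1) y n by simp_all
    then show ?thesis using G'I[OF g R.zero_closed] by simp
  qed
  have "partial_solution (u \<otimes> u) \<pi> k G'"
    unfolding partial_solution_def
  proof (intro conjI allI ballI impI)
    fix m nn assume "(m, nn) \<in> G'"
    then obtain m0 n0 b where *: "(m0, n0) \<in> G" "b \<in> carrier R" "m = m0 \<oplus>\<^bsub>M\<^esub> (b \<otimes> \<epsilon>) \<odot>\<^bsub>M\<^esub> y"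
      "nn = n0 \<oplus>\<^bsub>N\<^esub> (b \<otimes> \<epsilon>) \<odot>\<^bsub>N\<^esub> n"
      using G'E by blast
    note mc = G(1)[OF *(1)] and nc = G(2)[OF *(1)] and b = bc[OF *(2)]
    show "m \<in> carrier M" "nn \<in> carrier N" unfolding *(3,4) using mc nc b by simp_all
    show "r \<odot>\<^bsub>N\<^esub> nn = (u \<otimes> u) \<odot>\<^bsub>N\<^esub> f m"
    proof -
      have comm: "r \<otimes> (b \<otimes> \<epsilon>) = (b \<otimes> \<epsilon>) \<otimes> r" "(b \<otimes> \<epsilon>) \<otimes> (u \<otimes> u) = (u \<otimes> u) \<otimes> (b \<otimes> \<epsilon>)"
        using r *(2) c(1,3) by algebra+
      have "r \<odot>\<^bsub>N\<^esub> nn = r \<odot>\<^bsub>N\<^esub> n0 \<oplus>\<^bsub>N\<^esub> (r \<otimes> (b \<otimes> \<epsilon>)) \<odot>\<^bsub>N\<^esub> n"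
        unfolding *(4) using r nc b n by (simp add: N.smult_r_distr smN)
      also have "(r \<otimes> (b \<otimes> \<epsilon>)) \<odot>\<^bsub>N\<^esub> n = (b \<otimes> \<epsilon>) \<odot>\<^bsub>N\<^esub> (r \<odot>\<^bsub>N\<^esub> n)"
        unfolding comm(1) using r b n by (simp add: N.smult_assoc1)
      also have "\<dots> = ((b \<otimes> \<epsilon>) \<otimes> (u \<otimes> u)) \<odot>\<^bsub>N\<^esub> f y"
        unfolding E2 using b c(3) f_closed[OF y] by (simp add: smN)
      also have "\<dots> = (u \<otimes> u) \<odot>\<^bsub>N\<^esub> f ((b \<otimes> \<epsilon>) \<odot>\<^bsub>M\<^esub> y)"
        unfolding comm(2) using b c(3) f_closed[OF y] f_smult y by (simp add: N.smult_assoc1)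
      also have "r \<odot>\<^bsub>N\<^esub> n0 = (u \<otimes> u) \<odot>\<^bsub>N\<^esub> f m0" by (rule G(3)[OF *(1)])
      finally show ?thesis unfolding *(3)
        using f_add[OF mc] b mc f_closed c(3) by (simp add: N.smult_r_distr)
    qed
    { fix m' nn' assume "(m', nn') \<in> G'"
      then obtain m0' n0' b' where **: "(m0', n0') \<in> G" "b' \<in> carrier R" "m' = m0' \<oplus>\<^bsub>M\<^esub> (b' \<otimes> \<epsilon>) \<odot>\<^bsub>M\<^esub> y"
        "nn' = n0' \<oplus>\<^bsub>N\<^esub> (b' \<otimes> \<epsilon>) \<odot>\<^bsub>N\<^esub> n"
        using G'E by blast
      note mc' = G(1)[OF **(1)] and nc' = G(2)[OF **(1)] and b' = bc[OF **(2)]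
      have "((m0 \<oplus>\<^bsub>M\<^esub> m0') \<oplus>\<^bsub>M\<^esub> ((b \<oplus> b') \<otimes> \<epsilon>) \<odot>\<^bsub>M\<^esub> y, (n0 \<oplus>\<^bsub>N\<^esub> n0') \<oplus>\<^bsub>N\<^esub> ((b \<oplus> b') \<otimes> \<epsilon>) \<odot>\<^bsub>N\<^esub> n) \<in> G'"
        using *(2) **(2) by (intro G'I G(4)[OF *(1) **(1)]) simp
      moreover have "m \<oplus>\<^bsub>M\<^esub> m' = (m0 \<oplus>\<^bsub>M\<^esub> m0') \<oplus>\<^bsub>M\<^esub> ((b \<oplus> b') \<otimes> \<epsilon>) \<odot>\<^bsub>M\<^esub> y"
        unfolding *(3) **(3)
          using mc mc' b b' *(2) **(2) c(1) y by (simp add: R.l_distr M.smult_l_distr M.M.a_ac)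
      moreover have "nn \<oplus>\<^bsub>N\<^esub> nn' = (n0 \<oplus>\<^bsub>N\<^esub> n0') \<oplus>\<^bsub>N\<^esub> ((b \<oplus> b') \<otimes> \<epsilon>) \<odot>\<^bsub>N\<^esub> n"
        unfolding *(4) **(4)
          using nc nc' b b' *(2) **(2) c(1) n by (simp add: R.l_distr N.smult_l_distr N.M.a_ac)
      ultimately show "(m \<oplus>\<^bsub>M\<^esub> m', nn \<oplus>\<^bsub>N\<^esub> nn') \<in> G'" by simp }
    fix a assume a: "a \<in> carrier R"
    have "(a \<odot>\<^bsub>M\<^esub> m0 \<oplus>\<^bsub>M\<^esub> ((a \<otimes> b) \<otimes> \<epsilon>) \<odot>\<^bsub>M\<^esub> y, a \<odot>\<^bsub>N\<^esub> n0 \<oplus>\<^bsub>N\<^esub> ((a \<otimes> b) \<otimes> \<epsilon>) \<odot>\<^bsub>N\<^esub> n) \<in> G'"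
      using a *(2) by (intro G'I G(5)[OF a *(1)]) simp
    moreover have "a \<odot>\<^bsub>M\<^esub> m = a \<odot>\<^bsub>M\<^esub> m0 \<oplus>\<^bsub>M\<^esub> ((a \<otimes> b) \<otimes> \<epsilon>) \<odot>\<^bsub>M\<^esub> y"
      unfolding *(3) using a mc b *(2) c(1) y by (simp add: M.smult_r_distr sm R.m_assoc)
    moreover have "a \<odot>\<^bsub>N\<^esub> nn = a \<odot>\<^bsub>N\<^esub> n0 \<oplus>\<^bsub>N\<^esub> ((a \<otimes> b) \<otimes> \<epsilon>) \<odot>\<^bsub>N\<^esub> n"
      unfolding *(4) using a nc b *(2) c(1) n by (simp add: N.smult_r_distr smN R.m_assoc)
    ultimately show "(a \<odot>\<^bsub>M\<^esub> m, a \<odot>\<^bsub>N\<^esub> nn) \<in> G'" by simp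
  next
    fix m assume "m \<in> carrier M"
    then show "(r \<odot>\<^bsub>M\<^esub> m, (u \<otimes> u) \<odot>\<^bsub>N\<^esub> f m) \<in> G'" by (intro sub G(6))
  next
    fix nn assume "(\<zero>\<^bsub>M\<^esub>, nn) \<in> G'"
    then obtain m0 n0 b where *: "(m0, n0) \<in> G" "b \<in> carrier R" "\<zero>\<^bsub>M\<^esub> = m0 \<oplus>\<^bsub>M\<^esub> (b \<otimes> \<epsilon>) \<odot>\<^bsub>M\<^esub> y"
      "nn = n0 \<oplus>\<^bsub>N\<^esub> (b \<otimes> \<epsilon>) \<odot>\<^bsub>N\<^esub> n"
      using G'E by blast
    note b = bc[OF *(2)]
    have "D \<zero>\<^bsub>M\<^esub>" using Dsm[OF R.zero_closed DI[OF d]] dc by simp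
    then have "D ((b \<otimes> \<epsilon>) \<odot>\<^bsub>M\<^esub> y)" using Dsub[of m0 "(b \<otimes> \<epsilon>) \<odot>\<^bsub>M\<^esub> y"] DI[OF *(1)] b *(3) by simp
    from G(4)[OF *(1) K[OF *(2) this]] have "(\<zero>\<^bsub>M\<^esub>, nn) \<in> G" unfolding *(3)[symmetric] *(4)[symmetric] .
    then show "nn = \<zero>\<^bsub>N\<^esub>" by (rule G(7))
  next
    fix h m nn assume h: "h \<le> k" and m: "m \<in> carrier M" and "(\<pi> [^] h \<odot>\<^bsub>M\<^esub> m, nn) \<in> G'"
    then obtain d0 n0 b where *: "(d0, n0) \<in> G" "b \<in> carrier R" "\<pi> [^] h \<odot>\<^bsub>M\<^esub> m = d0 \<oplus>\<^bsub>M\<^esub> (b \<otimes> \<epsilon>) \<odot>\<^bsub>M\<^esub> y"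
      using G'E by blast
    note b = bc[OF *(2)] and d0 = G(1)[OF *(1)]
    let ?goal = "\<exists>d n'. (d, n') \<in> G' \<and> (\<exists>m'\<in>carrier M. \<pi> [^] h \<odot>\<^bsub>M\<^esub> m = \<pi> [^] h \<odot>\<^bsub>M\<^esub> d \<oplus>\<^bsub>M\<^esub> r \<odot>\<^bsub>M\<^esub> m')"
    show ?goal
    proof (cases "j \<le> h")
      \<comment> \<open>By the choice of \<open>j\<close>, \<open>\<epsilon> \<pi> [^] h m\<close>
        lies in \<open>D\<close>. Hence so does the multiple of \<open>\<epsilon> y\<close>, and
        purity of \<open>G\<close> applies.\<close>
      case True
      have "D ((\<pi> [^] (h - j) \<otimes> (\<pi> [^] j \<otimes> \<epsilon>)) \<odot>\<^bsub>M\<^esub> m)"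
        using Dmul[OF jall[OF m] _ pk m] pk c(1) by simp
      moreover have "\<pi> [^] (h - j) \<otimes> (\<pi> [^] j \<otimes> \<epsilon>) = \<epsilon> \<otimes> \<pi> [^] h"
        using True c(1,2) pk R.m_assoc[of "\<pi> [^] (h - j)" "\<pi> [^] j" \<epsilon>, symmetric] R.m_comm[OF c(1) pk, of h]
        by (simp add: R.nat_pow_mult)
      ultimately have "D (\<epsilon> \<odot>\<^bsub>M\<^esub> (\<pi> [^] h \<odot>\<^bsub>M\<^esub> m))" using c(1) pk m by (simp add: sm)
      then have "D (\<epsilon> \<odot>\<^bsub>M\<^esub> d0 \<oplus>\<^bsub>M\<^esub> \<epsilon> \<odot>\<^bsub>M\<^esub> ((b \<otimes> \<epsilon>) \<odot>\<^bsub>M\<^esub> y))"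
        unfolding *(3) using c(1) d0 b by (simp add: M.smult_r_distr)
      then have "D (\<epsilon> \<odot>\<^bsub>M\<^esub> ((b \<otimes> \<epsilon>) \<odot>\<^bsub>M\<^esub> y))" using Dsub Dsm[OF c(1) DI[OF *(1)]] c(1) b by simp
      then have "D ((\<epsilon> \<otimes> (b \<otimes> \<epsilon>)) \<odot>\<^bsub>M\<^esub> y)" using c(1) b y by (simp add: sm)
      moreover have "\<epsilon> \<otimes> (b \<otimes> \<epsilon>) \<ominus> b \<otimes> \<epsilon> = b \<otimes> (\<epsilon> \<otimes> \<epsilon> \<ominus> \<epsilon>)" using c(1) *(2) by algebra
      then have "\<epsilon> \<otimes> (b \<otimes> \<epsilon>) \<ominus> b \<otimes> \<epsilon> \<in> PIdl r" using idemI[OF *(2)] by simp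
      ultimately have "D ((b \<otimes> \<epsilon>) \<odot>\<^bsub>M\<^esub> y)" using Dcong[of "\<epsilon> \<otimes> (b \<otimes> \<epsilon>)" "b \<otimes> \<epsilon>" y] c(1) b y by simp
      then have "D (\<pi> [^] h \<odot>\<^bsub>M\<^esub> m)" unfolding *(3) by (rule Dadd[OF DI[OF *(1)]])
      then obtain n2 where "(\<pi> [^] h \<odot>\<^bsub>M\<^esub> m, n2) \<in> G" unfolding D_def by blast
      from G(8)[OF h m this] show ?thesis using sub by blast
    next
      case False
      from tri[OF *(2), of h] show ?thesis
      proof
        \<comment> \<open>The coefficient of \<open>y\<close> is divisible by
          \<open>\<pi> [^] h\<close> modulo \<open>r\<close>. Subtracting \<open>v\<close> from
          \<open>m\<close> reduces to purity of \<open>G\<close>, and \<open>v\<close> is then added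
          to \<open>d2\<close>.\<close>
        assume "\<exists>b'\<in>carrier R. \<epsilon> \<otimes> b \<ominus> \<epsilon> \<otimes> \<pi> [^] h \<otimes> b' \<in> PIdl r"
        then obtain b' where b': "b' \<in> carrier R" "\<epsilon> \<otimes> b \<ominus> \<epsilon> \<otimes> \<pi> [^] h \<otimes> b' \<in> PIdl r" by blast
        then obtain z where z: "z \<in> carrier R" "\<epsilon> \<otimes> b = \<epsilon> \<otimes> \<pi> [^] h \<otimes> b' \<oplus> z \<otimes> r"
          using pid[OF b'(2)] c(1) *(2) pk by auto
        have "b \<otimes> \<epsilon> = \<epsilon> \<otimes> b" by (rule R.m_comm[OF *(2) c(1)])
        also have "\<dots> = \<pi> [^] h \<otimes> (b' \<otimes> \<epsilon>) \<oplus> r \<otimes> z" unfolding z(2)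
          using c(1) b'(1) pk[of h] z(1) r by algebra
        finally have e: "b \<otimes> \<epsilon> = \<pi> [^] h \<otimes> (b' \<otimes> \<epsilon>) \<oplus> r \<otimes> z" .
        note bb = bc[OF b'(1)]
        define v where "v = (b' \<otimes> \<epsilon>) \<odot>\<^bsub>M\<^esub> y"
        have v: "v \<in> carrier M" using bb by (simp add: v_def)
        have zy: "z \<odot>\<^bsub>M\<^esub> y \<in> carrier M" using z(1) y by simp
        have ey: "(b \<otimes> \<epsilon>) \<odot>\<^bsub>M\<^esub> y = \<pi> [^] h \<odot>\<^bsub>M\<^esub> v \<oplus>\<^bsub>M\<^esub> r \<odot>\<^bsub>M\<^esub> (z \<odot>\<^bsub>M\<^esub> y)"
          unfolding e v_def using bb pk z(1) r y by (simp add: M.smult_l_distr M.smult_assoc1)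
        define m' where "m' = m \<oplus>\<^bsub>M\<^esub> \<ominus>\<^bsub>M\<^esub> v"
        have m': "m' \<in> carrier M" using m v by (simp add: m'_def)
        have "\<pi> [^] h \<odot>\<^bsub>M\<^esub> m' = \<pi> [^] h \<odot>\<^bsub>M\<^esub> m \<oplus>\<^bsub>M\<^esub> \<ominus>\<^bsub>M\<^esub> (\<pi> [^] h \<odot>\<^bsub>M\<^esub> v)"
          unfolding m'_def using pk m v by (simp add: M.smult_r_distr M.smult_r_minus)
        also have "\<dots> = d0 \<oplus>\<^bsub>M\<^esub> r \<odot>\<^bsub>M\<^esub> (z \<odot>\<^bsub>M\<^esub> y)"
          unfolding *(3) ey by (rule canc3) (use pk d0 v zy r in simp_all)
        finally have "D (\<pi> [^] h \<odot>\<^bsub>M\<^esub> m')" using Dadd[OF DI[OF *(1)] DrM[OF zy]] by simp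
        then obtain n2 where "(\<pi> [^] h \<odot>\<^bsub>M\<^esub> m', n2) \<in> G" unfolding D_def by blast
        then obtain d2 n3 x2 where d2: "(d2, n3) \<in> G" "x2 \<in> carrier M"
          "\<pi> [^] h \<odot>\<^bsub>M\<^esub> m' = \<pi> [^] h \<odot>\<^bsub>M\<^esub> d2 \<oplus>\<^bsub>M\<^esub> r \<odot>\<^bsub>M\<^esub> x2" using G(8)[OF h m'] by blast
        note d2c = G(1)[OF d2(1)]
        have "m = m' \<oplus>\<^bsub>M\<^esub> v" unfolding m'_def using m v by (simp add: M.M.a_assoc M.M.l_neg)
        then have "\<pi> [^] h \<odot>\<^bsub>M\<^esub> m = \<pi> [^] h \<odot>\<^bsub>M\<^esub> m' \<oplus>\<^bsub>M\<^esub> \<pi> [^] h \<odot>\<^bsub>M\<^esub> v"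
          using pk m' v by (simp add: M.smult_r_distr)
        also have "\<dots> = \<pi> [^] h \<odot>\<^bsub>M\<^esub> (d2 \<oplus>\<^bsub>M\<^esub> v) \<oplus>\<^bsub>M\<^esub> r \<odot>\<^bsub>M\<^esub> x2"
          unfolding d2(3) using pk d2c v d2(2) r by (simp add: M.smult_r_distr M.M.a_ac)
        finally have "\<pi> [^] h \<odot>\<^bsub>M\<^esub> m = \<pi> [^] h \<odot>\<^bsub>M\<^esub> (d2 \<oplus>\<^bsub>M\<^esub> v) \<oplus>\<^bsub>M\<^esub> r \<odot>\<^bsub>M\<^esub> x2" .
        moreover have "(d2 \<oplus>\<^bsub>M\<^esub> v, n3 \<oplus>\<^bsub>N\<^esub> (b' \<otimes> \<epsilon>) \<odot>\<^bsub>N\<^esub> n) \<in> G'" unfolding v_def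
          by (rule G'I[OF d2(1) b'(1)])
        ultimately show ?goal using d2(2) by blast
      next
        \<comment> \<open>Multiplication by \<open>\<pi> [^] (j - h)\<close> leads to a multiple of
          \<open>\<pi> [^] j \<epsilon> m\<close>, which is in \<open>D\<close>. Then
          \<open>\<epsilon> y\<close> would have order at most \<open>j - h + l\<close> modulo
          \<open>D\<close>, less than \<open>j\<close>.\<close>
        assume "\<exists>l<h. \<exists>w\<in>carrier R. \<epsilon> \<otimes> w \<otimes> b \<ominus> \<epsilon> \<otimes> \<pi> [^] l \<in> PIdl r"
        then obtain l w where l: "l < h" "w \<in> carrier R" "\<epsilon> \<otimes> w \<otimes> b \<ominus> \<epsilon> \<otimes> \<pi> [^] l \<in> PIdl r" by blast
        define g where "g = \<pi> [^] (j - h)"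
        have gc: "g \<in> carrier R" using pk by (simp add: g_def)
        have gh: "g \<otimes> \<pi> [^] h = \<pi> [^] j" using False c(2) by (simp add: g_def R.nat_pow_mult)
        let ?a = "w \<otimes> \<epsilon> \<otimes> g"
        have ac: "?a \<in> carrier R" using l(2) c(1) gc by simp
        have "?a \<otimes> \<pi> [^] h = w \<otimes> ((g \<otimes> \<pi> [^] h) \<otimes> \<epsilon>)" using l(2) c(1) gc pk[of h] by algebra
        then have "?a \<otimes> \<pi> [^] h = w \<otimes> (\<pi> [^] j \<otimes> \<epsilon>)" unfolding gh .
        moreover have "D ((w \<otimes> (\<pi> [^] j \<otimes> \<epsilon>)) \<odot>\<^bsub>M\<^esub> m)" using Dmul[OF jall[OF m] _ l(2) m] pk c(1) by simp
        ultimately have "D (?a \<odot>\<^bsub>M\<^esub> (\<pi> [^] h \<odot>\<^bsub>M\<^esub> m))" using M.smult_assoc1[OF ac pk m, of h] by simp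
        then have "D (?a \<odot>\<^bsub>M\<^esub> d0 \<oplus>\<^bsub>M\<^esub> ?a \<odot>\<^bsub>M\<^esub> ((b \<otimes> \<epsilon>) \<odot>\<^bsub>M\<^esub> y))"
          unfolding *(3) using M.smult_r_distr[OF ac d0] b by simp
        then have "D (?a \<odot>\<^bsub>M\<^esub> ((b \<otimes> \<epsilon>) \<odot>\<^bsub>M\<^esub> y))"
          using Dsub Dsm[OF ac DI[OF *(1)]] M.smult_closed[OF ac] b by blast
        then have 1: "D ((?a \<otimes> (b \<otimes> \<epsilon>)) \<odot>\<^bsub>M\<^esub> y)" using M.smult_assoc1[OF ac _ y, of "b \<otimes> \<epsilon>"] b by simp
        have "?a \<otimes> (b \<otimes> \<epsilon>) \<ominus> (g \<otimes> \<epsilon>) \<otimes> (\<epsilon> \<otimes> \<pi> [^] l) = (g \<otimes> \<epsilon>) \<otimes> (\<epsilon> \<otimes> w \<otimes> b \<ominus> \<epsilon> \<otimes> \<pi> [^] l)"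
          using l(2) c(1) gc *(2) pk[of l] by algebra
        then have 2: "?a \<otimes> (b \<otimes> \<epsilon>) \<ominus> (g \<otimes> \<epsilon>) \<otimes> (\<epsilon> \<otimes> \<pi> [^] l) \<in> PIdl r"
          using I.I_l_closed[OF l(3), of "g \<otimes> \<epsilon>"] gc c(1) by simp
        have c2: "?a \<otimes> (b \<otimes> \<epsilon>) \<in> carrier R" "(g \<otimes> \<epsilon>) \<otimes> (\<epsilon> \<otimes> \<pi> [^] l) \<in> carrier R"
          "(g \<otimes> \<pi> [^] l) \<otimes> \<epsilon> \<in> carrier R"
          using ac b gc c(1) pk by simp_all
        have 3: "D (((g \<otimes> \<epsilon>) \<otimes> (\<epsilon> \<otimes> \<pi> [^] l)) \<odot>\<^bsub>M\<^esub> y)" by (rule Dcong[OF 2 c2(1,2) y 1])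
        have "(g \<otimes> \<epsilon>) \<otimes> (\<epsilon> \<otimes> \<pi> [^] l) \<ominus> (g \<otimes> \<pi> [^] l) \<otimes> \<epsilon> = (g \<otimes> \<pi> [^] l) \<otimes> (\<epsilon> \<otimes> \<epsilon> \<ominus> \<epsilon>)"
          using gc c(1) pk[of l] by algebra
        then have 4: "(g \<otimes> \<epsilon>) \<otimes> (\<epsilon> \<otimes> \<pi> [^] l) \<ominus> (g \<otimes> \<pi> [^] l) \<otimes> \<epsilon> \<in> PIdl r"
          using idemI[of "g \<otimes> \<pi> [^] l"] gc pk by simp
        have "D (((g \<otimes> \<pi> [^] l) \<otimes> \<epsilon>) \<odot>\<^bsub>M\<^esub> y)" by (rule Dcong[OF 4 c2(2,3) y 3])
        moreover have "g \<otimes> \<pi> [^] l = \<pi> [^] (j - h + l)" unfolding g_def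
          using c(2) by (simp add: R.nat_pow_mult)
        ultimately have "D ((\<pi> [^] (j - h + l) \<otimes> \<epsilon>) \<odot>\<^bsub>M\<^esub> y)" by simp
        moreover have "j - h + l \<le> i" using l(1) False ji by linarith
        ultimately have False using nil by blast
        then show ?goal ..
      qed
    qed
  qed
  moreover have "G \<subseteq> G'" using sub by auto
  \<comment> \<open>The coefficient \<open>\<one>\<close> puts \<open>\<epsilon> y\<close> into the
    new domain, whereas \<open>nil\<close> at exponent 0 excludes it from the old one.\<close>
  moreover have "G \<noteq> G'"
  proof
    assume eq: "G = G'"
    have "(\<zero> \<odot>\<^bsub>M\<^esub> d \<oplus>\<^bsub>M\<^esub> (\<one> \<otimes> \<epsilon>) \<odot>\<^bsub>M\<^esub> y, \<zero> \<odot>\<^bsub>N\<^esub> nd \<oplus>\<^bsub>N\<^esub> (\<one> \<otimes> \<epsilon>) \<odot>\<^bsub>N\<^esub> n) \<in> G'"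
      by (rule G'I[OF G(5)[OF R.zero_closed d] R.one_closed])
    then have "D (\<zero> \<odot>\<^bsub>M\<^esub> d \<oplus>\<^bsub>M\<^esub> (\<one> \<otimes> \<epsilon>) \<odot>\<^bsub>M\<^esub> y)" unfolding eq[symmetric] by (rule DI)
    then have "D ((\<pi> [^] (0::nat) \<otimes> \<epsilon>) \<odot>\<^bsub>M\<^esub> y)" using dc c(1) y by simp
    then show False by (rule nil[rotated]) simp
  qed
  ultimately show ?thesis by blast
qed

end

text \<open>A maximal partial solution is defined on all of \<open>\<epsilon> M\<close>. Its
  composition with multiplication by \<open>\<epsilon>\<close> is the required quotient; linearity
  follows from single-valuedness of the graph.\<close>

lemma (in divisibility_problem) multiplier_local:
  assumes c: "\<epsilon> \<in> carrier R" "\<pi> \<in> carrier R" "u \<in> carrier R" "t \<in> carrier R"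
    and idem: "\<epsilon> \<otimes> \<epsilon> \<ominus> \<epsilon> \<in> PIdl r" and epk: "\<epsilon> \<otimes> \<pi> [^] (k::nat) \<in> PIdl r" and ut: "u \<otimes> r = t \<otimes> \<pi> [^] k"
    and tri: "\<And>b i. b \<in> carrier R \<Longrightarrow> (\<exists>b'\<in>carrier R. \<epsilon> \<otimes> b \<ominus> \<epsilon> \<otimes> \<pi> [^] i \<otimes> b' \<in> PIdl r) \<or>
      (\<exists>l<i. \<exists>w\<in>carrier R. \<epsilon> \<otimes> w \<otimes> b \<ominus> \<epsilon> \<otimes> \<pi> [^] (l::nat) \<in> PIdl r)"
  shows "multiplier (u \<otimes> u \<otimes> \<epsilon>)"
proof -
  let ?A = "{G. partial_solution (u \<otimes> u) \<pi> k G}"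
  have "\<exists>G\<in>?A. \<forall>H\<in>?A. G \<subseteq> H \<longrightarrow> H = G"
  proof (rule subset_Zorn_nonempty)
    show "?A \<noteq> {}"
      by (rule ex_in_conv[THEN iffD1]) (rule exI, rule CollectI, rule partial_solution_base[OF R.m_closed[OF c(3,3)] c(2)])
    fix \<C> assume ne: "\<C> \<noteq> {}" and "subset.chain ?A \<C>"
    then have sub: "\<C> \<subseteq> ?A" and lin: "\<forall>G\<in>\<C>. \<forall>H\<in>\<C>. G \<subseteq> H \<or> H \<subseteq> G"
      unfolding subset_chain_def by simp_all
    have "partial_solution (u \<otimes> u) \<pi> k (\<Union>\<C>)"
      by (rule partial_solution_Union[OF ne]) (rule CollectD[OF subsetD[OF sub]], assumption, rule lin[rule_format])
    then show "\<Union>\<C> \<in> ?A" by (rule CollectI)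
  qed
  then obtain G where G: "partial_solution (u \<otimes> u) \<pi> k G"
    and max: "\<forall>H\<in>?A. G \<subseteq> H \<longrightarrow> H = G" by (elim bexE CollectE)
  note D = partial_solutionD[OF G]
  have "\<exists>n. (\<epsilon> \<odot>\<^bsub>M\<^esub> m, n) \<in> G" if m: "m \<in> carrier M" for m
  proof (rule ccontr)
    assume no: "\<nexists>n. (\<epsilon> \<odot>\<^bsub>M\<^esub> m, n) \<in> G"
    have "\<exists>G'. partial_solution (u \<otimes> u) \<pi> k G' \<and> G \<subset> G'"
      by (rule partial_solution_extend[OF c idem epk ut _ G m no]) (erule tri)
    then obtain G' where G': "partial_solution (u \<otimes> u) \<pi> k G'" "G \<subset> G'" by (elim exE conjE)
    have "G' \<in> ?A" using G'(1) by (rule CollectI)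
    then have "G' = G" using max G'(2) by blast
    then show False using G'(2) by blast
  qed
  then have "\<exists>g. \<forall>m\<in>carrier M. (\<epsilon> \<odot>\<^bsub>M\<^esub> m, g m) \<in> G" by (intro bchoice ballI)
  then obtain g where g: "\<And>m. m \<in> carrier M \<Longrightarrow> (\<epsilon> \<odot>\<^bsub>M\<^esub> m, g m) \<in> G" by blast
  have uniq: "n = n'" if 1: "(m, n) \<in> G" and 2: "(m, n') \<in> G" for m n n'
  proof -
    note mc = D(1)[OF 1] and nc = D(2)[OF 1] D(2)[OF 2]
    have "((\<ominus> \<one>) \<odot>\<^bsub>M\<^esub> m \<oplus>\<^bsub>M\<^esub> m, (\<ominus> \<one>) \<odot>\<^bsub>N\<^esub> n' \<oplus>\<^bsub>N\<^esub> n) \<in> G"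
      by (rule D(4)[OF D(5)[OF _ 2] 1]) simp
    moreover have "(\<ominus> \<one>) \<odot>\<^bsub>M\<^esub> m \<oplus>\<^bsub>M\<^esub> m = \<zero>\<^bsub>M\<^esub>" using mc M.smult_l_minus[of \<one> m] by (simp add: M.M.l_neg)
    ultimately have "(\<ominus> \<one>) \<odot>\<^bsub>N\<^esub> n' \<oplus>\<^bsub>N\<^esub> n = \<zero>\<^bsub>N\<^esub>" using D(7) by simp
    then have "\<ominus>\<^bsub>N\<^esub> n' \<oplus>\<^bsub>N\<^esub> n = \<zero>\<^bsub>N\<^esub>" using nc N.smult_l_minus[of \<one> n'] by simp
    then have "\<ominus>\<^bsub>N\<^esub> n = \<ominus>\<^bsub>N\<^esub> n'" using N.M.minus_equality[of "\<ominus>\<^bsub>N\<^esub> n'" n] nc by simp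
    then have "\<ominus>\<^bsub>N\<^esub> (\<ominus>\<^bsub>N\<^esub> n) = \<ominus>\<^bsub>N\<^esub> (\<ominus>\<^bsub>N\<^esub> n')" by (rule arg_cong)
    then show ?thesis unfolding N.M.minus_minus[OF nc(1)] N.M.minus_minus[OF nc(2)] .
  qed
  have "g \<in> modhom R M N"
    unfolding modhom_def
  proof (intro CollectI conjI ballI funcsetI)
    fix m assume m: "m \<in> carrier M"
    show "g m \<in> carrier N" by (rule D(2)[OF g[OF m]])
    show "g (m \<oplus>\<^bsub>M\<^esub> m') = g m \<oplus>\<^bsub>N\<^esub> g m'" if m': "m' \<in> carrier M" for m'
    proof (rule uniq)
      show "(\<epsilon> \<odot>\<^bsub>M\<^esub> (m \<oplus>\<^bsub>M\<^esub> m'), g (m \<oplus>\<^bsub>M\<^esub> m')) \<in> G" using m m' by (intro g) simp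
      show "(\<epsilon> \<odot>\<^bsub>M\<^esub> (m \<oplus>\<^bsub>M\<^esub> m'), g m \<oplus>\<^bsub>N\<^esub> g m') \<in> G"
        using D(4)[OF g[OF m] g[OF m']] M.smult_r_distr[OF c(1) m m'] by simp
    qed
    show "g (a \<odot>\<^bsub>M\<^esub> m) = a \<odot>\<^bsub>N\<^esub> g m" if a: "a \<in> carrier R" for a
    proof (rule uniq)
      show "(\<epsilon> \<odot>\<^bsub>M\<^esub> (a \<odot>\<^bsub>M\<^esub> m), g (a \<odot>\<^bsub>M\<^esub> m)) \<in> G" using m a by (intro g) simp
      have "\<epsilon> \<odot>\<^bsub>M\<^esub> (a \<odot>\<^bsub>M\<^esub> m) = a \<odot>\<^bsub>M\<^esub> (\<epsilon> \<odot>\<^bsub>M\<^esub> m)"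
        using M.smult_assoc1[OF c(1) a m] M.smult_assoc1[OF a c(1) m] R.m_comm[OF a c(1)] by simp
      then show "(\<epsilon> \<odot>\<^bsub>M\<^esub> (a \<odot>\<^bsub>M\<^esub> m), a \<odot>\<^bsub>N\<^esub> g m) \<in> G" using D(5)[OF a g[OF m]] by simp
    qed
  qed
  moreover have "(u \<otimes> u \<otimes> \<epsilon>) \<odot>\<^bsub>N\<^esub> f m = r \<odot>\<^bsub>N\<^esub> g m" if m: "m \<in> carrier M" for m
    using D(3)[OF g[OF m]] f_smult[OF c(1) m] N.smult_assoc1[OF _ c(1) f_closed[OF m], of "u \<otimes> u"] c(3)
      by simp
  ultimately show ?thesis using c(1,3) by (intro multiplierI) simp_all
qed

text \<open>A multiplier outside \<open>P\<close> is \<open>r\<close> itself if \<open>r\<close> is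
  not in \<open>P\<close>, an annihilator of \<open>r\<close> if \<open>r\<close> vanishes at
  \<open>P\<close>, and otherwise the element \<open>u u \<epsilon>\<close> built from
  \<open>local_data\<close>.\<close>

lemma (in cring) seemingly_divisible_imp_divisible_if_splits_at:
  assumes unif: "\<forall>P. primeideal P R \<longrightarrow> (\<exists>\<pi>. uniformizer R P \<pi>)" and split: "\<forall>x\<in>carrier R. splits_at R x"
  shows "seemingly_divisible_imp_divisible R TYPE('m) TYPE('n)"
  unfolding seemingly_divisible_imp_divisible_def
proof (intro ballI allI impI)
  fix r and M :: "('a, 'm) module" and N :: "('a, 'n) module" and f
  assume r: "r \<in> carrier R" and M: "Module.module R M" and N: "Module.module R N"
    and f: "f \<in> modhom R M N" "seemingly_divisible M N f r"
  interpret d: divisibility_problem R M N r f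
    by (intro divisibility_problem.intro divisibility_problem_axioms.intro is_cring M N r f)
  let ?I = "{c. d.multiplier c}"
  have I: "ideal ?I R"
  proof (rule idealI')
    show "?I \<subseteq> carrier R" by (auto simp: d.multiplier_def)
  qed (use d.multiplier_zero d.multiplier_add d.multiplier_mult in simp_all)
  have "\<one> \<in> ?I"
  proof (rule ideal_eq_carrier_if_locally[OF I])
    fix P assume P: "primeideal P R"
    have "\<exists>c. d.multiplier c \<and> c \<notin> P"
    proof (cases "r \<in> P")
      case False
      then show ?thesis using d.multiplier_self by blast
    next
      case rP: True
      show ?thesis
      proof (cases "loc_zero R P r")
        case True
        then obtain s where s: "s \<in> carrier R - P" "s \<otimes> r = \<zero>" by (auto simp: loc_zero_def)
        have "d.multiplier s" by (rule d.multiplier_if_annihilates[OF _ s(2)]) (use s(1) in blast)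
        then show ?thesis using s(1) by blast
      next
        case nz: False
        have isol: "\<exists>c\<in>carrier R - P. \<forall>Q. primeideal Q R \<longrightarrow> r \<in> Q \<longrightarrow> c \<notin> Q \<longrightarrow> Q = P"
          by (rule isolated_if_splits_at[OF unif r split[rule_format, OF r] P rP nz])
        obtain \<epsilon> \<pi> u t and k :: nat where c: "\<epsilon> \<in> carrier R - P" "\<pi> \<in> carrier R" "u \<in> carrier R - P"
          "t \<in> carrier R"
          and l: "\<epsilon> \<otimes> \<epsilon> \<ominus> \<epsilon> \<in> PIdl r" "\<epsilon> \<otimes> \<pi> [^] k \<in> PIdl r" "u \<otimes> r = t \<otimes> \<pi> [^] k"
          and tri: "\<forall>b\<in>carrier R. \<forall>i::nat. (\<exists>b'\<in>carrier R. \<epsilon> \<otimes> b \<ominus> \<epsilon> \<otimes> \<pi> [^] i \<otimes> b' \<in> PIdl r) \<or>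
            (\<exists>l<i. \<exists>w\<in>carrier R. \<epsilon> \<otimes> w \<otimes> b \<ominus> \<epsilon> \<otimes> \<pi> [^] l \<in> PIdl r)"
          using local_data[OF unif r P rP nz isol] by (elim bexE exE conjE)
        have "d.multiplier (u \<otimes> u \<otimes> \<epsilon>)"
          by (rule d.multiplier_local[OF c(1)[THEN DiffD1] c(2) c(3)[THEN DiffD1] c(4) l tri[rule_format]])
        moreover have "u \<otimes> u \<otimes> \<epsilon> \<notin> P"
          using prime_compl_mult[OF P prime_compl_mult[OF P c(3,3)] c(1)] by blast
        ultimately show ?thesis by blast
      qed
    qed
    then show "\<not> ?I \<subseteq> P" by blast
  qed
  then obtain g where g: "g \<in> modhom R M N" "\<forall>m\<in>carrier M. \<one> \<odot>\<^bsub>N\<^esub> f m = r \<odot>\<^bsub>N\<^esub> g m"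
    unfolding d.multiplier_def by blast
  have "\<forall>m\<in>carrier M. f m = r \<odot>\<^bsub>N\<^esub> g m" using g(2) d.f_closed by simp
  then show "divisible_hom R M N f r" using g(1) unfolding divisible_hom_def by blast
qed

text \<open>Statement (1) is taken for modules with carriers in one type \<open>'u\<close>, large
  enough to hold the test modules of (1) implies (3). The last conjunct provides (1) for modules
  with carriers in arbitrary types.\<close>

theorem theorem2p4:
  fixes R :: "('a, 'x) ring_scheme"
  assumes "cring R"
    and large_universe: "\<exists>i :: ('a + nat) set \<Rightarrow> 'u. inj i"
  shows "(seemingly_divisible_imp_divisible R TYPE('u) TYPE('u)
      \<longleftrightarrow>
        ((\<forall>\<pp>\<in>Spec R. principal_ideal_ring (localization R \<pp>)) \<and>
         (\<forall>x\<in>carrier R. splits_at R x)))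
    \<and>
     (((\<forall>\<pp>\<in>Spec R. principal_ideal_ring (localization R \<pp>)) \<and>
       (\<forall>x\<in>carrier R. splits_at R x))
      \<longleftrightarrow>
        ((\<forall>\<pp>\<in>Spec R. principal_ideal_ring (localization R \<pp>)) \<and>
         (\<forall>\<pp>\<in>Spec R. nonreduced_point R \<pp> \<longrightarrow> isolated_point (zariski R) \<pp>) \<and>
         (\<forall>\<pp>\<in>Spec R. \<forall>\<qq>\<in>Spec R. \<forall>S \<subseteq> Spec R - {\<pp>}.
            accumulation_point (zariski R) \<pp> S \<and> \<qq> \<subseteq> \<pp> \<longrightarrow>
            accumulation_point (zariski R) \<qq> S)))
    \<and>
     ((\<forall>\<pp>\<in>Spec R. principal_ideal_ring (localization R \<pp>)) \<and>
      (\<forall>x\<in>carrier R. splits_at R x)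
      \<longrightarrow> seemingly_divisible_imp_divisible R TYPE('m) TYPE('n))"
    (is "(?one \<longleftrightarrow> ?pir \<and> ?split) \<and> (?pir \<and> ?split \<longleftrightarrow> ?pir \<and> ?iso \<and> ?acc) \<and> (?pir \<and> ?split \<longrightarrow> ?div)")
proof -
  interpret cring R by (rule assms(1))
  have unif: "\<forall>P. primeideal P R \<longrightarrow> (\<exists>\<pi>. uniformizer R P \<pi>)" if ?pir
  proof (intro allI impI)
    fix P assume P: "primeideal P R"
    then have "principal_ideal_ring (localization R P)" using that by (simp add: Spec_def)
    then show "\<exists>\<pi>. uniformizer R P \<pi>" using principal_localization_iff[OF P] by simp
  qed
  have 13: "?pir \<and> ?iso \<and> ?acc" if ?one
  proof -
    interpret s: seemingly_divisible_ring R "TYPE('u)"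
      by (intro seemingly_divisible_ring.intro seemingly_divisible_ring_axioms.intro is_cring that large_universe)
    have ?pir using s.principal_localization by blast
    moreover have ?iso using s.isolated_if_nonreduced by blast
    moreover have ?acc
    proof (intro ballI allI impI)
      fix p q S assume "p \<in> Spec R" "q \<in> Spec R" "S \<subseteq> Spec R - {p}"
        and "accumulation_point (zariski R) p S \<and> q \<subseteq> p"
      then show "accumulation_point (zariski R) q S"
        by (intro s.accumulation_point_generization[of p q S]) simp_all
    qed
    ultimately show ?thesis by (intro conjI)
  qed
  have 32: ?split if pir: ?pir and iso: ?iso and acc: ?acc
  proof
    fix x assume x: "x \<in> carrier R"
    show "splits_at R x"
    proof (rule splits_at_if_accumulation[OF _ _ _ x])
      show "\<exists>\<pi>. uniformizer R P \<pi>" if "primeideal P R" for P using unif[OF pir] that by simp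
      show "isolated_point (zariski R) P" if "P \<in> Spec R" "nonreduced_point R P" for P
        using iso that by simp
      show "accumulation_point (zariski R) Q S"
        if "P \<in> Spec R" "Q \<in> Spec R" "S \<subseteq> Spec R - {P}" "accumulation_point (zariski R) P S" "Q \<subseteq> P"
          for P Q S
        using acc[rule_format, OF that(1,2,3)] that(4,5) by simp
    qed
  qed
  have 21: ?one and div: ?div if "?pir" "?split"
    using seemingly_divisible_imp_divisible_if_splits_at[OF unif[OF that(1)] that(2)] by simp_all
  show ?thesis using 13 32 21 div by argo
qed

end
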